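(* For every $\mathsf{B}^\mathsf{l}\subseteq\mathrm{Bin}_{lg}$ and every $n\in\mathbb{N}$, both problems $\mathrm{ATL}^2_{\mathrm{Learn}}(\{\mathbf{F}\},\emptyset,\mathsf{B}^\mathsf{l},n)$ and $\mathrm{ATL}^2_{\mathrm{Learn}}(\{\mathbf{G}\},\emptyset,\mathsf{B}^\mathsf{l},n)$ are P-complete (under logarithmic-space reductions).
   Context: $\mathrm{Bin}_{lg}$ is the set of binary logical operators $\vee,\wedge,\Rightarrow,\Leftarrow,\Leftrightarrow$ and their negations. A concurrent game structure (CGS) with agents $\mathrm{Ag}=\{1,\dots,k\}$: finite states $Q$, initial states $I\subseteq Q$, labelling $\pi:Q\to2^{\mathsf{Prop}}$, actions $d(q,a)\ge1$ per state and agent, transition function $\delta(q,\alpha_1,\dots,\alpha_k)\in Q$; size = number of tuples $(q,\alpha_1,\dots,\alpha_k)$ plus $|\mathsf{Prop}|$. Strategies map histories to actions; $\mathrm{Out}(q,s)$ = infinite paths from $q$ consistent with the profile $s$ of a coalition. $\mathrm{ATL}^k(\mathsf{Prop},\mathsf{U}^\mathsf{t},\emptyset,\mathsf{B}^\mathsf{l})$: $\phi::=p\mid\phi*\phi\ ( *\in\mathsf{B}^\mathsf{l})\mid\langle\!\langle A\rangle\!\rangle\circ\phi$ with $A\subseteq\mathrm{Ag}$, $\circ\in\mathsf{U}^\mathsf{t}$ (with $\mathsf{U}^\mathsf{t}=\{\mathbf{F}\}$ or $\{\mathbf{G}\}$ here, so no negation operator $\neg$ is available, while binary logical operators from $\mathsf{B}^\mathsf{l}$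 are); $q\models\langle\!\langle A\rangle\!\rangle\circ\phi$ iff some profile of $A$ makes every outcome path $\rho$ from $q$ satisfy $\circ\phi$ ($\mathbf{F}\phi$: some $\rho[i]\models\phi$; $\mathbf{G}\phi$: all $\rho[i]\models\phi$). A CGS satisfies $\phi$ iff all initial states do. $|\phi|$ = number of distinct subformulas; $|\phi|_{\mathrm{Bin}}$ = number of distinct subformulas $\phi_1*\phi_2$. $\mathrm{ATL}^2_{\mathrm{Learn}}(\mathsf{U}^\mathsf{t},\emptyset,\mathsf{B}^\mathsf{l},n)$: input $(\mathsf{Prop},\mathcal{P},\mathcal{N},B)$ with finite sets of $2$-agent CGS and $B$ in unary; yes iff some $\phi$ in the fragment with $|\phi|\le B$, $|\phi|_{\mathrm{Bin}}\le n$ holds on all structures of $\mathcal{P}$ and fails on all of $\mathcal{N}$. *)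

theory Defs
  imports Complex_Main "HOL-Computational_Algebra.Polynomial"
begin

section \<open>Deterministic Turing machines, polynomial time and logarithmic space\<close>

text \<open>
  The machine model is the usual deterministic off-line Turing machine: a two-way read-only input
  tape holding a binary word between two end markers, finitely many one-way infinite read-write
  work tapes, and a one-way write-only output tape. The same model is used for decision procedures
  (which ignore the output) and for transducers (which ignore the distinction between the two
  halting states).
\<close>

datatype move = Move_Left | Stay | Move_Right

datatype insym = Left_End | Bit bool | Right_End

text \<open>
  States and work symbols are initial segments of the naturals; work symbol \<open>0\<close> is the blank.
  A transition maps the state, the scanned input symbol and the scanned work symbols to the new
  state, the move of the input head, for each work tape the symbol written and the move of its
  head, and optionally a bit appended to the output.
\<close>

record tm =
  num_states :: nat
  num_syms :: nat
  num_tapes :: nat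
  start :: nat
  acc :: nat
  rej :: nat
  trans :: "nat \<Rightarrow> insym \<Rightarrow> nat list \<Rightarrow> nat \<times> move \<times> (nat \<times> move) list \<times> bool option"

definition wf_tm :: "tm \<Rightarrow> bool" where
  "wf_tm M \<longleftrightarrow>
     start M < num_states M \<and> acc M < num_states M \<and> rej M < num_states M \<and> acc M \<noteq> rej M \<and>
     0 < num_syms M \<and>
     (\<forall>q < num_states M. \<forall>s rs. length rs = num_tapes M \<and> set rs \<subseteq> {..<num_syms M} \<longrightarrow>
        (case trans M q s rs of (q', mv, ws, out) \<Rightarrow>
           q' < num_states M \<and> length ws = num_tapes M \<and> fst ` set ws \<subseteq> {..<num_syms M}))"

record config =
  state :: nat
  in_pos :: nat
  work :: "((nat \<Rightarrow> nat) \<times> nat) list"  \<comment> \<open>contents and head position of each work tape\<close>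
  out :: "bool list"

definition init_config :: "tm \<Rightarrow> config" where
  "init_config M =
     \<lparr>state = start M, in_pos = 0, work = replicate (num_tapes M) (\<lambda>_. 0, 0), out = []\<rparr>"

definition read_input :: "bool list \<Rightarrow> nat \<Rightarrow> insym" where
  "read_input w i =
     (if i = 0 then Left_End else if i \<le> length w then Bit (w ! (i - 1)) else Right_End)"

text \<open>A head at position \<open>0\<close> stays there when it is told to move left.\<close>

fun move_head :: "move \<Rightarrow> nat \<Rightarrow> nat" where
  "move_head Move_Left i = i - 1"
| "move_head Stay i = i"
| "move_head Move_Right i = i + 1"

definition halted :: "tm \<Rightarrow> config \<Rightarrow> bool" where
  "halted M c \<longleftrightarrow> state c = acc M \<or> state c = rej M"

text \<open>The input head cannot leave the cells \<open>0, \<dots>, length w + 1\<close>.\<close>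

definition step :: "tm \<Rightarrow> bool list \<Rightarrow> config \<Rightarrow> config" where
  "step M w c =
     (if halted M c then c
      else case trans M (state c) (read_input w (in_pos c)) (map (\<lambda>(t, h). t h) (work c)) of
        (q', mv, ws, b) \<Rightarrow>
          \<lparr>state = q',
           in_pos = min (move_head mv (in_pos c)) (length w + 1),
           work = map2 (\<lambda>(t, h) (a, m). (t(h := a), move_head m h)) (work c) ws,
           out = out c @ (case b of None \<Rightarrow> [] | Some x \<Rightarrow> [x])\<rparr>)"

definition run :: "tm \<Rightarrow> bool list \<Rightarrow> nat \<Rightarrow> config" where
  "run M w t = (step M w ^^ t) (init_config M)"

definition polytime :: "bool list set \<Rightarrow> bool" where
  "polytime L \<longleftrightarrow>
     (\<exists>M (p :: nat poly). wf_tm M \<and>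
        (\<forall>w. \<exists>t \<le> poly p (length w).
           halted M (run M w t) \<and> (state (run M w t) = acc M \<longleftrightarrow> w \<in> L)))"

text \<open>Only the work tapes count towards the space.\<close>

definition logspace_computable :: "(bool list \<Rightarrow> bool list) \<Rightarrow> bool" where
  "logspace_computable f \<longleftrightarrow>
     (\<exists>M (c :: real). wf_tm M \<and>
        (\<forall>w. (\<exists>t. halted M (run M w t) \<and> out (run M w t) = f w) \<and>
             (\<forall>t. \<forall>(tp, h) \<in> set (work (run M w t)).
                real h \<le> c * log 2 (real (length w + 2)))))"

definition logspace_reducible :: "bool list set \<Rightarrow> bool list set \<Rightarrow> bool" where
  "logspace_reducible L L' \<longleftrightarrow> (\<exists>f. logspace_computable f \<and> (\<forall>w. w \<in> L \<longleftrightarrow> f w \<in> L'))"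

definition P_complete :: "bool list set \<Rightarrow> bool" where
  "P_complete L \<longleftrightarrow> polytime L \<and> (\<forall>L'. polytime L' \<longrightarrow> logspace_reducible L' L)"


section \<open>Concurrent game structures\<close>

definition agents :: "nat \<Rightarrow> nat set" where
  "agents k = {1..k}"

text \<open>
  The actions available to agent \<open>a\<close> in state \<open>q\<close> are \<open>1, \<dots>, acts C q a\<close>; a joint action is the
  list of the actions of the agents \<open>1, \<dots>, k\<close>, so agent \<open>a\<close> plays entry \<open>a - 1\<close>.
\<close>

record ('q, 'p) cgs =
  states :: "'q set"
  init :: "'q set"
  label :: "'q \<Rightarrow> 'p set"
  acts :: "'q \<Rightarrow> nat \<Rightarrow> nat"
  delta :: "'q \<Rightarrow> nat list \<Rightarrow> 'q"

definition joint_actions :: "nat \<Rightarrow> ('q, 'p) cgs \<Rightarrow> 'q \<Rightarrow> nat list list" where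
  "joint_actions k C q = product_lists (map (\<lambda>a. [1..<Suc (acts C q a)]) [1..<Suc k])"

definition wf_cgs :: "nat \<Rightarrow> 'p set \<Rightarrow> ('q, 'p) cgs \<Rightarrow> bool" where
  "wf_cgs k Props C \<longleftrightarrow>
     finite (states C) \<and> init C \<subseteq> states C \<and>
     (\<forall>q \<in> states C.
        label C q \<subseteq> Props \<and>
        (\<forall>a \<in> agents k. 1 \<le> acts C q a) \<and>
        (\<forall>\<alpha> \<in> set (joint_actions k C q). delta C q \<alpha> \<in> states C))"

text \<open>Histories are non-empty lists of states, with the current state last.\<close>

definition strategy :: "('q, 'p) cgs \<Rightarrow> nat \<Rightarrow> ('q list \<Rightarrow> nat) \<Rightarrow> bool" where
  "strategy C a s \<longleftrightarrow> (\<forall>h. h \<noteq> [] \<and> set h \<subseteq> states C \<longrightarrow> s h \<in> {1..acts C (last h) a})"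

definition strategy_profile :: "('q, 'p) cgs \<Rightarrow> nat set \<Rightarrow> (nat \<Rightarrow> 'q list \<Rightarrow> nat) \<Rightarrow> bool" where
  "strategy_profile C A s \<longleftrightarrow> (\<forall>a \<in> A. strategy C a (s a))"

definition Out ::
    "nat \<Rightarrow> ('q, 'p) cgs \<Rightarrow> nat set \<Rightarrow> 'q \<Rightarrow> (nat \<Rightarrow> 'q list \<Rightarrow> nat) \<Rightarrow> (nat \<Rightarrow> 'q) set" where
  "Out k C A q s =
     {\<rho>. \<rho> 0 = q \<and>
         (\<forall>i. \<exists>\<alpha> \<in> set (joint_actions k C (\<rho> i)).
            (\<forall>a \<in> A. \<alpha> ! (a - 1) = s a (map \<rho> [0..<Suc i])) \<and>
            \<rho> (Suc i) = delta C (\<rho> i) \<alpha>)}"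


section \<open>ATL formulas\<close>

datatype binop = Or | And | Imp | Rev_Imp | Iff | Nor | Nand | Not_Imp | Not_Rev_Imp | Not_Iff

fun eval_binop :: "binop \<Rightarrow> bool \<Rightarrow> bool \<Rightarrow> bool" where
  "eval_binop Or x y = (x \<or> y)"
| "eval_binop And x y = (x \<and> y)"
| "eval_binop Imp x y = (x \<longrightarrow> y)"
| "eval_binop Rev_Imp x y = (y \<longrightarrow> x)"
| "eval_binop Iff x y = (x \<longleftrightarrow> y)"
| "eval_binop Nor x y = (\<not> (x \<or> y))"
| "eval_binop Nand x y = (\<not> (x \<and> y))"
| "eval_binop Not_Imp x y = (\<not> (x \<longrightarrow> y))"
| "eval_binop Not_Rev_Imp x y = (\<not> (y \<longrightarrow> x))"
| "eval_binop Not_Iff x y = (\<not> (x \<longleftrightarrow> y))"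

datatype tempop = Finally | Globally

datatype 'p form =
  Atom 'p
| Bin binop "'p form" "'p form"
| Strat "nat set" tempop "'p form"

inductive_set ATL :: "nat \<Rightarrow> 'p set \<Rightarrow> tempop set \<Rightarrow> binop set \<Rightarrow> 'p form set"
  for k :: nat and Props :: "'p set" and Ut :: "tempop set" and Bl :: "binop set"
where
  "p \<in> Props \<Longrightarrow> Atom p \<in> ATL k Props Ut Bl"
| "b \<in> Bl \<Longrightarrow> \<phi> \<in> ATL k Props Ut Bl \<Longrightarrow> \<psi> \<in> ATL k Props Ut Bl \<Longrightarrow> Bin b \<phi> \<psi> \<in> ATL k Props Ut Bl"
| "A \<subseteq> agents k \<Longrightarrow> op \<in> Ut \<Longrightarrow> \<phi> \<in> ATL k Props Ut Bl \<Longrightarrow> Strat A op \<phi> \<in> ATL k Props Ut Bl"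

primrec sat :: "nat \<Rightarrow> ('q, 'p) cgs \<Rightarrow> 'p form \<Rightarrow> 'q \<Rightarrow> bool" where
  "sat k C (Atom p) q \<longleftrightarrow> p \<in> label C q"
| "sat k C (Bin b \<phi> \<psi>) q \<longleftrightarrow> eval_binop b (sat k C \<phi> q) (sat k C \<psi> q)"
| "sat k C (Strat A op \<phi>) q \<longleftrightarrow>
     (\<exists>s. strategy_profile C A s \<and>
        (\<forall>\<rho> \<in> Out k C A q s.
           case op of Finally \<Rightarrow> \<exists>i. sat k C \<phi> (\<rho> i) | Globally \<Rightarrow> \<forall>i. sat k C \<phi> (\<rho> i)))"

definition cgs_sat :: "nat \<Rightarrow> ('q, 'p) cgs \<Rightarrow> 'p form \<Rightarrow> bool" where
  "cgs_sat k C \<phi> \<longleftrightarrow> (\<forall>q \<in> init C. sat k C \<phi> q)"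

primrec subformulas :: "'p form \<Rightarrow> 'p form set" where
  "subformulas (Atom p) = {Atom p}"
| "subformulas (Bin b \<phi> \<psi>) = insert (Bin b \<phi> \<psi>) (subformulas \<phi> \<union> subformulas \<psi>)"
| "subformulas (Strat A op \<phi>) = insert (Strat A op \<phi>) (subformulas \<phi>)"

definition form_size :: "'p form \<Rightarrow> nat" where
  "form_size \<phi> = card (subformulas \<phi>)"

definition bin_size :: "'p form \<Rightarrow> nat" where
  "bin_size \<phi> = card {\<psi> \<in> subformulas \<phi>. \<exists>b \<psi>\<^sub>1 \<psi>\<^sub>2. \<psi> = Bin b \<psi>\<^sub>1 \<psi>\<^sub>2}"


section \<open>The learning problem as a language\<close>

text \<open>
  In an encoded instance the propositions are \<open>0, \<dots>, m - 1\<close>, and the states of each structure with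
  \<open>l\<close> states are \<open>0, \<dots>, l - 1\<close>. An instance is first flattened to a list of numbers and then
  written in binary letters with every number \<open>x\<close> in unary, as \<open>x\<close> ones and a zero. As every state
  has at least one joint action, and one entry is written per state and joint action, the length
  of the code is polynomially related to the number of pairs of a state and a joint action, plus
  the number of propositions, structures and the bound. The code is self-delimiting: it determines
  the instance up to the values of functions outside their intended domains, on which nothing
  depends.
\<close>

definition encode_nats :: "nat list \<Rightarrow> bool list" where
  "encode_nats xs = concat (map (\<lambda>x. replicate x True @ [False]) xs)"

definition flatten_state :: "nat \<Rightarrow> nat \<Rightarrow> (nat, nat) cgs \<Rightarrow> nat \<Rightarrow> nat list" where
  "flatten_state k m C q =
     of_bool (q \<in> init C) # map (\<lambda>p. of_bool (p \<in> label C q)) [0..<m] @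
     map (acts C q) [1..<Suc k] @ map (delta C q) (joint_actions k C q)"

definition flatten_cgs :: "nat \<Rightarrow> nat \<Rightarrow> (nat, nat) cgs \<Rightarrow> nat list" where
  "flatten_cgs k m C =
     card (states C) # concat (map (flatten_state k m C) [0..<card (states C)])"

text \<open>
  An instance \<open>(m, Ps, Ns, B)\<close> lists the finite sets \<open>set Ps\<close> and \<open>set Ns\<close> of positive and negative
  structures.
\<close>

type_synonym learn_instance = "nat \<times> (nat, nat) cgs list \<times> (nat, nat) cgs list \<times> nat"

fun wf_instance :: "nat \<Rightarrow> learn_instance \<Rightarrow> bool" where
  "wf_instance k (m, Ps, Ns, B) \<longleftrightarrow>
     (\<forall>C \<in> set Ps \<union> set Ns. wf_cgs k {..<m} C \<and> states C = {..<card (states C)})"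

fun encode_instance :: "nat \<Rightarrow> learn_instance \<Rightarrow> bool list" where
  "encode_instance k (m, Ps, Ns, B) =
     encode_nats
       (m # length Ps # concat (map (flatten_cgs k m) Ps) @
        length Ns # concat (map (flatten_cgs k m) Ns) @ [B])"

fun learnable :: "nat \<Rightarrow> tempop set \<Rightarrow> binop set \<Rightarrow> nat \<Rightarrow> learn_instance \<Rightarrow> bool" where
  "learnable k Ut Bl n (m, Ps, Ns, B) \<longleftrightarrow>
     (\<exists>\<phi> \<in> ATL k {..<m} Ut Bl. form_size \<phi> \<le> B \<and> bin_size \<phi> \<le> n \<and>
        (\<forall>C \<in> set Ps. cgs_sat k C \<phi>) \<and> (\<forall>C \<in> set Ns. \<not> cgs_sat k C \<phi>))"

definition ATL_Learn :: "nat \<Rightarrow> tempop set \<Rightarrow> binop set \<Rightarrow> nat \<Rightarrow> bool list set" where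
  "ATL_Learn k Ut Bl n =
     {encode_instance k x | x. wf_instance k x \<and> learnable k Ut Bl n x}"

end

theory Submission
  imports Defs
begin

text \<open>
  \<^emph>\<open>Membership in P.\<close> Each strategy operator is a least or greatest fixpoint, and nested operators
  with comparable coalitions collapse, so that with two players only alternating chains of \<open>{1}\<close> and
  \<open>{2}\<close> remain between the boundedly many binary operators. A formula is therefore a sequence of a
  bounded number of chains, each given by its length, and there are polynomially many candidates.
  Model checking is a dynamic program that fills a table of bits. Polynomial time and logarithmic
  space are handled together: expressions of polynomial cost are compiled to Turing machines whose
  registers hold binary numbers, so that they occupy logarithmic space; only the table is larger.

  \<^emph>\<open>Hardness.\<close> A polynomial time computation becomes a game on positions of logarithmic size, in which
  player \<open>1\<close> claims and justifies views of the configurations and player \<open>2\<close> challenges them. The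
  bound \<open>2\<close> and a two-state negative structure on which player \<open>2\<close> alone decides leave a formula with
  the single operator of the coalition \<open>{1}\<close> as the only useful candidate.
\<close>

section \<open>Flowcharts\<close>

text \<open>Two agents are essential for membership: among their coalitions only \<open>{1}\<close>
  and \<open>{2}\<close> are incomparable, so in a reduced chain each coalition determines the next
  one. This also settles the difficulty that the size counts distinct subformulas: reduced chains
  that meet run together up to the next operand of a binary formula, so that lengths of different
  chains can simply be added. With at most \<open>n\<close> binary formulas there are at most
  \<open>2 n + 1\<close> operands and as many atoms, hence \<open>5 n + 2\<close> pieces; one more
  is padding. Strategies may depend on the whole history, but the states where a strategy operator
  holds are found after as many one-step iterations as there are states, which removes strategies
  from the algorithm. The reduction may keep nothing but counters, so the code of the game is
  produced number by number, each computed from its index. Neither the binary operators nor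
  \<open>n\<close> help against the negative structure: the single proposition has the same value in
  both initial states, and a binary formula of size \<open>2\<close> can only combine it with
  itself.\<close>

datatype flow =
  Act "insym \<Rightarrow> nat list \<Rightarrow> move \<times> (nat \<times> move) list \<times> bool option"
| Seq flow flow (infixr ";;" 60)
| Branch "insym \<Rightarrow> nat list \<Rightarrow> bool" flow flow
| While "insym \<Rightarrow> nat list \<Rightarrow> bool" flow

type_synonym tapes = "((nat \<Rightarrow> nat) \<times> nat) list"

type_synonym data = "nat \<times> tapes \<times> bool list"

definition scan :: "tapes \<Rightarrow> nat list" where
  "scan ws = map (\<lambda>(t, h). t h) ws"

text \<open>The effect of a step on everything but the control state, so that a flowchart has a
  meaning independent of where its states are placed.\<close>

definition act_data ::
    "bool list \<Rightarrow> move \<times> (nat \<times> move) list \<times> bool option \<Rightarrow> data \<Rightarrow> data" where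
  "act_data w u d = (case u of (mv, us, b) \<Rightarrow> case d of (i, ws, os) \<Rightarrow>
     (min (move_head mv i) (length w + 1),
      map2 (\<lambda>(t, h) (a, m). (t(h := a), move_head m h)) ws us,
      os @ (case b of None \<Rightarrow> [] | Some x \<Rightarrow> [x])))"

definition idle :: "nat list \<Rightarrow> move \<times> (nat \<times> move) list \<times> bool option" where
  "idle rs = (Stay, map (\<lambda>a. (a, Stay)) rs, None)"

definition fits :: "nat \<Rightarrow> bool list \<Rightarrow> data \<Rightarrow> bool" where
  "fits H w d = (case d of (i, ws, os) \<Rightarrow> i \<le> length w + 1 \<and> (\<forall>(t, h) \<in> set ws. h \<le> H))"

text \<open>The head bound \<open>H\<close> is demanded at every visited configuration, not only at
  the ends, because the space bound speaks about all times of a run. A test costs one step, in which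
  the machine idles.\<close>

inductive exec :: "nat \<Rightarrow> bool list \<Rightarrow> flow \<Rightarrow> data \<Rightarrow> nat \<Rightarrow> data \<Rightarrow> bool" for H w where
  exec_Act: "fits H w (i, ws, os) \<Longrightarrow> d = act_data w (a (read_input w i) (scan ws)) (i, ws, os) \<Longrightarrow>
     fits H w d \<Longrightarrow> exec H w (Act a) (i, ws, os) 1 d"
| exec_Seq: "exec H w c d t d' \<Longrightarrow> exec H w c' d' t' d'' \<Longrightarrow> exec H w (c ;; c') d (t + t') d''"
| exec_BranchT: "P (read_input w i) (scan ws) \<Longrightarrow> fits H w (i, ws, os) \<Longrightarrow> exec H w c (i, ws, os) t d \<Longrightarrow>
     exec H w (Branch P c c') (i, ws, os) (Suc t) d"
| exec_BranchF: "\<not> P (read_input w i) (scan ws) \<Longrightarrow> fits H w (i, ws, os) \<Longrightarrow> exec H w c' (i, ws, os) t d \<Longrightarrow>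
     exec H w (Branch P c c') (i, ws, os) (Suc t) d"
| exec_WhileF: "\<not> P (read_input w i) (scan ws) \<Longrightarrow> fits H w (i, ws, os) \<Longrightarrow>
     exec H w (While P c) (i, ws, os) 1 (i, ws, os)"
| exec_WhileT: "P (read_input w i) (scan ws) \<Longrightarrow> fits H w (i, ws, os) \<Longrightarrow> exec H w c (i, ws, os) t d \<Longrightarrow>
     exec H w (While P c) d t' d' \<Longrightarrow> exec H w (While P c) (i, ws, os) (Suc (t + t')) d'"

fun len :: "flow \<Rightarrow> nat" where
  "len (Act a) = 1"
| "len (c ;; c') = len c + len c'"
| "len (Branch P c c') = 1 + len c + len c'"
| "len (While P c) = 1 + len c"

lemma len_pos: "0 < len c"
  by (induction c) auto

text \<open>\<^term>\<open>code c b e\<close> is the transition function of \<^term>\<open>c\<close> laid out on the states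
  from \<^term>\<open>b\<close> on; control leaves it by entering the state \<^term>\<open>e\<close>.\<close>

fun code :: "flow \<Rightarrow> nat \<Rightarrow> nat \<Rightarrow> nat \<Rightarrow> insym \<Rightarrow> nat list \<Rightarrow>
    nat \<times> move \<times> (nat \<times> move) list \<times> bool option" where
  "code (Act a) b e s i rs = (e, a i rs)"
| "code (c ;; c') b e s i rs =
     (if s < b + len c then code c b (b + len c) s i rs else code c' (b + len c) e s i rs)"
| "code (Branch P c c') b e s i rs =
     (if s = b then (if P i rs then b + 1 else b + 1 + len c, idle rs)
      else if s < b + 1 + len c then code c (b + 1) e s i rs
      else code c' (b + 1 + len c) e s i rs)"
| "code (While P c) b e s i rs =
     (if s = b then (if P i rs then b + 1 else e, idle rs) else code c (b + 1) b s i rs)"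

fun wf_flow :: "nat \<Rightarrow> nat \<Rightarrow> flow \<Rightarrow> bool" where
  "wf_flow k S (Act a) \<longleftrightarrow> (\<forall>i rs. length rs = k \<longrightarrow> set rs \<subseteq> {..<S} \<longrightarrow>
     (case a i rs of (mv, us, b) \<Rightarrow> length us = k \<and> fst ` set us \<subseteq> {..<S}))"
| "wf_flow k S (c ;; c') \<longleftrightarrow> wf_flow k S c \<and> wf_flow k S c'"
| "wf_flow k S (Branch P c c') \<longleftrightarrow> wf_flow k S c \<and> wf_flow k S c'"
| "wf_flow k S (While P c) \<longleftrightarrow> wf_flow k S c"

text \<open>Control never escapes into foreign states: a block is left only through
  \<open>e\<close>. This keeps the successor states of \<open>machine\<close> in range.\<close>

lemma code_state:
  assumes "b \<le> s" "s < b + len c"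
  shows "fst (code c b e s i rs) = e \<or> (b \<le> fst (code c b e s i rs) \<and> fst (code c b e s i rs) < b + len c)"
  using assms
proof (induction c arbitrary: b e)
  case (Seq c c')
  show ?case
  proof (cases "s < b + len c")
    case True
    then show ?thesis using Seq.IH(1)[of b "b + len c"] Seq.prems len_pos[of c'] by auto
  next
    case False
    then show ?thesis using Seq.IH(2)[of "b + len c" e] Seq.prems by auto
  qed
next
  case (Branch P c c')
  then show ?case
    using Branch.IH(1)[of "b + 1" e] Branch.IH(2)[of "b + 1 + len c" e] len_pos[of c] len_pos[of c']
    by (auto simp: not_less_eq)
next
  case (While P c)
  then show ?case using While.IH[of "b + 1" b] len_pos[of c] by auto
qed simp

lemma code_writes:
  assumes "wf_flow k S c" "length rs = k" "set rs \<subseteq> {..<S}" "b \<le> s" "s < b + len c"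
  shows "case code c b e s i rs of (q, mv, us, x) \<Rightarrow> length us = k \<and> fst ` set us \<subseteq> {..<S}"
  using assms
proof (induction c arbitrary: b e)
  case (Act a)
  then show ?case by (auto split: prod.splits)
next
  case (Branch P c c')
  then show ?case
    using Branch.IH(1)[of "b + 1" e] Branch.IH(2)[of "b + 1 + len c" e]
    by (auto simp: idle_def image_image)
next
  case (While P c)
  then show ?case using While.IH[of "b + 1" b] by (auto simp: idle_def image_image)
qed auto

section \<open>Simulation of flowcharts by runs of a machine\<close>

definition conf :: "nat \<Rightarrow> data \<Rightarrow> config" where
  "conf q d = (case d of (i, ws, os) \<Rightarrow> \<lparr>state = q, in_pos = i, work = ws, out = os\<rparr>)"

lemma step_conf:
  assumes "q \<noteq> acc M" "q \<noteq> rej M"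
  shows "step M w (conf q (i, ws, os)) =
    (case trans M q (read_input w i) (scan ws) of (q', u) \<Rightarrow> conf q' (act_data w u (i, ws, os)))"
  using assms by (auto simp: step_def conf_def halted_def act_data_def scan_def split: prod.splits)

lemma act_idle: "fits H w (i, ws, os) \<Longrightarrow> act_data w (idle (scan ws)) (i, ws, os) = (i, ws, os)"
  by (auto simp: act_data_def idle_def fits_def scan_def intro!: nth_equalityI split: prod.split)

lemma exec_fits: "exec H w c d t d' \<Longrightarrow> fits H w d \<and> fits H w d'"
  by (induction rule: exec.induct) auto

definition reaches :: "tm \<Rightarrow> nat \<Rightarrow> bool list \<Rightarrow> nat \<times> data \<Rightarrow> nat \<Rightarrow> nat \<times> data \<Rightarrow> bool" where
  "reaches M H w x t y \<longleftrightarrow> (step M w ^^ t) (case_prod conf x) = case_prod conf y \<and>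
     (\<forall>s\<le>t. \<exists>q d. (step M w ^^ s) (case_prod conf x) = conf q d \<and> fits H w d)"

lemma reaches_trans:
  assumes "reaches M H w x t y" "reaches M H w y t' z"
  shows "reaches M H w x (t + t') z"
proof -
  have *: "(step M w ^^ (t + s)) (case_prod conf x) = (step M w ^^ s) (case_prod conf y)" for s
    using assms(1) by (simp add: reaches_def add.commute[of t] funpow_add)
  have "\<exists>q d. (step M w ^^ s) (case_prod conf x) = conf q d \<and> fits H w d" if "s \<le> t + t'" for s
  proof (cases "s \<le> t")
    case False
    then have "s = t + (s - t)" "s - t \<le> t'" using that by auto
    then show ?thesis using assms(2) *[of "s - t"] by (auto simp: reaches_def)
  qed (use assms(1) in \<open>auto simp: reaches_def\<close>)
  then show ?thesis using *[of t'] assms(2) by (auto simp: reaches_def)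
qed

lemma reaches_step:
  assumes "q \<noteq> acc M" "q \<noteq> rej M" "fits H w d" "fits H w d'" "step M w (conf q d) = conf q' d'"
  shows "reaches M H w (q, d) 1 (q', d')"
proof -
  have "\<exists>p e. (step M w ^^ s) (conf q d) = conf p e \<and> fits H w e" if "s \<le> 1" for s
  proof (cases "s = 0")
    case True
    then show ?thesis using assms(3) by (metis funpow_0)
  next
    case False
    then have "s = 1" using that by simp
    then have "(step M w ^^ s) (conf q d) = conf q' d'" using assms(5) by simp
    then show ?thesis using assms(4) by blast
  qed
  then show ?thesis unfolding reaches_def using assms(5) by simp
qed

lemma reaches_test:
  assumes "q \<noteq> acc M" "q \<noteq> rej M" "fits H w (i, ws, os)"
    "trans M q (read_input w i) (scan ws) = (q', idle (scan ws))"
  shows "reaches M H w (q, (i, ws, os)) 1 (q', (i, ws, os))"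
  using assms by (intro reaches_step) (auto simp: step_conf act_idle)

text \<open>The machine \<open>M\<close> may be larger than the block; only its transitions on the
  states of the block matter. Entry \<open>b\<close> and exit \<open>e\<close> are generalised in
  the induction because a loop body returns to the test of its loop.\<close>

lemma exec_reaches:
  assumes "exec H w c d t d'"
    "\<And>s i rs. b \<le> s \<Longrightarrow> s < b + len c \<Longrightarrow>
       s \<noteq> acc M \<and> s \<noteq> rej M \<and> trans M s i rs = code c b e s i rs"
  shows "reaches M H w (b, d) t (e, d')"
  using assms
proof (induction arbitrary: b e rule: exec.induct)
  case (exec_Act i ws os d a)
  show ?case
    using exec_Act.prems[of b] exec_Act.hyps by (intro reaches_step) (auto simp: step_conf)
next
  case (exec_Seq c d t d' c' t' d'')
  have "reaches M H w (b, d) t (b + len c, d')"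
    using exec_Seq.prems by (intro exec_Seq.IH(1)) auto
  moreover have "reaches M H w (b + len c, d') t' (e, d'')"
    using exec_Seq.prems by (intro exec_Seq.IH(2)) auto
  ultimately show ?case by (rule reaches_trans)
next
  case (exec_BranchT P i ws os c t d c')
  have "reaches M H w (b, (i, ws, os)) 1 (b + 1, (i, ws, os))"
    using exec_BranchT.hyps exec_BranchT.prems[of b] by (intro reaches_test) auto
  moreover have "reaches M H w (b + 1, (i, ws, os)) t (e, d)"
  proof (intro exec_BranchT.IH)
    fix s i rs assume "b + 1 \<le> s" "s < b + 1 + len c"
    then show "s \<noteq> acc M \<and> s \<noteq> rej M \<and> trans M s i rs = code c (b + 1) e s i rs"
      using exec_BranchT.prems[of s i rs] by auto
  qed
  ultimately show ?case by (metis plus_1_eq_Suc reaches_trans)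
next
  case (exec_BranchF P i ws os c' t d c)
  have "reaches M H w (b, (i, ws, os)) 1 (b + 1 + len c, (i, ws, os))"
    using exec_BranchF.hyps exec_BranchF.prems[of b] by (intro reaches_test) auto
  moreover have "reaches M H w (b + 1 + len c, (i, ws, os)) t (e, d)"
  proof (intro exec_BranchF.IH)
    fix s i rs assume "b + 1 + len c \<le> s" "s < b + 1 + len c + len c'"
    then show "s \<noteq> acc M \<and> s \<noteq> rej M \<and> trans M s i rs = code c' (b + 1 + len c) e s i rs"
      using exec_BranchF.prems[of s i rs] by auto
  qed
  ultimately show ?case by (metis plus_1_eq_Suc reaches_trans)
next
  case (exec_WhileF P i ws os c)
  then show ?case using exec_WhileF.prems[of b] by (intro reaches_test) auto
next
  case (exec_WhileT P i ws os c t d t' d')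
  have "reaches M H w (b, (i, ws, os)) 1 (b + 1, (i, ws, os))"
    using exec_WhileT.hyps exec_WhileT.prems[of b] by (intro reaches_test) auto
  moreover have "reaches M H w (b + 1, (i, ws, os)) t (b, d)"
  proof (intro exec_WhileT.IH)
    fix s i rs assume "b + 1 \<le> s" "s < b + 1 + len c"
    then show "s \<noteq> acc M \<and> s \<noteq> rej M \<and> trans M s i rs = code c (b + 1) b s i rs"
      using exec_WhileT.prems[of s i rs] by auto
  qed
  moreover have "reaches M H w (b, d) t' (e, d')"
    using exec_WhileT.prems by (intro exec_WhileT.IH)
  ultimately show ?case by (metis plus_1_eq_Suc reaches_trans)
qed

text \<open>Behind the block lie its exit state \<open>len c\<close>, which inspects the scanned
  work symbols once, and the two halting states; hence \<open>len c + 3\<close>.\<close>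

definition machine :: "nat \<Rightarrow> nat \<Rightarrow> flow \<Rightarrow> (nat list \<Rightarrow> bool) \<Rightarrow> tm" where
  "machine k S c P = \<lparr>num_states = len c + 3, num_syms = S, num_tapes = k, start = 0,
     acc = len c + 1, rej = len c + 2,
     trans = \<lambda>s i rs. if s < len c then code c 0 (len c) s i rs
       else (if P rs then len c + 1 else len c + 2, idle rs)\<rparr>"

lemma wf_machine:
  assumes "wf_flow k S c" "0 < S"
  shows "wf_tm (machine k S c P)"
proof -
  have "case trans (machine k S c P) q s rs of (q', mv, ws, b) \<Rightarrow>
           q' < len c + 3 \<and> length ws = k \<and> fst ` set ws \<subseteq> {..<S}"
    if "length rs = k" "set rs \<subseteq> {..<S}" for q s rs
  proof (cases "q < len c")
    case True
    obtain q' mv us b where *: "code c 0 (len c) q s rs = (q', mv, us, b)"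
      by (metis prod_cases4)
    then show ?thesis
      using True code_state[of 0 q c "len c" s rs] code_writes[OF assms(1) that, of 0 q "len c" s]
      by (auto simp: machine_def)
  next
    case False
    then show ?thesis using that by (auto simp: machine_def idle_def)
  qed
  then show ?thesis using assms(2) by (auto simp: wf_tm_def machine_def)
qed

text \<open>The second claim concerns all times: from step \<open>t + 1\<close> on the machine has
  halted and repeats its configuration, so the bound along the finite execution is enough.\<close>

lemma run_machine:
  fixes P S
  assumes "exec H w c (0, replicate k (\<lambda>_. 0, 0), []) t (i, ws, os)"
  defines "M \<equiv> machine k S c P"
  shows "run M w (t + 1) = conf (if P (scan ws) then acc M else rej M) (i, ws, os)"
    and "\<exists>q d. run M w s = conf q d \<and> fits H w d"
proof -
  let ?d = "(0, replicate k (\<lambda>_. 0, 0), [])" and ?q = "if P (scan ws) then acc M else rej M"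
  have init: "init_config M = case_prod conf (0, ?d)"
    by (simp add: init_config_def M_def machine_def conf_def)
  have "reaches M H w (0, ?d) t (len c, (i, ws, os))"
    by (rule exec_reaches[OF assms(1)]) (auto simp: M_def machine_def)
  moreover have "reaches M H w (len c, (i, ws, os)) 1 (?q, (i, ws, os))"
    using exec_fits[OF assms(1)] by (intro reaches_test) (auto simp: M_def machine_def)
  ultimately have *: "reaches M H w (0, ?d) (t + 1) (?q, (i, ws, os))"
    by (rule reaches_trans)
  then show **: "run M w (t + 1) = conf ?q (i, ws, os)"
    by (auto simp: reaches_def run_def init)
  show "\<exists>q d. run M w s = conf q d \<and> fits H w d"
  proof (cases "s \<le> t + 1")
    case True
    then show ?thesis using * by (auto simp: reaches_def run_def init)
  next
    case False
    then obtain r where r: "s = r + (t + 1)" by (metis add.commute le_add_diff_inverse nat_le_linear)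
    have "step M w (conf ?q (i, ws, os)) = conf ?q (i, ws, os)"
      by (auto simp: step_def halted_def conf_def)
    then have "(step M w ^^ r) (conf ?q (i, ws, os)) = conf ?q (i, ws, os)"
      by (induction r) auto
    moreover have "run M w s = (step M w ^^ r) (run M w (t + 1))"
      unfolding r run_def by (simp only: funpow_add o_apply)
    ultimately have "run M w s = run M w (t + 1)"
      using ** by simp
    then show ?thesis using ** exec_fits[OF assms(1)] by metis
  qed
qed

section \<open>Binary registers on work tapes\<close>

text \<open>Symbol \<open>0\<close> is the blank and \<open>1\<close> the end marker, which leaves
  \<open>2\<close> and \<open>3\<close> for the bits; all compiled machines use these four
  symbols.\<close>

definition bsym :: "bool \<Rightarrow> nat" where
  "bsym b = (if b then 3 else 2)"

text \<open>Cell \<open>0\<close> carries the end marker \<open>1\<close>; the bits follow, least significant first.\<close>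

definition tape :: "bool list \<Rightarrow> nat \<Rightarrow> nat" where
  "tape bs = (\<lambda>j. if j = 0 then 1 else if j \<le> length bs then bsym (bs ! (j - 1)) else 0)"

text \<open>High-order \<open>False\<close> entries are permitted, so a number has many words; this
  spares the machine any normalisation.\<close>

fun bval :: "bool list \<Rightarrow> nat" where
  "bval [] = 0"
| "bval (b # bs) = of_bool b + 2 * bval bs"

declare split_paired_Ex [simp del]

lemma bval_append: "bval (xs @ ys) = bval xs + 2 ^ length xs * bval ys"
  by (induction xs) (auto simp: algebra_simps)

lemma bval_replicate_False: "bval (replicate n False) = 0"
  by (induction n) auto

lemma bval_replicate_True: "bval (replicate n True) + 1 = 2 ^ n"
  by (induction n) auto

lemma bval_eq_0: "bval bs = 0 \<longleftrightarrow> True \<notin> set bs"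
  by (induction bs) auto

text \<open>The shape that governs a carry (\<open>x = True\<close>), a borrow
  (\<open>x = False\<close>) and the search for the first nonzero bit
  (\<open>x = False\<close>).\<close>

lemma leading: obtains c ys where "bs = replicate c x @ ys" "ys = [] \<or> hd ys = (\<not> x)"
proof
  show "bs = replicate (length (takeWhile (\<lambda>b. b = x) bs)) x @ dropWhile (\<lambda>b. b = x) bs"
    by (induction bs) auto
  show "dropWhile (\<lambda>b. b = x) bs = [] \<or> hd (dropWhile (\<lambda>b. b = x) bs) = (\<not> x)"
    by (induction bs) auto
qed

definition on_tape :: "nat \<Rightarrow> (nat \<Rightarrow> nat) \<Rightarrow> move \<Rightarrow> flow" where
  "on_tape r g m = Act (\<lambda>i rs. (Stay, (map (\<lambda>a. (a, Stay)) rs)[r := (g (rs ! r), m)], None))"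

definition shift_in :: "move \<Rightarrow> flow" where
  "shift_in m = Act (\<lambda>i rs. (m, map (\<lambda>a. (a, Stay)) rs, None))"

definition emit :: "bool \<Rightarrow> flow" where
  "emit b = Act (\<lambda>i rs. (Stay, map (\<lambda>a. (a, Stay)) rs, Some b))"

definition nop :: flow where
  "nop = Act (\<lambda>i. idle)"

definition rewind :: "nat \<Rightarrow> flow" where
  "rewind r = While (\<lambda>_ rs. rs ! r \<noteq> 1) (on_tape r id Move_Left)"

text \<open>Increment for \<open>x = True\<close>, decrement of a positive register for \<open>x = False\<close>.\<close>

definition bump :: "nat \<Rightarrow> bool \<Rightarrow> flow" where
  "bump r x = on_tape r id Move_Right ;;
     While (\<lambda>_ rs. rs ! r = bsym x) (on_tape r (\<lambda>_. bsym (\<not> x)) Move_Right) ;;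
     on_tape r (\<lambda>_. bsym x) Stay ;; rewind r"

definition seek :: "nat \<Rightarrow> flow" where
  "seek r = on_tape r id Move_Right ;; While (\<lambda>_ rs. rs ! r = 2) (on_tape r id Move_Right)"

text \<open>The answer is visible only where \<open>seek\<close> stops, so the head is rewound after
  the branching, once in each branch.\<close>

definition if_pos :: "nat \<Rightarrow> flow \<Rightarrow> flow \<Rightarrow> flow" where
  "if_pos r c c' = seek r ;; Branch (\<lambda>_ rs. rs ! r = 3) (rewind r ;; c) (rewind r ;; c')"

definition while_pos :: "nat \<Rightarrow> flow \<Rightarrow> flow" where
  "while_pos r c = seek r ;; While (\<lambda>_ rs. rs ! r = 3) (rewind r ;; c ;; seek r) ;; rewind r"

text \<open>The loop ends when both words are exhausted. Destination cells beyond the source become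
  high-order zeros, which do not change the value.\<close>

definition copy :: "nat \<Rightarrow> nat \<Rightarrow> flow" where
  "copy r d =
     While (\<lambda>_ rs. rs ! r \<noteq> 0 \<or> rs ! d \<noteq> 0)
       (Act (\<lambda>i rs. (Stay, (map (\<lambda>a. (a, Stay)) rs)
          [r := (rs ! r, Move_Right), d := (if rs ! r = 0 then 2 else rs ! r, Move_Right)], None))) ;;
     rewind r ;; rewind d"

section \<open>Running times of the tape operations\<close>

lemma scan_nth: "r < length ws \<Longrightarrow> ws ! r = (f, h) \<Longrightarrow> scan ws ! r = f h"
  by (simp add: scan_def)

lemma fits_update:
  "fits H w (i, ws, os) \<Longrightarrow> h \<le> H \<Longrightarrow> fits H w (i, ws[r := (f, h)], os)"
  using set_update_subset_insert[of ws r "(f, h)"] by (auto simp: fits_def)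

lemma fits_same:
  "fits H w (i, ws, os) \<Longrightarrow> act_data w (m, map (\<lambda>a. (a, Stay)) (scan ws), b) (i, ws, os) =
     (min (move_head m i) (length w + 1), ws, os @ (case b of None \<Rightarrow> [] | Some x \<Rightarrow> [x]))"
  by (auto simp: act_data_def scan_def intro!: nth_equalityI split: prod.split)

lemma map2_writes:
  "r < length ws \<Longrightarrow> ws ! r = (f, h) \<Longrightarrow>
   map2 (\<lambda>(t, h) (a, m). (t(h := a), move_head m h)) ws
     ((map (\<lambda>a. (a, Stay)) (scan ws))[r := (a, m)]) = ws[r := (f(h := a), move_head m h)]"
  by (auto simp: scan_def nth_list_update intro!: nth_equalityI split: prod.split)

lemma exec_on_tape:
  assumes "fits H w (i, ws, os)" "r < length ws" "ws ! r = (f, h)" "move_head m h \<le> H"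
  shows "exec H w (on_tape r g m) (i, ws, os) 1 (i, ws[r := (f(h := g (f h)), move_head m h)], os)"
  unfolding on_tape_def
proof (rule exec_Act[OF assms(1)])
  show "(i, ws[r := (f(h := g (f h)), move_head m h)], os) =
    act_data w (Stay, (map (\<lambda>a. (a, Stay)) (scan ws))[r := (g (scan ws ! r), m)], None) (i, ws, os)"
    using assms by (simp add: act_data_def map2_writes scan_nth fits_def)
  show "fits H w (i, ws[r := (f(h := g (f h)), move_head m h)], os)"
    using assms fits_update by blast
qed

lemma exec_walk:
  assumes "fits H w (i, ws, os)" "r < length ws" "h + n \<le> H"
    "\<And>j. j < n \<Longrightarrow> P (f (h + j))" "\<not> P (f (h + n))"
  shows "exec H w (While (\<lambda>_ rs. P (rs ! r)) (on_tape r g Move_Right)) (i, ws[r := (f, h)], os)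
     (2 * n + 1) (i, ws[r := (\<lambda>x. if h \<le> x \<and> x < h + n then g (f x) else f x, h + n)], os)"
  using assms(3-5)
proof (induction n arbitrary: f h)
  case 0
  have "fits H w (i, ws[r := (f, h)], os)" using assms(1) 0 by (simp add: fits_update)
  moreover have "(\<lambda>x. if h \<le> x \<and> x < h + 0 then g (f x) else f x) = f" by auto
  ultimately show ?case
    using 0 assms(2) exec_WhileF[of "\<lambda>_ rs. P (rs ! r)" w i "ws[r := (f, h)]" H os]
    by (simp add: scan_nth)
next
  case (Suc n)
  let ?f = "f(h := g (f h))"
  have fit: "fits H w (i, ws[r := (f, h)], os)" using assms(1) Suc.prems by (simp add: fits_update)
  have 1: "exec H w (on_tape r g Move_Right) (i, ws[r := (f, h)], os) 1 (i, ws[r := (?f, h + 1)], os)"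
    using exec_on_tape[OF fit, of r f h Move_Right g] assms(2) Suc.prems(1) by simp
  have 2: "exec H w (While (\<lambda>_ rs. P (rs ! r)) (on_tape r g Move_Right)) (i, ws[r := (?f, h + 1)], os)
     (2 * n + 1) (i, ws[r := (\<lambda>x. if h + 1 \<le> x \<and> x < h + 1 + n then g (?f x) else ?f x, h + 1 + n)], os)"
  proof (rule Suc.IH)
    show "P (?f (h + 1 + j))" if "j < n" for j using Suc.prems(2)[of "Suc j"] that by simp
    show "\<not> P (?f (h + 1 + n))" using Suc.prems(3) by simp
  qed (use Suc.prems in simp)
  have 3: "(\<lambda>x. if h + 1 \<le> x \<and> x < h + 1 + n then g (?f x) else ?f x) =
      (\<lambda>x. if h \<le> x \<and> x < h + Suc n then g (f x) else f x)"
    by auto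
  have "P (scan (ws[r := (f, h)]) ! r)"
    using Suc.prems(2)[of 0] assms(2) by (simp add: scan_nth)
  from exec_WhileT[OF this fit 1 2[unfolded 3]] show ?case by simp
qed

lemma exec_rewind:
  assumes "fits H w (i, ws, os)" "r < length ws" "h \<le> H" "f 0 = 1" "\<And>j. 0 < j \<Longrightarrow> j \<le> h \<Longrightarrow> f j \<noteq> 1"
  shows "exec H w (rewind r) (i, ws[r := (f, h)], os) (2 * h + 1) (i, ws[r := (f, 0)], os)"
  using assms(3-5)
proof (induction h)
  case 0
  have "fits H w (i, ws[r := (f, 0)], os)" using assms(1) 0 by (simp add: fits_update)
  then show ?case
    using 0 assms(2) exec_WhileF[of "\<lambda>_ rs. rs ! r \<noteq> 1" w i "ws[r := (f, 0)]" H os]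
    by (simp add: scan_nth rewind_def)
next
  case (Suc h)
  have fit: "fits H w (i, ws[r := (f, Suc h)], os)" using assms(1) Suc.prems by (simp add: fits_update)
  have 1: "exec H w (on_tape r id Move_Left) (i, ws[r := (f, Suc h)], os) 1 (i, ws[r := (f, h)], os)"
    using exec_on_tape[OF fit, of r f "Suc h" Move_Left id] assms(2) Suc.prems(1) by simp
  have 2: "scan (ws[r := (f, Suc h)]) ! r \<noteq> 1"
    using Suc.prems(3)[of "Suc h"] assms(2) by (simp add: scan_nth)
  have 3: "exec H w (rewind r) (i, ws[r := (f, h)], os) (2 * h + 1) (i, ws[r := (f, 0)], os)"
    using Suc.prems by (intro Suc.IH) auto
  show ?case
    using exec_WhileT[of "\<lambda>_ rs. rs ! r \<noteq> 1", OF 2 fit 1 3[unfolded rewind_def]]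
    by (simp add: rewind_def)
qed

lemma tape_marker: "tape bs 0 = 1" "0 < j \<Longrightarrow> tape bs j \<noteq> Suc 0"
  by (auto simp: tape_def bsym_def)

lemma exec_rewind_tape:
  assumes "fits H w (i, ws, os)" "r < length ws" "h \<le> H"
  shows "exec H w (rewind r) (i, ws[r := (tape bs, h)], os) (2 * h + 1) (i, ws[r := (tape bs, 0)], os)"
  using assms by (intro exec_rewind) (auto simp: tape_marker)

text \<open>The initial run of bits \<open>x\<close> is flipped and the first cell behind it
  receives \<open>x\<close>. If a carry consumes the whole word, that cell is blank and the word
  grows by one bit, which \<open>tl [] = []\<close> covers.\<close>

lemma exec_bump:
  assumes "fits H w (i, ws, os)" "r < length ws" "ws ! r = (tape (replicate n x @ ys), 0)"
    "ys = [] \<or> hd ys = (\<not> x)" "n + 1 \<le> H"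
  shows "exec H w (bump r x) (i, ws, os) (4 * n + 6)
    (i, ws[r := (tape (replicate n (\<not> x) @ x # tl ys), 0)], os)"
proof -
  let ?f = "tape (replicate n x @ ys)" and ?g = "tape (replicate n (\<not> x) @ x # tl ys)"
  let ?h = "\<lambda>y. if 1 \<le> y \<and> y < 1 + n then bsym (\<not> x) else ?f y"
  have 1: "exec H w (on_tape r id Move_Right) (i, ws, os) 1 (i, ws[r := (?f, 1)], os)"
    using exec_on_tape[OF assms(1-3), of Move_Right id] assms(5) by simp
  have 2: "exec H w (While (\<lambda>_ rs. rs ! r = bsym x) (on_tape r (\<lambda>_. bsym (\<not> x)) Move_Right))
      (i, ws[r := (?f, 1)], os) (2 * n + 1) (i, ws[r := (?h, 1 + n)], os)"
  proof (rule exec_walk)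
    show "\<not> ?f (1 + n) = bsym x"
      using assms(4) by (cases ys) (auto simp: tape_def bsym_def nth_append)
  qed (use assms in \<open>auto simp: tape_def nth_append\<close>)
  have fit: "fits H w (i, ws[r := (?h, 1 + n)], os)"
    using assms by (intro fits_update) auto
  have eq: "?h(1 + n := bsym x) = ?g"
    by (rule ext) (auto simp: tape_def nth_append nth_Cons' nth_tl; cases ys; auto)
  have 3: "exec H w (on_tape r (\<lambda>_. bsym x) Stay) (i, ws[r := (?h, 1 + n)], os) 1
      (i, ws[r := (?g, 1 + n)], os)"
    using exec_on_tape[OF fit, of r ?h "1 + n" Stay "\<lambda>_. bsym x"] assms eq by simp
  have 4: "exec H w (rewind r) (i, ws[r := (?g, 1 + n)], os) (2 * (1 + n) + 1)
      (i, ws[r := (?g, 0)], os)"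
    using assms by (intro exec_rewind_tape) auto
  show ?thesis
    using exec_Seq[OF 1 exec_Seq[OF 2 exec_Seq[OF 3 4]]]
    by (simp add: bump_def numeral_eq_Suc algebra_simps)
qed

lemma exec_seek:
  assumes "fits H w (i, ws, os)" "r < length ws" "ws ! r = (tape bs, 0)" "length bs + 1 \<le> H"
  obtains h where "h \<le> length bs + 1" "tape bs h = 3 \<longleftrightarrow> bval bs \<noteq> 0"
    "exec H w (seek r) (i, ws, os) (2 * h) (i, ws[r := (tape bs, h)], os)"
proof -
  obtain n ys where ys: "bs = replicate n False @ ys" "ys = [] \<or> hd ys"
    using leading[of bs False] by auto
  have 1: "exec H w (on_tape r id Move_Right) (i, ws, os) 1 (i, ws[r := (tape bs, 1)], os)"
    using exec_on_tape[OF assms(1-3), of Move_Right id] assms(4) by simp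
  have 2: "exec H w (While (\<lambda>_ rs. rs ! r = 2) (on_tape r id Move_Right))
      (i, ws[r := (tape bs, 1)], os) (2 * n + 1)
      (i, ws[r := (\<lambda>x. if 1 \<le> x \<and> x < 1 + n then id (tape bs x) else tape bs x, 1 + n)], os)"
  proof (rule exec_walk)
    show "\<not> tape bs (1 + n) = 2"
      using ys by (cases ys) (auto simp: tape_def bsym_def nth_append)
  qed (use assms ys in \<open>auto simp: tape_def nth_append bsym_def\<close>)
  have 3: "(\<lambda>x. if 1 \<le> x \<and> x < 1 + n then id (tape bs x) else tape bs x) = tape bs" by auto
  show ?thesis
  proof (rule that)
    show "1 + n \<le> length bs + 1" using ys by simp
    show "tape bs (1 + n) = 3 \<longleftrightarrow> bval bs \<noteq> 0"
      using ys by (cases ys) (auto simp: tape_def bsym_def nth_append bval_eq_0)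
    show "exec H w (seek r) (i, ws, os) (2 * (1 + n)) (i, ws[r := (tape bs, 1 + n)], os)"
      using exec_Seq[OF 1 2] unfolding 3 seek_def by simp
  qed
qed

lemma exec_copy:
  assumes "fits H w (i, ws, os)" "r < length ws" "d < length ws" "r \<noteq> d"
    "ws ! r = (tape bs, 0)" "ws ! d = (tape cs, 0)" "length bs + 1 \<le> H" "length cs + 1 \<le> H"
  defines "n \<equiv> max (length bs) (length cs)"
  shows "exec H w (copy r d) (i, ws, os) (6 * n + 9)
    (i, ws[d := (tape (bs @ replicate (n - length bs) False), 0)], os)"
proof -
  \<comment> \<open>\<open>L j\<close> is the destination after its first \<open>j\<close> bits have
    been overwritten. The heads start on the marker cell \<open>0\<close>, so with the heads at
    \<open>j\<close> only \<open>j - 1\<close> bits are done.\<close>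
  define L where "L = (\<lambda>j. map (\<lambda>y. y < length bs \<and> bs ! y) [0..<j] @ drop j cs)"
  let ?st = "\<lambda>j. (i, ws[r := (tape bs, j), d := (tape (L (j - 1)), j)], os)"
  let ?P = "\<lambda>_ rs. rs ! r \<noteq> (0::nat) \<or> rs ! d \<noteq> 0"
  let ?A = "Act (\<lambda>i rs. (Stay, (map (\<lambda>a. (a, Stay)) rs)
      [r := (rs ! r, Move_Right), d := (if rs ! r = 0 then 2 else rs ! r, Move_Right)], None))"
  have lenL: "length (L j) = max j (length cs)" for j by (auto simp: L_def)
  have nthL: "L j ! y = (if y < j then y < length bs \<and> bs ! y else cs ! y)"
    if "y < max j (length cs)" for j y
    using that by (auto simp: L_def nth_append)
  have L0: "L 0 = cs" by (simp add: L_def)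
  have nH: "n + 1 \<le> H" using assms(7,8) by (simp add: n_def)
  have fit: "fits H w (?st j)" if "j \<le> n + 1" for j
    using that nH assms(1) by (intro fits_update) auto
  have scan: "scan (fst (snd (?st j))) ! r = tape bs j" "scan (fst (snd (?st j))) ! d = tape (L (j - 1)) j"
    for j using assms(2-4) by (simp_all add: scan_nth)
  have P: "?P x (scan (fst (snd (?st j)))) \<longleftrightarrow> j \<le> n" if "j \<le> n + 1" for j x
    unfolding scan using that assms(2-4)
    by (auto simp: tape_def L_def n_def bsym_def)
  have wr: "(tape (L (j - 1)))(j := if tape bs j = 0 then 2 else tape bs j) = tape (L j)"
    if "j \<le> n" for j
  proof (rule ext)
    fix y
    show "((tape (L (j - 1)))(j := if tape bs j = 0 then 2 else tape bs j)) y = tape (L j) y"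
    proof (cases "y = j")
      case True
      then show ?thesis using that by (cases j) (simp_all add: tape_def lenL nthL bsym_def n_def)
    next
      case False
      then have "y - Suc 0 < j - Suc 0 \<longleftrightarrow> y - Suc 0 < j" if "0 < y" using that by auto
      moreover from False have "y \<le> max (j - Suc 0) (length cs) \<longleftrightarrow> y \<le> max j (length cs)"
        using that by (auto simp: max_def)
      ultimately show ?thesis using False that
        by (cases "y = 0") (auto simp: tape_def lenL nthL)
    qed
  qed
  have A: "exec H w ?A (?st j) 1 (?st (Suc j))" if "j \<le> n" for j
  proof (rule exec_Act)
    show "fits H w (?st j)" using fit[of j] that by auto
    show "fits H w (?st (Suc j))" using fit[of "Suc j"] that by auto
    let ?ws = "ws[r := (tape bs, j), d := (tape (L (j - 1)), j)]"
    have m: "map2 (\<lambda>(t, h) (a, m). (t(h := a), move_head m h)) ?ws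
       ((map (\<lambda>a. (a, Stay)) (scan ?ws))[r := (tape bs j, Move_Right), d := (u, Move_Right)]) =
       ws[r := (tape bs, Suc j), d := ((tape (L (j - 1)))(j := u), Suc j)]" for u
      using assms(2-4)
      by (auto simp: scan_def nth_list_update fun_upd_idem intro!: nth_equalityI split: prod.split)
    have scan': "scan ?ws ! r = tape bs j" "scan ?ws ! d = tape (L (j - 1)) j"
      using scan[of j] by simp_all
    have "i \<le> length w + 1" using assms(1) by (simp add: fits_def)
    then show "?st (Suc j) = act_data w (Stay, (map (\<lambda>a. (a, Stay)) (scan ?ws))
      [r := (scan ?ws ! r, Move_Right), d := (if scan ?ws ! r = 0 then 2 else scan ?ws ! r, Move_Right)], None)
      (i, ?ws, os)"
      unfolding act_data_def prod.case scan' m wr[OF that] by simp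
  qed
  have loop: "exec H w (While ?P ?A) (?st j) (2 * (n + 1 - j) + 1) (?st (n + 1))" if "j \<le> n + 1" for j
    using that
  proof (induction j rule: inc_induct)
    case base
    show ?case using exec_WhileF[of ?P w i _ H os ?A] P[of "n + 1"] fit[of "n + 1"] by simp
  next
    case (step j)
    have "exec H w (While ?P ?A) (?st j) (Suc (1 + (2 * (n + 1 - Suc j) + 1))) (?st (n + 1))"
      using step P[of j] fit[of j] by (intro exec_WhileT[OF _ _ A]) auto
    then show ?case using step.hyps by (simp add: Suc_diff_le)
  qed
  have "ws[r := (tape bs, 0), d := (tape cs, 0)] = ws"
    using assms(2-6) by (metis list_update_id)
  then have 1: "exec H w (While ?P ?A) (i, ws, os) (2 * (n + 1) + 1) (?st (n + 1))"
    using loop[of 0] by (simp add: L0)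
  have Ln: "L n = bs @ replicate (n - length bs) False"
    by (auto simp: L_def n_def nth_append max_def intro!: nth_equalityI split: if_splits)
  have st: "?st (n + 1) = (i, (ws[d := (tape (L n), n + 1)])[r := (tape bs, n + 1)], os)"
    using assms(4) by (simp add: list_update_swap)
  have 2: "exec H w (rewind r) (?st (n + 1)) (2 * (n + 1) + 1)
      (i, (ws[d := (tape (L n), n + 1)])[r := (tape bs, 0)], os)"
    unfolding st using assms(1,2) nH by (intro exec_rewind_tape fits_update) auto
  have eq: "(ws[d := (tape (L n), n + 1)])[r := (tape bs, 0)] = ws[d := (tape (L n), n + 1)]"
    using assms(2,4,5) by (metis list_update_id nth_list_update_neq)
  have 3: "exec H w (rewind d) (i, ws[d := (tape (L n), n + 1)], os) (2 * (n + 1) + 1)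
      (i, ws[d := (tape (L n), 0)], os)"
    using assms(1,3) nH by (intro exec_rewind_tape) auto
  show ?thesis
    using exec_Seq[OF 1 exec_Seq[OF 2[unfolded eq] 3]] by (simp add: copy_def Ln numeral_eq_Suc algebra_simps)
qed

text \<open>
  Abstract memory states \<open>(i, a, R, xs, os)\<close>: input head, head of the array tape, register values,
  bits stored on the array tape, output. The array is tape number \<open>k\<close>, after the registers.
\<close>

type_synonym mem = "nat \<times> nat \<times> (nat \<Rightarrow> nat) \<times> bool list \<times> bool list"

text \<open>\<open>W\<close> bounds the length of register words, \<open>H\<close> all head
  positions. A head may stand on the blank behind a word, whence the margin, which also provides
  \<open>length xs + 2 \<le> H\<close> for the empty array of the start.\<close>

locale register_machine =
  fixes w :: "bool list" and H W k :: nat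
  assumes H: "W + 2 \<le> H"
begin

definition rep :: "mem \<Rightarrow> data \<Rightarrow> bool" where
  "rep m d = (case m of (i, a, R, xs, os) \<Rightarrow> case d of (i', ws, os') \<Rightarrow>
     i' = i \<and> os' = os \<and> i \<le> length w + 1 \<and> a \<le> length xs + 1 \<and> length xs + 2 \<le> H \<and>
     length ws = Suc k \<and> ws ! k = (tape xs, a) \<and>
     (\<forall>r<k. \<exists>bs. length bs \<le> W \<and> bval bs = R r \<and> ws ! r = (tape bs, 0)))"

text \<open>The time is only an upper bound, uniform over all representations of \<open>m\<close>,
  since equal values may be stored in words of different lengths.\<close>

definition runs :: "flow \<Rightarrow> nat \<Rightarrow> mem \<Rightarrow> mem \<Rightarrow> bool" where
  "runs c T m m' \<longleftrightarrow> (\<forall>d. rep m d \<longrightarrow> (\<exists>t d'. t \<le> T \<and> exec H w c d t d' \<and> rep m' d'))"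

lemma rep_fits: "rep m d \<Longrightarrow> fits H w d"
  unfolding rep_def fits_def using H
  by (auto simp: in_set_conv_nth less_Suc_eq split: prod.splits)
    (metis Pair_inject less_eq_nat.simps(1))

lemma runs_Seq: "runs c T m m' \<Longrightarrow> runs c' T' m' m'' \<Longrightarrow> runs (c ;; c') (T + T') m m''"
  unfolding runs_def by (meson add_mono exec_Seq)

lemma runs_mono: "runs c T m m' \<Longrightarrow> T \<le> T' \<Longrightarrow> runs c T' m m'"
  unfolding runs_def by (meson order.trans)

lemma rep_update:
  assumes "rep (i, a, R, xs, os) (i, ws, os)" "r < k" "length bs \<le> W" "bval bs = x"
  shows "rep (i, a, R(r := x), xs, os) (i, ws[r := (tape bs, 0)], os)"
  using assms by (auto simp: rep_def nth_list_update)

lemma rep_reg: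
  assumes "rep (i, a, R, xs, os) (i, ws, os)" "r < k"
  obtains bs where "length bs \<le> W" "bval bs = R r" "ws ! r = (tape bs, 0)" "r < length ws"
  using assms by (auto simp: rep_def)

text \<open>The premise isolates what differs between increment and decrement: the resulting value,
  and the reason why the word does not outgrow \<open>W\<close>.\<close>

lemma runs_bump:
  assumes "r < k"
    "\<And>n ys. R r = bval (replicate n x @ ys) \<Longrightarrow> ys = [] \<or> hd ys = (\<not> x) \<Longrightarrow>
       length (replicate n x @ ys) \<le> W \<Longrightarrow>
       bval (replicate n (\<not> x) @ x # tl ys) = y \<and> n < W \<and> length (tl ys) + n < W"
  shows "runs (bump r x) (4 * W + 6) (i, a, R, xs, os) (i, a, R(r := y), xs, os)"
  unfolding runs_def
proof (intro allI impI)
  fix d assume rep: "rep (i, a, R, xs, os) d"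
  then obtain ws where d: "d = (i, ws, os)" by (auto simp: rep_def split: prod.splits)
  obtain bs where bs: "length bs \<le> W" "bval bs = R r" "ws ! r = (tape bs, 0)" "r < length ws"
    using rep_reg rep assms(1) unfolding d by blast
  obtain n ys where ys: "bs = replicate n x @ ys" "ys = [] \<or> hd ys = (\<not> x)"
    using leading by blast
  have *: "bval (replicate n (\<not> x) @ x # tl ys) = y" "n < W" "length (tl ys) + n < W"
    using assms(2)[of n ys] bs ys by auto
  have "exec H w (bump r x) (i, ws, os) (4 * n + 6) (i, ws[r := (tape (replicate n (\<not> x) @ x # tl ys), 0)], os)"
    using rep_fits[OF rep] bs ys * H unfolding d by (intro exec_bump) auto
  moreover have "rep (i, a, R(r := y), xs, os) (i, ws[r := (tape (replicate n (\<not> x) @ x # tl ys), 0)], os)"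
    using rep assms(1) * unfolding d by (intro rep_update) auto
  ultimately show "\<exists>t d'. t \<le> 4 * W + 6 \<and> exec H w (bump r x) d t d' \<and> rep (i, a, R(r := y), xs, os) d'"
    using * unfolding d by (intro exI[of _ "4 * n + 6"] exI conjI) auto
qed

lemma runs_inc:
  assumes "r < k" "R r + 1 < 2 ^ W"
  shows "runs (bump r True) (4 * W + 6) (i, a, R, xs, os) (i, a, R(r := R r + 1), xs, os)"
proof (rule runs_bump[OF assms(1)])
  fix n ys
  assume *: "R r = bval (replicate n True @ ys)" "ys = [] \<or> hd ys = (\<not> True)"
    "length (replicate n True @ ys) \<le> W"
  have val: "bval (replicate n (\<not> True) @ True # tl ys) = R r + 1"
    using * bval_replicate_True[of n] bval_replicate_False[of n]
    by (cases ys) (auto simp: bval_append algebra_simps)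
  \<comment> \<open>The \<open>n\<close> low-order ones alone contribute \<open>2 ^ n - 1\<close>,
    so the carry stops before position \<open>W\<close> and a new leading bit still fits.\<close>
  have "(2::nat) ^ n \<le> R r + 1"
    using *(1) bval_replicate_True[of n] by (simp add: bval_append)
  then have "(2::nat) ^ n < 2 ^ W" using assms(2) by linarith
  then have "n < W" by simp
  then show "bval (replicate n (\<not> True) @ True # tl ys) = R r + 1 \<and> n < W \<and> length (tl ys) + n < W"
    using val * by (cases ys) auto
qed

lemma runs_dec:
  assumes "r < k" "0 < R r"
  shows "runs (bump r False) (4 * W + 6) (i, a, R, xs, os) (i, a, R(r := R r - 1), xs, os)"
proof (rule runs_bump[OF assms(1)])
  fix n ys
  assume *: "R r = bval (replicate n False @ ys)" "ys = [] \<or> hd ys = (\<not> False)"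
    "length (replicate n False @ ys) \<le> W"
  then obtain zs where zs: "ys = True # zs"
    using assms(2) by (cases ys) (auto simp: bval_replicate_False)
  have "bval (replicate n True) + 1 = 2 ^ n" by (rule bval_replicate_True)
  then have "bval (replicate n (\<not> False) @ False # tl ys) = R r - 1"
    using * zs by (simp add: bval_append bval_replicate_False)
  then show "bval (replicate n (\<not> False) @ False # tl ys) = R r - 1 \<and> n < W \<and> length (tl ys) + n < W"
    using * zs by simp
qed

lemma runs_copy:
  assumes "r < k" "r' < k" "r \<noteq> r'"
  shows "runs (copy r r') (6 * W + 9) (i, a, R, xs, os) (i, a, R(r' := R r), xs, os)"
  unfolding runs_def
proof (intro allI impI)
  fix d assume rep: "rep (i, a, R, xs, os) d"
  then obtain ws where d: "d = (i, ws, os)" by (auto simp: rep_def split: prod.splits)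
  obtain bs where bs: "length bs \<le> W" "bval bs = R r" "ws ! r = (tape bs, 0)" "r < length ws"
    using rep_reg rep assms(1) unfolding d by blast
  obtain cs where cs: "length cs \<le> W" "bval cs = R r'" "ws ! r' = (tape cs, 0)" "r' < length ws"
    using rep_reg rep assms(2) unfolding d by blast
  let ?n = "max (length bs) (length cs)"
  let ?bs = "bs @ replicate (?n - length bs) False"
  have "exec H w (copy r r') (i, ws, os) (6 * ?n + 9) (i, ws[r' := (tape ?bs, 0)], os)"
    using rep_fits[OF rep] bs cs assms H unfolding d by (intro exec_copy) auto
  moreover have "rep (i, a, R(r' := R r), xs, os) (i, ws[r' := (tape ?bs, 0)], os)"
    using rep assms bs cs unfolding d
    by (intro rep_update) (auto simp: bval_append bval_replicate_False)
  ultimately show "\<exists>t d'. t \<le> 6 * W + 9 \<and> exec H w (copy r r') d t d' \<and> rep (i, a, R(r' := R r), xs, os) d'"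
    using bs cs unfolding d by (intro exI[of _ "6 * ?n + 9"] exI conjI) auto
qed

text \<open>After \<open>seek\<close> one head is away from its marker, so no memory state is
  represented. What is kept is that rewinding restores a representation of \<open>m\<close> and that
  the scanned symbol tells whether the register is nonzero.\<close>

definition sought :: "nat \<Rightarrow> mem \<Rightarrow> data \<Rightarrow> bool" where
  "sought r m e \<longleftrightarrow> (\<exists>d t. rep m d \<and> exec H w (rewind r) e t d \<and> t \<le> 2 * W + 3 \<and>
     (scan (fst (snd e)) ! r = 3 \<longleftrightarrow> fst (snd (snd m)) r \<noteq> 0))"

lemma seek:
  assumes "rep m d" "r < k"
  obtains e t where "exec H w (seek r) d t e" "t \<le> 2 * W + 2" "sought r m e"
proof -
  obtain i a R xs os where m: "m = (i, a, R, xs, os)" by (metis prod_cases5)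
  obtain ws where d: "d = (i, ws, os)" using assms unfolding m by (auto simp: rep_def split: prod.splits)
  obtain bs where bs: "length bs \<le> W" "bval bs = R r" "ws ! r = (tape bs, 0)" "r < length ws"
    using rep_reg assms unfolding d m by blast
  have fit: "fits H w (i, ws, os)" using rep_fits assms(1) unfolding d by blast
  have le: "length bs + 1 \<le> H" using bs H by simp
  obtain h where h: "h \<le> length bs + 1" "tape bs h = 3 \<longleftrightarrow> bval bs \<noteq> 0"
    "exec H w (seek r) (i, ws, os) (2 * h) (i, ws[r := (tape bs, h)], os)"
    by (rule exec_seek[OF fit bs(4,3) le])
  have "exec H w (rewind r) (i, ws[r := (tape bs, h)], os) (2 * h + 1) (i, ws[r := (tape bs, 0)], os)"
    using bs h H by (intro exec_rewind_tape fit) auto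
  moreover have "ws[r := (tape bs, 0)] = ws" using bs by (metis list_update_id)
  ultimately have "sought r m (i, ws[r := (tape bs, h)], os)"
    unfolding sought_def using assms(1) bs h
    by (intro exI[of _ d] exI[of _ "2 * h + 1"]) (auto simp: d m scan_nth)
  then show ?thesis using that h(1,3) bs(1) unfolding d by fastforce
qed

lemma runs_if_pos:
  assumes "r < k" "fst (snd (snd m)) r \<noteq> 0 \<Longrightarrow> runs c T m m'" "fst (snd (snd m)) r = 0 \<Longrightarrow> runs c' T m m'"
  shows "runs (if_pos r c c') (T + 4 * W + 6) m m'"
  unfolding runs_def
proof (intro allI impI)
  fix d assume "rep m d"
  then obtain e t where e: "exec H w (seek r) d t e" "t \<le> 2 * W + 2" "sought r m e"
    using seek assms(1) by blast
  then obtain d' t' where d': "rep m d'" "exec H w (rewind r) e t' d'" "t' \<le> 2 * W + 3"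
      "scan (fst (snd e)) ! r = 3 \<longleftrightarrow> fst (snd (snd m)) r \<noteq> 0"
    unfolding sought_def by blast
  obtain i ws os where ee: "e = (i, ws, os)" by (metis prod_cases3)
  have fit: "fits H w (i, ws, os)" using exec_fits[OF e(1)] ee by simp
  have "\<exists>t'' d''. t'' \<le> t' + T + 1 \<and> rep m' d'' \<and>
     exec H w (Branch (\<lambda>_ rs. rs ! r = 3) (rewind r ;; c) (rewind r ;; c')) e t'' d''"
  proof (cases "fst (snd (snd m)) r = 0")
    case True
    then obtain u d'' where u: "u \<le> T" "exec H w c' d' u d''" "rep m' d''"
      using assms(3) d'(1) unfolding runs_def by blast
    have "exec H w (Branch (\<lambda>_ rs. rs ! r = 3) (rewind r ;; c) (rewind r ;; c')) e (Suc (t' + u)) d''"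
      unfolding ee using True d' ee u fit by (intro exec_BranchF exec_Seq) auto
    then show ?thesis using u by (intro exI[of _ "Suc (t' + u)"]) auto
  next
    case False
    then obtain u d'' where u: "u \<le> T" "exec H w c d' u d''" "rep m' d''"
      using assms(2) d'(1) unfolding runs_def by blast
    have "exec H w (Branch (\<lambda>_ rs. rs ! r = 3) (rewind r ;; c) (rewind r ;; c')) e (Suc (t' + u)) d''"
      unfolding ee using False d' ee u fit by (intro exec_BranchT exec_Seq) auto
    then show ?thesis using u by (intro exI[of _ "Suc (t' + u)"]) auto
  qed
  then obtain t'' d'' where "t'' \<le> t' + T + 1" "rep m' d''"
     "exec H w (Branch (\<lambda>_ rs. rs ! r = 3) (rewind r ;; c) (rewind r ;; c')) e t'' d''" by blast
  with exec_Seq[OF e(1) this(3)] e(2) d'(3)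
  show "\<exists>t d'. t \<le> T + 4 * W + 6 \<and> exec H w (if_pos r c c') d t d' \<and> rep m' d'"
    unfolding if_pos_def by (intro exI[of _ "t + t''"] exI[of _ d'']) auto
qed

lemma runs_while_pos:
  assumes "r < k" "\<And>j. j < n \<Longrightarrow> fst (snd (snd (m j))) r \<noteq> 0" "fst (snd (snd (m n))) r = 0"
    "\<And>j. j < n \<Longrightarrow> runs c (T j) (m j) (m (Suc j))"
  shows "runs (while_pos r c) ((\<Sum>j<n. T j + 4 * W + 6) + 4 * W + 6) (m 0) (m n)"
proof -
  let ?P = "\<lambda>_ rs. rs ! r = (3::nat)" and ?c = "rewind r ;; c ;; seek r"
  have loop: "\<exists>t e'. exec H w (While ?P ?c) e t e' \<and> sought r (m n) e' \<and>
      t \<le> (\<Sum>j=j..<n. T j + 4 * W + 6) + 1"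
    if "j \<le> n" "sought r (m j) e" "fits H w e" for j e
    using that
  proof (induction j arbitrary: e rule: inc_induct)
    case base
    then show ?case
      using assms(3) exec_WhileF[of ?P w "fst e" "fst (snd e)" H "snd (snd e)" ?c]
      unfolding sought_def by (intro exI[of _ 1] exI[of _ e]) auto
  next
    case (step j)
    obtain d t where d: "rep (m j) d" "exec H w (rewind r) e t d" "t \<le> 2 * W + 3"
      "scan (fst (snd e)) ! r = 3"
      using step.prems(1) assms(2)[OF step.hyps(2)] unfolding sought_def by blast
    obtain u d' where u: "u \<le> T j" "exec H w c d u d'" "rep (m (Suc j)) d'"
      using assms(4)[OF step.hyps(2)] d(1) unfolding runs_def by blast
    obtain e' v where v: "exec H w (seek r) d' v e'" "v \<le> 2 * W + 2" "sought r (m (Suc j)) e'"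
      using seek u(3) assms(1) by blast
    obtain x e'' where x: "exec H w (While ?P ?c) e' x e''" "sought r (m n) e''"
        "x \<le> (\<Sum>j=Suc j..<n. T j + 4 * W + 6) + 1"
      using step.IH v(3) exec_fits[OF v(1)] by blast
    have "exec H w (While ?P ?c) e (Suc ((t + (u + v)) + x)) e''"
      using exec_WhileT[of ?P w "fst e" "fst (snd e)" H "snd (snd e)", OF _ _ _ x(1)]
        exec_Seq[OF d(2) exec_Seq[OF u(2) v(1)]] d(4) step.prems(2) by simp
    moreover have "Suc ((t + (u + v)) + x) \<le> (\<Sum>j=j..<n. T j + 4 * W + 6) + 1"
      using d(3) u(1) v(2) x(3) step.hyps(2) by (simp add: sum.atLeast_Suc_lessThan)
    ultimately show ?case using x(2) by blast
  qed
  show ?thesis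
    unfolding runs_def
  proof (intro allI impI)
    fix d assume "rep (m 0) d"
    then obtain e t where e: "exec H w (seek r) d t e" "t \<le> 2 * W + 2" "sought r (m 0) e"
      using seek assms(1) by blast
    obtain u e' where u: "exec H w (While ?P ?c) e u e'" "sought r (m n) e'"
      "u \<le> (\<Sum>j=0..<n. T j + 4 * W + 6) + 1"
      using loop[of 0 e] e exec_fits[OF e(1)] by auto
    then obtain v d' where v: "exec H w (rewind r) e' v d'" "rep (m n) d'" "v \<le> 2 * W + 3"
      unfolding sought_def by blast
    have "exec H w (while_pos r c) d (t + (u + v)) d'"
      unfolding while_pos_def using exec_Seq[OF e(1) exec_Seq[OF u(1) v(1)]] .
    moreover have "t + (u + v) \<le> (\<Sum>j<n. T j + 4 * W + 6) + 4 * W + 6"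
      using e(2) u(3) v(3) by (simp add: lessThan_atLeast0)
    ultimately show "\<exists>t d'. t \<le> (\<Sum>j<n. T j + 4 * W + 6) + 4 * W + 6 \<and>
        exec H w (while_pos r c) d t d' \<and> rep (m n) d'"
      using v(2) by blast
  qed
qed

definition seen :: "mem \<Rightarrow> insym \<times> nat" where
  "seen m = (case m of (i, a, R, xs, os) \<Rightarrow> (read_input w i, tape xs a))"

lemma seen: "rep m (i, ws, os) \<Longrightarrow> seen m = (read_input w i, scan ws ! k)"
  by (auto simp: rep_def seen_def scan_def split: prod.splits)

lemma runs_Branch:
  assumes "Q (seen m) \<Longrightarrow> runs c T m m'" "\<not> Q (seen m) \<Longrightarrow> runs c' T m m'"
  shows "runs (Branch (\<lambda>i rs. Q (i, rs ! k)) c c') (T + 1) m m'"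
  unfolding runs_def
proof (intro allI impI)
  fix d assume rep: "rep m d"
  obtain i ws os where d: "d = (i, ws, os)" by (metis prod_cases3)
  have fit: "fits H w (i, ws, os)" and see: "seen m = (read_input w i, scan ws ! k)"
    using rep_fits seen rep d by auto
  show "\<exists>t d'. t \<le> T + 1 \<and> exec H w (Branch (\<lambda>i rs. Q (i, rs ! k)) c c') d t d' \<and> rep m' d'"
  proof (cases "Q (seen m)")
    case True
    then obtain t d' where "t \<le> T" "exec H w c d t d'" "rep m' d'"
      using assms(1) rep unfolding runs_def by blast
    moreover from this have "exec H w (Branch (\<lambda>i rs. Q (i, rs ! k)) c c') d (Suc t) d'"
      using True see fit unfolding d by (auto intro: exec_BranchT)
    ultimately show ?thesis by (metis Suc_eq_plus1 Suc_le_mono)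
  next
    case False
    then obtain t d' where "t \<le> T" "exec H w c' d t d'" "rep m' d'"
      using assms(2) rep unfolding runs_def by blast
    moreover from this have "exec H w (Branch (\<lambda>i rs. Q (i, rs ! k)) c c') d (Suc t) d'"
      using False see fit unfolding d by (auto intro: exec_BranchF)
    ultimately show ?thesis by (metis Suc_eq_plus1 Suc_le_mono)
  qed
qed

lemma runs_While:
  assumes "\<And>j. j < n \<Longrightarrow> Q (seen (m j))" "\<not> Q (seen (m n))" "\<And>j. j < n \<Longrightarrow> runs c (T j) (m j) (m (Suc j))"
  shows "runs (While (\<lambda>i rs. Q (i, rs ! k)) c) ((\<Sum>j<n. T j + 1) + 1) (m 0) (m n)"
proof -
  let ?P = "\<lambda>i rs. Q (i, rs ! k)"
  have "\<exists>t d'. exec H w (While ?P c) d t d' \<and> rep (m n) d' \<and> t \<le> (\<Sum>j=j..<n. T j + 1) + 1"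
    if "j \<le> n" "rep (m j) d" for j d
    using that
  proof (induction j arbitrary: d rule: inc_induct)
    case base
    obtain i ws os where d: "d = (i, ws, os)" by (metis prod_cases3)
    have "exec H w (While ?P c) d 1 d"
      using assms(2) seen rep_fits base unfolding d by (intro exec_WhileF) auto
    then show ?case using base by auto
  next
    case (step j)
    obtain i ws os where d: "d = (i, ws, os)" by (metis prod_cases3)
    obtain t d' where t: "t \<le> T j" "exec H w c d t d'" "rep (m (Suc j)) d'"
      using assms(3)[OF step.hyps(2)] step.prems unfolding runs_def by blast
    obtain u d'' where u: "exec H w (While ?P c) d' u d''" "rep (m n) d''"
      "u \<le> (\<Sum>j=Suc j..<n. T j + 1) + 1" using step.IH[OF t(3)] by blast
    have "exec H w (While ?P c) d (Suc (t + u)) d''"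
      using assms(1)[OF step.hyps(2)] seen[of "m j" i ws os] rep_fits[OF step.prems] step.prems t(2) u(1)
      unfolding d by (intro exec_WhileT[of ?P, OF _ _ _ u(1)]) auto
    moreover have "Suc (t + u) \<le> (\<Sum>j=j..<n. T j + 1) + 1"
      using t(1) u(3) step.hyps(2) by (simp add: sum.atLeast_Suc_lessThan)
    ultimately show ?case using u(2) by blast
  qed
  from this[of 0] show ?thesis unfolding runs_def lessThan_atLeast0 by blast
qed

lemma runs_Act:
  assumes "\<And>ws. rep (i, a, R, xs, os) (i, ws, os) \<Longrightarrow>
     rep m' (act_data w (f (read_input w i) (scan ws)) (i, ws, os))"
  shows "runs (Act f) 1 (i, a, R, xs, os) m'"
  unfolding runs_def
proof (intro allI impI)
  fix d assume rep: "rep (i, a, R, xs, os) d"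
  then obtain ws where d: "d = (i, ws, os)" by (auto simp: rep_def split: prod.splits)
  have "exec H w (Act f) d 1 (act_data w (f (read_input w i) (scan ws)) (i, ws, os))"
    unfolding d using rep_fits rep assms[of ws] unfolding d by (intro exec_Act) (blast+)
  then show "\<exists>t d'. t \<le> 1 \<and> exec H w (Act f) d t d' \<and> rep m' d'"
    using assms rep d by blast
qed

lemma runs_nop: "runs nop 1 m m"
proof -
  obtain i a R xs os where m: "m = (i, a, R, xs, os)" by (metis prod_cases5)
  show ?thesis
    unfolding nop_def m by (rule runs_Act) (simp add: act_idle[OF rep_fits])
qed

lemma runs_shift_in:
  "runs (shift_in mv) 1 (i, a, R, xs, os) (min (move_head mv i) (length w + 1), a, R, xs, os)"
  unfolding shift_in_def
proof (rule runs_Act)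
  fix ws assume rep: "rep (i, a, R, xs, os) (i, ws, os)"
  show "rep (min (move_head mv i) (length w + 1), a, R, xs, os)
      (act_data w (mv, map (\<lambda>a. (a, Stay)) (scan ws), None) (i, ws, os))"
    unfolding fits_same[OF rep_fits[OF rep]] using rep by (auto simp: rep_def)
qed

lemma runs_emit: "runs (emit b) 1 (i, a, R, xs, os) (i, a, R, xs, os @ [b])"
  unfolding emit_def
proof (rule runs_Act)
  fix ws assume rep: "rep (i, a, R, xs, os) (i, ws, os)"
  show "rep (i, a, R, xs, os @ [b]) (act_data w (Stay, map (\<lambda>a. (a, Stay)) (scan ws), Some b) (i, ws, os))"
    unfolding fits_same[OF rep_fits[OF rep]] using rep by (auto simp: rep_def)
qed

lemma runs_on_array:
  assumes "length ys + 2 \<le> H" "move_head mv a \<le> length ys + 1" "(tape xs)(a := g (tape xs a)) = tape ys"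
  shows "runs (on_tape k g mv) 1 (i, a, R, xs, os) (i, move_head mv a, R, ys, os)"
  unfolding runs_def
proof (intro allI impI)
  fix d assume rep: "rep (i, a, R, xs, os) d"
  then obtain ws where d: "d = (i, ws, os)" "k < length ws" "ws ! k = (tape xs, a)"
    by (auto simp: rep_def split: prod.splits)
  have "exec H w (on_tape k g mv) d 1 (i, ws[k := (tape ys, move_head mv a)], os)"
    using exec_on_tape[of H w i ws os k "tape xs" a mv g] assms d rep_fits[OF rep] by auto
  moreover have "rep (i, move_head mv a, R, ys, os) (i, ws[k := (tape ys, move_head mv a)], os)"
    using rep d assms by (auto simp: rep_def)
  ultimately show "\<exists>t d'. t \<le> 1 \<and> exec H w (on_tape k g mv) d t d' \<and> rep (i, move_head mv a, R, ys, os) d'"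
    by blast
qed

definition rewind_in :: flow where
  "rewind_in = While (\<lambda>i rs. fst (i, rs ! k) \<noteq> Left_End) (shift_in Move_Left)"

lemma runs_rewind_in:
  assumes "i \<le> length w + 1"
  shows "runs rewind_in (2 * i + 1) (i, a, R, xs, os) (0, a, R, xs, os)"
proof -
  have "runs rewind_in ((\<Sum>j<i. 1 + 1) + 1) (i - 0, a, R, xs, os) (i - i, a, R, xs, os)"
    unfolding rewind_in_def
  proof (rule runs_While[of i "\<lambda>z. fst z \<noteq> Left_End" "\<lambda>j. (i - j, a, R, xs, os)"])
    fix j assume j: "j < i"
    show "fst (seen (i - j, a, R, xs, os)) \<noteq> Left_End" using j by (auto simp: seen_def read_input_def)
    have "min (move_head Move_Left (i - j)) (length w + 1) = i - Suc j" using assms j by auto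
    then show "runs (shift_in Move_Left) 1 (i - j, a, R, xs, os) (i - Suc j, a, R, xs, os)"
      using runs_shift_in[of Move_Left "i - j" a R xs os] by simp
  qed (simp add: seen_def read_input_def)
  then show ?thesis by (simp add: mult_2)
qed

definition rewind_array :: flow where
  "rewind_array = While (\<lambda>i rs. snd (i, rs ! k) \<noteq> Suc 0) (on_tape k id Move_Left)"

lemma runs_rewind_array:
  assumes "length xs + 2 \<le> H" "a \<le> length xs + 1"
  shows "runs rewind_array (2 * a + 1) (i, a, R, xs, os) (i, 0, R, xs, os)"
proof -
  have "runs rewind_array ((\<Sum>j<a. 1 + 1) + 1) (i, a - 0, R, xs, os) (i, a - a, R, xs, os)"
    unfolding rewind_array_def
  proof (rule runs_While[of a "\<lambda>z. snd z \<noteq> Suc 0" "\<lambda>j. (i, a - j, R, xs, os)"])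
    fix j assume j: "j < a"
    show "snd (seen (i, a - j, R, xs, os)) \<noteq> Suc 0" using j tape_marker(2)[of "a - j" xs] by (auto simp: seen_def)
    show "runs (on_tape k id Move_Left) 1 (i, a - j, R, xs, os) (i, a - Suc j, R, xs, os)"
      using runs_on_array[of xs Move_Left "a - j" xs id i R os] assms j by auto
  qed (simp add: seen_def tape_marker)
  then show ?thesis by (simp add: mult_2)
qed

text \<open>Stopping at the first blank makes reads beyond the array find no \<open>1\<close> bit,
  in agreement with the default value of \<open>orc\<close>.\<close>

definition next_cell :: flow where
  "next_cell = Branch (\<lambda>i rs. snd (i, rs ! k) \<noteq> 0) (on_tape k id Move_Right) nop"

lemma runs_next_cell:
  assumes "length xs + 2 \<le> H" "a \<le> length xs + 1"
  shows "runs next_cell 2 (i, a, R, xs, os) (i, min (a + 1) (length xs + 1), R, xs, os)"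
proof -
  have blank: "tape xs a = 0 \<longleftrightarrow> a = length xs + 1" using assms(2) by (auto simp: tape_def bsym_def)
  have "runs next_cell (1 + 1) (i, a, R, xs, os) (i, min (a + 1) (length xs + 1), R, xs, os)"
    unfolding next_cell_def
  proof (rule runs_Branch[of "\<lambda>z. snd z \<noteq> 0"])
    assume "snd (seen (i, a, R, xs, os)) \<noteq> 0"
    then have "a \<le> length xs" using assms(2) blank by (auto simp: seen_def)
    then show "runs (on_tape k id Move_Right) 1 (i, a, R, xs, os) (i, min (a + 1) (length xs + 1), R, xs, os)"
      using runs_on_array[of xs Move_Right a xs id i R os] assms by simp
  next
    assume "\<not> snd (seen (i, a, R, xs, os)) \<noteq> 0"
    then show "runs nop 1 (i, a, R, xs, os) (i, min (a + 1) (length xs + 1), R, xs, os)"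
      using blank runs_nop by (simp add: seen_def)
  qed
  then show ?thesis by (simp add: numeral_2_eq_2)
qed

definition append_bit :: "bool \<Rightarrow> flow" where
  "append_bit b = While (\<lambda>i rs. snd (i, rs ! k) \<noteq> 0) (on_tape k id Move_Right) ;;
     on_tape k (\<lambda>_. bsym b) Stay ;; rewind_array"

lemma runs_append_bit:
  assumes "length xs + 3 \<le> H"
  shows "runs (append_bit b) (4 * length xs + 10) (i, 0, R, xs, os) (i, 0, R, xs @ [b], os)"
proof -
  let ?n = "length xs + 1"
  have "runs (While (\<lambda>i rs. snd (i, rs ! k) \<noteq> 0) (on_tape k id Move_Right)) ((\<Sum>j<?n. 1 + 1) + 1)
    (i, 0, R, xs, os) (i, ?n, R, xs, os)"
  proof (rule runs_While[of ?n "\<lambda>z. snd z \<noteq> 0" "\<lambda>j. (i, j, R, xs, os)"])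
    fix j assume j: "j < ?n"
    show "snd (seen (i, j, R, xs, os)) \<noteq> 0" using j by (auto simp: seen_def tape_def bsym_def)
    show "runs (on_tape k id Move_Right) 1 (i, j, R, xs, os) (i, Suc j, R, xs, os)"
      using runs_on_array[of xs Move_Right j xs id i R os] assms j by simp
  qed (simp add: seen_def tape_def)
  moreover have "(tape xs)(?n := bsym b) = tape (xs @ [b])"
    by (auto simp: tape_def nth_append fun_eq_iff)
  then have "runs (on_tape k (\<lambda>_. bsym b) Stay) 1 (i, ?n, R, xs, os) (i, ?n, R, xs @ [b], os)"
    using runs_on_array[of "xs @ [b]" Stay ?n xs "\<lambda>_. bsym b" i R os] assms by simp
  moreover have "runs rewind_array (2 * ?n + 1) (i, ?n, R, xs @ [b], os) (i, 0, R, xs @ [b], os)"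
    using assms by (intro runs_rewind_array) auto
  ultimately have "runs (append_bit b) (((\<Sum>j<?n. 1 + 1) + 1) + (1 + (2 * ?n + 1)))
      (i, 0, R, xs, os) (i, 0, R, xs @ [b], os)"
    unfolding append_bit_def by (intro runs_Seq)
  then show ?thesis by (rule runs_mono) simp
qed

end

section \<open>A functional language and its compilation\<close>

text \<open>
  Environments are lists of numbers; \<^term>\<open>Bind\<close> and \<^term>\<open>Loop\<close> push their values in front, and
  \<^term>\<open>Ren\<close> rearranges the environment, which costs nothing at run time. A pair \<open>(w, X)\<close> provides
  the input word and the array.
\<close>

datatype exp =
  V nat | Succ exp | Pred exp | Cond exp exp exp | Bind exp exp | Ren "nat list" exp
| Len | Inp exp | Orc exp | Loop exp exp exp

text \<open>The default survives compilation: a variable out of range is sent by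
  \<open>lk rs\<close> to register \<open>0\<close>, and this register contains
  \<open>0\<close>.\<close>

definition lk :: "nat list \<Rightarrow> nat \<Rightarrow> nat" where
  "lk e j = (if j < length e then e ! j else 0)"

type_synonym glob = "bool list \<times> bool list"

definition inp :: "glob \<Rightarrow> nat \<Rightarrow> nat" where
  "inp g i = (if i < length (fst g) then of_bool (fst g ! i) else 2)"

definition orc :: "glob \<Rightarrow> nat \<Rightarrow> nat" where
  "orc g i = of_bool (i < length (snd g) \<and> snd g ! i)"

primrec eval :: "exp \<Rightarrow> glob \<Rightarrow> nat list \<Rightarrow> nat" where
  "eval (V j) g e = lk e j"
| "eval (Succ a) g e = Suc (eval a g e)"
| "eval (Pred a) g e = eval a g e - 1"
| "eval (Cond a b c) g e = (if eval a g e \<noteq> 0 then eval b g e else eval c g e)"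
| "eval (Bind a b) g e = eval b g (eval a g e # e)"
| "eval (Ren js a) g e = eval a g (map (lk e) js)"
| "eval Len g e = length (fst g)"
| "eval (Inp a) g e = inp g (eval a g e)"
| "eval (Orc a) g e = orc g (eval a g e)"
| "eval (Loop n a b) g e = rec_nat (eval a g e) (\<lambda>i x. eval b g (i # x # e)) (eval n g e)"

text \<open>The cost bounds the number of register operations, hence also the growth of the registers.\<close>

primrec cost :: "exp \<Rightarrow> glob \<Rightarrow> nat list \<Rightarrow> nat" where
  "cost (V j) g e = 1"
| "cost (Succ a) g e = cost a g e + 1"
| "cost (Pred a) g e = cost a g e + 1"
| "cost (Cond a b c) g e = cost a g e + cost b g e + cost c g e + 1"
| "cost (Bind a b) g e = cost a g e + cost b g (eval a g e # e) + 1"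
| "cost (Ren js a) g e = cost a g (map (lk e) js)"
| "cost Len g e = length (fst g) + 1"
| "cost (Inp a) g e = cost a g e + eval a g e + length (fst g) + 1"
| "cost (Orc a) g e = cost a g e + eval a g e + 1"
| "cost (Loop n a b) g e = cost n g e + cost a g e +
     (\<Sum>i<eval n g e. cost b g (i # rec_nat (eval a g e) (\<lambda>i x. eval b g (i # x # e)) i # e) + 1) + 1"

lemma cost_pos: "0 < cost a g e"
  by (induction a arbitrary: e) auto

text \<open>Registers needed from the result register \<open>d\<close> upwards. A loop occupies
  \<open>d\<close> (accumulator), \<open>d + 1\<close> (round) and \<open>d + 2\<close> (rounds
  left), and its body delivers to \<open>d + 3\<close>.\<close>

primrec regs :: "exp \<Rightarrow> nat" where
  "regs (V j) = 1"
| "regs (Succ a) = regs a"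
| "regs (Pred a) = regs a"
| "regs (Cond a b c) = max (regs a) (max (regs b) (regs c))"
| "regs (Bind a b) = max (regs a) (1 + regs b)"
| "regs (Ren js a) = regs a"
| "regs Len = 1"
| "regs (Inp a) = regs a"
| "regs (Orc a) = regs a"
| "regs (Loop n a b) = max (regs a) (max (2 + regs n) (3 + regs b))"

lemma regs_pos: "0 < regs a"
  by (induction a) auto

context register_machine
begin

text \<open>The variables live in the registers \<open>rs\<close>, the result goes to register \<open>d\<close>, and the registers
  from \<open>d\<close> on may be overwritten. Register \<open>0\<close> always contains \<open>0\<close>.\<close>

primrec comp :: "exp \<Rightarrow> nat list \<Rightarrow> nat \<Rightarrow> flow" where
  "comp (V j) rs d = copy (lk rs j) d"
| "comp (Succ a) rs d = comp a rs d ;; bump d True"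
| "comp (Pred a) rs d = comp a rs d ;; if_pos d (bump d False) nop"
| "comp (Cond a b c) rs d = comp a rs d ;; if_pos d (comp b rs d) (comp c rs d)"
| "comp (Bind a b) rs d = comp a rs d ;; comp b (d # rs) (d + 1) ;; copy (d + 1) d"
| "comp (Ren js a) rs d = comp a (map (lk rs) js) d"
| "comp Len rs d = copy 0 d ;; rewind_in ;; shift_in Move_Right ;;
     While (\<lambda>i rs. fst (i, rs ! k) \<noteq> Right_End) (shift_in Move_Right ;; bump d True)"
| "comp (Inp a) rs d = comp a rs d ;; rewind_in ;; shift_in Move_Right ;;
     while_pos d (bump d False ;; shift_in Move_Right) ;;
     Branch (\<lambda>i rs. fst (i, rs ! k) = Right_End) (bump d True ;; bump d True)
       (Branch (\<lambda>i rs. fst (i, rs ! k) = Bit True) (bump d True) nop)"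
| "comp (Orc a) rs d = comp a rs d ;; next_cell ;;
     while_pos d (bump d False ;; next_cell) ;;
     Branch (\<lambda>i rs. snd (i, rs ! k) = 3) (bump d True) nop ;; rewind_array"
| "comp (Loop n a b) rs d = comp a rs d ;; comp n rs (d + 2) ;; copy 0 (d + 1) ;;
     while_pos (d + 2) (bump (d + 2) False ;; comp b ((d + 1) # d # rs) (d + 3) ;;
       copy (d + 3) d ;; bump (d + 1) True)"

text \<open>Registers bounded by \<open>v\<close> stay below \<open>v\<close> plus the cost, because
  growth is charged; hence \<open>v + cost < 2 ^ W\<close> keeps every word within \<open>W\<close>
  bits. Each unit of cost pays for a bounded number of passes over words of that length, whence the
  factor \<open>40 * (W + 1)\<close>. The input head may end anywhere, since each access to the
  input rewinds it; the array head returns to \<open>0\<close>.\<close>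

lemma comp_correct:
  assumes "d + regs a \<le> k" "\<forall>r \<in> set rs. r < d" "0 < d" "R 0 = 0" "\<forall>r<k. R r \<le> v"
    "v + cost a (w, xs) (map R rs) < 2 ^ W" "i \<le> length w + 1" "length xs + 2 \<le> H"
  shows "\<exists>i' R'. runs (comp a rs d) (40 * (W + 1) * cost a (w, xs) (map R rs))
      (i, 0, R, xs, os) (i', 0, R', xs, os) \<and> i' \<le> length w + 1 \<and>
    R' d = eval a (w, xs) (map R rs) \<and> (\<forall>r<d. R' r = R r) \<and>
    (\<forall>r<k. R' r \<le> v + cost a (w, xs) (map R rs))"
  using assms
proof (induction a arbitrary: rs d R v i)
  case (V j)
  have "lk rs j < d" using V.prems by (auto simp: lk_def)
  then have "runs (copy (lk rs j) d) (6 * W + 9) (i, 0, R, xs, os) (i, 0, R(d := R (lk rs j)), xs, os)"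
    using V.prems by (intro runs_copy) auto
  then have "runs (copy (lk rs j) d) (40 * (W + 1) * 1) (i, 0, R, xs, os) (i, 0, R(d := R (lk rs j)), xs, os)"
    by (rule runs_mono) simp
  moreover have "R (lk rs j) = lk (map R rs) j" using V.prems(4) by (simp add: lk_def)
  moreover have "R (lk rs j) \<le> v" using V.prems \<open>lk rs j < d\<close> by simp
  ultimately show ?case using V.prems
    by (intro exI[of _ i] exI[of _ "R(d := R (lk rs j))"]) (auto simp: fun_upd_def)
next
  case (Succ a)
  let ?c = "cost a (w, xs) (map R rs)"
  obtain i1 R1 where 1: "runs (comp a rs d) (40 * (W + 1) * ?c) (i, 0, R, xs, os) (i1, 0, R1, xs, os)"
    "i1 \<le> length w + 1" "R1 d = eval a (w, xs) (map R rs)" "\<forall>r<d. R1 r = R r" "\<forall>r<k. R1 r \<le> v + ?c"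
    using Succ.IH[of d rs R v i] Succ.prems by auto
  have dk: "d < k" using Succ.prems(1) regs_pos[of a] by simp
  have "R1 d + 1 < 2 ^ W" using 1(5) dk Succ.prems(6) by (auto simp: le_less_trans)
  then have "runs (bump d True) (4 * W + 6) (i1, 0, R1, xs, os) (i1, 0, R1(d := R1 d + 1), xs, os)"
    by (intro runs_inc dk)
  with runs_Seq[OF 1(1) this]
  have "runs (comp (Succ a) rs d) (40 * (W + 1) * (?c + 1)) (i, 0, R, xs, os) (i1, 0, R1(d := R1 d + 1), xs, os)"
    by (auto elim!: runs_mono simp: algebra_simps)
  then show ?case using 1 dk
    by (intro exI[of _ i1] exI[of _ "R1(d := R1 d + 1)"]) (auto simp: fun_upd_def intro: le_SucI)
next
  case (Pred a)
  let ?c = "cost a (w, xs) (map R rs)"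
  obtain i1 R1 where 1: "runs (comp a rs d) (40 * (W + 1) * ?c) (i, 0, R, xs, os) (i1, 0, R1, xs, os)"
    "i1 \<le> length w + 1" "R1 d = eval a (w, xs) (map R rs)" "\<forall>r<d. R1 r = R r" "\<forall>r<k. R1 r \<le> v + ?c"
    using Pred.IH[of d rs R v i] Pred.prems by auto
  have dk: "d < k" using Pred.prems(1) regs_pos[of a] by simp
  have "runs (if_pos d (bump d False) nop) ((4 * W + 6) + 4 * W + 6) (i1, 0, R1, xs, os)
      (i1, 0, R1(d := R1 d - 1), xs, os)"
  proof (rule runs_if_pos[OF dk])
    show "runs (bump d False) (4 * W + 6) (i1, 0, R1, xs, os) (i1, 0, R1(d := R1 d - 1), xs, os)"
      if "fst (snd (snd (i1, 0, R1, xs, os))) d \<noteq> 0"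
      using that by (intro runs_dec dk) auto
    show "runs nop (4 * W + 6) (i1, 0, R1, xs, os) (i1, 0, R1(d := R1 d - 1), xs, os)"
      if "fst (snd (snd (i1, 0, R1, xs, os))) d = 0"
    proof -
      have "R1(d := R1 d - 1) = R1" using that by auto
      then show ?thesis using runs_mono[OF runs_nop] by simp
    qed
  qed
  with runs_Seq[OF 1(1) this]
  have "runs (comp (Pred a) rs d) (40 * (W + 1) * (?c + 1)) (i, 0, R, xs, os) (i1, 0, R1(d := R1 d - 1), xs, os)"
    by (auto elim!: runs_mono simp: algebra_simps)
  then show ?case using 1 dk
    by (intro exI[of _ i1] exI[of _ "R1(d := R1 d - 1)"]) (auto simp: fun_upd_def intro: le_SucI)
next
  case (Cond a b c)
  let ?e = "map R rs"
  let ?c = "cost a (w, xs) ?e" and ?b = "if eval a (w, xs) ?e \<noteq> 0 then b else c"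
  let ?t = "cost b (w, xs) ?e + cost c (w, xs) ?e"
  have k: "d + regs a \<le> k" "d + regs b \<le> k" "d + regs c \<le> k"
    using Cond.prems(1) by (simp_all add: max_def split: if_splits)
  obtain i1 R1 where 1: "runs (comp a rs d) (40 * (W + 1) * ?c) (i, 0, R, xs, os) (i1, 0, R1, xs, os)"
    "i1 \<le> length w + 1" "R1 d = eval a (w, xs) (map R rs)" "\<forall>r<d. R1 r = R r" "\<forall>r<k. R1 r \<le> v + ?c"
    using Cond.IH(1)[of d rs R v i] Cond.prems k by auto
  have dk: "d < k" using k regs_pos[of a] by simp
  have e: "map R1 rs = ?e" using 1(4) Cond.prems(2) by simp
  have "\<exists>i' R'. runs (comp ?b rs d) (40 * (W + 1) * cost ?b (w, xs) (map R1 rs))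
      (i1, 0, R1, xs, os) (i', 0, R', xs, os) \<and> i' \<le> length w + 1 \<and>
    R' d = eval ?b (w, xs) (map R1 rs) \<and> (\<forall>r<d. R' r = R1 r) \<and>
    (\<forall>r<k. R' r \<le> v + ?c + cost ?b (w, xs) (map R1 rs))"
    using Cond.IH(2)[of d rs R1 "v + ?c" i1] Cond.IH(3)[of d rs R1 "v + ?c" i1] 1 Cond.prems k
    unfolding e by auto
  then obtain i2 R2 where 2: "runs (comp ?b rs d) (40 * (W + 1) * cost ?b (w, xs) ?e)
      (i1, 0, R1, xs, os) (i2, 0, R2, xs, os)" "i2 \<le> length w + 1"
    "R2 d = eval ?b (w, xs) ?e" "\<forall>r<d. R2 r = R1 r" "\<forall>r<k. R2 r \<le> v + ?c + cost ?b (w, xs) ?e"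
    unfolding e by blast
  have le: "cost ?b (w, xs) ?e \<le> ?t" by simp
  then have "runs (comp ?b rs d) (40 * (W + 1) * ?t) (i1, 0, R1, xs, os) (i2, 0, R2, xs, os)"
    by (intro runs_mono[OF 2(1)] mult_left_mono) auto
  then have "runs (if_pos d (comp b rs d) (comp c rs d)) (40 * (W + 1) * ?t + 4 * W + 6)
      (i1, 0, R1, xs, os) (i2, 0, R2, xs, os)"
    using 1(3) by (intro runs_if_pos[OF dk]) auto
  with runs_Seq[OF 1(1) this]
  have "runs (comp (Cond a b c) rs d) (40 * (W + 1) * (?c + ?t + 1)) (i, 0, R, xs, os) (i2, 0, R2, xs, os)"
    by (auto elim!: runs_mono simp: algebra_simps)
  moreover have "\<forall>r<k. R2 r \<le> v + (?c + ?t + 1)" using 2(5) le by fastforce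
  ultimately show ?case using 1 2
    by (intro exI[of _ i2] exI[of _ R2]) (auto simp: add.assoc)
next
  case (Bind a b)
  let ?e = "map R rs"
  let ?x = "eval a (w, xs) ?e"
  let ?c = "cost a (w, xs) ?e" and ?t = "cost b (w, xs) (?x # ?e)"
  have k: "d + regs a \<le> k" "d + 1 + regs b \<le> k"
    using Bind.prems(1) by (simp_all add: max_def split: if_splits)
  obtain i1 R1 where 1: "runs (comp a rs d) (40 * (W + 1) * ?c) (i, 0, R, xs, os) (i1, 0, R1, xs, os)"
    "i1 \<le> length w + 1" "R1 d = ?x" "\<forall>r<d. R1 r = R r" "\<forall>r<k. R1 r \<le> v + ?c"
    using Bind.IH(1)[of d rs R v i] Bind.prems k by auto
  have dk: "d + 1 < k" using k regs_pos[of b] by simp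
  have e: "map R1 (d # rs) = ?x # ?e" using 1(3,4) Bind.prems(2) by simp
  have prem: "\<forall>r \<in> set (d # rs). r < d + 1" "R1 0 = 0" using Bind.prems 1(4) by auto
  obtain i2 R2 where 2: "runs (comp b (d # rs) (d + 1)) (40 * (W + 1) * ?t)
      (i1, 0, R1, xs, os) (i2, 0, R2, xs, os)" "i2 \<le> length w + 1"
    "R2 (d + 1) = eval b (w, xs) (?x # ?e)" "\<forall>r<d + 1. R2 r = R1 r" "\<forall>r<k. R2 r \<le> v + ?c + ?t"
    using Bind.IH(2)[of "d + 1" "d # rs" R1 "v + ?c" i1] 1 prem Bind.prems k unfolding e by auto
  have "runs (copy (d + 1) d) (6 * W + 9) (i2, 0, R2, xs, os) (i2, 0, R2(d := R2 (d + 1)), xs, os)"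
    using dk by (intro runs_copy) auto
  with runs_Seq[OF 1(1) runs_Seq[OF 2(1) this]]
  have A: "runs (comp (Bind a b) rs d) (40 * (W + 1) * (?c + ?t + 1)) (i, 0, R, xs, os)
      (i2, 0, R2(d := R2 (d + 1)), xs, os)"
    by (auto elim!: runs_mono simp: algebra_simps)
  have "R2 (d + 1) \<le> v + ?c + ?t" using 2(5) dk by blast
  then show ?case unfolding cost.simps eval.simps using 1 2
    by (intro exI[of _ i2] exI[of _ "R2(d := R2 (d + 1))"] conjI[OF A])
      (auto simp: add.assoc intro: le_SucI)
next
  case (Ren js a)
  have eq: "map (lk (map R rs)) js = map R (map (lk rs) js)"
    using Ren.prems(4) by (auto simp: lk_def)
  have "\<forall>r \<in> set (map (lk rs) js). r < d" using Ren.prems(2,3) by (auto simp: lk_def)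
  then show ?case using Ren.IH[of d "map (lk rs) js" R v i] Ren.prems
    unfolding comp.simps cost.simps eval.simps regs.simps eq by blast
next
  case Len
  have dk: "d < k" using Len.prems(1) by simp
  define n where "n = length w"
  let ?m = "\<lambda>j. (min (Suc j) (n + 1), 0, R(d := j), xs, os) :: mem"
  have 1: "runs (copy 0 d) (6 * W + 9) (i, 0, R, xs, os) (i, 0, R(d := R 0), xs, os)"
    using dk Len.prems by (intro runs_copy) auto
  have 2: "runs rewind_in (2 * n + 3) (i, 0, R(d := R 0), xs, os) (0, 0, R(d := 0), xs, os)"
    using Len.prems(4,7) runs_mono[OF runs_rewind_in[OF Len.prems(7)]] by (simp add: n_def)
  have 3: "runs (shift_in Move_Right) 1 (0, 0, R(d := 0), xs, os) (?m 0)"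
    using runs_shift_in[of Move_Right 0 0 "R(d := 0)" xs os] by (simp add: n_def)
  have "runs (While (\<lambda>i rs. fst (i, rs ! k) \<noteq> Right_End) (shift_in Move_Right ;; bump d True))
    ((\<Sum>j<n. (1 + (4 * W + 6)) + 1) + 1) (?m 0) (?m n)"
  proof (rule runs_While[of n "\<lambda>z. fst z \<noteq> Right_End" ?m])
    fix j assume j: "j < n"
    show "fst (seen (?m j)) \<noteq> Right_End" using j by (auto simp: seen_def read_input_def n_def)
    have "runs (shift_in Move_Right) 1 (?m j) (min (Suc (Suc j)) (n + 1), 0, R(d := j), xs, os)"
      using runs_shift_in[of Move_Right "min (Suc j) (n + 1)" 0 "R(d := j)" xs os] j by (simp add: n_def)
    moreover have "j + 1 < 2 ^ W" using j Len.prems(6) by (simp add: n_def)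
    then have "runs (bump d True) (4 * W + 6) (min (Suc (Suc j)) (n + 1), 0, R(d := j), xs, os) (?m (Suc j))"
      using runs_inc[OF dk, of "R(d := j)" "min (Suc (Suc j)) (n + 1)" 0 xs os] by simp
    ultimately show "runs (shift_in Move_Right ;; bump d True) (1 + (4 * W + 6)) (?m j) (?m (Suc j))"
      by (rule runs_Seq)
  qed (auto simp: seen_def read_input_def n_def)
  with runs_Seq[OF 1 runs_Seq[OF 2 runs_Seq[OF 3 this]]]
  have A: "runs (comp Len rs d) (40 * (W + 1) * (n + 1)) (i, 0, R, xs, os) (?m n)"
    by (auto elim!: runs_mono simp: algebra_simps)
  show ?case unfolding cost.simps eval.simps fst_conv using Len.prems dk
    by (intro exI[of _ "min (Suc (length w)) (length w + 1)"] exI[of _ "R(d := length w)"] conjI[OF A[unfolded n_def]])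
      (auto simp: n_def intro: trans_le_add1)
next
  case (Inp a)
  let ?c = "cost a (w, xs) (map R rs)"
  define n where "n = length w"
  define x where "x = eval a (w, xs) (map R rs)"
  obtain i1 R1 where 1: "runs (comp a rs d) (40 * (W + 1) * ?c) (i, 0, R, xs, os) (i1, 0, R1, xs, os)"
    "i1 \<le> length w + 1" "R1 d = x" "\<forall>r<d. R1 r = R r" "\<forall>r<k. R1 r \<le> v + ?c"
    using Inp.IH[of d rs R v i] Inp.prems by (auto simp: x_def)
  have dk: "d < k" using Inp.prems(1) regs_pos[of a] by simp
  let ?m = "\<lambda>j. (min (Suc j) (n + 1), 0, R1(d := x - j), xs, os) :: mem"
  have 2: "runs rewind_in (2 * n + 3) (i1, 0, R1, xs, os) (0, 0, R1, xs, os)"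
    using runs_mono[OF runs_rewind_in[OF 1(2)]] 1(2) by (simp add: n_def)
  have "R1(d := x) = R1" using 1(3) by auto
  then have 3: "runs (shift_in Move_Right) 1 (0, 0, R1, xs, os) (?m 0)"
    using runs_shift_in[of Move_Right 0 0 R1 xs os] by (simp add: n_def)
  have 4: "runs (while_pos d (bump d False ;; shift_in Move_Right))
    ((\<Sum>j<x. ((4 * W + 6) + 1) + 4 * W + 6) + 4 * W + 6) (?m 0) (?m x)"
  proof (rule runs_while_pos[OF dk])
    fix j assume j: "j < x"
    show "fst (snd (snd (?m j))) d \<noteq> 0" using j by simp
    have "runs (bump d False) (4 * W + 6) (?m j) (min (Suc j) (n + 1), 0, R1(d := x - Suc j), xs, os)"
      using runs_dec[OF dk, of "R1(d := x - j)" "min (Suc j) (n + 1)" 0 xs os] j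
      by simp
    moreover have eq: "min (move_head Move_Right (min (Suc j) (n + 1))) (length w + 1) = min (Suc (Suc j)) (n + 1)"
      by (auto simp: n_def min_def)
    have "runs (shift_in Move_Right) 1 (min (Suc j) (n + 1), 0, R1(d := x - Suc j), xs, os) (?m (Suc j))"
      using runs_shift_in[of Move_Right "min (Suc j) (n + 1)" 0 "R1(d := x - Suc j)" xs os]
      unfolding eq .
    ultimately show "runs (bump d False ;; shift_in Move_Right) ((4 * W + 6) + 1) (?m j) (?m (Suc j))"
      by (rule runs_Seq)
  qed simp
  let ?y = "inp (w, xs) x" and ?j = "min (Suc x) (n + 1)"
  have c: "1 \<le> ?c" using cost_pos[of a] by (simp add: Suc_le_eq)
  then have W: "2 < (2::nat) ^ W" using Inp.prems(6) by simp
  have inc: "runs (bump d True) (4 * W + 6) (?j, 0, R1(d := y), xs, os) (?j, 0, R1(d := y + 1), xs, os)"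
    if "y < 2" for y
    using runs_inc[OF dk, of "R1(d := y)" ?j 0 xs os] that W by simp
  have seen: "fst (seen (?m x)) = (if x < n then Bit (w ! x) else Right_End)"
    by (auto simp: seen_def read_input_def n_def)
  have 5: "runs (Branch (\<lambda>i rs. fst (i, rs ! k) = Right_End) (bump d True ;; bump d True)
       (Branch (\<lambda>i rs. fst (i, rs ! k) = Bit True) (bump d True) nop)) ((4 * W + 6 + (4 * W + 6)) + 1)
       (?m x) (?j, 0, R1(d := ?y), xs, os)"
  proof (rule runs_Branch[of "\<lambda>z. fst z = Right_End"])
    assume "fst (seen (?m x)) = Right_End"
    then have "?y = 1 + 1" "x - x = (0::nat)" unfolding seen by (auto simp: inp_def n_def split: if_splits)
    then show "runs (bump d True ;; bump d True) (4 * W + 6 + (4 * W + 6)) (?m x) (?j, 0, R1(d := ?y), xs, os)"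
      using runs_Seq[OF inc[of 0, unfolded add_0] inc[of 1]] by simp
  next
    assume "\<not> fst (seen (?m x)) = Right_End"
    then have *: "x < n" "fst (seen (?m x)) = Bit (w ! x)" unfolding seen by (auto split: if_splits)
    then have y: "?y = of_bool (w ! x)" by (simp add: inp_def n_def)
    have "runs (Branch (\<lambda>i rs. fst (i, rs ! k) = Bit True) (bump d True) nop) ((4 * W + 6) + 1)
       (?m x) (?j, 0, R1(d := ?y), xs, os)"
      by (rule runs_Branch[of "\<lambda>z. fst z = Bit True"]) 
        (use * y inc[of 0] in \<open>auto intro: runs_mono[OF runs_nop]\<close>)
    then show "runs (Branch (\<lambda>i rs. fst (i, rs ! k) = Bit True) (bump d True) nop)
        (4 * W + 6 + (4 * W + 6)) (?m x) (?j, 0, R1(d := ?y), xs, os)"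
      by (rule runs_mono) simp
  qed
  have A: "runs (comp (Inp a) rs d) (40 * (W + 1) * (?c + x + n + 1)) (i, 0, R, xs, os) (?j, 0, R1(d := ?y), xs, os)"
    using runs_Seq[OF 1(1) runs_Seq[OF 2 runs_Seq[OF 3 runs_Seq[OF 4 5]]]]
    by (auto elim!: runs_mono simp: algebra_simps)
  have "?y \<le> ?c + 1" using c by (simp add: inp_def)
  moreover have "R1 r \<le> v + (?c + x + n + 1)" if "r < k" for r using 1(5) that by fastforce
  ultimately show ?case unfolding cost.simps eval.simps fst_conv x_def[symmetric] n_def[symmetric] using 1 dk
    by (intro exI[of _ ?j] exI[of _ "R1(d := ?y)"] conjI[OF A]) auto
next
  case (Orc a)
  let ?c = "cost a (w, xs) (map R rs)"
  define n where "n = length xs"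
  define x where "x = eval a (w, xs) (map R rs)"
  obtain i1 R1 where 1: "runs (comp a rs d) (40 * (W + 1) * ?c) (i, 0, R, xs, os) (i1, 0, R1, xs, os)"
    "i1 \<le> length w + 1" "R1 d = x" "\<forall>r<d. R1 r = R r" "\<forall>r<k. R1 r \<le> v + ?c"
    using Orc.IH[of d rs R v i] Orc.prems by (auto simp: x_def)
  have dk: "d < k" using Orc.prems(1) regs_pos[of a] by simp
  let ?m = "\<lambda>j. (i1, min (Suc j) (n + 1), R1(d := x - j), xs, os) :: mem"
  have "R1(d := x) = R1" using 1(3) by auto
  then have 2: "runs next_cell 2 (i1, 0, R1, xs, os) (?m 0)"
    using runs_next_cell[of xs 0 i1 R1 os] Orc.prems(8) by (simp add: n_def)
  have 3: "runs (while_pos d (bump d False ;; next_cell))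
    ((\<Sum>j<x. ((4 * W + 6) + 2) + 4 * W + 6) + 4 * W + 6) (?m 0) (?m x)"
  proof (rule runs_while_pos[OF dk])
    fix j assume j: "j < x"
    show "fst (snd (snd (?m j))) d \<noteq> 0" using j by simp
    have "runs (bump d False) (4 * W + 6) (?m j) (i1, min (Suc j) (n + 1), R1(d := x - Suc j), xs, os)"
      using runs_dec[OF dk, of "R1(d := x - j)" i1 "min (Suc j) (n + 1)" xs os] j
      by simp
    moreover have eq: "min (min (Suc j) (n + 1) + 1) (length xs + 1) = min (Suc (Suc j)) (n + 1)"
      by (auto simp: n_def min_def)
    have "runs next_cell 2 (i1, min (Suc j) (n + 1), R1(d := x - Suc j), xs, os) (?m (Suc j))"
      using runs_next_cell[of xs "min (Suc j) (n + 1)" i1 "R1(d := x - Suc j)" os] Orc.prems(8)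
      unfolding eq by (simp add: n_def)
    ultimately show "runs (bump d False ;; next_cell) ((4 * W + 6) + 2) (?m j) (?m (Suc j))"
      by (rule runs_Seq)
  qed simp
  let ?y = "orc (w, xs) x" and ?a = "min (Suc x) (n + 1)"
  have W: "1 < (2::nat) ^ W" using cost_pos[of a] Orc.prems(6) by simp
  have seen: "snd (seen (?m x)) = 3 \<longleftrightarrow> x < n \<and> xs ! x"
    by (auto simp: seen_def tape_def n_def bsym_def)
  have 4: "runs (Branch (\<lambda>i rs. snd (i, rs ! k) = 3) (bump d True) nop) ((4 * W + 6) + 1)
      (?m x) (i1, ?a, R1(d := ?y), xs, os)"
  proof (rule runs_Branch[of "\<lambda>z. snd z = 3"])
    assume "snd (seen (?m x)) = 3"
    then have "?y = 1" unfolding seen by (simp add: orc_def n_def)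
    then show "runs (bump d True) (4 * W + 6) (?m x) (i1, ?a, R1(d := ?y), xs, os)"
      using runs_inc[OF dk, of "R1(d := 0)" i1 ?a xs os] W by simp
  next
    assume "\<not> snd (seen (?m x)) = 3"
    then have "?y = 0" unfolding seen by (simp add: orc_def n_def)
    then show "runs nop (4 * W + 6) (?m x) (i1, ?a, R1(d := ?y), xs, os)"
      by (auto intro: runs_mono[OF runs_nop])
  qed
  have 5: "runs rewind_array (2 * x + 3) (i1, ?a, R1(d := ?y), xs, os) (i1, 0, R1(d := ?y), xs, os)"
    by (rule runs_mono[OF runs_rewind_array[OF Orc.prems(8)]]) (auto simp: n_def)
  have A: "runs (comp (Orc a) rs d) (40 * (W + 1) * (?c + x + 1)) (i, 0, R, xs, os) (i1, 0, R1(d := ?y), xs, os)"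
    using runs_Seq[OF 1(1) runs_Seq[OF 2 runs_Seq[OF 3 runs_Seq[OF 4 5]]]]
    by (auto elim!: runs_mono simp: algebra_simps)
  have "?y \<le> 1" by (simp add: orc_def)
  moreover have "R1 r \<le> v + (?c + x + 1)" if "r < k" for r using 1(5) that by fastforce
  ultimately show ?case unfolding cost.simps eval.simps x_def[symmetric] using 1 dk
    by (intro exI[of _ i1] exI[of _ "R1(d := ?y)"] conjI[OF A]) auto
next
  case (Loop n a b)
  let ?e = "map R rs"
  define N where "N = eval n (w, xs) ?e"
  define f where "f = rec_nat (eval a (w, xs) ?e) (\<lambda>i x. eval b (w, xs) (i # x # ?e))"
  define u where "u = (\<lambda>j. cost b (w, xs) (j # f j # ?e) + 1)"
  let ?ca = "cost a (w, xs) ?e" and ?cn = "cost n (w, xs) ?e"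
  have cost: "cost (Loop n a b) (w, xs) ?e = ?cn + ?ca + (\<Sum>j<N. u j) + 1"
    by (simp add: N_def f_def u_def)
  have k: "d + regs a \<le> k" "d + 2 + regs n \<le> k" "d + 3 + regs b \<le> k"
    using Loop.prems(1) by (simp_all add: max_def split: if_splits)
  have kk: "d + 1 < k" "d + 2 < k" "d + 3 < k"
    using k regs_pos[of b] by auto
  obtain i1 R1 where 1: "runs (comp a rs d) (40 * (W + 1) * ?ca) (i, 0, R, xs, os) (i1, 0, R1, xs, os)"
    "i1 \<le> length w + 1" "R1 d = f 0" "\<forall>r<d. R1 r = R r" "\<forall>r<k. R1 r \<le> v + ?ca"
    using Loop.IH(2)[of d rs R v i] Loop.prems k by (auto simp: f_def)
  have e1: "map R1 rs = ?e" using 1(4) Loop.prems(2) by simp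
  have prem: "\<forall>r \<in> set rs. r < d + 2" using Loop.prems(2) by auto
  obtain i2 R2 where 2: "runs (comp n rs (d + 2)) (40 * (W + 1) * ?cn)
      (i1, 0, R1, xs, os) (i2, 0, R2, xs, os)" "i2 \<le> length w + 1"
    "R2 (d + 2) = N" "\<forall>r<d + 2. R2 r = R1 r" "\<forall>r<k. R2 r \<le> v + ?ca + ?cn"
    using Loop.IH(1)[of "d + 2" rs R1 "v + ?ca" i1] 1 Loop.prems k(2) prem cost
    unfolding e1 N_def by auto
  have R20: "R2 0 = 0" "R2 d = f 0" using 1(3,4) 2(4) Loop.prems(3,4) by auto
  have 3: "runs (copy 0 (d + 1)) (6 * W + 9) (i2, 0, R2, xs, os) (i2, 0, R2(d + 1 := 0), xs, os)"
    using runs_copy[of 0 "d + 1" i2 0 R2 xs os] k R20 by simp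
  let ?body = "bump (d + 2) False ;; comp b ((d + 1) # d # rs) (d + 3) ;; copy (d + 3) d ;; bump (d + 1) True"
  define T where "T = (\<lambda>j. 40 * (W + 1) * (u j - 1) + 18 * W + 21)"
  \<comment> \<open>The loop invariant: accumulator, round, remaining rounds, untouched variables,
    and a register bound that grows by the cost of each round.\<close>
  define ok where "ok = (\<lambda>j z. fst z \<le> length w + 1 \<and> snd z (d + 2) = N - j \<and> snd z (d + 1) = j \<and>
      snd z d = f j \<and> (\<forall>r<d. snd z r = R r) \<and> (\<forall>r<k. snd z r \<le> v + ?ca + ?cn + (\<Sum>j<j. u j)))"
  have ok0: "ok 0 (i2, R2(d + 1 := 0))"
    using 1(4) 2 R20 by (auto simp: ok_def)
  have step: "\<exists>z'. ok (Suc j) z' \<and>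
      runs ?body (T j) (fst z, 0, snd z, xs, os) (fst z', 0, snd z', xs, os)"
    if "ok j z" "j < N" for j z
  proof -
    obtain i S where z: "z = (i, S)" by (metis prod.exhaust)
    let ?vj = "v + ?ca + ?cn + (\<Sum>j<j. u j)"
    have S: "i \<le> length w + 1" "S (d + 2) = N - j" "S (d + 1) = j" "S d = f j" "\<forall>r<d. S r = R r"
      "\<forall>r<k. S r \<le> ?vj" using that(1) by (auto simp: ok_def z)
    have u: "u j = (u j - 1) + 1" by (simp add: u_def)
    have "(\<Sum>j<j. u j) + u j \<le> (\<Sum>j<N. u j)"
      using that(2) sum_mono2[of "{..<N}" "{..<Suc j}" u] by auto
    then have bound: "?vj + u j < 2 ^ W" using Loop.prems(6) unfolding cost by simp
    let ?S1 = "S(d + 2 := N - j - 1)"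
    have 1: "runs (bump (d + 2) False) (4 * W + 6) (i, 0, S, xs, os) (i, 0, ?S1, xs, os)"
      using runs_dec[of "d + 2" S i 0 xs os] S(2) k that(2) by simp
    have e: "map ?S1 ((d + 1) # d # rs) = j # f j # ?e"
      using S Loop.prems(2) by auto
    have p: "\<forall>r \<in> set ((d + 1) # d # rs). r < d + 3" "0 < d + 3" "?S1 0 = 0" "\<forall>r<k. ?S1 r \<le> ?vj"
    proof -
      have "S (d + 2) \<le> ?vj" using S(6) kk by blast
      then have "N - j - 1 \<le> ?vj" using S(2) by linarith
      then show "\<forall>r<k. ?S1 r \<le> ?vj" using S(6) by simp
    qed (use k Loop.prems S in auto)
    have cb: "u j - 1 = cost b (w, xs) (map ?S1 ((d + 1) # d # rs))"
      unfolding e by (simp add: u_def)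
    have fj: "f (Suc j) = eval b (w, xs) (map ?S1 ((d + 1) # d # rs))"
      unfolding e by (simp add: f_def)
    have b: "?vj + cost b (w, xs) (map ?S1 ((d + 1) # d # rs)) < 2 ^ W"
      using bound unfolding cb[symmetric] by linarith
    obtain i' S2 where 2: "runs (comp b ((d + 1) # d # rs) (d + 3)) (40 * (W + 1) * (u j - 1))
      (i, 0, ?S1, xs, os) (i', 0, S2, xs, os)" "i' \<le> length w + 1"
      "S2 (d + 3) = f (Suc j)" "\<forall>r<d + 3. S2 r = ?S1 r" "\<forall>r<k. S2 r \<le> ?vj + (u j - 1)"
      using Loop.IH(3)[OF k(3) p b S(1) Loop.prems(8)] unfolding cb[symmetric] fj[symmetric] by blast
    have 3: "runs (copy (d + 3) d) (6 * W + 9) (i', 0, S2, xs, os) (i', 0, S2(d := f (Suc j)), xs, os)"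
      using runs_copy[of "d + 3" d i' 0 S2 xs os] k 2(3) regs_pos[of b] by simp
    have "S (d + 1) \<le> ?vj" using S(6) kk by blast
    then have "j \<le> ?vj" using S(3) by simp
    then have "S2 (d + 1) + 1 < 2 ^ W" "S2 (d + 1) = j" using 2(4) S(3) bound u by auto
    then have 4: "runs (bump (d + 1) True) (4 * W + 6) (i', 0, S2(d := f (Suc j)), xs, os)
        (i', 0, S2(d := f (Suc j), d + 1 := Suc j), xs, os)"
      using runs_inc[of "d + 1" "S2(d := f (Suc j))" i' 0 xs os] k by simp
    have "runs ?body (T j) (i, 0, S, xs, os) (i', 0, S2(d := f (Suc j), d + 1 := Suc j), xs, os)"
      using runs_Seq[OF 1 runs_Seq[OF 2(1) runs_Seq[OF 3 4]]]
      by (auto elim!: runs_mono simp: T_def)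
    moreover have "ok (Suc j) (i', S2(d := f (Suc j), d + 1 := Suc j))"
    proof -
      have "f (Suc j) \<le> ?vj + (u j - 1)" using 2(5) kk(3) unfolding 2(3)[symmetric] by blast
      moreover have "S2 r \<le> ?vj + u j" if "r < k" for r using 2(5) that u by fastforce
      ultimately show ?thesis using S 2 \<open>j \<le> ?vj\<close> u by (auto simp: ok_def)
    qed
    ultimately show ?thesis unfolding z by (metis fst_conv snd_conv)
  qed
  \<comment> \<open>Input head and scratch registers after a round are only known to exist, so the
    sequence of memory states is obtained by dependent choice.\<close>
  obtain z where z: "\<forall>j. (j \<le> N \<longrightarrow> ok j (z j)) \<and> (j < N \<longrightarrow>
      runs ?body (T j) (fst (z j), 0, snd (z j), xs, os) (fst (z (Suc j)), 0, snd (z (Suc j)), xs, os))"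
    and z0: "z 0 = (i2, R2(d + 1 := 0))"
  proof -
    have "\<exists>z. \<forall>j. ((j \<le> N \<longrightarrow> ok j (z j)) \<and> (j = 0 \<longrightarrow> z j = (i2, R2(d + 1 := 0)))) \<and> (j < N \<longrightarrow>
      runs ?body (T j) (fst (z j), 0, snd (z j), xs, os) (fst (z (Suc j)), 0, snd (z (Suc j)), xs, os))"
    proof (rule dependent_nat_choice)
      show "\<exists>z. (0 \<le> N \<longrightarrow> ok 0 z) \<and> (0 = (0::nat) \<longrightarrow> z = (i2, R2(d + 1 := 0)))"
        by (rule exI[of _ "(i2, R2(d + 1 := 0))"]) (use ok0 in blast)
    next
      fix z j
      assume *: "(j \<le> N \<longrightarrow> ok j z) \<and> (j = 0 \<longrightarrow> z = (i2, R2(d + 1 := 0)))"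
      show "\<exists>z'. ((Suc j \<le> N \<longrightarrow> ok (Suc j) z') \<and> (Suc j = 0 \<longrightarrow> z' = (i2, R2(d + 1 := 0)))) \<and>
        (j < N \<longrightarrow> runs ?body (T j) (fst z, 0, snd z, xs, os) (fst z', 0, snd z', xs, os))"
      proof (cases "j < N")
        case True
        then show ?thesis using step[of j z] * by (meson Suc_neq_Zero less_imp_le)
      qed auto
    qed
    then show ?thesis using that by auto
  qed
  let ?m = "\<lambda>j. (fst (z j), 0, snd (z j), xs, os) :: mem"
  have d2: "d + 2 < k" using k regs_pos[of n] by simp
  have 4: "runs (while_pos (d + 2) ?body) ((\<Sum>j<N. T j + 4 * W + 6) + 4 * W + 6) (?m 0) (?m N)"
  proof (rule runs_while_pos[OF d2])
    show "runs ?body (T j) (?m j) (?m (Suc j))" if "j < N" for j using z that by blast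
    have "snd (z j) (d + 2) = N - j" if "j \<le> N" for j using z that unfolding ok_def by blast
    then show "fst (snd (snd (?m N))) (d + 2) = 0" "j < N \<Longrightarrow> fst (snd (snd (?m j))) (d + 2) \<noteq> 0" for j
      by auto
  qed
  have T: "T j + 4 * W + 6 \<le> 40 * (W + 1) * u j" for j
    by (simp add: T_def u_def algebra_simps)
  have "(\<Sum>j<N. T j + 4 * W + 6) \<le> 40 * (W + 1) * (\<Sum>j<N. u j)"
    unfolding sum_distrib_left by (intro sum_mono T)
  then have A: "runs (comp (Loop n a b) rs d) (40 * (W + 1) * (?cn + ?ca + (\<Sum>j<N. u j) + 1)) (i, 0, R, xs, os) (?m N)"
    using runs_Seq[OF 1(1) runs_Seq[OF 2(1) runs_Seq[OF 3 4[unfolded z0 fst_conv snd_conv]]]]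
    by (auto elim!: runs_mono simp: algebra_simps)
  have "ok N (z N)" using z by simp
  moreover have "eval (Loop n a b) (w, xs) ?e = f N" by (simp add: f_def N_def)
  ultimately show ?case unfolding cost
    by (intro exI[of _ "fst (z N)"] exI[of _ "snd (z N)"] conjI[OF A])
      (auto simp: ok_def add_ac intro: le_SucI)
qed

end

section \<open>Polynomial cost\<close>

text \<open>The base \<open>n + 2\<close> is at least \<open>2\<close>, so constants, sums and
  products are absorbed by the exponent.\<close>

definition pbound :: "(nat \<Rightarrow> nat) \<Rightarrow> bool" where
  "pbound F \<longleftrightarrow> (\<exists>c. \<forall>n. F n \<le> (n + 2) ^ c)"

lemma pbound_mono: "pbound G \<Longrightarrow> (\<And>n. F n \<le> G n) \<Longrightarrow> pbound F"
  unfolding pbound_def by (meson order_trans)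

lemma pbound_id: "pbound (\<lambda>n. n)"
  unfolding pbound_def by (rule exI[of _ 1]) simp

lemma less_power2: "(n::nat) \<le> 2 ^ n"
  by (simp add: less_imp_le)

lemma pbound_const: "pbound (\<lambda>_. k)"
  unfolding pbound_def
proof (rule exI[of _ k], rule allI)
  fix n :: nat
  have "k \<le> 2 ^ k" by (rule less_power2)
  also have "\<dots> \<le> (n + 2) ^ k" by (intro power_mono) auto
  finally show "k \<le> (n + 2) ^ k" .
qed

lemma pbound_mult: "pbound F \<Longrightarrow> pbound G \<Longrightarrow> pbound (\<lambda>n. F n * G n)"
  unfolding pbound_def by (metis mult_le_mono power_add)

lemma pbound_add: assumes "pbound F" "pbound G" shows "pbound (\<lambda>n. F n + G n)"
proof -
  have "pbound (\<lambda>n. (F n + 1) * (G n + 1))" if "pbound (\<lambda>n. F n + 1)" "pbound (\<lambda>n. G n + 1)"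
    using that by (rule pbound_mult)
  moreover have "pbound (\<lambda>n. K n + 1)" if K: "pbound K" for K
  proof -
    obtain c where c: "K n \<le> (n + 2) ^ c" for n using K unfolding pbound_def by blast
    have "K n + 1 \<le> (n + 2) ^ (c + 1)" for n
    proof -
      have "(n + 2) ^ (c + 1) = n * (n + 2) ^ c + (n + 2) ^ c + (n + 2) ^ c"
        by (simp add: algebra_simps)
      moreover have "1 \<le> (n + 2) ^ c" by (rule one_le_power) simp
      ultimately show ?thesis using c[of n] by linarith
    qed
    then show ?thesis unfolding pbound_def by blast
  qed
  ultimately show ?thesis using assms by (auto elim!: pbound_mono)
qed

lemma pbound_power: "pbound F \<Longrightarrow> pbound (\<lambda>n. F n ^ c)"
  by (induction c) (auto intro: pbound_const pbound_mult)

lemmas pbound_intros = pbound_id pbound_const pbound_add pbound_mult pbound_power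

text \<open>Polynomial in the values of the arguments, not in their bit lengths, and uniform in the
  array: reading position \<open>x\<close> costs in terms of \<open>x\<close>, whatever the length
  of the array.\<close>

definition pb :: "nat \<Rightarrow> exp \<Rightarrow> bool" where
  "pb m a \<longleftrightarrow> (\<exists>c. \<forall>g e v. length e = m \<longrightarrow> length (fst g) \<le> v \<longrightarrow> (\<forall>x \<in> set e. x \<le> v) \<longrightarrow>
     cost a g e \<le> (v + 2) ^ c)"

lemma pbI:
  assumes "pbound F" "\<And>g e v. length e = m \<Longrightarrow> length (fst g) \<le> v \<Longrightarrow> \<forall>x \<in> set e. x \<le> v \<Longrightarrow> cost a g e \<le> F v"
  shows "pb m a"
  using assms unfolding pb_def pbound_def by (meson order_trans)

lemma pbE:
  assumes "pb m a"
  obtains F where "pbound F" "mono F"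
    "\<And>g e v. length e = m \<Longrightarrow> length (fst g) \<le> v \<Longrightarrow> \<forall>x \<in> set e. x \<le> v \<Longrightarrow> cost a g e \<le> F v"
proof -
  obtain c where c: "length e = m \<Longrightarrow> length (fst g) \<le> v \<Longrightarrow> \<forall>x \<in> set e. x \<le> v \<Longrightarrow> cost a g e \<le> (v + 2) ^ c" for g e v
    using assms unfolding pb_def by blast
  have "mono (\<lambda>v::nat. (v + 2) ^ c)" by (intro monoI power_mono) auto
  moreover have "pbound (\<lambda>v. (v + 2) ^ c)" by (intro pbound_intros)
  ultimately show ?thesis using c that by blast
qed

text \<open>Growth is charged, so a bound on the cost is also a bound on the result. This makes
  composition of programs of polynomial cost possible.\<close>

lemma eval_le: "\<forall>x \<in> set e. x \<le> v \<Longrightarrow> eval a g e \<le> v + cost a g e"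
proof (induction a arbitrary: e v)
  case (V j)
  then show ?case by (auto simp: lk_def intro: le_SucI)
next
  case (Cond a b c)
  have "eval b g e \<le> v + cost b g e" "eval c g e \<le> v + cost c g e"
    using Cond.IH(2,3) Cond.prems by blast+
  then show ?case by simp
next
  case (Bind a b)
  have "eval a g e \<le> v + cost a g e" using Bind.IH(1) Bind.prems by blast
  then have "\<forall>x \<in> set (eval a g e # e). x \<le> v + cost a g e" using Bind.prems by auto
  then have "eval b g (eval a g e # e) \<le> v + cost a g e + cost b g (eval a g e # e)"
    by (rule Bind.IH(2))
  then show ?case by simp
next
  case (Ren js a)
  have "\<forall>x \<in> set (map (lk e) js). x \<le> v" using Ren.prems by (auto simp: lk_def)
  then show ?case using Ren.IH by simp
next
  case (Inp a)
  then show ?case using cost_pos[of a g e] by (simp add: inp_def)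
next
  case (Loop n a b)
  let ?N = "eval n g e" and ?f = "rec_nat (eval a g e) (\<lambda>i x. eval b g (i # x # e))"
  let ?u = "\<lambda>j. cost b g (j # ?f j # e) + 1" and ?v = "v + cost n g e + cost a g e"
  have N: "?N \<le> v + cost n g e" using Loop.IH(1) Loop.prems by blast
  have "j \<le> ?N \<Longrightarrow> ?f j \<le> ?v + (\<Sum>i<j. ?u i)" for j
  proof (induction j)
    case 0
    then show ?case using Loop.IH(2)[OF Loop.prems] by simp
  next
    case (Suc j)
    then have "\<forall>x \<in> set (j # ?f j # e). x \<le> ?v + (\<Sum>i<j. ?u i)"
      using Loop.prems N by fastforce
    from Loop.IH(3)[OF this] show ?case by simp
  qed
  from this[of ?N] show ?case by simp
qed (fastforce simp: orc_def)+

lemma pb_eval: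
  assumes "pb m a"
  obtains F where "pbound F" "mono F"
    "\<And>g e v. length e = m \<Longrightarrow> length (fst g) \<le> v \<Longrightarrow> \<forall>x \<in> set e. x \<le> v \<Longrightarrow> cost a g e \<le> F v \<and> eval a g e \<le> F v"
proof -
  obtain F where F: "pbound F" "mono F"
    "\<And>g e v. length e = m \<Longrightarrow> length (fst g) \<le> v \<Longrightarrow> \<forall>x \<in> set e. x \<le> v \<Longrightarrow> cost a g e \<le> F v"
    by (rule pbE[OF assms]) blast
  show ?thesis
  proof (rule that[of "\<lambda>v. v + F v"])
    fix g e v assume *: "length e = m" "length (fst (g :: glob)) \<le> v" "\<forall>x \<in> set e. x \<le> v"
    show "cost a g e \<le> v + F v \<and> eval a g e \<le> v + F v"
      using F(3)[OF *] eval_le[OF *(3), of a g] by simp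
  qed (use F in \<open>auto intro!: pbound_intros mono_add simp: mono_def add_mono\<close>)
qed

section \<open>From programs to Turing machines\<close>

lemma wf_on_tape: "(\<And>s. s < 4 \<Longrightarrow> g s < 4) \<Longrightarrow> wf_flow k 4 (on_tape r g m)"
proof -
  assume g: "\<And>s. s < 4 \<Longrightarrow> g s < 4"
  have "fst ` set ((map (\<lambda>a. (a, Stay)) rs)[r := (g (rs ! r), m)]) \<subseteq> {..<4}"
    if "set rs \<subseteq> {..<4}" for rs
  proof (cases "r < length rs")
    case True
    have "set ((map (\<lambda>a. (a, Stay)) rs)[r := (g (rs ! r), m)]) \<subseteq>
        insert (g (rs ! r), m) (set (map (\<lambda>a. (a, Stay)) rs))"
      by (rule set_update_subset_insert)
    moreover have "g (rs ! r) < 4" using True that g by (meson lessThan_iff nth_mem subsetD)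
    ultimately show ?thesis using that by fastforce
  next
    case False
    then show ?thesis using that by (auto simp: list_update_beyond)
  qed
  then show ?thesis unfolding on_tape_def by simp
qed

lemma bsym_less: "bsym b < 4"
  by (simp add: bsym_def)

lemma wf_macros:
  "wf_flow k 4 (shift_in m)" "wf_flow k 4 (emit b)" "wf_flow k 4 nop"
  "wf_flow k 4 (rewind r)" "wf_flow k 4 (bump r x)" "wf_flow k 4 (seek r)"
  "wf_flow k 4 c \<Longrightarrow> wf_flow k 4 c' \<Longrightarrow> wf_flow k 4 (if_pos r c c')"
  "wf_flow k 4 c \<Longrightarrow> wf_flow k 4 (while_pos r c)"
  by (auto simp: shift_in_def emit_def nop_def idle_def rewind_def bump_def seek_def if_pos_def
      while_pos_def intro!: wf_on_tape bsym_less)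

lemma wf_copy: assumes "r < k" shows "wf_flow k 4 (copy r d)"
proof -
  have "fst ` set ((map (\<lambda>a. (a, Stay)) rs)[r := (rs ! r, Move_Right), d := (if rs ! r = 0 then 2 else rs ! r, Move_Right)]) \<subseteq> {..<4}"
    if "length rs = k" "set rs \<subseteq> {..<4}" for rs :: "nat list"
  proof -
    have "rs ! r < 4" using assms that nth_mem by blast
    moreover have "set ((map (\<lambda>a. (a, Stay)) rs)[r := (rs ! r, Move_Right), d := (if rs ! r = 0 then 2 else rs ! r, Move_Right)]) \<subseteq>
       insert (if rs ! r = 0 then 2 else rs ! r, Move_Right) (insert (rs ! r, Move_Right) (set (map (\<lambda>a. (a, Stay)) rs)))"
      by (meson insert_mono order_trans set_update_subset_insert)
    ultimately show ?thesis using that(2) by (fastforce split: if_splits)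
  qed
  then show ?thesis using assms unfolding copy_def by (simp add: wf_macros)
qed

context register_machine
begin

lemma wf_array_macros:
  "wf_flow n 4 rewind_in" "wf_flow n 4 rewind_array" "wf_flow n 4 next_cell" "wf_flow n 4 (append_bit b)"
  by (auto simp: rewind_in_def rewind_array_def next_cell_def append_bit_def
      intro!: wf_on_tape bsym_less wf_macros)

lemma wf_comp: "d + regs a \<le> n \<Longrightarrow> \<forall>r \<in> set rs. r < d \<Longrightarrow> 0 < d \<Longrightarrow> wf_flow n 4 (comp a rs d)"
proof (induction a arbitrary: d rs)
  case (V j)
  then have "lk rs j < n" using nth_mem[of j rs] by (fastforce simp: lk_def)
  then show ?case by (auto intro!: wf_copy)
next
  case (Ren js a)
  then have "\<forall>r \<in> set (map (lk rs) js). r < d" by (auto simp: lk_def)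
  then show ?case using Ren by simp
next
  case (Bind a b)
  then have "\<forall>r \<in> set (d # rs). r < d + 1" "d + regs a \<le> n" "d + 1 + regs b \<le> n"
    by (auto simp: max_def split: if_splits)
  then show ?case using Bind regs_pos[of b] by (auto intro!: wf_copy)
next
  case (Loop n' a b)
  then have "\<forall>r \<in> set ((d + 1) # d # rs). r < d + 3" "\<forall>r \<in> set rs. r < d + 2"
    "d + regs a \<le> n" "d + 2 + regs n' \<le> n" "d + 3 + regs b \<le> n"
    by (auto simp: max_def split: if_splits)
  then show ?case using Loop regs_pos[of b] by (auto intro!: wf_copy wf_macros)
qed (auto intro!: wf_macros wf_array_macros wf_copy simp: max_def split: if_splits)

text \<open>
  Register \<open>1\<close> counts down from \<open>h\<close>, register \<open>2\<close> counts up; \<open>c\<close> consumes the value of \<open>f\<close> found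
  in register \<open>3\<close>.
\<close>

definition for_each :: "exp \<Rightarrow> exp \<Rightarrow> flow \<Rightarrow> flow" where
  "for_each h f c = comp h [] 1 ;; copy 0 2 ;;
     while_pos 1 (bump 1 False ;; comp f [2] 3 ;; c ;; bump 2 True)"

text \<open>Used for transducers and for deciders: the consumer \<open>c\<close> may extend the
  output or the array, as described by \<open>os\<close> and \<open>xs\<close>. Evaluating
  \<open>f\<close> against \<open>xs j\<close> lets round \<open>j\<close> read the bits appended
  before.\<close>

lemma runs_for_each:
  fixes h f :: exp and xs :: "nat \<Rightarrow> bool list"
  defines "N \<equiv> eval h (w, []) []"
  defines "u \<equiv> \<lambda>j. cost f (w, xs j) [j] + 1"
  defines "B \<equiv> cost h (w, []) [] + (\<Sum>j<N. u j)"
  assumes k: "1 + regs h \<le> k" "3 + regs f \<le> k"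
    and B: "B < 2 ^ W"
    and xs: "xs 0 = []" "\<And>j. j \<le> N \<Longrightarrow> length (xs j) + 2 \<le> H"
    and c: "\<And>j S i. j < N \<Longrightarrow> S 3 = eval f (w, xs j) [j] \<Longrightarrow> \<forall>r<k. S r \<le> B \<Longrightarrow> i \<le> length w + 1 \<Longrightarrow>
       \<exists>S'. runs c (T j) (i, 0, S, xs j, os j) (i, 0, S', xs (Suc j), os (Suc j)) \<and>
         S' 3 \<le> S 3 \<and> (\<forall>r. r \<noteq> 3 \<longrightarrow> S' r = S r)"
  shows "\<exists>i R. runs (for_each h f c) (40 * (W + 1) * (B + 1) + (\<Sum>j<N. T j))
      (0, 0, \<lambda>_. 0, [], os 0) (i, 0, R, xs N, os N) \<and> i \<le> length w + 1 \<and> R 0 = 0 \<and> (\<forall>r<k. R r \<le> B)"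
proof -
  let ?ch = "cost h (w, []) []"
  let ?R0 = "\<lambda>_. 0 :: nat"
  have kk: "1 < k" "2 < k" "3 < k" using k regs_pos[of f] by auto
  obtain i1 R1 where 1: "runs (comp h [] 1) (40 * (W + 1) * ?ch) (0, 0, ?R0, [], os 0) (i1, 0, R1, [], os 0)"
    "i1 \<le> length w + 1" "R1 1 = N" "\<forall>r<1. R1 r = 0" "\<forall>r<k. R1 r \<le> ?ch"
    using comp_correct[of 1 h "[]" ?R0 0 "[]" 0 "os 0"] k B H unfolding B_def N_def by auto
  have 2: "runs (copy 0 2) (6 * W + 9) (i1, 0, R1, [], os 0) (i1, 0, R1(2 := R1 0), [], os 0)"
    using kk by (intro runs_copy) auto
  let ?body = "bump 1 False ;; comp f [2] 3 ;; c ;; bump 2 True"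
  define U where "U = (\<lambda>j. 40 * (W + 1) * (u j - 1) + 12 * W + 12 + T j)"
  define ok where "ok = (\<lambda>j z. fst z \<le> length w + 1 \<and> snd z 0 = 0 \<and> snd z 1 = N - j \<and> snd z 2 = j \<and>
      (\<forall>r<k. snd z r \<le> ?ch + (\<Sum>j<j. u j)))"
  let ?z0 = "(i1, R1(2 := 0))"
  have ok0: "ok 0 ?z0" using 1 by (auto simp: ok_def)
  have step: "\<exists>z'. ok (Suc j) z' \<and>
      runs ?body (U j) (fst z, 0, snd z, xs j, os j) (fst z', 0, snd z', xs (Suc j), os (Suc j))"
    if "ok j z" "j < N" for j z
  proof -
    obtain i S where z: "z = (i, S)" by (metis prod.exhaust)
    let ?vj = "?ch + (\<Sum>j<j. u j)"
    note jN = that(2)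
    have S: "i \<le> length w + 1" "S 0 = 0" "S 1 = N - j" "S 2 = j" "\<forall>r<k. S r \<le> ?vj"
      using that(1) by (auto simp: ok_def z)
    have u: "u j = (u j - 1) + 1" by (simp add: u_def)
    have "(\<Sum>j<j. u j) + u j \<le> (\<Sum>j<N. u j)"
      using that(2) sum_mono2[of "{..<N}" "{..<Suc j}" u] by auto
    then have bound: "?vj + u j \<le> B" unfolding B_def by simp
    let ?S1 = "S(1 := N - j - 1)"
    have 1: "runs (bump 1 False) (4 * W + 6) (i, 0, S, xs j, os j) (i, 0, ?S1, xs j, os j)"
      using runs_dec[of 1 S i 0 "xs j" "os j"] S(3) kk that(2) by simp
    have e: "map ?S1 [2] = [j]" using S by simp
    have "N - j - 1 \<le> ?vj" using S(3,5) kk by (metis diff_le_self le_trans)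
    then have p: "\<forall>r \<in> set [2::nat]. r < 3" "0 < (3::nat)" "?S1 0 = 0" "\<forall>r<k. ?S1 r \<le> ?vj"
      using S by auto
    have b: "?vj + cost f (w, xs j) (map ?S1 [2]) < 2 ^ W"
      using bound B u unfolding e u_def by linarith
    have cb: "u j - 1 = cost f (w, xs j) (map ?S1 [2])" unfolding e by (simp add: u_def)
    have fj: "eval f (w, xs j) [j] = eval f (w, xs j) (map ?S1 [2])" unfolding e ..
    have hx: "length (xs j) + 2 \<le> H" using xs(2) jN by simp
    obtain i' S2 where 2: "runs (comp f [2] 3) (40 * (W + 1) * (u j - 1))
      (i, 0, ?S1, xs j, os j) (i', 0, S2, xs j, os j)" "i' \<le> length w + 1"
      "S2 3 = eval f (w, xs j) [j]" "\<forall>r<3. S2 r = ?S1 r" "\<forall>r<k. S2 r \<le> ?vj + (u j - 1)"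
      using comp_correct[OF k(2) p b S(1) hx, of "os j"] unfolding cb[symmetric] fj[symmetric] by blast
    have "\<forall>r<k. S2 r \<le> B" using 2(5) bound by fastforce
    then obtain S3 where 3: "runs c (T j) (i', 0, S2, xs j, os j) (i', 0, S3, xs (Suc j), os (Suc j))"
      "S3 3 \<le> S2 3" "\<forall>r. r \<noteq> 3 \<longrightarrow> S3 r = S2 r"
      using c[of j S2 i'] jN 2(2,3) by blast
    have S32: "S3 2 = j" "S3 1 = N - Suc j" "S3 0 = 0" using 3(3) 2(4) S by auto
    have S3le: "S3 r \<le> S2 r" for r using 3(2,3) by (cases "r = 3") auto
    have "j \<le> ?vj" using S(4,5) kk by blast
    then have "S3 2 + 1 < 2 ^ W" using S32 bound B u by linarith
    then have 4: "runs (bump 2 True) (4 * W + 6) (i', 0, S3, xs (Suc j), os (Suc j))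
        (i', 0, S3(2 := Suc j), xs (Suc j), os (Suc j))"
      using runs_inc[of 2 S3 i' 0 "xs (Suc j)" "os (Suc j)"] kk S32 by simp
    have "runs ?body (U j) (i, 0, S, xs j, os j) (i', 0, S3(2 := Suc j), xs (Suc j), os (Suc j))"
      using runs_Seq[OF 1 runs_Seq[OF 2(1) runs_Seq[OF 3(1) 4]]]
      by (auto elim!: runs_mono simp: U_def)
    moreover have "ok (Suc j) (i', S3(2 := Suc j))"
    proof -
      have "S3 r \<le> ?vj + u j" if "r < k" for r
        using 2(5) that S3le[of r] u by fastforce
      then show ?thesis using 2 S32 \<open>j \<le> ?vj\<close> u by (auto simp: ok_def add.assoc)
    qed
    ultimately show ?thesis unfolding z by (metis fst_conv snd_conv)
  qed
  obtain z where z: "\<forall>j. (j \<le> N \<longrightarrow> ok j (z j)) \<and> (j < N \<longrightarrow> runs ?body (U j)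
      (fst (z j), 0, snd (z j), xs j, os j) (fst (z (Suc j)), 0, snd (z (Suc j)), xs (Suc j), os (Suc j)))"
    and z0: "z 0 = ?z0"
  proof -
    have "\<exists>z. \<forall>j. ((j \<le> N \<longrightarrow> ok j (z j)) \<and> (j = 0 \<longrightarrow> z j = ?z0)) \<and> (j < N \<longrightarrow> runs ?body (U j)
      (fst (z j), 0, snd (z j), xs j, os j) (fst (z (Suc j)), 0, snd (z (Suc j)), xs (Suc j), os (Suc j)))"
    proof (rule dependent_nat_choice)
      show "\<exists>z. (0 \<le> N \<longrightarrow> ok 0 z) \<and> (0 = (0::nat) \<longrightarrow> z = ?z0)"
        by (rule exI[of _ ?z0]) (use ok0 in blast)
    next
      fix z j
      assume *: "(j \<le> N \<longrightarrow> ok j z) \<and> (j = 0 \<longrightarrow> z = ?z0)"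
      show "\<exists>z'. ((Suc j \<le> N \<longrightarrow> ok (Suc j) z') \<and> (Suc j = 0 \<longrightarrow> z' = ?z0)) \<and>
        (j < N \<longrightarrow> runs ?body (U j) (fst z, 0, snd z, xs j, os j) (fst z', 0, snd z', xs (Suc j), os (Suc j)))"
      proof (cases "j < N")
        case True
        then show ?thesis using step[of j z] * by (meson Suc_neq_Zero less_imp_le)
      qed auto
    qed
    then show ?thesis using that by auto
  qed
  let ?m = "\<lambda>j. (fst (z j), 0, snd (z j), xs j, os j) :: mem"
  have 3: "runs (while_pos 1 ?body) ((\<Sum>j<N. U j + 4 * W + 6) + 4 * W + 6) (?m 0) (?m N)"
  proof (rule runs_while_pos[OF kk(1)])
    show "runs ?body (U j) (?m j) (?m (Suc j))" if "j < N" for j using z that by blast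
    have "snd (z j) 1 = N - j" if "j \<le> N" for j using z that unfolding ok_def by blast
    then show "fst (snd (snd (?m N))) 1 = 0" "j < N \<Longrightarrow> fst (snd (snd (?m j))) 1 \<noteq> 0" for j
      by auto
  qed
  have "U j + 4 * W + 6 \<le> 40 * (W + 1) * u j + T j" for j
    by (simp add: U_def u_def algebra_simps)
  then have "(\<Sum>j<N. U j + 4 * W + 6) \<le> (\<Sum>j<N. 40 * (W + 1) * u j + T j)"
    by (intro sum_mono)
  also have "\<dots> = 40 * (W + 1) * (\<Sum>j<N. u j) + (\<Sum>j<N. T j)"
    by (simp add: sum.distrib sum_distrib_left)
  finally have le: "(\<Sum>j<N. U j + 4 * W + 6) \<le> 40 * (W + 1) * (\<Sum>j<N. u j) + (\<Sum>j<N. T j)" .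
  have "?m 0 = (i1, 0, R1(2 := R1 0), [], os 0)" using 1(4) by (simp add: z0 xs(1))
  from runs_Seq[OF 1(1) runs_Seq[OF 2 3[unfolded this]]]
  have "runs (for_each h f c) (40 * (W + 1) * (B + 1) + (\<Sum>j<N. T j)) (0, 0, \<lambda>_. 0, [], os 0) (?m N)"
    unfolding for_each_def using le by (auto elim!: runs_mono simp: B_def algebra_simps)
  moreover have "ok N (z N)" using z by blast
  ultimately show ?thesis
    by (intro exI[of _ "fst (z N)"] exI[of _ "snd (z N)"]) (auto simp: ok_def B_def)
qed

text \<open>All tapes start blank; marking cell \<open>0\<close> turns every register into
  \<open>0\<close> and the array into the empty one.\<close>

definition mark :: flow where
  "mark = Act (\<lambda>i rs. (Stay, map (\<lambda>_. (1, Stay)) rs, None))"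

lemma exec_mark:
  "exec H w mark (0, replicate (Suc k) (\<lambda>_. 0, 0), []) 1 (0, replicate (Suc k) (tape [], 0), [])"
  "rep (0, 0, \<lambda>_. 0, [], []) (0, replicate (Suc k) (tape [], 0), [])"
proof -
  have t: "tape [] = (\<lambda>_. 0)(0 := 1)" by (auto simp: tape_def)
  show "rep (0, 0, \<lambda>_. 0, [], []) (0, replicate (Suc k) (tape [], 0), [])"
    using H by (auto simp: rep_def nth_Cons' intro!: exI[of _ "[]"])
  then have "fits H w (0, replicate (Suc k) (tape [], 0), [])" by (rule rep_fits)
  then show "exec H w mark (0, replicate (Suc k) (\<lambda>_. 0, 0), []) 1 (0, replicate (Suc k) (tape [], 0), [])"
    unfolding mark_def
    by (intro exec_Act) (auto simp: act_data_def scan_def fits_def zip_replicate t map_replicate_const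
      simp del: replicate_Suc)
qed

section \<open>Programs that print a list of numbers in unary\<close>

definition emit_unary :: flow where
  "emit_unary = while_pos 3 (bump 3 False ;; emit True) ;; emit False"

lemma runs_emit_unary:
  assumes "3 < k"
  shows "runs emit_unary ((S 3 * (8 * W + 13) + 4 * W + 6) + 1)
    (i, 0, S, xs, os) (i, 0, S(3 := 0), xs, os @ replicate (S 3) True @ [False])"
proof -
  let ?m = "\<lambda>j. (i, 0, S(3 := S 3 - j), xs, os @ replicate j True) :: mem"
  have "runs (while_pos 3 (bump 3 False ;; emit True))
      ((\<Sum>j<S 3. ((4 * W + 6) + 1) + 4 * W + 6) + 4 * W + 6) (?m 0) (?m (S 3))"
  proof (rule runs_while_pos[OF assms])
    fix j assume j: "j < S 3"
    have "runs (bump 3 False) (4 * W + 6) (?m j) (i, 0, S(3 := S 3 - Suc j), xs, os @ replicate j True)"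
      using runs_dec[OF assms, of "S(3 := S 3 - j)" i 0 xs] j by simp
    moreover have "runs (emit True) 1 (i, 0, S(3 := S 3 - Suc j), xs, os @ replicate j True) (?m (Suc j))"
      using runs_emit[of True i 0 "S(3 := S 3 - Suc j)" xs "os @ replicate j True"]
      by (simp add: replicate_append_same)
    ultimately show "runs (bump 3 False ;; emit True) ((4 * W + 6) + 1) (?m j) (?m (Suc j))"
      by (rule runs_Seq)
  qed auto
  then have "runs (while_pos 3 (bump 3 False ;; emit True)) (S 3 * (8 * W + 13) + 4 * W + 6) (?m 0) (?m (S 3))"
    by (rule runs_mono) (simp add: algebra_simps)
  from runs_Seq[OF this runs_emit[of False]] show ?thesis
    unfolding emit_unary_def by simp
qed

definition unary_program :: "exp \<Rightarrow> exp \<Rightarrow> flow" where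
  "unary_program h f = mark ;; for_each h f emit_unary"

text \<open>The array stays empty throughout, so \<open>H\<close> has to accommodate the registers
  only; logarithmic space rests on this.\<close>

lemma exec_unary_program:
  assumes "1 + regs h \<le> k" "3 + regs f \<le> k"
    and "cost h (w, []) [] + (\<Sum>j<eval h (w, []) []. cost f (w, []) [j] + 1) < 2 ^ W"
  shows "\<exists>t i ws. exec H w (unary_program h f) (0, replicate (Suc k) (\<lambda>_. 0, 0), []) t
    (i, ws, encode_nats (map (\<lambda>j. eval f (w, []) [j]) [0..<eval h (w, []) []]))"
proof -
  let ?N = "eval h (w, []) []" and ?f = "\<lambda>j. eval f (w, []) [j]"
  let ?os = "\<lambda>j. encode_nats (map ?f [0..<j])"
  have k: "3 < k" using assms(2) regs_pos[of f] by simp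
  obtain T i R where 1: "runs (for_each h f emit_unary) T (0, 0, \<lambda>_. 0, [], ?os 0) (i, 0, R, [], ?os ?N)"
  proof -
    have "\<exists>i R. runs (for_each h f emit_unary)
      (40 * (W + 1) * (cost h (w, []) [] + (\<Sum>j<?N. cost f (w, []) [j] + 1) + 1) +
        (\<Sum>j<?N. (?f j * (8 * W + 13) + 4 * W + 6) + 1))
      (0, 0, \<lambda>_. 0, [], ?os 0) (i, 0, R, [], ?os ?N) \<and> i \<le> length w + 1 \<and> R 0 = 0 \<and>
        (\<forall>r<k. R r \<le> cost h (w, []) [] + (\<Sum>j<?N. cost f (w, []) [j] + 1))"
    proof (rule runs_for_each[where xs = "\<lambda>_. []" and os = ?os, OF assms])
      fix j i and S :: "nat \<Rightarrow> nat" assume "j < ?N" and S: "S 3 = ?f j"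
      have "?os (Suc j) = ?os j @ replicate (S 3) True @ [False]"
        by (simp add: encode_nats_def S)
      then show "\<exists>S'. runs emit_unary ((?f j * (8 * W + 13) + 4 * W + 6) + 1) (i, 0, S, [], ?os j)
          (i, 0, S', [], ?os (Suc j)) \<and> S' 3 \<le> S 3 \<and> (\<forall>r. r \<noteq> 3 \<longrightarrow> S' r = S r)"
        using runs_emit_unary[OF k, of S i "[]" "?os j"]
        by (intro exI[of _ "S(3 := 0)"]) (simp add: S)
    qed (use H in auto)
    then show ?thesis using that by blast
  qed
  moreover have os0: "?os 0 = []" by (simp add: encode_nats_def)
  ultimately obtain t d where "exec H w (for_each h f emit_unary) (0, replicate (Suc k) (tape [], 0), []) t d"
    "rep (i, 0, R, [], ?os ?N) d"
    using exec_mark(2) unfolding runs_def os0 by blast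
  moreover from this(2) obtain ws where "d = (i, ws, ?os ?N)"
    by (auto simp: rep_def split: prod.splits)
  ultimately show ?thesis unfolding unary_program_def using exec_Seq[OF exec_mark(1)] by blast
qed

lemma wf_unary_program:
  assumes "1 + regs h \<le> k" "3 + regs f \<le> k"
  shows "wf_flow (Suc k) 4 (unary_program h f)"
proof -
  have "wf_flow (Suc k) 4 mark" by (auto simp: mark_def)
  then show ?thesis
    unfolding unary_program_def for_each_def emit_unary_def using assms
    by (auto intro!: wf_macros wf_copy wf_comp)
qed

end

section \<open>Programs that fill a table of bits\<close>

primrec bits :: "exp \<Rightarrow> bool list \<Rightarrow> nat \<Rightarrow> bool list" where
  "bits f w 0 = []"
| "bits f w (Suc t) = bits f w t @ [eval f (w, bits f w t) [t] \<noteq> 0]"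

lemma length_bits [simp]: "length (bits f w t) = t"
  by (induction t) auto

context register_machine
begin

text \<open>The final \<open>seek\<close> leaves the head of register \<open>1\<close> on symbol
  \<open>3\<close> exactly if the result is nonzero, which is the acceptance test of the
  machine.\<close>

definition bit_program :: "exp \<Rightarrow> exp \<Rightarrow> exp \<Rightarrow> flow" where
  "bit_program h f g = mark ;; for_each h f (if_pos 3 (append_bit True) (append_bit False)) ;;
     comp g [] 1 ;; seek 1"

lemma exec_bit_program:
  fixes h f g :: exp
  defines "N \<equiv> eval h (w, []) []"
  defines "B \<equiv> cost h (w, []) [] + (\<Sum>j<N. cost f (w, bits f w j) [j] + 1)"
  defines "C \<equiv> B + cost g (w, bits f w N) []"
  assumes k: "1 + regs h \<le> k" "3 + regs f \<le> k" "1 + regs g \<le> k"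
    and W: "C < 2 ^ W" and N: "N + 2 \<le> H"
  shows "\<exists>t i ws os. exec H w (bit_program h f g) (0, replicate (Suc k) (\<lambda>_. 0, 0), []) t (i, ws, os) \<and>
    t \<le> 100 * (W + 1) * (C + 1) + N * (4 * N + 4 * W + 16) \<and>
    (scan ws ! 1 = 3 \<longleftrightarrow> eval g (w, bits f w N) [] \<noteq> 0)"
proof -
  let ?c = "if_pos 3 (append_bit True) (append_bit False)"
  have kk: "3 < k" and k1: "1 < k" using k regs_pos[of f] by simp_all
  have "\<exists>i R. runs (for_each h f ?c)
      (40 * (W + 1) * (B + 1) + (\<Sum>j<N. (4 * N + 10) + 4 * W + 6))
      (0, 0, \<lambda>_. 0, [], []) (i, 0, R, bits f w N, []) \<and> i \<le> length w + 1 \<and> R 0 = 0 \<and> (\<forall>r<k. R r \<le> B)"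
    unfolding N_def B_def
  proof (rule runs_for_each[where xs = "bits f w" and os = "\<lambda>_. []", OF k(1,2)], fold N_def)
    show "cost h (w, []) [] + (\<Sum>j<N. cost f (w, bits f w j) [j] + 1) < 2 ^ W"
      using W unfolding B_def C_def by simp
    fix j i and S :: "nat \<Rightarrow> nat" assume j: "j < N" and S: "S 3 = eval f (w, bits f w j) [j]"
    have "runs ?c ((4 * N + 10) + 4 * W + 6) (i, 0, S, bits f w j, []) (i, 0, S, bits f w (Suc j), [])"
    proof (rule runs_if_pos[OF kk])
      have a: "runs (append_bit b) (4 * N + 10) (i, 0, S, bits f w j, []) (i, 0, S, bits f w j @ [b], [])" for b
        by (rule runs_mono[OF runs_append_bit]) (use j N in auto)
      show "runs (append_bit True) (4 * N + 10) (i, 0, S, bits f w j, []) (i, 0, S, bits f w (Suc j), [])"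
        if "fst (snd (snd (i, 0, S, bits f w j, []))) 3 \<noteq> 0"
        using a[of True] that by (simp add: S)
      show "runs (append_bit False) (4 * N + 10) (i, 0, S, bits f w j, []) (i, 0, S, bits f w (Suc j), [])"
        if "fst (snd (snd (i, 0, S, bits f w j, []))) 3 = 0"
        using a[of False] that by (simp add: S)
    qed
    then show "\<exists>S'. runs ?c ((4 * N + 10) + 4 * W + 6) (i, 0, S, bits f w j, [])
        (i, 0, S', bits f w (Suc j), []) \<and> S' 3 \<le> S 3 \<and> (\<forall>r. r \<noteq> 3 \<longrightarrow> S' r = S r)"
      by blast
  qed (use N in auto)
  then obtain i R where 1: "runs (for_each h f ?c)
      (40 * (W + 1) * (B + 1) + (\<Sum>j<N. (4 * N + 10) + 4 * W + 6))
      (0, 0, \<lambda>_. 0, [], []) (i, 0, R, bits f w N, [])" "i \<le> length w + 1" "R 0 = 0" "\<forall>r<k. R r \<le> B"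
    by blast
  obtain i' R' where 2: "runs (comp g [] 1) (40 * (W + 1) * cost g (w, bits f w N) [])
      (i, 0, R, bits f w N, []) (i', 0, R', bits f w N, [])" "R' 1 = eval g (w, bits f w N) []"
    using comp_correct[OF k(3), of "[]" R B "bits f w N" i "[]"] 1 W N unfolding C_def by auto
  obtain t d where t: "t \<le> (40 * (W + 1) * (B + 1) + (\<Sum>j<N. (4 * N + 10) + 4 * W + 6)) +
       40 * (W + 1) * cost g (w, bits f w N) []"
    "exec H w (for_each h f ?c ;; comp g [] 1) (0, replicate (Suc k) (tape [], 0), []) t d"
    "rep (i', 0, R', bits f w N, []) d"
    using runs_Seq[OF 1(1) 2(1)] exec_mark(2) unfolding runs_def by blast
  obtain t' e where e: "exec H w (seek 1) d t' e" "t' \<le> 2 * W + 2" "sought 1 (i', 0, R', bits f w N, []) e"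
    by (rule seek[OF t(3) k1]) blast
  obtain i2 ws os where ee: "e = (i2, ws, os)" by (metis prod_cases3)
  have assoc: "exec H w (c1 ;; c2 ;; c3) d1 x d2" if "exec H w (c1 ;; c2) d1 y d3" "exec H w c3 d3 z d2" "x = y + z"
    for c1 c2 c3 d1 d2 d3 x y z
  proof -
    from that(1) obtain y1 y2 d4 where "exec H w c1 d1 y1 d4" "exec H w c2 d4 y2 d3" "y = y1 + y2"
      by (cases rule: exec.cases) auto
    then show ?thesis using that by (auto simp: add.assoc intro: exec_Seq)
  qed
  have "exec H w (bit_program h f g) (0, replicate (Suc k) (\<lambda>_. 0, 0), []) (1 + (t + t')) (i2, ws, os)"
    unfolding bit_program_def using exec_Seq[OF exec_mark(1) assoc[OF t(2) e(1) refl]] ee by simp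
  moreover have "1 + (t + t') \<le> 100 * (W + 1) * (C + 1) + N * (4 * N + 4 * W + 16)"
    using t(1) e(2) by (simp add: C_def algebra_simps)
  moreover have "scan ws ! 1 = 3 \<longleftrightarrow> eval g (w, bits f w N) [] \<noteq> 0"
    using e(3) 2(2) ee by (auto simp: sought_def)
  ultimately show ?thesis by blast
qed

lemma wf_bit_program:
  assumes "1 + regs h \<le> k" "3 + regs f \<le> k" "1 + regs g \<le> k"
  shows "wf_flow (Suc k) 4 (bit_program h f g)"
proof -
  have "wf_flow (Suc k) 4 mark" by (auto simp: mark_def)
  then show ?thesis
    unfolding bit_program_def for_each_def using assms
    by (auto intro!: wf_macros wf_array_macros wf_copy wf_comp)
qed

end

section \<open>Time and space of the compiled machines\<close>

lemma pb_sum: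
  assumes "pb 0 h" "pb 1 f"
  obtains F where "pbound F" "\<And>w X. cost h (w, []) [] +
    (\<Sum>j<eval h (w, []) []. cost f (w, X j) [j] + 1) + eval h (w, []) [] \<le> F (length w)"
proof -
  obtain F where F: "pbound F" "mono F" "\<And>g e v. length e = 0 \<Longrightarrow> length (fst g) \<le> v \<Longrightarrow> \<forall>x \<in> set e. x \<le> v \<Longrightarrow>
    cost h g e \<le> F v \<and> eval h g e \<le> F v" by (rule pb_eval[OF assms(1)]) blast
  obtain G where G: "pbound G" "mono G" "\<And>g e v. length e = 1 \<Longrightarrow> length (fst g) \<le> v \<Longrightarrow> \<forall>x \<in> set e. x \<le> v \<Longrightarrow>
    cost f g e \<le> G v" by (rule pbE[OF assms(2)]) blast
  obtain c where c: "\<And>n. G n \<le> (n + 2) ^ c" using G(1) unfolding pbound_def by blast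
  show ?thesis
  proof (rule that[of "\<lambda>n. F n + F n * ((n + F n + 2) ^ c + 1) + F n"])
    show "pbound (\<lambda>n. F n + F n * ((n + F n + 2) ^ c + 1) + F n)"
      by (intro pbound_intros F)
    fix w :: "bool list" and X :: "nat \<Rightarrow> bool list"
    let ?n = "length w"
    have h: "cost h (w, []) [] \<le> F ?n" "eval h (w, []) [] \<le> F ?n" using F(3)[of "[]" "(w, [])" ?n] by auto
    have "cost f (w, X j) [j] + 1 \<le> (?n + F ?n + 2) ^ c + 1" if "j < eval h (w, []) []" for j
      using G(3)[of "[j]" "(w, X j)" "?n + F ?n"] c[of "?n + F ?n"] that h(2) by simp
    then have "(\<Sum>j<eval h (w, []) []. cost f (w, X j) [j] + 1) \<le> (\<Sum>j<eval h (w, []) []. (?n + F ?n + 2) ^ c + 1)"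
      by (intro sum_mono) auto
    also have "\<dots> = eval h (w, []) [] * ((?n + F ?n + 2) ^ c + 1)" by simp
    also have "\<dots> \<le> F ?n * ((?n + F ?n + 2) ^ c + 1)" using h(2) by (rule mult_right_mono) simp
    finally show "cost h (w, []) [] + (\<Sum>j<eval h (w, []) []. cost f (w, X j) [j] + 1) + eval h (w, []) []
        \<le> F ?n + F ?n * ((?n + F ?n + 2) ^ c + 1) + F ?n"
      using h by linarith
  qed
qed

text \<open>The flowchart depends on \<open>k\<close>, \<open>h\<close> and \<open>f\<close> only;
  \<open>W\<close> and \<open>H\<close> belong to the analysis. One machine can therefore be studied
  with a different word length for each input.\<close>

theorem logspace_computable_unary:
  assumes "pb 0 h" "pb 1 f"
  shows "logspace_computable (\<lambda>w. encode_nats (map (\<lambda>j. eval f (w, []) [j]) [0..<eval h (w, []) []]))"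
proof -
  define k where "k = max (1 + regs h) (3 + regs f)"
  have k: "1 + regs h \<le> k" "3 + regs f \<le> k" by (auto simp: k_def)
  obtain F where F: "pbound F" "\<And>w X. cost h (w, []) [] +
    (\<Sum>j<eval h (w, []) []. cost f (w, X j) [j] + 1) + eval h (w, []) [] \<le> F (length w)"
    by (rule pb_sum[OF assms]) blast
  obtain c where c: "F n \<le> (n + 2) ^ c" for n using F(1) unfolding pbound_def by blast
  define M where "M = machine (Suc k) 4 (register_machine.unary_program k h f) (\<lambda>_. True)"
  have run: "(\<exists>t. halted M (run M w t) \<and>
        out (run M w t) = encode_nats (map (\<lambda>j. eval f (w, []) [j]) [0..<eval h (w, []) []])) \<and>
      (\<forall>t. \<forall>(tp, h) \<in> set (work (run M w t)). real h \<le> (real c + 5) * log 2 (real (length w + 2)))" for w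
  proof -
    let ?l = "log 2 (real (length w + 2))"
    \<comment> \<open>Chosen so that \<open>2 ^ W\<close> exceeds \<open>(length w + 2) ^ c\<close>,
      a bound on all values. Then \<open>W\<close> is at most \<open>c * log + 2\<close>, heads stay
      below \<open>W + 2\<close>, and as the logarithm is at least \<open>1\<close> the additive
      constants fit under \<open>c + 5\<close>.\<close>
    define W where "W = nat \<lceil>real c * ?l\<rceil> + 1"
    interpret register_machine w "W + 2" W k by standard simp
    have l: "1 \<le> ?l" by simp
    have cW: "real c * ?l < real W"
      unfolding W_def using real_nat_ceiling_ge[of "real c * ?l"] by linarith
    have "F (length w) \<le> (length w + 2) ^ c" by (rule c)
    also have "real ((length w + 2) ^ c) = (2 powr ?l) powr real c" by (simp add: powr_realpow)
    also have "\<dots> = 2 powr (real c * ?l)" by (simp only: powr_powr mult.commute)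
    also have "\<dots> < 2 powr real W" using cW by simp
    also have "\<dots> = real (2 ^ W)" by (simp add: powr_realpow)
    finally have "F (length w) < 2 ^ W" by (simp only: of_nat_less_iff)
    then have B: "cost h (w, []) [] + (\<Sum>j<eval h (w, []) []. cost f (w, []) [j] + 1) < 2 ^ W"
      using F(2)[of w "\<lambda>_. []"] by linarith
    obtain t i ws where e: "exec (W + 2) w (unary_program h f) (0, replicate (Suc k) (\<lambda>_. 0, 0), []) t
      (i, ws, encode_nats (map (\<lambda>j. eval f (w, []) [j]) [0..<eval h (w, []) []]))"
      using exec_unary_program[OF k B] by blast
    note run = run_machine[OF e, where P = "\<lambda>_. True" and S = 4, folded M_def]
    have "real hd \<le> (real c + 5) * ?l" if "(tp, hd) \<in> set (work (run M w t))" for t tp hd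
    proof -
      obtain q d where "run M w t = conf q d" "fits (W + 2) w d" using run(2) by blast
      then have "hd \<le> W + 2" using that by (auto simp: conf_def fits_def split: prod.splits)
      then have "real hd \<le> real W + 2" by simp
      moreover have "0 \<le> real c * ?l" using l by simp
      then have "real W \<le> real c * ?l + 2" unfolding W_def by linarith
      ultimately show ?thesis unfolding distrib_right using l by linarith
    qed
    then show ?thesis using run(1) by (intro conjI exI[of _ "t + 1"]) (auto simp: halted_def conf_def)
  qed
  interpret R: register_machine "[]" 2 0 k by standard simp
  have "wf_tm M" unfolding M_def using R.wf_unary_program[OF k] by (intro wf_machine) auto
  then show ?thesis unfolding logspace_computable_def using run by blast
qed

theorem polytime_bits:
  assumes "pb 0 h" "pb 1 f" "pb 0 g"
  shows "polytime {w. eval g (w, bits f w (eval h (w, []) [])) [] \<noteq> 0}"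
proof -
  define k where "k = max (1 + regs h) (max (3 + regs f) (1 + regs g))"
  have k: "1 + regs h \<le> k" "3 + regs f \<le> k" "1 + regs g \<le> k" by (auto simp: k_def)
  obtain F where F: "pbound F" "\<And>w X. cost h (w, []) [] +
    (\<Sum>j<eval h (w, []) []. cost f (w, X j) [j] + 1) + eval h (w, []) [] \<le> F (length w)"
    by (rule pb_sum[OF assms(1,2)]) blast
  obtain G where G: "pbound G" "mono G" "\<And>g' e v. length e = 0 \<Longrightarrow> length (fst g') \<le> v \<Longrightarrow> \<forall>x \<in> set e. x \<le> v \<Longrightarrow>
    cost g g' e \<le> G v" by (rule pbE[OF assms(3)]) blast
  let ?C = "\<lambda>n. F n + G n"
  let ?T = "\<lambda>n. 100 * (?C n + 1) * (?C n + 1) + ?C n * (8 * ?C n + 16) + 1"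
  have "pbound ?T" by (intro pbound_intros F G)
  then obtain c where c: "?T n \<le> (n + 2) ^ c" for n unfolding pbound_def by blast
  define M where "M = machine (Suc k) 4 (register_machine.bit_program k h f g) (\<lambda>rs. rs ! 1 = 3)"
  have run: "\<exists>t \<le> poly ([:2, 1:] ^ c) (length w). halted M (run M w t) \<and>
      (state (run M w t) = acc M \<longleftrightarrow> eval g (w, bits f w (eval h (w, []) [])) [] \<noteq> 0)" for w
  proof -
    define N where "N = eval h (w, []) []"
    define B where "B = cost h (w, []) [] + (\<Sum>j<N. cost f (w, bits f w j) [j] + 1)"
    define C where "C = B + cost g (w, bits f w N) []"
    define W where "W = ?C (length w)"
    have B: "B + N \<le> F (length w)" using F(2)[of w "bits f w"] by (simp add: B_def N_def)
    then have C: "C \<le> W" "N \<le> W"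
      using G(3)[of "[]" "(w, bits f w N)" "length w"] by (auto simp: C_def W_def)
    have CW: "C < 2 ^ W" using C(1) by (meson le_less_trans less_exp)
    interpret register_machine w "W + 2 + N" W k by standard simp
    obtain t i ws os where e: "exec (W + 2 + N) w (bit_program h f g) (0, replicate (Suc k) (\<lambda>_. 0, 0), []) t (i, ws, os)"
      "t \<le> 100 * (W + 1) * (C + 1) + N * (4 * N + 4 * W + 16)"
      "scan ws ! 1 = 3 \<longleftrightarrow> eval g (w, bits f w N) [] \<noteq> 0"
      using exec_bit_program[OF k, folded N_def, folded B_def, folded C_def, OF CW] by auto
    have "100 * (W + 1) * (C + 1) \<le> 100 * (W + 1) * (W + 1)" "N * (4 * N + 4 * W + 16) \<le> W * (8 * W + 16)"
      using C by (intro mult_le_mono; simp)+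
    then have "t + 1 \<le> ?T (length w)" using e(2) unfolding W_def by linarith
    then have "t + 1 \<le> poly ([:2, 1:] ^ c) (length w)" using c[of "length w"] by (simp add: add.commute)
    moreover have "acc M \<noteq> rej M" by (simp add: M_def machine_def)
    ultimately show ?thesis
      using run_machine(1)[OF e(1), where P = "\<lambda>rs. rs ! 1 = 3" and S = 4, folded M_def] e(3)
      by (intro exI[of _ "t + 1"]) (auto simp: halted_def conf_def N_def split: if_splits)
  qed
  interpret R: register_machine "[]" 2 0 k by standard simp
  have "wf_tm M" unfolding M_def using R.wf_bit_program[OF k] by (intro wf_machine) auto
  then show ?thesis unfolding polytime_def using run by blast
qed

section \<open>Computable numeric functions\<close>

text \<open>Abstracts from programs to the functions they compute, so that the algorithms below can
  be ordinary terms whose computability follows from closure rules alone.\<close>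

definition lc :: "nat \<Rightarrow> (glob \<Rightarrow> nat list \<Rightarrow> nat) \<Rightarrow> bool" where
  "lc m F \<longleftrightarrow> (\<exists>a. pb m a \<and> (\<forall>g e. length e = m \<longrightarrow> eval a g e = F g e))"

abbreviation lb :: "nat \<Rightarrow> (glob \<Rightarrow> nat list \<Rightarrow> bool) \<Rightarrow> bool" where
  "lb m P \<equiv> lc m (\<lambda>g e. of_bool (P g e))"

lemma lcI: "pb m a \<Longrightarrow> (\<And>g e. length e = m \<Longrightarrow> eval a g e = F g e) \<Longrightarrow> lc m F"
  by (auto simp: lc_def)

lemma lc_cong: "lc m F \<Longrightarrow> (\<And>g e. length e = m \<Longrightarrow> F g e = G g e) \<Longrightarrow> lc m G"
  by (auto simp: lc_def)

lemma lcE: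
  assumes "lc m F"
  obtains a K where "pb m a" "\<And>g e. length e = m \<Longrightarrow> eval a g e = F g e" "pbound K" "mono K"
    "\<And>g e v. length e = m \<Longrightarrow> length (fst g) \<le> v \<Longrightarrow> \<forall>x \<in> set e. x \<le> v \<Longrightarrow> cost a g e \<le> K v"
    "\<And>g e v. length e = m \<Longrightarrow> length (fst g) \<le> v \<Longrightarrow> \<forall>x \<in> set e. x \<le> v \<Longrightarrow> F g e \<le> K v"
proof -
  obtain a where a: "pb m a" "\<And>g e. length e = m \<Longrightarrow> eval a g e = F g e"
    using assms by (auto simp: lc_def)
  obtain K where K: "pbound K" "mono K" "\<And>g e v. length e = m \<Longrightarrow> length (fst g) \<le> v \<Longrightarrow>
      \<forall>x \<in> set e. x \<le> v \<Longrightarrow> cost a g e \<le> K v \<and> eval a g e \<le> K v"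
    by (rule pb_eval[OF a(1)]) blast
  show ?thesis using that[OF a K(1,2)] K(3) a(2) by metis
qed

section \<open>Closure properties of the computable functions\<close>

lemma lc_V: "j < m \<Longrightarrow> lc m (\<lambda>g e. e ! j)"
  by (rule lcI[of _ "V j"]) (auto simp: lk_def intro!: pbI[of "\<lambda>_. 1"] pbound_intros)

lemma lc_0: "lc m (\<lambda>g e. 0)"
  by (rule lcI[of _ "Ren [] (V 0)"]) (auto simp: lk_def intro!: pbI[of "\<lambda>_. 1"] pbound_intros)

lemma lc_Suc: assumes "lc m A" shows "lc m (\<lambda>g e. Suc (A g e))"
proof -
  obtain a K where a: "pb m a" "\<And>g e. length e = m \<Longrightarrow> eval a g e = A g e" "pbound K"
    "\<And>g e v. length e = m \<Longrightarrow> length (fst g) \<le> v \<Longrightarrow> \<forall>x \<in> set e. x \<le> v \<Longrightarrow> cost a g e \<le> K v"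
    by (rule lcE[OF assms]) blast
  show ?thesis
    by (rule lcI[of _ "Succ a"]) (use a in \<open>auto intro!: pbI[of "\<lambda>v. K v + 1"] pbound_intros\<close>)
qed

lemma lc_pred: assumes "lc m A" shows "lc m (\<lambda>g e. A g e - Suc 0)"
proof -
  obtain a K where a: "pb m a" "\<And>g e. length e = m \<Longrightarrow> eval a g e = A g e" "pbound K"
    "\<And>g e v. length e = m \<Longrightarrow> length (fst g) \<le> v \<Longrightarrow> \<forall>x \<in> set e. x \<le> v \<Longrightarrow> cost a g e \<le> K v"
    by (rule lcE[OF assms]) blast
  show ?thesis
    by (rule lcI[of _ "Pred a"]) (use a in \<open>auto intro!: pbI[of "\<lambda>v. K v + 1"] pbound_intros\<close>)
qed

lemma lc_cond:
  assumes "lc m A" "lc m B" "lc m C"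
  shows "lc m (\<lambda>g e. if A g e \<noteq> 0 then B g e else C g e)"
proof -
  obtain a K where a: "pb m a" "\<And>g e. length e = m \<Longrightarrow> eval a g e = A g e" "pbound K"
    "\<And>g e v. length e = m \<Longrightarrow> length (fst g) \<le> v \<Longrightarrow> \<forall>x \<in> set e. x \<le> v \<Longrightarrow> cost a g e \<le> K v"
    by (rule lcE[OF assms(1)]) blast
  obtain b L where b: "pb m b" "\<And>g e. length e = m \<Longrightarrow> eval b g e = B g e" "pbound L"
    "\<And>g e v. length e = m \<Longrightarrow> length (fst g) \<le> v \<Longrightarrow> \<forall>x \<in> set e. x \<le> v \<Longrightarrow> cost b g e \<le> L v"
    by (rule lcE[OF assms(2)]) blast
  obtain c M where c: "pb m c" "\<And>g e. length e = m \<Longrightarrow> eval c g e = C g e" "pbound M"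
    "\<And>g e v. length e = m \<Longrightarrow> length (fst g) \<le> v \<Longrightarrow> \<forall>x \<in> set e. x \<le> v \<Longrightarrow> cost c g e \<le> M v"
    by (rule lcE[OF assms(3)]) blast
  have "pb m (Cond a b c)"
  proof (rule pbI[of "\<lambda>v. K v + L v + M v + 1"])
    show "pbound (\<lambda>v. K v + L v + M v + 1)" using a b c by (intro pbound_intros)
    fix g e v assume *: "length e = m" "length (fst (g :: glob)) \<le> v" "\<forall>x \<in> set e. x \<le> v"
    show "cost (Cond a b c) g e \<le> K v + L v + M v + 1"
      using a(4)[OF *] b(4)[OF *] c(4)[OF *] by simp
  qed
  then show ?thesis by (rule lcI) (use a b c in auto)
qed

lemma lc_bind:
  assumes "lc m A" "lc (Suc m) B"
  shows "lc m (\<lambda>g e. B g (A g e # e))"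
proof -
  obtain a K where a: "\<And>g e. length e = m \<Longrightarrow> eval a g e = A g e" "pbound K"
    "\<And>g e v. length e = m \<Longrightarrow> length (fst g) \<le> v \<Longrightarrow> \<forall>x \<in> set e. x \<le> v \<Longrightarrow> cost a g e \<le> K v"
    "\<And>g e v. length e = m \<Longrightarrow> length (fst g) \<le> v \<Longrightarrow> \<forall>x \<in> set e. x \<le> v \<Longrightarrow> A g e \<le> K v"
    by (rule lcE[OF assms(1)]) blast
  obtain b L where b: "\<And>g e. length e = Suc m \<Longrightarrow> eval b g e = B g e" "pbound L"
    "\<And>g e v. length e = Suc m \<Longrightarrow> length (fst g) \<le> v \<Longrightarrow> \<forall>x \<in> set e. x \<le> v \<Longrightarrow> cost b g e \<le> L v"
    by (rule lcE[OF assms(2)]) blast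
  obtain c where c: "\<And>v. L v \<le> (v + 2) ^ c" using b(2) unfolding pbound_def by blast
  have "pb m (Bind a b)"
  proof (rule pbI[of "\<lambda>v. K v + (v + K v + 2) ^ c + 1"])
    show "pbound (\<lambda>v. K v + (v + K v + 2) ^ c + 1)" using a by (intro pbound_intros)
    fix g e v assume *: "length e = m" "length (fst (g :: glob)) \<le> v" "\<forall>x \<in> set e. x \<le> v"
    have "\<forall>x \<in> set (A g e # e). x \<le> v + K v" using a(4)[OF *] * by auto
    then have "cost b g (A g e # e) \<le> L (v + K v)" using * by (intro b(3)) auto
    then show "cost (Bind a b) g e \<le> K v + (v + K v + 2) ^ c + 1"
      using a(3)[OF *] a(1) * c[of "v + K v"] by simp
  qed
  then show ?thesis by (rule lcI) (use a b in auto)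
qed

lemma lc_ren:
  assumes "lc k F" "length js = k" "\<forall>j \<in> set js. j < m"
  shows "lc m (\<lambda>g e. F g (map (\<lambda>j. e ! j) js))"
proof -
  obtain a K where a: "\<And>g e. length e = k \<Longrightarrow> eval a g e = F g e" "pbound K"
    "\<And>g e v. length e = k \<Longrightarrow> length (fst g) \<le> v \<Longrightarrow> \<forall>x \<in> set e. x \<le> v \<Longrightarrow> cost a g e \<le> K v"
    by (rule lcE[OF assms(1)]) blast
  have js: "map (lk e) js = map (\<lambda>j. e ! j) js" if "length e = m" for e
    using assms(3) that by (auto simp: lk_def)
  have "pb m (Ren js a)"
  proof (rule pbI[OF a(2)])
    fix g e v assume *: "length e = m" "length (fst (g :: glob)) \<le> v" "\<forall>x \<in> set e. x \<le> v"
    then show "cost (Ren js a) g e \<le> K v"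
      using assms(2,3) by (auto simp: js intro!: a(3))
  qed
  then show ?thesis by (rule lcI) (simp add: js a(1) assms(2))
qed

text \<open>Iterating a body of polynomial cost may produce exponential values. The last premise
  excludes this by a polynomial bound on all intermediate results, after which the costs of the
  rounds add up to a polynomial.\<close>

lemma lc_rec_pbound:
  assumes "lc m A" "lc (Suc (Suc m)) (\<lambda>g e. B g (e ! 0) (e ! 1) (tl (tl e)))" "lc m C" "pbound D"
    "\<And>g e v i. length e = m \<Longrightarrow> length (fst g) \<le> v \<Longrightarrow> \<forall>x \<in> set e. x \<le> v \<Longrightarrow> i \<le> C g e \<Longrightarrow>
       rec_nat (A g e) (\<lambda>i x. B g i x e) i \<le> D v"
  shows "lc m (\<lambda>g e. rec_nat (A g e) (\<lambda>i x. B g i x e) (C g e))"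
proof -
  obtain a K where a: "\<And>g e. length e = m \<Longrightarrow> eval a g e = A g e" "pbound K"
    "\<And>g e v. length e = m \<Longrightarrow> length (fst g) \<le> v \<Longrightarrow> \<forall>x \<in> set e. x \<le> v \<Longrightarrow> cost a g e \<le> K v"
    by (rule lcE[OF assms(1)]) blast
  obtain b L where b: "\<And>g e. length e = Suc (Suc m) \<Longrightarrow> eval b g e = B g (e ! 0) (e ! 1) (tl (tl e))" "pbound L"
    "\<And>g e v. length e = Suc (Suc m) \<Longrightarrow> length (fst g) \<le> v \<Longrightarrow> \<forall>x \<in> set e. x \<le> v \<Longrightarrow> cost b g e \<le> L v"
    by (rule lcE[OF assms(2)]) blast
  obtain c M where c: "\<And>g e. length e = m \<Longrightarrow> eval c g e = C g e" "pbound M"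
    "\<And>g e v. length e = m \<Longrightarrow> length (fst g) \<le> v \<Longrightarrow> \<forall>x \<in> set e. x \<le> v \<Longrightarrow> cost c g e \<le> M v"
    "\<And>g e v. length e = m \<Longrightarrow> length (fst g) \<le> v \<Longrightarrow> \<forall>x \<in> set e. x \<le> v \<Longrightarrow> C g e \<le> M v"
    by (rule lcE[OF assms(3)]) blast
  obtain l where l: "\<And>v. L v \<le> (v + 2) ^ l" using b(2) unfolding pbound_def by blast
  have B: "eval b g (i # x # e) = B g i x e" if "length e = m" for g i x e
    using b(1)[of "i # x # e"] that by simp
  let ?u = "\<lambda>v. (v + M v + D v + 2) ^ l + 1"
  have "pb m (Loop c a b)"
  proof (rule pbI[of "\<lambda>v. M v + K v + M v * ?u v + 1"])
    show "pbound (\<lambda>v. M v + K v + M v * ?u v + 1)"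
      using a(2) c(2) assms(4) by (intro pbound_intros)
    fix g e v assume *: "length e = m" "length (fst (g :: glob)) \<le> v" "\<forall>x \<in> set e. x \<le> v"
    let ?f = "rec_nat (A g e) (\<lambda>i x. B g i x e)"
    have "cost b g (i # ?f i # e) + 1 \<le> ?u v" if "i < C g e" for i
    proof -
      have "i \<le> M v" "?f i \<le> D v" using c(4)[OF *] assms(5)[OF *, of i] that by auto
      then have "\<forall>x \<in> set (i # ?f i # e). x \<le> v + M v + D v" using *(3) by fastforce
      then have "cost b g (i # ?f i # e) \<le> L (v + M v + D v)" using * by (intro b(3)) auto
      then show ?thesis using l[of "v + M v + D v"] by simp
    qed
    then have "(\<Sum>i<C g e. cost b g (i # ?f i # e) + 1) \<le> (\<Sum>i<C g e. ?u v)" by (intro sum_mono) auto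
    also have "\<dots> = C g e * ?u v" by simp
    also have "\<dots> \<le> M v * ?u v" using c(4)[OF *] by (rule mult_right_mono) simp
    finally show "cost (Loop c a b) g e \<le> M v + K v + M v * ?u v + 1"
      using a(3)[OF *] c(3)[OF *] a(1)[OF *(1)] c(1)[OF *(1)] B[OF *(1)] by simp
  qed
  then show ?thesis by (rule lcI) (use a c B in auto)
qed

lemma lc_rec:
  assumes "lc m A" "lc (Suc (Suc m)) (\<lambda>g e. B g (e ! 0) (e ! 1) (tl (tl e)))" "lc m C" "lc m D"
    "\<And>g e i. length e = m \<Longrightarrow> i \<le> C g e \<Longrightarrow> rec_nat (A g e) (\<lambda>i x. B g i x e) i \<le> D g e"
  shows "lc m (\<lambda>g e. rec_nat (A g e) (\<lambda>i x. B g i x e) (C g e))"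
proof -
  obtain K where K: "pbound K"
    "\<And>g e v. length e = m \<Longrightarrow> length (fst g) \<le> v \<Longrightarrow> \<forall>x \<in> set e. x \<le> v \<Longrightarrow> D g e \<le> K v"
    by (rule lcE[OF assms(4)]) blast
  show ?thesis
    by (rule lc_rec_pbound[OF assms(1-3) K(1)]) (use K(2) assms(5) order_trans in blast)
qed

text \<open>Each pushed value shifts the environment, so the next argument is evaluated on the
  original environment, recovered by a renaming.\<close>

lemma lc_binds:
  assumes "\<forall>A \<in> set As. lc m A" "lc (length As + m) F"
  shows "lc m (\<lambda>g e. F g (map (\<lambda>A. A g e) As @ e))"
  using assms
proof (induction As arbitrary: F)
  case (Cons A As)
  let ?k = "length As + m"
  have "lc ?k (\<lambda>g e. A g (map (\<lambda>j. e ! j) [length As..<?k]))"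
    using Cons.prems(1) by (intro lc_ren[of m]) auto
  then have "lc ?k (\<lambda>g e. F g (A g (map (\<lambda>j. e ! j) [length As..<?k]) # e))"
    using Cons.prems(2) by (intro lc_bind) auto
  then have "lc m (\<lambda>g e. (\<lambda>g e. F g (A g (map (\<lambda>j. e ! j) [length As..<?k]) # e)) g (map (\<lambda>A. A g e) As @ e))"
    using Cons.prems(1) by (intro Cons.IH) auto
  moreover have "map (\<lambda>j. (map (\<lambda>A. A g e) As @ e) ! j) [length As..<?k] = e" if "length e = m" for g e
    using that by (auto simp: nth_append intro!: nth_equalityI)
  ultimately show ?case by (auto elim!: lc_cong)
qed auto

lemma lc_comp:
  assumes "lc (length As) F" "\<forall>A \<in> set As. lc m A"
  shows "lc m (\<lambda>g e. F g (map (\<lambda>A. A g e) As))"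
proof -
  have "lc (length As + m) (\<lambda>g e. F g (map (\<lambda>j. e ! j) [0..<length As]))"
    using assms(1) by (rule lc_ren) auto
  from lc_binds[OF assms(2) this] show ?thesis
    by (rule lc_cong) (auto simp: nth_append intro!: arg_cong[of _ _ "F _"] nth_equalityI)
qed

lemma lc_comp1: "lc 1 (\<lambda>g e. H g (e ! 0)) \<Longrightarrow> lc m A \<Longrightarrow> lc m (\<lambda>g e. H g (A g e))"
  using lc_comp[of "[A]" "\<lambda>g e. H g (e ! 0)" m] by simp

lemma lc_comp2:
  "lc 2 (\<lambda>g e. H g (e ! 0) (e ! 1)) \<Longrightarrow> lc m A \<Longrightarrow> lc m B \<Longrightarrow> lc m (\<lambda>g e. H g (A g e) (B g e))"
  using lc_comp[of "[A, B]" "\<lambda>g e. H g (e ! 0) (e ! 1)" m] by (simp add: numeral_2_eq_2)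

lemma lc_comp3:
  "lc 3 (\<lambda>g e. H g (e ! 0) (e ! 1) (e ! 2)) \<Longrightarrow> lc m A \<Longrightarrow> lc m B \<Longrightarrow> lc m C \<Longrightarrow>
   lc m (\<lambda>g e. H g (A g e) (B g e) (C g e))"
  using lc_comp[of "[A, B, C]" "\<lambda>g e. H g (e ! 0) (e ! 1) (e ! 2)" m] by (simp add: numeral_3_eq_3)

lemma lc_comp4:
  "lc 4 (\<lambda>g e. H g (e ! 0) (e ! 1) (e ! 2) (e ! 3)) \<Longrightarrow> lc m A \<Longrightarrow> lc m B \<Longrightarrow> lc m C \<Longrightarrow> lc m D \<Longrightarrow>
   lc m (\<lambda>g e. H g (A g e) (B g e) (C g e) (D g e))"
  using lc_comp[of "[A, B, C, D]" "\<lambda>g e. H g (e ! 0) (e ! 1) (e ! 2) (e ! 3)" m]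
  by (simp add: eval_nat_numeral)

text \<open>The bodies of bounded sums and quantifiers see the argument list as \<^term>\<open>tl e\<close>.\<close>

lemma lc_tl: "Suc j < m \<Longrightarrow> lc m (\<lambda>g e. tl e ! j)"
  "Suc (Suc j) < m \<Longrightarrow> lc m (\<lambda>g e. tl (tl e) ! j)"
  "Suc (Suc (Suc j)) < m \<Longrightarrow> lc m (\<lambda>g e. tl (tl (tl e)) ! j)"
  "Suc (Suc (Suc (Suc j))) < m \<Longrightarrow> lc m (\<lambda>g e. tl (tl (tl (tl e))) ! j)"
  "Suc (Suc (Suc (Suc (Suc j)))) < m \<Longrightarrow> lc m (\<lambda>g e. tl (tl (tl (tl (tl e)))) ! j)"
  by (rule lc_cong[OF lc_V], assumption, simp add: nth_tl)+

lemma lc_const: "lc m (\<lambda>g e. c)"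
  by (induction c) (auto intro: lc_0 lc_Suc)

lemma lc_add: assumes "lc m A" "lc m B" shows "lc m (\<lambda>g e. A g e + B g e)"
proof -
  have "rec_nat x (\<lambda>i y. Suc y) n = x + n" for x n :: nat by (induction n) auto
  moreover have "lc 2 (\<lambda>g e. rec_nat (e ! 0) (\<lambda>i x. Suc x) (e ! 1))"
  proof (rule lc_rec_pbound[of _ _ "\<lambda>g i x e. Suc x" _ "\<lambda>v. v + v"])
    show "pbound (\<lambda>v. v + v)" by (intro pbound_intros)
    fix g :: glob and e and v i :: nat
    assume "length e = 2" "\<forall>x \<in> set e. x \<le> v" "i \<le> e ! 1"
    then have "e ! 0 \<le> v" "e ! 1 \<le> v" by auto
    then show "rec_nat (e ! 0) (\<lambda>i x. Suc x) i \<le> v + v" using \<open>i \<le> e ! 1\<close>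
      by (simp add: \<open>\<And>x n. rec_nat x (\<lambda>i y. Suc y) n = x + n\<close>)
  qed (auto intro!: lc_V lc_Suc)
  ultimately have "lc 2 (\<lambda>g e. e ! 0 + e ! 1)" by simp
  then show ?thesis by (rule lc_comp2[of "\<lambda>g a b. a + b", OF _ assms])
qed

lemma lc_diff: assumes "lc m A" "lc m B" shows "lc m (\<lambda>g e. A g e - B g e)"
proof -
  have *: "rec_nat x (\<lambda>i y. y - Suc 0) n = x - n" for x n :: nat by (induction n) auto
  have "lc 2 (\<lambda>g e. rec_nat (e ! 0) (\<lambda>i x. x - Suc 0) (e ! 1))"
    by (rule lc_rec[of _ _ "\<lambda>g i x e. x - Suc 0" _ "\<lambda>g e. e ! 0"]) (auto intro!: lc_V lc_pred simp: *)
  then show ?thesis unfolding * by (rule lc_comp2[of "\<lambda>g a b. a - b", OF _ assms])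
qed

lemma lc_if: assumes "lb m P" "lc m A" "lc m B" shows "lc m (\<lambda>g e. if P g e then A g e else B g e)"
  using lc_cond[OF assms] by (rule lc_cong) auto

lemma lb_not: assumes "lb m P" shows "lb m (\<lambda>g e. \<not> P g e)"
  using lc_if[OF assms lc_const[of m 0] lc_const[of m 1]] by (rule lc_cong) auto

lemma lb_conj: assumes "lb m P" "lb m Q" shows "lb m (\<lambda>g e. P g e \<and> Q g e)"
  using lc_if[OF assms(1,2) lc_const[of m 0]] by (rule lc_cong) auto

lemma lb_disj: assumes "lb m P" "lb m Q" shows "lb m (\<lambda>g e. P g e \<or> Q g e)"
  using lc_if[OF assms(1) lc_const[of m 1] assms(2)] by (rule lc_cong) auto

lemma lb_imp: assumes "lb m P" "lb m Q" shows "lb m (\<lambda>g e. P g e \<longrightarrow> Q g e)"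
  using lc_if[OF assms(1,2) lc_const[of m 1]] by (rule lc_cong) auto

lemma lb_iff: assumes "lb m P" "lb m Q" shows "lb m (\<lambda>g e. P g e \<longleftrightarrow> Q g e)"
  using lc_if[OF assms(1,2) lb_not[OF assms(2)]] by (rule lc_cong) auto

lemma lb_if: assumes "lb m P" "lb m Q" "lb m R" shows "lb m (\<lambda>g e. if P g e then Q g e else R g e)"
  using lc_if[OF assms] by (rule lc_cong) auto

lemma lb_const: "lb m (\<lambda>g e. b)"
  by (rule lc_const)

lemma lb_nonzero: assumes "lc m A" shows "lb m (\<lambda>g e. A g e \<noteq> 0)"
  using lc_cond[OF assms lc_const[of m 1] lc_const[of m 0]] by (rule lc_cong) auto

lemma lb_less: assumes "lc m A" "lc m B" shows "lb m (\<lambda>g e. A g e < B g e)"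
  using lb_nonzero[OF lc_diff[OF assms(2,1)]] by (rule lc_cong) auto

lemma lb_le: assumes "lc m A" "lc m B" shows "lb m (\<lambda>g e. A g e \<le> B g e)"
  using lb_not[OF lb_less[OF assms(2,1)]] by (rule lc_cong) auto

lemma lb_eq: assumes "lc m A" "lc m B" shows "lb m (\<lambda>g e. A g e = B g e)"
  using lb_conj[OF lb_le[OF assms] lb_le[OF assms(2,1)]] by (rule lc_cong) auto

text \<open>Terms are polynomially bounded in the index and the arguments, hence so are the partial
  sums, and no bound has to be supplied by hand. Bounded quantifiers are derived from sums for this
  reason.\<close>

lemma lc_sum:
  assumes "lc m C" "lc (Suc m) (\<lambda>g e. B g (e ! 0) (tl e))"
  shows "lc m (\<lambda>g e. \<Sum>i<C g e. B g i e)"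
proof -
  obtain K where K: "pbound K" "mono K"
    "\<And>g e v. length e = m \<Longrightarrow> length (fst g) \<le> v \<Longrightarrow> \<forall>x \<in> set e. x \<le> v \<Longrightarrow> C g e \<le> K v"
    by (rule lcE[OF assms(1)]) blast
  obtain L where L: "pbound L" "\<And>g e v. length e = Suc m \<Longrightarrow> length (fst g) \<le> v \<Longrightarrow>
      \<forall>x \<in> set e. x \<le> v \<Longrightarrow> B g (e ! 0) (tl e) \<le> L v"
    by (rule lcE[OF assms(2)]) blast
  obtain l where l: "\<And>v. L v \<le> (v + 2) ^ l" using L(1) unfolding pbound_def by blast
  have *: "rec_nat 0 (\<lambda>i x. x + B g i e) n = (\<Sum>i<n. B g i e)" for g e n
    by (induction n) auto
  have "lc (Suc (Suc m)) (\<lambda>g e. (\<lambda>g e. B g (e ! 0) (tl e)) g (map (\<lambda>j. e ! j) (0 # [2..<Suc (Suc m)])))"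
    by (rule lc_ren[OF assms(2)]) auto
  moreover have "map (\<lambda>j. e ! j) (0 # [2..<Suc (Suc m)]) = e ! 0 # tl (tl e)" if "length e = Suc (Suc m)" for e :: "nat list"
    using that by (auto simp: nth_tl nth_Cons' intro!: nth_equalityI simp del: upt_Suc)
  ultimately have "lc (Suc (Suc m)) (\<lambda>g e. B g (e ! 0) (tl (tl e)))"
    by (auto elim!: lc_cong)
  then have "lc (Suc (Suc m)) (\<lambda>g e. e ! 1 + B g (e ! 0) (tl (tl e)))"
    by (intro lc_add lc_V) auto
  then have "lc m (\<lambda>g e. rec_nat 0 (\<lambda>i x. x + B g i e) (C g e))"
  proof (rule lc_rec_pbound[OF lc_const[of m 0] _ assms(1), of "\<lambda>g i x e. x + B g i e"])
    show "pbound (\<lambda>v. K v * (v + K v + 2) ^ l)" by (intro pbound_intros K)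
    fix g :: glob and e and v i :: nat
    assume *: "length e = m" "length (fst g) \<le> v" "\<forall>x \<in> set e. x \<le> v" "i \<le> C g e"
    have C: "C g e \<le> K v" using K(3) * by blast
    have "B g j e \<le> (v + K v + 2) ^ l" if "j < i" for j
    proof -
      have "\<forall>x \<in> set (j # e). x \<le> v + K v" using * C that by fastforce
      then have "B g j e \<le> L (v + K v)" using L(2)[of "j # e" g "v + K v"] * by simp
      then show ?thesis using l[of "v + K v"] by simp
    qed
    then have "(\<Sum>j<i. B g j e) \<le> (\<Sum>j<i. (v + K v + 2) ^ l)" by (intro sum_mono) auto
    also have "\<dots> = i * (v + K v + 2) ^ l" by simp
    also have "\<dots> \<le> K v * (v + K v + 2) ^ l" using C * by (intro mult_right_mono) auto
    finally show "rec_nat 0 (\<lambda>i x. x + B g i e) i \<le> K v * (v + K v + 2) ^ l"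
      by (simp only: \<open>\<And>g e n. rec_nat 0 (\<lambda>i x. x + B g i e) n = (\<Sum>i<n. B g i e)\<close>)
  qed
  then show ?thesis unfolding * .
qed

lemma lb_ex:
  assumes "lc m C" "lb (Suc m) (\<lambda>g e. P g (e ! 0) (tl e))"
  shows "lb m (\<lambda>g e. \<exists>i<C g e. P g i e)"
  using lb_nonzero[OF lc_sum[OF assms(1), of "\<lambda>g i e. of_bool (P g i e)", OF assms(2)]]
  by (rule lc_cong) auto

lemma lb_all:
  assumes "lc m C" "lb (Suc m) (\<lambda>g e. P g (e ! 0) (tl e))"
  shows "lb m (\<lambda>g e. \<forall>i<C g e. P g i e)"
  using lb_not[OF lb_ex[OF assms(1), of "\<lambda>g i e. \<not> P g i e", OF lb_not[OF assms(2)]]]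
  by (rule lc_cong) auto

lemma lb_ex_list: "(\<And>x. x \<in> set xs \<Longrightarrow> lb m (P x)) \<Longrightarrow> lb m (\<lambda>g e. \<exists>x\<in>set xs. P x g e)"
proof (induction xs)
  case (Cons x xs)
  then have "lb m (\<lambda>g e. P x g e \<or> (\<exists>x\<in>set xs. P x g e))" by (intro lb_disj) auto
  then show ?case by (rule lc_cong) auto
qed (simp add: lc_const)

lemma lb_all_list: "(\<And>x. x \<in> set xs \<Longrightarrow> lb m (P x)) \<Longrightarrow> lb m (\<lambda>g e. \<forall>x\<in>set xs. P x g e)"
proof (induction xs)
  case (Cons x xs)
  then have "lb m (\<lambda>g e. P x g e \<and> (\<forall>x\<in>set xs. P x g e))" by (intro lb_conj) auto
  then show ?case by (rule lc_cong) auto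
qed (simp add: lc_const)

lemma lc_mult: assumes "lc m A" "lc m B" shows "lc m (\<lambda>g e. A g e * B g e)"
proof -
  have "lc 2 (\<lambda>g e. \<Sum>i<e ! 0. e ! 1)"
    by (rule lc_sum[of _ _ "\<lambda>g i e. e ! 1"]) (auto intro!: lc_V lc_tl)
  then have "lc 2 (\<lambda>g e. e ! 0 * e ! 1)" by simp
  then show ?thesis by (rule lc_comp2[of "\<lambda>g a b. a * b", OF _ assms])
qed

lemma lc_power: assumes "lc m A" shows "lc m (\<lambda>g e. A g e ^ c)"
  by (induction c) (auto intro!: lc_mult assms lc_const simp del: power_eq_if)

text \<open>The quotient counts the positive multiples of the divisor up to the dividend; the
  conjunct \<open>0 < e ! 1\<close> gives the value \<open>0\<close> for division by zero.\<close>

lemma lc_div: assumes "lc m A" "lc m B" shows "lc m (\<lambda>g e. A g e div B g e)"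
proof -
  have "lc 2 (\<lambda>g e. \<Sum>i<e ! 0. of_bool (0 < e ! 1 \<and> (i + 1) * e ! 1 \<le> e ! 0))"
    by (rule lc_sum[of _ _ "\<lambda>g i e. of_bool (0 < e ! 1 \<and> (i + 1) * e ! 1 \<le> e ! 0)"];
      (intro lb_conj lb_less lb_le lc_mult lc_add lc_const lc_V lc_tl)?; simp)
  moreover have "(\<Sum>i<a. of_bool (0 < b \<and> (i + 1) * b \<le> a)) = a div b" for a b :: nat
  proof (cases "b = 0")
    case False
    have *: "(i + 1) * b \<le> a \<longleftrightarrow> i < a div b" for i
      using False less_eq_div_iff_mult_less_eq[of b "i + 1" a] by (simp add: Suc_le_eq)
    have "i < a" if "i < a div b" for i using that div_le_dividend less_le_trans by blast
    then have "{..<a} \<inter> {i. 0 < b \<and> (i + 1) * b \<le> a} = {..<a div b}"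
      unfolding * using False by auto
    then show ?thesis by (subst sum_of_bool_eq) auto
  qed auto
  ultimately have "lc 2 (\<lambda>g e. e ! 0 div e ! 1)" by simp
  then show ?thesis by (rule lc_comp2[of "\<lambda>g a b. a div b", OF _ assms])
qed

lemma lc_mod: assumes "lc m A" "lc m B" shows "lc m (\<lambda>g e. A g e mod B g e)"
proof -
  have "lc m (\<lambda>g e. A g e - A g e div B g e * B g e)"
    by (intro lc_diff lc_mult lc_div assms)
  then show ?thesis by (rule lc_cong) (simp add: minus_div_mult_eq_mod)
qed

lemma lc_length: "lc m (\<lambda>g e. length (fst g))"
  by (rule lcI[of _ Len]) (auto intro!: pbI[of "\<lambda>v. v + 1"] pbound_intros)

definition bit_at :: "bool list \<Rightarrow> nat \<Rightarrow> bool" where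
  "bit_at xs i \<longleftrightarrow> i < length xs \<and> xs ! i"

lemma lb_word: assumes "lc m A" shows "lb m (\<lambda>g e. bit_at (fst g) (A g e))"
proof -
  have "lc 1 (\<lambda>g e. inp g (e ! 0))"
    by (rule lcI[of _ "Inp (V 0)"])
      (auto simp: lk_def length_Suc_conv intro!: pbI[of "\<lambda>v. v + v + 2"] pbound_intros)
  then have "lc m (\<lambda>g e. inp g (A g e))" by (rule lc_comp1[OF _ assms])
  then have "lb m (\<lambda>g e. inp g (A g e) = 1)" by (intro lb_eq lc_const)
  then show ?thesis by (rule lc_cong) (simp add: inp_def bit_at_def)
qed

lemma lb_cell: assumes "lc m A" shows "lb m (\<lambda>g e. bit_at (snd g) (A g e))"
proof -
  have "lc 1 (\<lambda>g e. orc g (e ! 0))"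
    by (rule lcI[of _ "Orc (V 0)"])
      (auto simp: lk_def length_Suc_conv intro!: pbI[of "\<lambda>v. v + 2"] pbound_intros)
  from lc_comp1[OF this assms] show ?thesis by (simp add: orc_def bit_at_def)
qed

text \<open>A function that is constant from \<open>K\<close> on is a nest of \<open>K\<close>
  conditionals. It brings arbitrary fixed finite data, such as the set \<open>Bl\<close>, into
  programs.\<close>

lemma lc_table:
  assumes "lc m A" "\<And>x. K \<le> x \<Longrightarrow> T x = c"
  shows "lc m (\<lambda>g e. T (A g e))"
  using assms
proof (induction K arbitrary: T A)
  case 0
  then show ?case by (simp add: lc_const)
next
  case (Suc K)
  have "lc m (\<lambda>g e. (\<lambda>x. T (Suc x)) (A g e - Suc 0))"
    using Suc.IH[OF lc_pred[OF Suc.prems(1)], of "\<lambda>x. T (Suc x)"] Suc.prems(2) by simp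
  from lc_cond[OF Suc.prems(1) this lc_const[of m "T 0"]] show ?case
    by (rule lc_cong) auto
qed

lemma lb_table: "lc m A \<Longrightarrow> (\<And>x. K \<le> x \<Longrightarrow> \<not> T x) \<Longrightarrow> lb m (\<lambda>g e. T (A g e))"
  by (rule lc_table[of m A K "\<lambda>x. of_bool (T x)" 0]) auto

lemmas lc_intros = lc_V lc_tl lc_const lc_Suc lc_add lc_diff lc_mult lc_div lc_mod lc_power lc_if
  lc_sum lb_not lb_conj lb_disj lb_imp lb_iff lb_if lb_less lb_le lb_eq lb_ex lb_all lb_word lb_cell lc_length

theorem logspace_computable_lc:
  assumes "lc 0 h" "lc 1 f"
  shows "logspace_computable (\<lambda>w. encode_nats (map (\<lambda>j. f (w, []) [j]) [0..<h (w, []) []]))"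
proof -
  obtain a b where a: "pb 0 a" "\<And>g e. length e = 0 \<Longrightarrow> eval a g e = h g e"
    and b: "pb 1 b" "\<And>g e. length e = 1 \<Longrightarrow> eval b g e = f g e"
    using assms by (auto simp: lc_def)
  show ?thesis using logspace_computable_unary[OF a(1) b(1)] a(2) b(2) by simp
qed

primrec bitseq :: "(glob \<Rightarrow> nat list \<Rightarrow> bool) \<Rightarrow> bool list \<Rightarrow> nat \<Rightarrow> bool list" where
  "bitseq P w 0 = []"
| "bitseq P w (Suc t) = bitseq P w t @ [P (w, bitseq P w t) [t]]"

theorem polytime_lc:
  assumes "lc 0 h" "lb 1 P" "lb 0 Q"
  shows "polytime {w. Q (w, bitseq P w (h (w, []) [])) []}"
proof -
  obtain a b c where a: "pb 0 a" "\<And>g e. length e = 0 \<Longrightarrow> eval a g e = h g e"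
    and b: "pb 1 b" "\<And>g e. length e = 1 \<Longrightarrow> eval b g e = of_bool (P g e)"
    and c: "pb 0 c" "\<And>g e. length e = 0 \<Longrightarrow> eval c g e = of_bool (Q g e)"
    using assms by (auto simp: lc_def)
  have "bits b w t = bitseq P w t" for w t
    by (induction t) (auto simp: b)
  then show ?thesis using polytime_bits[OF a(1) b(1) c(1)] a(2) c(2) by simp
qed

section \<open>Fixpoint characterisation of the strategy operators\<close>

text \<open>The controllable predecessor. The choice of the coalition is given as a full joint
  action of which only the entries of members of \<open>A\<close> are compared.\<close>

definition pre :: "('q, 'p) cgs \<Rightarrow> nat set \<Rightarrow> ('q \<Rightarrow> bool) \<Rightarrow> 'q \<Rightarrow> bool" where
  "pre C A Y q \<longleftrightarrow> (\<exists>\<alpha> \<in> set (joint_actions 2 C q). \<forall>\<beta> \<in> set (joint_actions 2 C q).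
     (\<forall>a \<in> A. \<beta> ! (a - 1) = \<alpha> ! (a - 1)) \<longrightarrow> Y (delta C q \<beta>))"

lemma agents_2: "agents 2 = {1, 2}"
  by (auto simp: agents_def)

lemma joint_actions_2:
  "joint_actions 2 C q =
     concat (map (\<lambda>a. map (\<lambda>b. [a, b]) [1..<Suc (acts C q 2)]) [1..<Suc (acts C q 1)])"
proof -
  have "[1..<Suc 2] = [1, 2]" by (simp add: upt_rec)
  then show ?thesis by (simp add: joint_actions_def concat_map_singleton comp_def)
qed

lemma set_joint_actions_2:
  "set (joint_actions 2 C q) = {[a, b] | a b. 1 \<le> a \<and> a \<le> acts C q 1 \<and> 1 \<le> b \<and> b \<le> acts C q 2}"
  by (force simp: joint_actions_2)

lemma pre_mono:
  assumes "pre C A Y q" "A \<subseteq> B" "\<And>\<beta>. \<beta> \<in> set (joint_actions 2 C q) \<Longrightarrow> Y (delta C q \<beta>) \<Longrightarrow> Y' (delta C q \<beta>)"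
  shows "pre C B Y' q"
  using assms unfolding pre_def by (meson subset_eq)

lemma wf_delta:
  "wf_cgs 2 Props C \<Longrightarrow> q \<in> states C \<Longrightarrow> \<beta> \<in> set (joint_actions 2 C q) \<Longrightarrow> delta C q \<beta> \<in> states C"
  by (simp add: wf_cgs_def)

lemma pre_mono_states:
  assumes "wf_cgs 2 Props C" "q \<in> states C" "pre C A Y q" "A \<subseteq> B" "\<And>x. x \<in> states C \<Longrightarrow> Y x \<Longrightarrow> Y' x"
  shows "pre C B Y' q"
  using pre_mono[OF assms(3,4)] wf_delta[OF assms(1,2)] assms(5) by blast

lemma pre_cong_states:
  assumes "wf_cgs 2 Props C" "q \<in> states C" "\<And>x. x \<in> states C \<Longrightarrow> Y x \<longleftrightarrow> Y' x"
  shows "pre C A Y q \<longleftrightarrow> pre C A Y' q"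
  using pre_mono_states[OF assms(1,2), of A Y A Y'] pre_mono_states[OF assms(1,2), of A Y' A Y]
    assms(3) by blast

lemma joint_action_exists:
  assumes "wf_cgs 2 Props C" "q \<in> states C"
  shows "[1, 1] \<in> set (joint_actions 2 C q)"
  using assms by (auto simp: wf_cgs_def agents_2 set_joint_actions_2)

lemma pre_True: "wf_cgs 2 Props C \<Longrightarrow> q \<in> states C \<Longrightarrow> pre C A (\<lambda>_. True) q"
  using joint_action_exists[of Props C q] unfolding pre_def by blast

lemma not_pre_False: "\<not> pre C A (\<lambda>_. False) q"
  unfolding pre_def by blast

lemma Out_states:
  assumes "wf_cgs 2 Props C" "q \<in> states C" "\<rho> \<in> Out 2 C A q s"
  shows "\<rho> i \<in> states C"
proof (induction i)
  case (Suc i)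
  obtain \<beta> where "\<beta> \<in> set (joint_actions 2 C (\<rho> i))" "\<rho> (Suc i) = delta C (\<rho> i) \<beta>"
    using assms(3) unfolding Out_def by blast
  then show ?case using wf_delta[OF assms(1) Suc] by simp
qed (use assms in \<open>simp add: Out_def\<close>)

text \<open>One forcing action fixed per state gives a strategy that looks only at the last state.
  The relation \<open>G\<close> between consecutive states will express progress towards a goal or
  preservation of an invariant.\<close>

lemma memoryless_strategy:
  assumes wf: "wf_cgs 2 Props C" and A: "A \<subseteq> agents 2"
    and pre: "\<And>x. x \<in> states C \<Longrightarrow> pre C A (G x) x"
  obtains s where "strategy_profile C A s"
    "\<forall>q \<in> states C. \<forall>\<rho> \<in> Out 2 C A q s. \<forall>i. G (\<rho> i) (\<rho> (Suc i))"
proof -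
  obtain \<alpha> where \<alpha>: "\<And>x. x \<in> states C \<Longrightarrow> \<alpha> x \<in> set (joint_actions 2 C x) \<and>
      (\<forall>\<beta> \<in> set (joint_actions 2 C x). (\<forall>a \<in> A. \<beta> ! (a - 1) = \<alpha> x ! (a - 1)) \<longrightarrow> G x (delta C x \<beta>))"
    using pre unfolding pre_def by metis
  define s where "s = (\<lambda>a h. \<alpha> (last h) ! (a - 1))"
  show ?thesis
  proof (rule that[of s])
    show "strategy_profile C A s"
      unfolding strategy_profile_def strategy_def
    proof (intro ballI allI impI)
      fix a h assume a: "a \<in> A" and h: "h \<noteq> [] \<and> set h \<subseteq> states C"
      then have "last h \<in> states C" using last_in_set by blast
      then have "\<alpha> (last h) \<in> set (joint_actions 2 C (last h))" using \<alpha> by blast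
      then show "s a h \<in> {1..acts C (last h) a}"
        using a A unfolding set_joint_actions_2 s_def agents_2 by auto
    qed
    show "\<forall>q \<in> states C. \<forall>\<rho> \<in> Out 2 C A q s. \<forall>i. G (\<rho> i) (\<rho> (Suc i))"
    proof (intro ballI allI)
    fix q \<rho> i assume q: "q \<in> states C" and \<rho>: "\<rho> \<in> Out 2 C A q s"
    obtain \<beta> where \<beta>: "\<beta> \<in> set (joint_actions 2 C (\<rho> i))" "\<forall>a \<in> A. \<beta> ! (a - 1) = s a (map \<rho> [0..<Suc i])"
      "\<rho> (Suc i) = delta C (\<rho> i) \<beta>" using \<rho> unfolding Out_def by blast
    then show "G (\<rho> i) (\<rho> (Suc i))"
      using \<alpha>[OF Out_states[OF wf q \<rho>]] by (auto simp: s_def)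
    qed
  qed
qed

text \<open>The counterpart against an arbitrary, possibly history-dependent strategy: since the
  coalition cannot force the failure of \<open>G\<close> in one step, its prescribed actions always
  leave some successor related by \<open>G\<close>, and these answers are strung together into an
  outcome.\<close>

lemma adverse_outcome:
  assumes wf: "wf_cgs 2 Props C" and A: "A \<subseteq> agents 2" and q: "q \<in> states C"
    and s: "strategy_profile C A s"
    and pre: "\<And>x. x \<in> states C \<Longrightarrow> \<not> pre C A (\<lambda>y. \<not> G x y) x"
  obtains \<rho> where "\<rho> \<in> Out 2 C A q s" "\<forall>i. G (\<rho> i) (\<rho> (Suc i))"
proof -
  have "\<exists>\<beta> \<in> set (joint_actions 2 C (last h)). (\<forall>a \<in> A. \<beta> ! (a - 1) = s a h) \<and> G (last h) (delta C (last h) \<beta>)"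
    if h: "h \<noteq> []" "set h \<subseteq> states C" for h
  proof -
    have last: "last h \<in> states C" using h last_in_set by blast
    \<comment> \<open>Agents outside the coalition receive action \<open>1\<close>, which exists in
      every state; this completes the prescribed actions to a joint action.\<close>
    define f where "f = (\<lambda>a. if a \<in> A then s a h else 1)"
    have "f a \<in> {1..acts C (last h) a}" if "a \<in> agents 2" for a
      using wf last s h that unfolding f_def strategy_profile_def strategy_def wf_cgs_def by auto
    then have "[f 1, f 2] \<in> set (joint_actions 2 C (last h))"
      unfolding set_joint_actions_2 agents_2 by auto
    then obtain \<beta> where "\<beta> \<in> set (joint_actions 2 C (last h))" "\<forall>a \<in> A. \<beta> ! (a - 1) = [f 1, f 2] ! (a - 1)"
      "G (last h) (delta C (last h) \<beta>)"
      using pre[OF last] unfolding pre_def by blast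
    moreover from this(2) have "\<forall>a \<in> A. \<beta> ! (a - 1) = s a h"
      using A unfolding agents_2 f_def by auto
    ultimately show ?thesis by blast
  qed
  then obtain b where b: "\<And>h. h \<noteq> [] \<Longrightarrow> set h \<subseteq> states C \<Longrightarrow> b h \<in> set (joint_actions 2 C (last h)) \<and>
      (\<forall>a \<in> A. b h ! (a - 1) = s a h) \<and> G (last h) (delta C (last h) (b h))"
    by metis
  \<comment> \<open>The histories of the path under construction; they are needed in full because
    the strategy reads them.\<close>
  define H where "H = rec_nat [q] (\<lambda>_ h. h @ [delta C (last h) (b h)])"
  have H0: "H 0 = [q]" and HS: "H (Suc i) = H i @ [delta C (last (H i)) (b (H i))]" for i
    by (simp_all add: H_def)
  have H: "H i \<noteq> [] \<and> set (H i) \<subseteq> states C" for i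
  proof (induction i)
    case (Suc i)
    then have "last (H i) \<in> states C" using last_in_set by blast
    then show ?case using Suc b[of "H i"] wf_delta[OF wf] by (auto simp: HS)
  qed (use q in \<open>simp add: H0\<close>)
  define \<rho> where "\<rho> = (\<lambda>i. last (H i))"
  have H\<rho>: "H i = map \<rho> [0..<Suc i]" for i
    by (induction i) (simp_all add: H0 HS \<rho>_def)
  have step: "\<rho> (Suc i) = delta C (\<rho> i) (b (H i))" for i by (simp add: \<rho>_def HS)
  show ?thesis
  proof (rule that[of \<rho>])
    have "b (H i) \<in> set (joint_actions 2 C (\<rho> i)) \<and> (\<forall>a \<in> A. b (H i) ! (a - 1) = s a (map \<rho> [0..<Suc i]))" for i
      using b[of "H i"] H[of i] unfolding H\<rho>[symmetric] by (simp add: \<rho>_def)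
    moreover have "\<rho> 0 = q" by (simp add: H0 \<rho>_def)
    ultimately show "\<rho> \<in> Out 2 C A q s"
      unfolding Out_def using step by blast
    have "G (\<rho> i) (\<rho> (Suc i))" for i
      using b[of "H i"] H[of i] unfolding step by (simp add: \<rho>_def)
    then show "\<forall>i. G (\<rho> i) (\<rho> (Suc i))" by blast
  qed
qed

text \<open>Its iterates are the approximants of the least and greatest fixpoints. Keeping
  \<open>Y q\<close> itself makes the iteration monotone from any starting predicate.\<close>

definition upd :: "tempop \<Rightarrow> ('q, 'p) cgs \<Rightarrow> nat set \<Rightarrow> ('q \<Rightarrow> bool) \<Rightarrow> 'q \<Rightarrow> bool" where
  "upd op C A Y q = (case op of Finally \<Rightarrow> Y q \<or> pre C A Y q | Globally \<Rightarrow> Y q \<and> pre C A Y q)"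

lemma upd_mono_iter:
  "s \<le> t \<Longrightarrow> (upd Finally C A ^^ s) P q \<Longrightarrow> (upd Finally C A ^^ t) P q"
  "s \<le> t \<Longrightarrow> (upd Globally C A ^^ t) P q \<Longrightarrow> (upd Globally C A ^^ s) P q"
  by (induction rule: dec_induct) (auto simp: upd_def)

lemma Finally_sound:
  assumes wf: "wf_cgs 2 Props C" and A: "A \<subseteq> agents 2" and q: "q \<in> states C"
    and "(upd Finally C A ^^ s) (sat 2 C \<phi>) q"
  shows "sat 2 C (Strat A Finally \<phi>) q"
proof -
  let ?it = "\<lambda>s. (upd Finally C A ^^ s) (sat 2 C \<phi>)"
  \<comment> \<open>Progress: a state that enters at stage \<open>Suc s\<close> is left only to
    states of stage \<open>s\<close>. The stage of entry is unique, so the quantifier over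
    \<open>s\<close> poses one condition at most, which the one-step force established at that stage
    meets.\<close>
  define G where "G = (\<lambda>x y. \<forall>s. \<not> ?it s x \<and> ?it (Suc s) x \<longrightarrow> ?it s y)"
  have "pre C A (G x) x" if x: "x \<in> states C" for x
  proof (cases "\<exists>s. \<not> ?it s x \<and> ?it (Suc s) x")
    case True
    then obtain s where s: "\<not> ?it s x" "?it (Suc s) x" by blast
    then have p: "pre C A (?it s) x" by (simp add: upd_def)
    have uniq: "t = s" if "\<not> ?it t x" "?it (Suc t) x" for t
    proof (rule ccontr)
      assume "t \<noteq> s"
      then have "Suc t \<le> s \<or> Suc s \<le> t" by linarith
      then show False
        using that s upd_mono_iter(1)[of "Suc t" s C A _ x] upd_mono_iter(1)[of "Suc s" t C A _ x] by blast
    qed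
    show ?thesis
      by (rule pre_mono[OF p order_refl]) (unfold G_def, use uniq in blast)
  next
    case False
    then show ?thesis
      by (intro pre_mono[OF pre_True[OF wf x] order_refl]) (unfold G_def, blast)
  qed
  then obtain st where st: "strategy_profile C A st"
    "\<forall>q \<in> states C. \<forall>\<rho> \<in> Out 2 C A q st. \<forall>i. G (\<rho> i) (\<rho> (Suc i))"
    by (rule memoryless_strategy[OF wf A]) blast
  have "\<exists>j. sat 2 C \<phi> (\<rho> j)" if \<rho>: "\<rho> \<in> Out 2 C A q st" for \<rho>
  proof -
    have "?it s (\<rho> i) \<Longrightarrow> \<exists>j. sat 2 C \<phi> (\<rho> j)" for s i
    proof (induction s arbitrary: i)
      case (Suc s)
      then show ?case using st(2)[rule_format, OF q \<rho>, of i] unfolding G_def by blast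
    qed auto
    moreover have "\<rho> 0 = q" using \<rho> by (simp add: Out_def)
    ultimately show ?thesis using assms(4) by metis
  qed
  then show ?thesis using st(1) by auto
qed

text \<open>Outside a closed \<open>Y\<close> the coalition cannot force its way into
  \<open>Y\<close>, so every strategy has an outcome that avoids \<open>Y\<close> and with it
  \<phi>.\<close>

lemma Finally_least:
  assumes wf: "wf_cgs 2 Props C" and A: "A \<subseteq> agents 2" and q: "q \<in> states C"
    and Y: "\<And>x. x \<in> states C \<Longrightarrow> sat 2 C \<phi> x \<or> pre C A Y x \<Longrightarrow> Y x"
    and sat: "sat 2 C (Strat A Finally \<phi>) q"
  shows "Y q"
proof (rule ccontr)
  assume nY: "\<not> Y q"
  obtain s where s: "strategy_profile C A s" "\<And>\<rho>. \<rho> \<in> Out 2 C A q s \<Longrightarrow> \<exists>i. sat 2 C \<phi> (\<rho> i)"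
    using sat by auto
  have "\<not> pre C A (\<lambda>y. \<not> (\<not> Y x \<longrightarrow> \<not> Y y)) x" if x: "x \<in> states C" for x
  proof
    assume p: "pre C A (\<lambda>y. \<not> (\<not> Y x \<longrightarrow> \<not> Y y)) x"
    then have "pre C A Y x" by (rule pre_mono) auto
    then have "Y x" using Y x by blast
    then have "pre C A (\<lambda>_. False) x" by (intro pre_mono[OF p order_refl]) blast
    then show False by (rule notE[OF not_pre_False])
  qed
  then obtain \<rho> where \<rho>: "\<rho> \<in> Out 2 C A q s" "\<forall>i. \<not> Y (\<rho> i) \<longrightarrow> \<not> Y (\<rho> (Suc i))"
    by (rule adverse_outcome[where G = "\<lambda>x y. \<not> Y x \<longrightarrow> \<not> Y y", OF wf A q s(1)]) blast
  have "\<not> Y (\<rho> i)" for i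
    by (induction i) (use \<rho> nY in \<open>auto simp: Out_def\<close>)
  then show False using s(2)[OF \<rho>(1)] Y Out_states[OF wf q \<rho>(1)] by blast
qed

lemma Globally_greatest:
  assumes wf: "wf_cgs 2 Props C" and A: "A \<subseteq> agents 2" and q: "q \<in> states C"
    and Y: "\<And>x. x \<in> states C \<Longrightarrow> Y x \<Longrightarrow> sat 2 C \<phi> x \<and> pre C A Y x" and "Y q"
  shows "sat 2 C (Strat A Globally \<phi>) q"
proof -
  have "pre C A (\<lambda>y. Y x \<longrightarrow> Y y) x" if x: "x \<in> states C" for x
    by (cases "Y x") (use Y x pre_True[OF wf x] in auto)
  then obtain s where s: "strategy_profile C A s"
    "\<forall>q \<in> states C. \<forall>\<rho> \<in> Out 2 C A q s. \<forall>i. Y (\<rho> i) \<longrightarrow> Y (\<rho> (Suc i))"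
    by (rule memoryless_strategy[where G = "\<lambda>x y. Y x \<longrightarrow> Y y", OF wf A]) blast
  have "sat 2 C \<phi> (\<rho> i)" if \<rho>: "\<rho> \<in> Out 2 C A q s" for \<rho> i
  proof -
    have "Y (\<rho> i)" for i
      by (induction i) (use s(2)[rule_format, OF q \<rho>] \<rho> assms(5) in \<open>auto simp: Out_def\<close>)
    then show ?thesis using Y Out_states[OF wf q \<rho>] by blast
  qed
  then show ?thesis using s(1) by auto
qed

text \<open>Dual to the ranking argument for reachability: from a state that drops out at stage
  \<open>Suc s\<close> every strategy allows a successor missing at stage \<open>s\<close>, so after
  finitely many steps some outcome violates \<phi>.\<close>

lemma Globally_bound:
  assumes wf: "wf_cgs 2 Props C" and A: "A \<subseteq> agents 2" and q: "q \<in> states C"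
    and sat: "sat 2 C (Strat A Globally \<phi>) q"
  shows "(upd Globally C A ^^ n) (sat 2 C \<phi>) q"
proof (rule ccontr)
  let ?it = "\<lambda>s. (upd Globally C A ^^ s) (sat 2 C \<phi>)"
  assume n: "\<not> ?it n q"
  obtain s where s: "strategy_profile C A s" "\<And>\<rho> i. \<rho> \<in> Out 2 C A q s \<Longrightarrow> sat 2 C \<phi> (\<rho> i)"
    using sat by auto
  define G where "G = (\<lambda>x y. \<forall>s. ?it s x \<and> \<not> ?it (Suc s) x \<longrightarrow> \<not> ?it s y)"
  have "\<not> pre C A (\<lambda>y. \<not> G x y) x" if x: "x \<in> states C" for x
  proof
    assume p: "pre C A (\<lambda>y. \<not> G x y) x"
    then have "\<exists>y. \<not> G x y" using not_pre_False[of C A x] by (metis pre_mono order_refl)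
    then obtain s where s: "?it s x" "\<not> ?it (Suc s) x" unfolding G_def by blast
    have uniq: "t = s" if "?it t x" "\<not> ?it (Suc t) x" for t
    proof (rule ccontr)
      assume "t \<noteq> s"
      then have "Suc t \<le> s \<or> Suc s \<le> t" by linarith
      then show False
        using that s upd_mono_iter(2)[of "Suc t" s C A _ x] upd_mono_iter(2)[of "Suc s" t C A _ x] by blast
    qed
    have "pre C A (?it s) x"
      by (rule pre_mono[OF p order_refl]) (unfold G_def, use uniq in blast)
    then show False using s by (simp add: upd_def)
  qed
  then obtain \<rho> where \<rho>: "\<rho> \<in> Out 2 C A q s" "\<forall>i. G (\<rho> i) (\<rho> (Suc i))"
    by (rule adverse_outcome[OF wf A q s(1)]) blast
  have "\<not> ?it n (\<rho> i) \<Longrightarrow> \<exists>j. \<not> sat 2 C \<phi> (\<rho> j)" for n i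
  proof (induction n arbitrary: i)
    case (Suc n)
    then show ?case using \<rho>(2)[rule_format, of i] unfolding G_def by blast
  qed auto
  moreover have "\<rho> 0 = q" using \<rho>(1) by (simp add: Out_def)
  ultimately show False using s(2)[OF \<rho>(1)] n by metis
qed

lemma upd_cong:
  assumes "wf_cgs 2 Props C" "q \<in> states C" "\<And>x. x \<in> states C \<Longrightarrow> Y x \<longleftrightarrow> Y' x"
  shows "upd op C A Y q \<longleftrightarrow> upd op C A Y' q"
  using pre_cong_states[OF assms] assms(2,3) by (auto simp: upd_def split: tempop.split)

lemma upd_stable:
  assumes wf: "wf_cgs 2 Props C" and q: "q \<in> states C" and N: "card (states C) \<le> N"
  shows "(upd op C A ^^ Suc N) P q \<longleftrightarrow> (upd op C A ^^ N) P q"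
proof -
  let ?it = "\<lambda>s. (upd op C A ^^ s) P"
  have fin: "finite (states C)" using wf by (simp add: wf_cgs_def)
  \<comment> \<open>The iterate for \<open>Finally\<close> and its complement for
    \<open>Globally\<close>, so that \<open>f\<close> increases in both cases and becomes stationary
    after at most as many steps as there are states.\<close>
  define f where "f = (\<lambda>s. {x \<in> states C. ?it s x \<longleftrightarrow> op = Finally})"
  have "f s \<subseteq> f (Suc s)" for s
    unfolding f_def by (cases op) (auto simp: upd_def)
  then have mono: "mono f" by (simp add: mono_iff_le_Suc)
  have sub: "f s \<subseteq> states C" for s by (auto simp: f_def)
  have same: "f s = f t \<longleftrightarrow> (\<forall>x \<in> states C. ?it s x \<longleftrightarrow> ?it t x)" for s t
    unfolding f_def by blast
  have stable: "f (Suc s) = f (Suc (Suc s))" if "f s = f (Suc s)" for s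
    using that upd_cong[OF wf, of _ "?it s" "?it (Suc s)" op A] unfolding same by simp
  have "finite (range f)" by (rule finite_subset[of _ "Pow (states C)"]) (use sub fin in auto)
  then have "f (card (states C)) = (\<Union>n. f n)"
    using sub fin mono stable
    by (intro finite_mono_strict_prefix_implies_finite_fixpoint
        finite_mono_remains_stable_implies_strict_prefix) auto
  then have "f n \<subseteq> f (card (states C))" for n by auto
  then have "f N = f (Suc N)"
    using monoD[OF mono N] monoD[OF mono, of N "Suc N"] by (metis le_SucI order_refl subset_antisym subset_trans)
  then show ?thesis using same q by blast
qed

text \<open>Any \<open>N\<close> above the number of states is allowed, so that one iteration count
  can later serve all structures of an instance.\<close>

lemma sat_Strat:
  assumes wf: "wf_cgs 2 Props C" and A: "A \<subseteq> agents 2" and q: "q \<in> states C"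
    and N: "card (states C) \<le> N"
  shows "sat 2 C (Strat A op \<phi>) q \<longleftrightarrow> (upd op C A ^^ N) (sat 2 C \<phi>) q"
proof (cases op)
  case Finally
  let ?Y = "(upd Finally C A ^^ N) (sat 2 C \<phi>)"
  have "?Y x" if "x \<in> states C" "sat 2 C \<phi> x \<or> pre C A ?Y x" for x
    using that upd_stable[OF wf that(1) N, of Finally A "sat 2 C \<phi>"] upd_mono_iter(1)[of 0 N C A "sat 2 C \<phi>" x]
    by (auto simp: upd_def)
  then show ?thesis
    using Finally_least[OF wf A q, of \<phi> ?Y] Finally_sound[OF wf A q] Finally by blast
next
  case Globally
  let ?Y = "(upd Globally C A ^^ N) (sat 2 C \<phi>)"
  have "sat 2 C \<phi> x \<and> pre C A ?Y x" if "x \<in> states C" "?Y x" for x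
    using that upd_stable[OF wf that(1) N, of Globally A "sat 2 C \<phi>"] upd_mono_iter(2)[of 0 N C A "sat 2 C \<phi>" x]
    by (auto simp: upd_def)
  then show ?thesis
    using Globally_greatest[OF wf A q, of ?Y \<phi>] Globally_bound[OF wf A q] Globally by blast
qed

section \<open>Unfolding laws and collapse of adjacent strategy operators\<close>

lemma Finally_closed:
  assumes wf: "wf_cgs 2 Props C" and A: "A \<subseteq> agents 2" and q: "q \<in> states C"
    and "sat 2 C \<phi> q \<or> pre C A (sat 2 C (Strat A Finally \<phi>)) q"
  shows "sat 2 C (Strat A Finally \<phi>) q"
proof -
  let ?N = "card (states C)"
  have eq: "sat 2 C (Strat A Finally \<phi>) x \<longleftrightarrow> (upd Finally C A ^^ ?N) (sat 2 C \<phi>) x" if "x \<in> states C" for x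
    by (rule sat_Strat[OF wf A that order_refl])
  show ?thesis
    using assms(4) upd_stable[OF wf q order_refl, of Finally A "sat 2 C \<phi>"] upd_mono_iter(1)[of 0 ?N C A "sat 2 C \<phi>" q]
      pre_cong_states[OF wf q, of "sat 2 C (Strat A Finally \<phi>)" "(upd Finally C A ^^ ?N) (sat 2 C \<phi>)" A, OF eq]
    unfolding eq[OF q] by (auto simp: upd_def simp del: sat.simps)
qed

lemma Globally_closed:
  assumes wf: "wf_cgs 2 Props C" and A: "A \<subseteq> agents 2" and q: "q \<in> states C"
    and "sat 2 C (Strat A Globally \<phi>) q"
  shows "sat 2 C \<phi> q \<and> pre C A (sat 2 C (Strat A Globally \<phi>)) q"
proof -
  let ?N = "card (states C)"
  have eq: "sat 2 C (Strat A Globally \<phi>) x \<longleftrightarrow> (upd Globally C A ^^ ?N) (sat 2 C \<phi>) x" if "x \<in> states C" for x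
    by (rule sat_Strat[OF wf A that order_refl])
  show ?thesis
    using assms(4) upd_stable[OF wf q order_refl, of Globally A "sat 2 C \<phi>"] upd_mono_iter(2)[of 0 ?N C A "sat 2 C \<phi>" q]
      pre_cong_states[OF wf q, of "sat 2 C (Strat A Globally \<phi>)" "(upd Globally C A ^^ ?N) (sat 2 C \<phi>)" A, OF eq]
    unfolding eq[OF q] by (auto simp: upd_def simp del: sat.simps)
qed

lemma Finally_unfold:
  assumes wf: "wf_cgs 2 Props C" and A: "A \<subseteq> agents 2" and q: "q \<in> states C"
  shows "sat 2 C (Strat A Finally \<phi>) q \<longleftrightarrow> sat 2 C \<phi> q \<or> pre C A (sat 2 C (Strat A Finally \<phi>)) q"
proof
  let ?T = "sat 2 C (Strat A Finally \<phi>)"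
  assume "?T q"
  then show "sat 2 C \<phi> q \<or> pre C A ?T q"
  proof (rule Finally_least[OF wf A q, rotated])
    fix x assume x: "x \<in> states C" "sat 2 C \<phi> x \<or> pre C A (\<lambda>q. sat 2 C \<phi> q \<or> pre C A ?T q) x"
    then show "sat 2 C \<phi> x \<or> pre C A ?T x"
      using pre_mono_states[OF wf x(1), of A "\<lambda>q. sat 2 C \<phi> q \<or> pre C A ?T q" A ?T]
        Finally_closed[OF wf A] by blast
  qed
qed (rule Finally_closed[OF wf A q])

lemma Globally_unfold:
  assumes wf: "wf_cgs 2 Props C" and A: "A \<subseteq> agents 2" and q: "q \<in> states C"
  shows "sat 2 C (Strat A Globally \<phi>) q \<longleftrightarrow> sat 2 C \<phi> q \<and> pre C A (sat 2 C (Strat A Globally \<phi>)) q"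
proof
  let ?T = "sat 2 C (Strat A Globally \<phi>)"
  assume "sat 2 C \<phi> q \<and> pre C A ?T q"
  then show "?T q"
  proof (rule Globally_greatest[OF wf A q, rotated])
    fix x assume x: "x \<in> states C" "sat 2 C \<phi> x \<and> pre C A ?T x"
    then show "sat 2 C \<phi> x \<and> pre C A (\<lambda>q. sat 2 C \<phi> q \<and> pre C A ?T q) x"
      using pre_mono_states[OF wf x(1), of A ?T A "\<lambda>q. sat 2 C \<phi> q \<and> pre C A ?T q"]
        Globally_closed[OF wf A] by blast
  qed
qed (rule Globally_closed[OF wf A q])

text \<open>A larger coalition has a larger \<open>pre\<close>. Hence the reachability set of
  \<open>B\<close> is closed for \<open>A\<close>, and the invariance set of \<open>A\<close> is an
  invariant for \<open>B\<close>.\<close>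

lemma sat_mono_coalition:
  assumes wf: "wf_cgs 2 Props C" and B: "B \<subseteq> agents 2" and AB: "A \<subseteq> B" and q: "q \<in> states C"
    and sat: "sat 2 C (Strat A op \<phi>) q"
  shows "sat 2 C (Strat B op \<phi>) q"
proof (cases op)
  case Finally
  have A: "A \<subseteq> agents 2" using AB B by blast
  show ?thesis
    using sat unfolding Finally
  proof (rule Finally_least[OF wf A q, rotated])
    fix x assume x: "x \<in> states C" "sat 2 C \<phi> x \<or> pre C A (sat 2 C (Strat B Finally \<phi>)) x"
    then show "sat 2 C (Strat B Finally \<phi>) x"
      using Finally_closed[OF wf B x(1)] pre_mono_states[OF wf x(1) _ AB] by blast
  qed
next
  case Globally
  have A: "A \<subseteq> agents 2" using AB B by blast
  show ?thesis
    using sat unfolding Globally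
  proof (rule Globally_greatest[OF wf B q, rotated])
    fix x assume x: "x \<in> states C" "sat 2 C (Strat A Globally \<phi>) x"
    then show "sat 2 C \<phi> x \<and> pre C B (sat 2 C (Strat A Globally \<phi>)) x"
      using Globally_closed[OF wf A x] pre_mono_states[OF wf x(1) _ AB] by blast
  qed
qed

lemma sat_mono_form:
  assumes wf: "wf_cgs 2 Props C" and A: "A \<subseteq> agents 2" and q: "q \<in> states C"
    and sat: "sat 2 C (Strat A op \<phi>) q" and le: "\<And>x. x \<in> states C \<Longrightarrow> sat 2 C \<phi> x \<Longrightarrow> sat 2 C \<psi> x"
  shows "sat 2 C (Strat A op \<psi>) q"
proof -
  obtain s where s: "strategy_profile C A s" "\<forall>\<rho> \<in> Out 2 C A q s.
      case op of Finally \<Rightarrow> \<exists>i. sat 2 C \<phi> (\<rho> i) | Globally \<Rightarrow> \<forall>i. sat 2 C \<phi> (\<rho> i)"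
    using sat by auto
  have "\<forall>\<rho> \<in> Out 2 C A q s.
      case op of Finally \<Rightarrow> \<exists>i. sat 2 C \<psi> (\<rho> i) | Globally \<Rightarrow> \<forall>i. sat 2 C \<psi> (\<rho> i)"
    using s(2) le Out_states[OF wf q] by (cases op) (simp_all, blast+)
  then show ?thesis using s(1) by auto
qed

text \<open>For comparable coalitions this is the one that survives: the larger for reachability,
  the smaller for invariance.\<close>

fun merge :: "tempop \<Rightarrow> nat set \<Rightarrow> nat set \<Rightarrow> nat set" where
  "merge Finally A B = A \<union> B"
| "merge Globally A B = A \<inter> B"

text \<open>A strategy operator directly above one with a comparable coalition is redundant, because the
  operators are closure (for \<^term>\<open>Finally\<close>) or interior (for \<^term>\<open>Globally\<close>) operators that
  are monotone in the coalition.\<close>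

lemma sat_merge:
  fixes C :: "('q, 'p) cgs" and \<phi> :: "'p form"
  assumes wf: "wf_cgs 2 Props C" and A: "A \<subseteq> agents 2" and B: "B \<subseteq> agents 2" and q: "q \<in> states C"
    and cmp: "A \<subseteq> B \<or> B \<subseteq> A"
  shows "sat 2 C (Strat A op (Strat B op \<phi>)) q \<longleftrightarrow> sat 2 C (Strat (merge op A B) op \<phi>) q"
proof -
  let ?M = "merge op A B"
  have M: "?M \<subseteq> agents 2" using A B by (cases op) auto
  show ?thesis
  proof (cases op)
    case Finally
    have AM: "A \<subseteq> ?M" "B \<subseteq> ?M" by (auto simp: Finally)
    have idem: "sat 2 C (Strat ?M Finally \<phi>) x" if "x \<in> states C" "sat 2 C (Strat ?M Finally (Strat ?M Finally \<phi>)) x" for x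
      using that(2) by (rule Finally_least[OF wf M that(1), rotated]) (use Finally_closed[OF wf M] in blast)
    have ext: "sat 2 C (Strat D Finally \<psi>) x" if "x \<in> states C" "sat 2 C \<psi> x" "D \<subseteq> agents 2" for x D and \<psi> :: "'p form"
      using Finally_closed[OF wf that(3,1)] that(2) by blast
    show ?thesis
    proof
      assume "sat 2 C (Strat A op (Strat B op \<phi>)) q"
      then have "sat 2 C (Strat A op (Strat ?M op \<phi>)) q"
        by (rule sat_mono_form[OF wf A q]) (rule sat_mono_coalition[OF wf M AM(2)])
      then have "sat 2 C (Strat ?M op (Strat ?M op \<phi>)) q"
        by (rule sat_mono_coalition[OF wf M AM(1) q])
      then show "sat 2 C (Strat ?M op \<phi>) q" using idem[OF q] Finally by simp
    next
      assume sat: "sat 2 C (Strat ?M op \<phi>) q"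
      have "?M = A \<or> ?M = B" using cmp by (auto simp: Finally)
      then show "sat 2 C (Strat A op (Strat B op \<phi>)) q"
      proof
        assume "?M = A"
        then show ?thesis using sat sat_mono_form[OF wf A q, of op \<phi> "Strat B op \<phi>"] ext B Finally by metis
      next
        assume "?M = B"
        then show ?thesis using sat ext[OF q _ A] Finally by metis
      qed
    qed
  next
    case Globally
    have AM: "?M \<subseteq> A" "?M \<subseteq> B" by (auto simp: Globally)
    have idem: "sat 2 C (Strat ?M Globally (Strat ?M Globally \<phi>)) x" if "x \<in> states C" "sat 2 C (Strat ?M Globally \<phi>) x" for x
      using that(2) by (rule Globally_greatest[OF wf M that(1), rotated]) (use Globally_closed[OF wf M] in blast)
    have red: "sat 2 C \<psi> x" if "x \<in> states C" "sat 2 C (Strat D Globally \<psi>) x" "D \<subseteq> agents 2" for x D and \<psi> :: "'p form"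
      using Globally_closed[OF wf that(3,1)] that(2) by blast
    show ?thesis
    proof
      assume "sat 2 C (Strat ?M op \<phi>) q"
      then have "sat 2 C (Strat ?M op (Strat ?M op \<phi>)) q" using idem[OF q] Globally by simp
      then have "sat 2 C (Strat A op (Strat ?M op \<phi>)) q"
        by (rule sat_mono_coalition[OF wf A AM(1) q])
      then show "sat 2 C (Strat A op (Strat B op \<phi>)) q"
        by (rule sat_mono_form[OF wf A q]) (rule sat_mono_coalition[OF wf B AM(2)])
    next
      assume sat: "sat 2 C (Strat A op (Strat B op \<phi>)) q"
      have "?M = A \<or> ?M = B" using cmp by (auto simp: Globally)
      then show "sat 2 C (Strat ?M op \<phi>) q"
      proof
        assume "?M = A"
        then show ?thesis using sat sat_mono_form[OF wf A q, of op "Strat B op \<phi>" \<phi>] red B Globally by metis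
      next
        assume "?M = B"
        then show ?thesis using sat red[OF q _ A] Globally by metis
      qed
    qed
  qed
qed

section \<open>Normal forms and codes of formulas\<close>

text \<open>\<^term>\<open>add op A \<chi>\<close> is \<^term>\<open>Strat A op \<chi>\<close> with redundant operators at the top removed.\<close>

fun add :: "tempop \<Rightarrow> nat set \<Rightarrow> 'p form \<Rightarrow> 'p form" where
  "add op A (Strat B op' \<chi>) =
     (if A \<subseteq> B \<or> B \<subseteq> A then if merge op A B = B then Strat B op' \<chi> else add op A \<chi>
      else Strat A op (Strat B op' \<chi>))"
| "add op A \<chi> = Strat A op \<chi>"

fun nf :: "'p form \<Rightarrow> 'p form" where
  "nf (Atom p) = Atom p"
| "nf (Bin b \<phi> \<psi>) = Bin b (nf \<phi>) (nf \<psi>)"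
| "nf (Strat A op \<phi>) = add op A (nf \<phi>)"

lemma subformulas_refl: "\<phi> \<in> subformulas \<phi>"
  by (cases \<phi>) auto

lemma subformulas_trans: "\<psi> \<in> subformulas \<phi> \<Longrightarrow> \<chi> \<in> subformulas \<psi> \<Longrightarrow> \<chi> \<in> subformulas \<phi>"
  by (induction \<phi>) auto

lemma finite_subformulas: "finite (subformulas \<phi>)"
  by (induction \<phi>) auto

lemma subformulas_add: "subformulas (add op A \<chi>) \<subseteq> insert (add op A \<chi>) (subformulas \<chi>)"
  by (induction op A \<chi> rule: add.induct) (auto simp: subformulas_refl)

lemma add_Strat: "\<exists>B op' \<chi>'. add op A \<chi> = Strat B op' \<chi>'"
  by (induction op A \<chi> rule: add.induct) auto

text \<open>Normalisation acts on the set of distinct subformulas and creates none beyond its image,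
  so neither size nor the number of binary subformulas can grow, even under sharing.\<close>

lemma subformulas_nf: "subformulas (nf \<phi>) \<subseteq> nf ` subformulas \<phi>"
proof (induction \<phi>)
  case (Strat A op \<phi>)
  have "subformulas (nf (Strat A op \<phi>)) \<subseteq> insert (nf (Strat A op \<phi>)) (subformulas (nf \<phi>))"
    using subformulas_add[of op A "nf \<phi>"] by simp
  then show ?case using Strat by auto
qed auto

lemma form_size_nf: "form_size (nf \<phi>) \<le> form_size \<phi>"
  unfolding form_size_def
  by (meson card_image_le card_mono finite_imageI finite_subformulas order_trans subformulas_nf)

lemma nf_Bin: "nf \<phi> = Bin b \<psi> \<chi> \<Longrightarrow> \<exists>\<psi>' \<chi>'. \<phi> = Bin b \<psi>' \<chi>'"
  by (cases \<phi>) (use add_Strat in \<open>auto, metis form.distinct(5)\<close>)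

lemma bin_size_nf: "bin_size (nf \<phi>) \<le> bin_size \<phi>"
proof -
  let ?B = "\<lambda>\<phi>. {\<psi> \<in> subformulas \<phi>. \<exists>b \<psi>1 \<psi>2. \<psi> = Bin b \<psi>1 \<psi>2}"
  have fin: "finite (?B \<phi>)" using finite_subformulas[of \<phi>] by simp
  have "?B (nf \<phi>) \<subseteq> nf ` ?B \<phi>"
  proof
    fix \<chi> assume "\<chi> \<in> ?B (nf \<phi>)"
    then obtain b \<psi>1 \<psi>2 where "\<chi> \<in> nf ` subformulas \<phi>" "\<chi> = Bin b \<psi>1 \<psi>2"
      using subformulas_nf[of \<phi>] by blast
    then obtain \<psi> where "\<psi> \<in> subformulas \<phi>" "\<chi> = nf \<psi>" "nf \<psi> = Bin b \<psi>1 \<psi>2" by auto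
    then show "\<chi> \<in> nf ` ?B \<phi>"
      using nf_Bin[of \<psi> b \<psi>1 \<psi>2] by blast
  qed
  then have "card (?B (nf \<phi>)) \<le> card (nf ` ?B \<phi>)" using fin by (intro card_mono) auto
  also have "\<dots> \<le> card (?B \<phi>)" using fin by (rule card_image_le)
  finally show ?thesis unfolding bin_size_def .
qed

lemma add_ATL: "\<chi> \<in> ATL k Props {op} Bl \<Longrightarrow> A \<subseteq> agents k \<Longrightarrow> add op A \<chi> \<in> ATL k Props {op} Bl"
proof (induction op A \<chi> rule: add.induct)
  case (1 op A B op' \<chi>)
  then have "\<chi> \<in> ATL k Props {op} Bl" by (auto elim: ATL.cases)
  then show ?case using 1 by (auto intro: ATL.intros)
qed (auto intro: ATL.intros)

lemma nf_ATL: "\<phi> \<in> ATL k Props {op} Bl \<Longrightarrow> nf \<phi> \<in> ATL k Props {op} Bl"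
proof (induction rule: ATL.induct)
  case (3 A op' \<phi>)
  then show ?case using add_ATL by auto
qed (auto intro: ATL.intros)

lemma merge_cmp: "A \<subseteq> B \<or> B \<subseteq> A \<Longrightarrow> merge op A B = A \<or> merge op A B = B"
  by (cases op) auto

lemma sat_add:
  assumes wf: "wf_cgs 2 Props' C"
  shows "\<chi> \<in> ATL 2 Props {op} Bl \<Longrightarrow> A \<subseteq> agents 2 \<Longrightarrow> q \<in> states C \<Longrightarrow>
    sat 2 C (add op A \<chi>) q \<longleftrightarrow> sat 2 C (Strat A op \<chi>) q"
proof (induction op A \<chi> rule: add.induct)
  case (1 op A B op' \<chi>)
  have *: "B \<subseteq> agents 2" "op' = op" "\<chi> \<in> ATL 2 Props {op} Bl" using 1(2) by (auto elim: ATL.cases)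
  show ?case
  proof (cases "A \<subseteq> B \<or> B \<subseteq> A")
    case True
    have m: "sat 2 C (Strat A op (Strat B op \<chi>)) q \<longleftrightarrow> sat 2 C (Strat (merge op A B) op \<chi>) q"
      by (rule sat_merge[OF wf 1(3) *(1) 1(4) True])
    show ?thesis
    proof (cases "merge op A B = B")
      case True
      then show ?thesis using m *(2) \<open>A \<subseteq> B \<or> B \<subseteq> A\<close> by (simp del: sat.simps)
    next
      case False
      then have "merge op A B = A" using merge_cmp[OF True] by blast
      then show ?thesis using m *(2) True False 1(1)[OF True False *(3) 1(3,4)] by (simp del: sat.simps)
    qed
  next
    case False
    then show ?thesis using *(2) by (simp del: sat.simps)
  qed
qed auto

lemma sat_nf:
  assumes wf: "wf_cgs 2 Props' C"
  shows "\<phi> \<in> ATL 2 Props {op} Bl \<Longrightarrow> q \<in> states C \<Longrightarrow> sat 2 C (nf \<phi>) q \<longleftrightarrow> sat 2 C \<phi> q"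
proof (induction arbitrary: q rule: ATL.induct)
  case (3 A op' \<phi>)
  have "sat 2 C (add op' A (nf \<phi>)) q \<longleftrightarrow> sat 2 C (Strat A op' (nf \<phi>)) q"
    using 3 nf_ATL by (intro sat_add[OF wf]) auto
  also have "\<dots> \<longleftrightarrow> sat 2 C (Strat A op' \<phi>) q"
    using sat_mono_form[OF wf 3(1,5)] 3(4) by blast
  finally show ?case by simp
qed auto

text \<open>In a normal form only the operators of the coalitions \<open>{1}\<close> and \<open>{2}\<close> can be adjacent,
  and these alternate.\<close>

fun alternating :: "'p form \<Rightarrow> bool" where
  "alternating (Atom p) \<longleftrightarrow> True"
| "alternating (Bin b \<phi> \<psi>) \<longleftrightarrow> alternating \<phi> \<and> alternating \<psi>"
| "alternating (Strat A op (Strat B op' \<chi>)) \<longleftrightarrow> alternating (Strat B op' \<chi>) \<and> \<not> A \<subseteq> B \<and> \<not> B \<subseteq> A"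
| "alternating (Strat A op \<phi>) \<longleftrightarrow> alternating \<phi>"

lemma alternatingD:
  "alternating \<phi> \<Longrightarrow> Strat A op (Strat B op' \<chi>) \<in> subformulas \<phi> \<Longrightarrow> \<not> A \<subseteq> B \<and> \<not> B \<subseteq> A"
  by (induction \<phi> rule: alternating.induct) auto

lemma alternating_StratD: "alternating (Strat A op \<phi>) \<Longrightarrow> alternating \<phi>"
  by (cases \<phi>) auto

lemma alternating_add: "alternating \<chi> \<Longrightarrow> alternating (add op A \<chi>)"
  by (induction op A \<chi> rule: add.induct) (auto dest: alternating_StratD)

lemma alternating_nf: "alternating (nf \<phi>)"
  by (induction \<phi>) (auto simp: alternating_add)

text \<open>The two binary digits of \<open>c < 4\<close> tell the membership of the agents
  \<open>1\<close> and \<open>2\<close>; then \<open>3 - c\<close> is the complement.\<close>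

definition coal :: "nat \<Rightarrow> nat set" where
  "coal c = {a. (a = 1 \<and> odd c) \<or> (a = 2 \<and> 2 \<le> c)}"

lemma coal_agents: "coal c \<subseteq> agents 2"
  by (auto simp: coal_def agents_2)

lemma coal_ex: assumes "A \<subseteq> agents 2" obtains c where "c < 4" "A = coal c"
proof
  let ?c = "of_bool (1 \<in> A) + 2 * of_bool (2 \<in> A) :: nat"
  show "?c < 4" by simp
  show "A = coal ?c" using assms unfolding coal_def agents_2 by auto
qed

lemma coal_incomparable:
  assumes "A \<subseteq> agents 2" "\<not> A \<subseteq> coal c" "\<not> coal c \<subseteq> A" "c < 4"
  shows "A = coal (3 - c)"
proof -
  have "c = 0 \<or> c = 1 \<or> c = 2 \<or> c = 3" using assms(4) by linarith
  then show ?thesis using assms unfolding coal_def agents_2 by auto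
qed

text \<open>Incomparability forces \<open>B\<close> to be a singleton and the other coalition to be
  its complement. With three agents uniqueness fails, as \<open>{1}\<close> is incomparable to both
  \<open>{2}\<close> and \<open>{3}\<close>.\<close>

lemma incomparable_unique:
  assumes "A \<subseteq> agents 2" "A' \<subseteq> agents 2" "B \<subseteq> agents 2"
    "\<not> A \<subseteq> B" "\<not> B \<subseteq> A" "\<not> A' \<subseteq> B" "\<not> B \<subseteq> A'"
  shows "A = A'"
proof -
  obtain c where "c < 4" "B = coal c" using coal_ex[OF assms(3)] .
  then show ?thesis using coal_incomparable assms by metis
qed

definition letter :: "nat \<Rightarrow> nat \<Rightarrow> nat set" where
  "letter c i = coal (if even i then c else 3 - c)"

fun chain :: "tempop \<Rightarrow> nat \<Rightarrow> nat \<Rightarrow> 'p form \<Rightarrow> 'p form" where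
  "chain op c 0 \<phi> = \<phi>"
| "chain op c (Suc l) \<phi> = Strat (letter c l) op (chain op c l \<phi>)"

lemma chain_add: "size (chain op c l \<phi>) = size \<phi> + l"
  by (induction l) auto

lemma subformulas_chain:
  "subformulas (chain op c l \<phi>) = subformulas \<phi> \<union> (\<lambda>i. chain op c i \<phi>) ` {1..l}"
proof (induction l)
  case (Suc l)
  have "{1..Suc l} = insert (Suc l) {1..l}" by auto
  then show ?case using Suc by auto
qed auto

definition bops :: "binop list" where
  "bops = [Or, And, Imp, Rev_Imp, Iff, Nor, Nand, Not_Imp, Not_Rev_Imp, Not_Iff]"

lemma bops: obtains z where "z < 10" "bops ! z = b"
proof -
  have "b \<in> set bops" by (cases b) (auto simp: bops_def)
  then obtain z where "z < length bops" "bops ! z = b" by (metis in_set_conv_nth)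
  moreover have "length bops = 10" by (simp add: bops_def)
  ultimately show ?thesis using that by simp
qed

text \<open>
  A code is a sequence of segments \<open>(k, x, y, z)\<close> of three kinds: \<open>k = 0\<close> is the atom \<open>x\<close>, \<open>k = 1\<close>
  applies operator number \<open>z\<close> to the segments \<open>x\<close> and \<open>y\<close>, and \<open>k = 2\<close> puts an alternating chain
  of \<open>z\<close> strategy operators with innermost coalition number \<open>y\<close> on top of segment \<open>x\<close>.
\<close>

type_synonym seg = "nat \<times> nat \<times> nat \<times> nat"

text \<open>Segments refer to earlier segments by number, so a shared subformula is described once.
  Forward references yield the dummy \<open>Atom 0\<close>, which makes the recursion terminate;
  \<open>good\<close> rules them out.\<close>

function fm :: "tempop \<Rightarrow> (nat \<Rightarrow> seg) \<Rightarrow> nat \<Rightarrow> nat form" where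
  "fm op sg j = (case sg j of (k, x, y, z) \<Rightarrow>
     if k = 0 then Atom x
     else if k = 1 then if x < j \<and> y < j then Bin (bops ! z) (fm op sg x) (fm op sg y) else Atom 0
     else if x < j then chain op y z (fm op sg x) else Atom 0)"
  by pat_completeness auto
termination by (relation "measure (\<lambda>(op, sg, j). j)") auto

declare fm.simps [simp del]

fun good :: "nat \<Rightarrow> binop set \<Rightarrow> nat \<Rightarrow> seg \<Rightarrow> bool" where
  "good m Bl j (k, x, y, z) \<longleftrightarrow> (k = 0 \<and> x < m) \<or>
     (k = 1 \<and> x < j \<and> y < j \<and> z < 10 \<and> bops ! z \<in> Bl) \<or> (k = 2 \<and> x < j \<and> y < 4)"

fun weight :: "seg \<Rightarrow> nat" where
  "weight (k, x, y, z) = (if k = 2 then z else 1)"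

definition lines :: "tempop \<Rightarrow> (nat \<Rightarrow> seg) \<Rightarrow> nat \<Rightarrow> nat form set" where
  "lines op sg j = (case sg j of (k, x, y, z) \<Rightarrow>
     if k = 2 then (\<lambda>i. chain op y i (fm op sg x)) ` {1..z} else {fm op sg j})"

lemma fm_ATL:
  assumes "\<And>j. j < J \<Longrightarrow> good m Bl j (sg j)" "j < J"
  shows "fm op sg j \<in> ATL 2 {..<m} {op} Bl"
  using assms(2)
proof (induction j rule: less_induct)
  case (less j)
  obtain k x y z where sg: "sg j = (k, x, y, z)" by (metis prod_cases4)
  have good: "good m Bl j (k, x, y, z)" using assms(1)[OF less.prems] sg by simp
  have chain: "chain op y z \<phi> \<in> ATL 2 {..<m} {op} Bl" if "\<phi> \<in> ATL 2 {..<m} {op} Bl" for \<phi>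
    by (induction z) (use that coal_agents in \<open>auto simp: letter_def intro!: ATL.intros\<close>)
  have "fm op sg i \<in> ATL 2 {..<m} {op} Bl" if "i < j" for i
    using less.IH[OF that] less.prems that by simp
  then show ?case
    using good by (subst fm.simps) (auto simp: sg intro!: ATL.intros chain)
qed

lemma subformulas_fm:
  assumes "\<And>j. j < J \<Longrightarrow> good m Bl j (sg j)" "j < J"
  shows "subformulas (fm op sg j) \<subseteq> (\<Union>i\<le>j. lines op sg i)"
  using assms(2)
proof (induction j rule: less_induct)
  case (less j)
  obtain k x y z where sg: "sg j = (k, x, y, z)" by (metis prod_cases4)
  have good: "good m Bl j (k, x, y, z)" using assms(1)[OF less.prems] sg by simp
  have IH: "subformulas (fm op sg i) \<subseteq> (\<Union>i\<le>j. lines op sg i)" if "i < j" for i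
  proof -
    have "subformulas (fm op sg i) \<subseteq> (\<Union>i\<le>i. lines op sg i)" using less that by auto
    also have "\<dots> \<subseteq> (\<Union>i\<le>j. lines op sg i)" using that by (intro UN_mono) auto
    finally show ?thesis .
  qed
  have j: "lines op sg j \<subseteq> (\<Union>i\<le>j. lines op sg i)" by auto
  consider "k = 0" | "k = 1" "x < j" "y < j" | "k = 2" "x < j" using good by auto
  then show ?case
  proof cases
    case 1
    then have "subformulas (fm op sg j) \<subseteq> lines op sg j" by (simp add: sg fm.simps[of op sg j] lines_def)
    then show ?thesis using j by blast
  next
    case 2
    then have eq: "fm op sg j = Bin (bops ! z) (fm op sg x) (fm op sg y)"
      by (simp add: sg fm.simps[of op sg j])
    have "fm op sg j \<in> lines op sg j" using 2 by (simp add: sg lines_def)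
    then have "fm op sg j \<in> (\<Union>i\<le>j. lines op sg i)" using j by blast
    then show ?thesis using IH[OF 2(2)] IH[OF 2(3)] unfolding eq by simp
  next
    case 3
    then have "fm op sg j = chain op y z (fm op sg x)" by (simp add: sg fm.simps[of op sg j])
    moreover have "lines op sg j = (\<lambda>i. chain op y i (fm op sg x)) ` {1..z}" using 3 by (simp add: sg lines_def)
    ultimately show ?thesis using j IH[OF 3(2)] by (simp add: subformulas_chain)
  qed
qed

text \<open>Every subformula lies on some line of a segment, so overlaps only help, and a binary
  formula can lie only on the line of a segment of kind \<open>1\<close>.\<close>

lemma code_sound:
  assumes good: "\<And>j. j < J \<Longrightarrow> good m Bl j (sg j)" and j: "j < J"
  shows "form_size (fm op sg j) \<le> (\<Sum>j<J. weight (sg j))"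
    and "bin_size (fm op sg j) \<le> (\<Sum>j<J. of_bool (fst (sg j) = 1))"
proof -
  have fin: "finite (lines op sg j)" for j by (auto simp: lines_def split: prod.split)
  have sub: "subformulas (fm op sg j) \<subseteq> (\<Union>i<J. lines op sg i)"
    by (rule order_trans[OF subformulas_fm[OF good j] UN_mono]) (use j in auto)
  have "card (lines op sg j) \<le> weight (sg j)" for j
  proof -
    obtain k x y z where sg: "sg j = (k, x, y, z)" by (metis prod_cases4)
    show ?thesis
      using card_image_le[of "{1..z}" "\<lambda>i. chain op y i (fm op sg x)"] by (auto simp: sg lines_def)
  qed
  then have "card (\<Union>i<J. lines op sg i) \<le> (\<Sum>j<J. weight (sg j))"
    by (intro order_trans[OF card_UN_le] sum_mono) auto
  then show "form_size (fm op sg j) \<le> (\<Sum>j<J. weight (sg j))"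
    unfolding form_size_def using card_mono[OF _ sub] fin by (meson finite_UN_I finite_lessThan order_trans)
  have "\<psi> \<in> fm op sg ` {i. i < J \<and> fst (sg i) = 1}"
    if \<psi>: "\<psi> \<in> subformulas (fm op sg j)" and bin: "\<psi> = Bin b \<psi>1 \<psi>2" for \<psi> b \<psi>1 \<psi>2
  proof -
    obtain i where i: "i < J" "\<psi> \<in> lines op sg i" using sub \<psi> by blast
    obtain k x y z where sg: "sg i = (k, x, y, z)" by (metis prod_cases4)
    have "k \<noteq> 2"
    proof
      assume "k = 2"
      then obtain l where "1 \<le> l" "\<psi> = chain op y l (fm op sg x)" using i(2) by (auto simp: sg lines_def)
      then show False using bin by (cases l) auto
    qed
    then have \<psi>: "\<psi> = fm op sg i" using i(2) by (simp add: sg lines_def)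
    have "k \<noteq> 0" using bin unfolding \<psi> by (auto simp: sg fm.simps[of op sg i] split: if_splits)
    then have "k = 1" using good[OF i(1)] \<open>k \<noteq> 2\<close> by (simp add: sg)
    then show ?thesis using i(1) \<psi> sg by force
  qed
  then have "bin_size (fm op sg j) \<le> card (fm op sg ` {i. i < J \<and> fst (sg i) = 1})"
    unfolding bin_size_def by (intro card_mono) auto
  also have "\<dots> \<le> card {i. i < J \<and> fst (sg i) = 1}" by (intro card_image_le) simp
  also have "{i. i < J \<and> fst (sg i) = 1} = {..<J} \<inter> {i. fst (sg i) = 1}" by auto
  finally show "bin_size (fm op sg j) \<le> (\<Sum>j<J. of_bool (fst (sg j) = 1))"
    by (subst sum_of_bool_eq) auto
qed

text \<open>
  For completeness, the segments of a normal form end in its \<^emph>\<open>important\<close> subformulas: the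
  atoms, the binary formulas, and the formulas that occur as operands of a binary formula or as
  the whole formula. The chains between them share no subformula, because the coalition
  that continues a chain is determined by the chain.
\<close>

definition operands :: "'p form \<Rightarrow> 'p form set" where
  "operands \<phi> = insert \<phi> {x. \<exists>b y. Bin b x y \<in> subformulas \<phi> \<or> Bin b y x \<in> subformulas \<phi>}"

definition bins :: "'p form \<Rightarrow> 'p form set" where
  "bins \<phi> = {\<psi> \<in> subformulas \<phi>. \<exists>b \<psi>1 \<psi>2. \<psi> = Bin b \<psi>1 \<psi>2}"

definition atoms :: "'p form \<Rightarrow> 'p form set" where
  "atoms \<phi> = {\<psi> \<in> subformulas \<phi>. \<exists>p. \<psi> = Atom p}"

definition important :: "'p form \<Rightarrow> 'p form set" where
  "important \<phi> = operands \<phi> \<union> bins \<phi> \<union> atoms \<phi>"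

fun bottom :: "'p form \<Rightarrow> 'p form" where
  "bottom (Strat A op \<phi>) = bottom \<phi>"
| "bottom \<phi> = \<phi>"

lemma operands_subformulas: "operands \<phi> \<subseteq> subformulas \<phi>"
proof -
  have "x \<in> subformulas \<phi> \<and> y \<in> subformulas \<phi>" if "Bin b x y \<in> subformulas \<phi>" for b x y
    using subformulas_trans[OF that, of x] subformulas_trans[OF that, of y] by (simp add: subformulas_refl)
  then show ?thesis unfolding operands_def using subformulas_refl[of \<phi>] by blast
qed

lemma important_subformulas: "important \<phi> \<subseteq> subformulas \<phi>"
  using operands_subformulas by (auto simp: important_def bins_def atoms_def)

text \<open>Above an atom there are only strategy operators up to the next operand, so each atom is
  reached by descending from an operand. Atoms are thereby no more numerous than operands.\<close>

lemma atoms_bottom: "atoms \<phi> \<subseteq> bottom ` operands \<phi>"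
proof (induction \<phi>)
  case (Atom p)
  then show ?case by (auto simp: atoms_def operands_def)
next
  case (Bin b \<phi> \<psi>)
  have "atoms (Bin b \<phi> \<psi>) = atoms \<phi> \<union> atoms \<psi>" by (auto simp: atoms_def)
  moreover have "operands \<phi> \<union> operands \<psi> \<subseteq> operands (Bin b \<phi> \<psi>)" by (auto simp: operands_def)
  ultimately show ?case using Bin by blast
next
  case (Strat A op \<phi>)
  have "atoms (Strat A op \<phi>) = atoms \<phi>" by (auto simp: atoms_def)
  moreover have "bottom ` operands \<phi> \<subseteq> bottom ` operands (Strat A op \<phi>)"
    by (auto simp: operands_def)
  ultimately show ?case using Strat by blast
qed

text \<open>At most \<open>n\<close> binary formulas have at most \<open>2 n\<close> operands, and
  the whole formula is one more. Adding as many atoms and the \<open>n\<close> binary formulas gives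
  \<open>5 n + 2\<close>.\<close>

lemma card_important:
  fixes \<phi> :: "'p form"
  assumes "bin_size \<phi> \<le> n"
  shows "card (important \<phi>) \<le> 5 * n + 2"
proof -
  let ?l = "\<lambda>\<psi>. case \<psi> of Bin b x y \<Rightarrow> x | _ \<Rightarrow> \<phi>" and ?r = "\<lambda>\<psi>. case \<psi> of Bin b x y \<Rightarrow> y | _ \<Rightarrow> \<phi>"
  have fin: "finite (bins \<phi>)" "finite (operands \<phi>)"
    using finite_subformulas[of \<phi>] operands_subformulas[of \<phi>] by (auto simp: bins_def intro: finite_subset)
  have b: "card (bins \<phi>) \<le> n" using assms by (simp add: bin_size_def bins_def)
  have "operands \<phi> \<subseteq> insert \<phi> (?l ` bins \<phi> \<union> ?r ` bins \<phi>)"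
  proof -
    have "x \<in> ?l ` bins \<phi>" "y \<in> ?r ` bins \<phi>" if "Bin b x y \<in> subformulas \<phi>" for b x y
      using that by (auto simp: bins_def intro!: image_eqI[of _ _ "Bin b x y"])
    then show ?thesis unfolding operands_def by blast
  qed
  then have "card (operands \<phi>) \<le> card (insert \<phi> (?l ` bins \<phi> \<union> ?r ` bins \<phi>))"
    using fin by (intro card_mono) auto
  also have "\<dots> \<le> 1 + card (?l ` bins \<phi> \<union> ?r ` bins \<phi>)" by (simp add: card_insert_le_m1 card_insert_if fin)
  also have "\<dots> \<le> 1 + (card (bins \<phi>) + card (bins \<phi>))"
    by (intro add_left_mono order_trans[OF card_Un_le] add_mono card_image_le fin)
  finally have o: "card (operands \<phi>) \<le> 2 * n + 1" using b by simp
  have "card (atoms \<phi>) \<le> card (bottom ` operands \<phi>)"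
    using atoms_bottom fin by (intro card_mono) auto
  also have "\<dots> \<le> card (operands \<phi>)" by (intro card_image_le fin)
  finally have a: "card (atoms \<phi>) \<le> 2 * n + 1" using o by simp
  have "card (important \<phi>) \<le> card (operands \<phi>) + card (bins \<phi>) + card (atoms \<phi>)"
    unfolding important_def by (meson add_mono card_Un_le order_refl order_trans)
  then show ?thesis using o a b by simp
qed

text \<open>Descend from a strategy formula to the first important formula below it. On the way each
  coalition is incomparable to the one beneath, hence its complement, so the innermost coalition and
  the length describe everything passed.\<close>

lemma chain_decomposition:
  assumes \<phi>: "\<phi> \<in> ATL 2 Props {op} Bl" and alt: "alternating \<phi>" and r: "Strat A op' \<chi> \<in> subformulas \<phi>"
  shows "\<exists>c<4. \<exists>l\<ge>1. \<exists>r'. r' \<in> important \<phi> \<and> Strat A op' \<chi> = chain op c l r' \<and>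
    (\<forall>i\<in>{1..l}. chain op c i r' \<in> subformulas \<phi>) \<and> (\<forall>i\<in>{1..<l}. chain op c i r' \<notin> important \<phi>)"
  using r
proof (induction \<chi> arbitrary: A op')
  case (Atom p)
  have ATL: "\<psi> \<in> ATL 2 Props {op} Bl" if "\<psi> \<in> subformulas \<phi>" for \<psi>
    using \<phi> that by (induction rule: ATL.induct) (auto intro: ATL.intros)
  have *: "A \<subseteq> agents 2" "op' = op" using ATL[OF Atom] by (auto elim: ATL.cases)
  obtain c where c: "c < 4" "A = coal c" using coal_ex[OF *(1)] .
  have "Atom p \<in> important \<phi>"
    using subformulas_trans[OF Atom, of "Atom p"] by (auto simp: important_def atoms_def)
  then show ?case using c * Atom
    by (intro exI[of _ c] conjI exI[of _ 1] exI[of _ "Atom p"]) (auto simp: letter_def)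
next
  case (Bin b x y)
  have ATL: "\<psi> \<in> ATL 2 Props {op} Bl" if "\<psi> \<in> subformulas \<phi>" for \<psi>
    using \<phi> that by (induction rule: ATL.induct) (auto intro: ATL.intros)
  have *: "A \<subseteq> agents 2" "op' = op" using ATL[OF Bin.prems] by (auto elim: ATL.cases)
  obtain c where c: "c < 4" "A = coal c" using coal_ex[OF *(1)] .
  have "Bin b x y \<in> important \<phi>"
    using subformulas_trans[OF Bin.prems, of "Bin b x y"] by (auto simp: important_def bins_def)
  then show ?case using c * Bin.prems
    by (intro exI[of _ c] conjI exI[of _ 1] exI[of _ "Bin b x y"]) (auto simp: letter_def)
next
  case (Strat B op'' \<chi>)
  have ATL: "\<psi> \<in> ATL 2 Props {op} Bl" if "\<psi> \<in> subformulas \<phi>" for \<psi>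
    using \<phi> that by (induction rule: ATL.induct) (auto intro: ATL.intros)
  have *: "A \<subseteq> agents 2" "op' = op" using ATL[OF Strat.prems] by (auto elim: ATL.cases)
  show ?case
  proof (cases "Strat B op'' \<chi> \<in> important \<phi>")
    case True
    obtain c where c: "c < 4" "A = coal c" using coal_ex[OF *(1)] .
    then show ?thesis using True * Strat.prems
      by (intro exI[of _ c] conjI exI[of _ 1] exI[of _ "Strat B op'' \<chi>"]) (auto simp: letter_def)
  next
    case False
    have "Strat B op'' \<chi> \<in> subformulas \<phi>"
      using subformulas_trans[OF Strat.prems, of "Strat B op'' \<chi>"] by simp
    from Strat.IH[OF this] obtain c l r' where IH: "c < 4" "1 \<le> l" "r' \<in> important \<phi>"
      "Strat B op'' \<chi> = chain op c l r'" "\<forall>i\<in>{1..l}. chain op c i r' \<in> subformulas \<phi>"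
      "\<forall>i\<in>{1..<l}. chain op c i r' \<notin> important \<phi>" by blast
    obtain l' where l': "l = Suc l'" using IH(2) by (cases l) auto
    then have B: "B = coal (if even l' then c else 3 - c)" using IH(4) by (simp add: letter_def)
    have inc: "\<not> A \<subseteq> B" "\<not> B \<subseteq> A" using alternatingD[OF alt Strat.prems] by auto
    have "A = coal (3 - (if even l' then c else 3 - c))"
      by (rule coal_incomparable[OF *(1)]) (use inc IH(1) in \<open>auto simp: B\<close>)
    then have A: "A = letter c l" using IH(1) by (auto simp: letter_def l')
    then have eq: "Strat A op' (Strat B op'' \<chi>) = chain op c (Suc l) r'" using IH(4) *(2) by simp
    have "chain op c i r' \<in> subformulas \<phi>" if "i \<in> {1..Suc l}" for i
      using IH(5) that Strat.prems eq by (cases "i = Suc l") auto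
    moreover have "chain op c i r' \<notin> important \<phi>" if "i \<in> {1..<Suc l}" for i
      using IH(4,6) that False by (cases "i = l") auto
    ultimately show ?thesis using IH(1,3) eq by (intro exI[of _ c] conjI exI[of _ "Suc l"] exI[of _ r']) auto
  qed
qed

text \<open>The important formulas, at most \<open>5 n + 2\<close>, become one segment each. The
  remaining segments up to \<open>J = 5 n + 3\<close>, at least one, are chains of length
  \<open>0\<close> over \<phi>: they weigh nothing and make the last segment denote \<phi> whatever
  the number of important formulas.\<close>

lemma code_complete:
  fixes \<phi> :: "nat form"
  assumes \<phi>: "\<phi> \<in> ATL 2 {..<m} {op} Bl" and alt: "alternating \<phi>" and n: "bin_size \<phi> \<le> n"
  defines "J \<equiv> 5 * n + 3"
  obtains sg where "fm op sg (J - 1) = \<phi>" "\<And>j. j < J \<Longrightarrow> good m Bl j (sg j)"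
    "(\<Sum>j<J. weight (sg j)) \<le> form_size \<phi>" "(\<Sum>j<J. of_bool (fst (sg j) = 1)) \<le> n"
    "\<And>j k x y z. sg j = (k, x, y, z) \<Longrightarrow> k \<le> 2 \<and> x \<le> max m J \<and> y \<le> max 4 J \<and> z \<le> max 10 (form_size \<phi>)"
proof -
  let ?K = "important \<phi>"
  have fin: "finite ?K" using important_subformulas finite_subformulas finite_subset by blast
  have ATL: "\<psi> \<in> ATL 2 {..<m} {op} Bl" if "\<psi> \<in> subformulas \<phi>" for \<psi>
    using \<phi> that by (induction rule: ATL.induct) (auto intro: ATL.intros)
  obtain ps0 where ps0: "set ps0 = ?K" "distinct ps0" using finite_distinct_list[OF fin] by blast
  \<comment> \<open>Sorting by size places the constituents of a segment before the segment, as
    \<open>good\<close> demands.\<close>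
  define ps where "ps = sort_key size ps0"
  have ps: "set ps = ?K" "distinct ps" "sorted (map size ps)" using ps0 by (auto simp: ps_def)
  have len: "length ps \<le> 5 * n + 2" using card_important[OF n] ps distinct_card by metis
  define ix where "ix = (\<lambda>r. SOME i. i < length ps \<and> ps ! i = r)"
  have ix: "ix r < length ps \<and> ps ! ix r = r" if "r \<in> ?K" for r
    unfolding ix_def by (rule someI_ex) (use that ps(1) in \<open>auto simp: in_set_conv_nth\<close>)
  have ix_less: "ix r < j" if "r \<in> ?K" "j < length ps" "size r < size (ps ! j)" for r j
  proof (rule ccontr)
    assume "\<not> ix r < j"
    then have "map size ps ! j \<le> map size ps ! ix r"
      using ix[OF that(1)] that(2) by (intro sorted_nth_mono[OF ps(3)]) auto
    then show False using ix[OF that(1)] that by simp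
  qed
  define D where "D = (\<lambda>r d. case d of (c, l, r') \<Rightarrow> c < 4 \<and> 1 \<le> l \<and> r' \<in> ?K \<and> r = chain op c l r' \<and>
      (\<forall>i\<in>{1..l}. chain op c i r' \<in> subformulas \<phi>) \<and> (\<forall>i\<in>{1..<l}. chain op c i r' \<notin> ?K))"
  have "\<exists>d. D r d" if "r \<in> ?K" "r = Strat A op' \<chi>" for r A op' \<chi>
  proof -
    have "Strat A op' \<chi> \<in> subformulas \<phi>" using that important_subformulas by blast
    from chain_decomposition[OF \<phi> alt this] obtain c l r' where "c < 4" "1 \<le> l" "r' \<in> ?K"
      "Strat A op' \<chi> = chain op c l r'" "\<forall>i\<in>{1..l}. chain op c i r' \<in> subformulas \<phi>"
      "\<forall>i\<in>{1..<l}. chain op c i r' \<notin> ?K" by blast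
    then show ?thesis unfolding D_def that(2) by (intro exI[of _ "(c, l, r')"]) simp
  qed
  then have "\<forall>r. \<exists>d. r \<in> ?K \<and> (\<exists>A op' \<chi>. r = Strat A op' \<chi>) \<longrightarrow> D r d" by metis
  then obtain dc where "\<forall>r. r \<in> ?K \<and> (\<exists>A op' \<chi>. r = Strat A op' \<chi>) \<longrightarrow> D r (dc r)"
    by (rule exE[OF choice])
  then have dc': "D r (dc r)" if "r \<in> ?K" "\<exists>A op' \<chi>. r = Strat A op' \<chi>" for r
    using that by blast
  note dc = dc'[unfolded D_def]
  define bx where "bx = (\<lambda>b. SOME z. z < 10 \<and> bops ! z = b)"
  have bx: "bx b < 10 \<and> bops ! bx b = b" for b
    unfolding bx_def by (rule someI_ex) (metis bops)
  define enc :: "nat form \<Rightarrow> seg" where "enc = (\<lambda>r. case r of Atom p \<Rightarrow> (0, p, 0, 0) | Bin b x y \<Rightarrow> (1, ix x, ix y, bx b)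
     | Strat A op' \<chi> \<Rightarrow> (case dc r of (c, l, r') \<Rightarrow> (2, ix r', c, l)))"
  define sg where "sg = (\<lambda>j. if j < length ps then enc (ps ! j) else (2, ix \<phi>, 0, 0))"
  have K: "ps ! j \<in> ?K" if "j < length ps" for j using that ps(1) nth_mem by blast
  have \<phi>K: "\<phi> \<in> ?K" by (simp add: important_def operands_def)
  have sub: "x \<in> ?K \<and> y \<in> ?K" if "Bin b x y \<in> ?K" for b x y
  proof -
    have "Bin b x y \<in> subformulas \<phi>" using that important_subformulas by blast
    then have "x \<in> operands \<phi>" "y \<in> operands \<phi>" unfolding operands_def by blast+
    then show ?thesis unfolding important_def by blast
  qed
  have enc: "\<exists>k x y z. enc (ps ! j) = (k, x, y, z) \<and> good m Bl j (k, x, y, z)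
      \<and> x \<le> max m J \<and> y \<le> max 4 J \<and> z \<le> max 10 (form_size \<phi>)" (is ?E)
    and fm_step: "(\<And>i. i < j \<Longrightarrow> fm op sg i = ps ! i) \<Longrightarrow> fm op sg j = ps ! j"
    if j: "j < length ps" for j
  proof -
    have sgj: "sg j = enc (ps ! j)" using j by (simp add: sg_def)
    have "?E \<and> ((\<forall>i<j. fm op sg i = ps ! i) \<longrightarrow> fm op sg j = ps ! j)"
    proof (cases "ps ! j")
      case (Atom p)
      then have "p < m" using ATL K[OF j] important_subformulas by (metis ATL.cases form.distinct(1,3) form.inject(1) lessThan_iff subsetD)
      then show ?thesis using Atom j by (auto simp: enc_def fm.simps[of op sg j] sgj)
    next
      case (Bin b x y)
      then have xy: "x \<in> ?K" "y \<in> ?K" using sub K[OF j] by metis+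
      have "b \<in> Bl" using ATL[of "Bin b x y"] K[OF j] important_subformulas Bin by (auto elim: ATL.cases)
      moreover have "ix x < j" "ix y < j" using ix_less[OF _ j] xy Bin by auto
      ultimately show ?thesis using Bin j len bx[of b] ix[OF xy(1)] ix[OF xy(2)]
        by (auto simp: enc_def fm.simps[of op sg j] sgj J_def)
    next
      case (Strat A op' \<chi>)
      obtain c l r' where d: "dc (ps ! j) = (c, l, r')" by (metis prod_cases3)
      have *: "c < 4" "1 \<le> l" "r' \<in> ?K" "ps ! j = chain op c l r'"
        "\<forall>i\<in>{1..l}. chain op c i r' \<in> subformulas \<phi>"
        using dc[OF K[OF j]] Strat d by auto
      then have "size r' < size (ps ! j)" by (simp add: chain_add)
      then have less: "ix r' < j" using ix_less[OF *(3) j] by simp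
      have "inj_on (\<lambda>i. chain op c i r') {1..l}"
        by (rule inj_onI) (metis add_left_cancel chain_add)
      then have "l = card ((\<lambda>i. chain op c i r') ` {1..l})" by (simp add: card_image)
      also have "\<dots> \<le> form_size \<phi>" unfolding form_size_def
        using *(5) finite_subformulas by (intro card_mono) auto
      finally show ?thesis using Strat d * less j len ix[OF *(3)]
        by (auto simp: enc_def fm.simps[of op sg j] sgj J_def)
    qed
    then show ?E and "(\<And>i. i < j \<Longrightarrow> fm op sg i = ps ! i) \<Longrightarrow> fm op sg j = ps ! j" by auto
  qed
  have fm: "fm op sg j = ps ! j" if "j < length ps" for j
    using that by (induction j rule: less_induct) (rule fm_step, auto)
  \<comment> \<open>The subformulas paid for by the segment of \<open>r\<close>. Disjointness of the
    pieces of different \<open>r\<close> is what turns the sum of the weights into a lower bound for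
    the size of \<phi>.\<close>
  define piece where "piece = (\<lambda>r. case dc r of (c, l, r') \<Rightarrow> case r of
     Strat A op' \<chi> \<Rightarrow> (\<lambda>i. chain op c i r') ` {1..l} | _ \<Rightarrow> {r})"
  have w: "weight (enc r) = card (piece r)" if "r \<in> ?K" for r
  proof (cases r)
    case (Strat A op' \<chi>)
    obtain c l r' where d: "dc r = (c, l, r')" by (metis prod_cases3)
    have "inj_on (\<lambda>i. chain op c i r') {1..l}"
      by (rule inj_onI) (metis add_left_cancel chain_add)
    then show ?thesis using Strat d by (simp add: enc_def piece_def card_image)
  qed (auto simp: enc_def piece_def split: prod.split)
  have piece_sub: "piece r \<subseteq> subformulas \<phi>" if "r \<in> ?K" for r
    using that dc[OF that] important_subformulas[of \<phi>]
    by (cases r) (auto simp: piece_def split: prod.splits)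
  have piece_K: "s = r" if h: "s \<in> piece r" "s \<in> ?K" "r \<in> ?K" for r s
  proof (cases r)
    case (Strat A op' \<chi>)
    obtain c l r' where d: "dc r = (c, l, r')" by (metis prod_cases3)
    have *: "r = chain op c l r'" "\<forall>i\<in>{1..<l}. chain op c i r' \<notin> ?K"
      using dc[OF h(3)] Strat d by auto
    obtain i where "i \<in> {1..l}" "s = chain op c i r'" using h(1) Strat d by (auto simp: piece_def)
    then show ?thesis using * h(2) by (cases "i = l") auto
  qed (use h in \<open>auto simp: piece_def split: prod.splits\<close>)
  have piece_up: "\<exists>A. Strat A op s \<in> piece r" if h: "s \<in> piece r" "s \<noteq> r" "r \<in> ?K" for r s
  proof (cases r)
    case (Strat A op' \<chi>)
    obtain c l r' where d: "dc r = (c, l, r')" by (metis prod_cases3)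
    have *: "r = chain op c l r'" using dc[OF h(3)] Strat d by auto
    obtain i where i: "i \<in> {1..l}" "s = chain op c i r'" using h(1) Strat d by (auto simp: piece_def)
    then have "i < l" using * h(2) by (cases "i = l") auto
    moreover have "chain op c (Suc i) r' = Strat (letter c i) op s" using i by simp
    ultimately have "Strat (letter c i) op s \<in> piece r"
      using Strat d i(1) by (auto simp: piece_def intro!: image_eqI[of _ _ "Suc i"])
    then show ?thesis by blast
  qed (use h in \<open>auto simp: piece_def split: prod.splits\<close>)
  have piece_shape: "\<exists>A \<chi>. s = Strat A op \<chi>" if h: "s \<in> piece r" "s \<noteq> r" for r s
  proof (cases r)
    case (Strat A op' \<chi>)
    obtain c l r' where d: "dc r = (c, l, r')" by (metis prod_cases3)
    obtain i where i: "i \<in> {1..l}" "s = chain op c i r'" using h(1) Strat d by (auto simp: piece_def)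
    then show ?thesis by (cases i) auto
  qed (use h in \<open>auto simp: piece_def split: prod.splits\<close>)
  \<comment> \<open>A formula common to two pieces is followed upwards. Unless it tops one of them,
    both continue it by a coalition incomparable to its own, hence by the same one, so the next
    formula is common as well. The size grows, so the top of a piece is reached, and an important
    formula in a piece can only be its top.\<close>
  have disjoint: "r1 = r2" if "s \<in> piece r1" "s \<in> piece r2" "r1 \<in> ?K" "r2 \<in> ?K" for r1 r2 s
    using that
  proof (induction "Max (size ` subformulas \<phi>) - size s" arbitrary: s rule: less_induct)
    case less
    show ?case
    proof (cases "s = r1 \<or> s = r2")
      case True
      then show ?thesis using piece_K less.prems by metis
    next
      case False
      obtain A1 A2 where A: "Strat A1 op s \<in> piece r1" "Strat A2 op s \<in> piece r2"
        using piece_up less.prems False by metis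
      obtain B \<chi> where B: "s = Strat B op \<chi>" using piece_shape less.prems(1) False by blast
      have S: "Strat A1 op s \<in> subformulas \<phi>" "Strat A2 op s \<in> subformulas \<phi>" "s \<in> subformulas \<phi>"
        using piece_sub A less.prems by blast+
      have "A1 \<subseteq> agents 2" "A2 \<subseteq> agents 2" "B \<subseteq> agents 2"
        using ATL[OF S(1)] ATL[OF S(2)] ATL[OF S(3)] unfolding B by (auto elim: ATL.cases)
      then have "A1 = A2"
        using alternatingD[OF alt, of A1 op B op \<chi>] alternatingD[OF alt, of A2 op B op \<chi>] S
        unfolding B by (intro incomparable_unique[of A1 A2 B]) blast+
      moreover have "size (Strat A1 op s) \<le> Max (size ` subformulas \<phi>)"
        by (rule Max_ge[OF finite_imageI[OF finite_subformulas] imageI[OF S(1)]])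
      ultimately show ?thesis using less.hyps[of "Strat A1 op s"] A less.prems by simp
    qed
  qed
  have pad: "j < J - length ps \<Longrightarrow> sg (length ps + j) = (2, ix \<phi>, 0, 0)" for j by (simp add: sg_def)
  have split: "(\<Sum>j<J. f (sg j)) = (\<Sum>j<length ps. f (enc (ps ! j))) + (\<Sum>j<J - length ps. f (2, ix \<phi>, 0, 0))"
    for f :: "seg \<Rightarrow> nat"
  proof -
    have plus: "(\<Sum>j<a + b. F j) = (\<Sum>j<a. F j) + (\<Sum>j<b. F (a + j))" for a b and F :: "nat \<Rightarrow> nat"
      by (induction b) auto
    have "length ps \<le> J" using len by (simp add: J_def)
    then have "(\<Sum>j<J. f (sg j)) = (\<Sum>j<length ps. f (sg j)) + (\<Sum>j<J - length ps. f (sg (length ps + j)))"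
      using plus[of "\<lambda>j. f (sg j)" "length ps" "J - length ps"] by simp
    then show ?thesis by (simp add: sg_def)
  qed
  have sum_ps: "(\<Sum>j<length ps. f (ps ! j)) = (\<Sum>r\<in>?K. f r)" for f :: "nat form \<Rightarrow> nat"
    using sum.distinct_set_conv_list[OF ps(2), of f] ps(1)
    by (simp add: sum_list_sum_nth lessThan_atLeast0)
  show ?thesis
  proof (rule that[of sg])
    have "length ps \<le> J - 1" using len by (simp add: J_def)
    moreover have "ix \<phi> < length ps" "fm op sg (ix \<phi>) = \<phi>" using ix[OF \<phi>K] fm by auto
    ultimately show "fm op sg (J - 1) = \<phi>"
      by (subst fm.simps) (auto simp: sg_def)
    show "good m Bl j (sg j)" if "j < J" for j
    proof (cases "j < length ps")
      case True
      then show ?thesis using enc[OF True] by (auto simp: sg_def)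
    next
      case False
      then show ?thesis using ix[OF \<phi>K] by (simp add: sg_def)
    qed
    have "(\<Sum>j<J. weight (sg j)) = (\<Sum>r\<in>?K. weight (enc r))"
      unfolding split[of weight] by (simp add: sum_ps[of "\<lambda>r. weight (enc r)"])
    also have "\<dots> = (\<Sum>r\<in>?K. card (piece r))" using w by simp
    also have "\<dots> = card (\<Union>r\<in>?K. piece r)"
      using fin finite_subset[OF piece_sub finite_subformulas] disjoint
      by (intro card_UN_disjoint[symmetric]) auto
    also have "\<dots> \<le> form_size \<phi>"
      unfolding form_size_def using piece_sub finite_subformulas by (intro card_mono) auto
    finally show "(\<Sum>j<J. weight (sg j)) \<le> form_size \<phi>" .
    have "(\<Sum>j<J. of_bool (fst (sg j) = 1)) = (\<Sum>r\<in>?K. of_bool (fst (enc r) = 1) :: nat)"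
      unfolding split[of "\<lambda>s. of_bool (fst s = 1)"] sum_ps[of "\<lambda>r. of_bool (fst (enc r) = 1)"] by simp
    also have "\<dots> = card (?K \<inter> {r. fst (enc r) = 1})" using fin by (subst sum_of_bool_eq) auto
    also have "\<dots> \<le> card (bins \<phi>)"
    proof (intro card_mono)
      show "finite (bins \<phi>)" using finite_subformulas[of \<phi>] by (simp add: bins_def)
      show "?K \<inter> {r. fst (enc r) = 1} \<subseteq> bins \<phi>"
      proof
        fix r assume "r \<in> ?K \<inter> {r. fst (enc r) = 1}"
        then show "r \<in> bins \<phi>"
          using important_subformulas[of \<phi>]
          by (cases r) (auto simp: enc_def bins_def split: prod.splits)
      qed
    qed
    also have "\<dots> \<le> n" using n by (simp add: bins_def bin_size_def)
    finally show "(\<Sum>j<J. of_bool (fst (sg j) = 1)) \<le> n" .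
    show "k \<le> 2 \<and> x \<le> max m J \<and> y \<le> max 4 J \<and> z \<le> max 10 (form_size \<phi>)" if "sg j = (k, x, y, z)" for j k x y z
    proof (cases "j < length ps")
      case True
      then show ?thesis using enc[OF True] that by (auto simp: sg_def)
    next
      case False
      then show ?thesis using that ix[OF \<phi>K] len by (auto simp: sg_def J_def)
    qed
  qed
qed

section \<open>Decoding instances\<close>

definition zeros :: "bool list \<Rightarrow> nat \<Rightarrow> nat" where
  "zeros w i = (\<Sum>i'<i. of_bool (\<not> bit_at w i'))"

text \<open>Number \<open>j\<close> of a unary code is the count of ones preceded by exactly
  \<open>j\<close> zeros, so any entry is accessible by counting alone. On words that are no codes
  the value is still defined and at most the length.\<close>

definition num :: "bool list \<Rightarrow> nat \<Rightarrow> nat" where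
  "num w j = (\<Sum>i<length w. of_bool (bit_at w i \<and> zeros w i = j))"

lemma bit_at_append: "bit_at (xs @ ys) i \<longleftrightarrow> (if i < length xs then bit_at xs i else bit_at ys (i - length xs))"
  by (auto simp: bit_at_def nth_append)

lemma zeros_append_left: "i \<le> length u \<Longrightarrow> zeros (u @ v) i = zeros u i"
  unfolding zeros_def by (intro sum.cong) (auto simp: bit_at_append)

lemma zeros_append_right: "zeros (u @ v) (length u + i) = zeros u (length u) + zeros v i"
  by (induction i) (auto simp: zeros_def zeros_append_left[unfolded zeros_def] bit_at_append)

lemma zeros_replicate: "i \<le> x \<Longrightarrow> zeros (replicate x True @ v) i = 0"
  unfolding zeros_def by (auto simp: bit_at_def nth_append)

lemma sum_lessThan_add: "(\<Sum>j<a + b. F j) = (\<Sum>j<a. F j) + (\<Sum>j<b. F (a + j))" for F :: "nat \<Rightarrow> nat"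
  by (induction b) auto

lemma encode_nats_snoc: "encode_nats (xs @ [x]) = encode_nats xs @ replicate x True @ [False]"
  by (simp add: encode_nats_def)

lemma encode_nats_num:
  "zeros (encode_nats xs) (length (encode_nats xs)) = length xs \<and>
   (\<forall>i<length (encode_nats xs). zeros (encode_nats xs) i < length xs) \<and>
   (\<forall>j. num (encode_nats xs) j = lk xs j)"
proof (induction xs rule: rev_induct)
  case Nil
  then show ?case by (simp add: encode_nats_def zeros_def num_def lk_def)
next
  case (snoc x xs)
  let ?u = "encode_nats xs" and ?v = "replicate x True @ [False]"
  have zu: "zeros ?u (length ?u) = length xs" "\<And>i. i < length ?u \<Longrightarrow> zeros ?u i < length xs"
    using snoc by auto
  have zr: "zeros (?u @ ?v) (length ?u + i) = length xs" if "i \<le> x" for i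
    unfolding zeros_append_right using zeros_replicate[OF that, of "[False]"] zu by simp
  have last: "zeros ?v (Suc x) = 1"
    using zeros_replicate[of x x "[False]"] by (simp add: zeros_def bit_at_def nth_append)
  have "zeros (?u @ ?v) (length (?u @ ?v)) = Suc (length xs)"
    using zeros_append_right[of ?u ?v "Suc x"] last zu by simp
  moreover have "zeros (?u @ ?v) i < Suc (length xs)" if "i < length (?u @ ?v)" for i
  proof (cases "i < length ?u")
    case True
    then show ?thesis using zu(2) zeros_append_left[of i ?u ?v] by (simp add: less_SucI)
  next
    case False
    then have "zeros (?u @ ?v) i = length xs" using zr[of "i - length ?u"] that by simp
    then show ?thesis by simp
  qed
  moreover have "num (?u @ ?v) j = lk (xs @ [x]) j" for j
  proof -
    have "num (?u @ ?v) j =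
        (\<Sum>i<length ?u. of_bool (bit_at (?u @ ?v) i \<and> zeros (?u @ ?v) i = j)) +
        (\<Sum>i<Suc x. of_bool (bit_at (?u @ ?v) (length ?u + i) \<and> zeros (?u @ ?v) (length ?u + i) = j))"
      unfolding num_def using sum_lessThan_add[of _ "length ?u" "Suc x"] by simp
    also have "(\<Sum>i<length ?u. of_bool (bit_at (?u @ ?v) i \<and> zeros (?u @ ?v) i = j)) = num ?u j"
      unfolding num_def by (intro sum.cong) (auto simp: bit_at_append zeros_append_left)
    also have "(\<Sum>i<Suc x. of_bool (bit_at (?u @ ?v) (length ?u + i) \<and> zeros (?u @ ?v) (length ?u + i) = j)) =
        (\<Sum>i<Suc x. of_bool (i < x \<and> j = length xs) :: nat)"
      by (intro sum.cong) (auto simp: zr bit_at_append bit_at_def nth_append)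
    also have "\<dots> = (if j = length xs then x else 0)" by simp
    finally show ?thesis using snoc by (auto simp: lk_def nth_append)
  qed
  ultimately show ?case unfolding encode_nats_snoc by simp
qed

lemma num_encode: "num (encode_nats xs) j = lk xs j"
  using encode_nats_num by blast

lemma zeros_encode: "zeros (encode_nats xs) (length (encode_nats xs)) = length xs"
  using encode_nats_num by blast

lemma encode_nats_ex: "\<exists>xs k. w = encode_nats xs @ replicate k True"
proof (induction w rule: rev_induct)
  case Nil
  then show ?case by (intro exI[of _ "[]"] exI[of _ 0]) (simp add: encode_nats_def)
next
  case (snoc b w)
  then obtain xs k where w: "w = encode_nats xs @ replicate k True" by blast
  show ?case
  proof (cases b)
    case True
    then have "w @ [b] = encode_nats xs @ replicate (Suc k) True"
      by (simp add: w replicate_append_same)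
    then show ?thesis by blast
  next
    case False
    then have "w @ [b] = encode_nats (xs @ [k]) @ replicate 0 True"
      by (simp add: w encode_nats_snoc)
    then show ?thesis by blast
  qed
qed

text \<open>Each number ends in a zero, so a word is a code unless it ends in a one. The empty word
  is covered, since \<open>bit_at\<close> is false out of range.\<close>

lemma encode_nats_iff: "(\<exists>xs. w = encode_nats xs) \<longleftrightarrow> \<not> bit_at w (length w - 1)"
proof
  assume "\<exists>xs. w = encode_nats xs"
  then obtain xs where "w = encode_nats xs" by blast
  then show "\<not> bit_at w (length w - 1)"
    by (cases xs rule: rev_cases) (auto simp: encode_nats_snoc bit_at_def nth_append, simp add: encode_nats_def)
next
  assume last: "\<not> bit_at w (length w - 1)"
  obtain xs k where w: "w = encode_nats xs @ replicate k True" using encode_nats_ex by blast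
  have "k = 0"
  proof (rule ccontr)
    assume "k \<noteq> 0"
    then have "bit_at w (length w - 1)" by (auto simp: w bit_at_def nth_append)
    then show False using last by blast
  qed
  then show "\<exists>xs. w = encode_nats xs" using w by auto
qed

lemma num_le: "num w j \<le> length w"
proof -
  have "num w j \<le> (\<Sum>i<length w. 1)" unfolding num_def by (intro sum_mono) auto
  then show ?thesis by simp
qed

text \<open>
  In the following \<open>A j\<close> is entry number \<open>j\<close> of the flattened instance and \<open>m\<close> the number of
  propositions. A structure is identified by its offset \<open>z\<close>, and \<^term>\<open>row A m z q\<close> is the offset
  of the entries of its state \<open>q\<close>.
\<close>

definition row :: "(nat \<Rightarrow> nat) \<Rightarrow> nat \<Rightarrow> nat \<Rightarrow> nat \<Rightarrow> nat" where
  "row A m z q = rec_nat (z + 1) (\<lambda>_ r. r + (3 + m + A (r + m + 1) * A (r + m + 2))) q"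

definition offset :: "(nat \<Rightarrow> nat) \<Rightarrow> nat \<Rightarrow> nat \<Rightarrow> nat \<Rightarrow> nat" where
  "offset A m z i = rec_nat z (\<lambda>_ z. row A m z (A z)) i"

definition cgs_at :: "(nat \<Rightarrow> nat) \<Rightarrow> nat \<Rightarrow> nat \<Rightarrow> (nat, nat) cgs" where
  "cgs_at A m z = \<lparr>states = {..<A z}, init = {q. q < A z \<and> A (row A m z q) \<noteq> 0},
     label = \<lambda>q. {p. p < m \<and> A (row A m z q + 1 + p) \<noteq> 0},
     acts = \<lambda>q a. A (row A m z q + m + a),
     delta = \<lambda>q \<alpha>. A (row A m z q + 3 + m + ((\<alpha> ! 0 - 1) * A (row A m z q + m + 2) + (\<alpha> ! 1 - 1)))\<rparr>"

definition valid_at :: "(nat \<Rightarrow> nat) \<Rightarrow> nat \<Rightarrow> nat \<Rightarrow> bool" where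
  "valid_at A m z \<longleftrightarrow> (\<forall>q<A z. A (row A m z q) \<le> 1 \<and> (\<forall>p<m. A (row A m z q + 1 + p) \<le> 1) \<and>
     1 \<le> A (row A m z q + m + 1) \<and> 1 \<le> A (row A m z q + m + 2) \<and>
     (\<forall>i<A (row A m z q + m + 1) * A (row A m z q + m + 2). A (row A m z q + 3 + m + i) < A z))"

lemma row_0: "row A m z 0 = z + 1"
  by (simp add: row_def)

lemma row_Suc: "row A m z (Suc q) = row A m z q +
    (3 + m + A (row A m z q + m + 1) * A (row A m z q + m + 2))"
  by (simp add: row_def)

text \<open>Joint actions are listed lexicographically, so the pair of actions \<open>a\<close> and
  \<open>b\<close> has index \<open>(a - 1) * n + (b - 1)\<close>, where \<open>n\<close> is the
  number of actions of agent \<open>2\<close>.\<close>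

lemma map_joint_actions:
  "map (\<lambda>\<alpha>. h ((\<alpha> ! 0 - 1) * acts C q 2 + (\<alpha> ! 1 - 1))) (joint_actions 2 C q) =
   map h [0..<acts C q 1 * acts C q 2]"
proof -
  let ?n = "acts C q 2"
  have inner: "map (\<lambda>b. h ((a - 1) * ?n + (b - 1))) [1..<Suc ?n] = map h [(a - 1) * ?n..<(a - 1) * ?n + ?n]" for a
    by (rule nth_equalityI) (simp_all del: upt_Suc)
  have "concat (map (\<lambda>a. map h [(a - 1) * ?n..<(a - 1) * ?n + ?n]) [1..<Suc k]) = map h [0..<k * ?n]" for k
  proof (induction k)
    case (Suc k)
    have "[0..<Suc k * ?n] = [0..<k * ?n] @ [k * ?n..<k * ?n + ?n]"
      using upt_add_eq_append[of 0 "k * ?n" ?n] by (simp add: add.commute)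
    then show ?case using Suc by simp
  qed simp
  note blocks = this
  have "map (\<lambda>\<alpha>. h ((\<alpha> ! 0 - 1) * ?n + (\<alpha> ! 1 - 1))) (joint_actions 2 C q) =
      concat (map (\<lambda>a. map (\<lambda>b. h ((a - 1) * ?n + (b - 1))) [1..<Suc ?n]) [1..<Suc (acts C q 1)])"
    by (simp add: joint_actions_2 map_concat comp_def del: upt_Suc)
  also have "\<dots> = map h [0..<acts C q 1 * ?n]" by (simp only: inner blocks)
  finally show ?thesis .
qed

lemma joint_action_index:
  assumes "1 \<le> a" "a \<le> k" "1 \<le> b" "b \<le> n"
  shows "(a - 1) * n + (b - 1) < k * (n::nat)"
proof -
  have "(a - 1) * n + (b - 1) < (a - 1) * n + n" using assms by simp
  also have "\<dots> = a * n" using assms by (cases a) auto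
  also have "\<dots> \<le> k * n" using assms by simp
  finally show ?thesis .
qed

lemma map_upt_shift: "map f [a..<a + n] = map (\<lambda>i. f (a + i)) [0..<n]"
  by (rule nth_equalityI) auto

lemma map_upt_split: "map g [0..<a + b] = map g [0..<a] @ map (\<lambda>i. g (a + i)) [0..<b]"
  using upt_add_eq_append[of 0 a b] by (simp add: map_upt_shift)

lemma flatten_state_at:
  assumes "valid_at A m z" "q < A z"
  shows "flatten_state 2 m (cgs_at A m z) q = map A [row A m z q..<row A m z (Suc q)]"
proof -
  let ?r = "row A m z q" and ?C = "cgs_at A m z"
  let ?n = "A (?r + m + 1) * A (?r + m + 2)"
  have ag: "[1..<Suc 2] = [1, 2]" by (simp add: upt_rec)
  have "map (delta ?C q) (joint_actions 2 ?C q) = map (\<lambda>i. A (?r + 3 + m + i)) [0..<?n]"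
    using map_joint_actions[of "\<lambda>i. A (?r + 3 + m + i)" ?C q] by (simp add: cgs_at_def)
  moreover have "of_bool (q \<in> init ?C) = A ?r"
    using assms by (cases "A ?r") (auto simp: cgs_at_def valid_at_def)
  moreover have "of_bool (p \<in> label ?C q) = A (?r + 1 + p)" if "p < m" for p
    using assms that by (cases "A (?r + 1 + p)") (fastforce simp: cgs_at_def valid_at_def)+
  then have "map (\<lambda>p. of_bool (p \<in> label ?C q)) [0..<m] = map (\<lambda>p. A (?r + 1 + p)) [0..<m]" by simp
  moreover have "map (acts ?C q) [1..<Suc 2] = [A (?r + m + 1), A (?r + m + 2)]"
    unfolding ag by (simp add: cgs_at_def)
  moreover have "map A [?r..<row A m z (Suc q)] = A ?r # map (\<lambda>p. A (?r + 1 + p)) [0..<m] @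
      [A (?r + m + 1), A (?r + m + 2)] @ map (\<lambda>i. A (?r + 3 + m + i)) [0..<?n]"
  proof -
    let ?g = "\<lambda>i. A (?r + i)"
    have u: "[0..<1] = [0::nat]" "[0..<2] = [0, 1::nat]" by (simp_all add: upt_rec)
    have "map A [?r..<row A m z (Suc q)] = map ?g [0..<1 + (m + (2 + ?n))]"
    proof -
      have "3 + m + ?n = 1 + (m + (2 + ?n))" by simp
      then show ?thesis unfolding row_Suc map_upt_shift by (rule arg_cong)
    qed
    also have "\<dots> = map ?g [0..<1] @ map (\<lambda>i. ?g (1 + i)) [0..<m] @
        map (\<lambda>i. ?g (1 + (m + i))) [0..<2] @ map (\<lambda>i. ?g (1 + (m + (2 + i)))) [0..<?n]"
      by (simp only: map_upt_split)
    also have "\<dots> = ?g 0 # map (\<lambda>i. ?g (1 + i)) [0..<m] @ [?g (1 + m), ?g (1 + (m + 1))] @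
        map (\<lambda>i. ?g (1 + (m + (2 + i)))) [0..<?n]"
      by (simp only: u list.map append.simps add_0_right)
    finally show ?thesis by (simp add: add.assoc numeral_3_eq_3)
  qed
  ultimately show ?thesis by (simp add: flatten_state_def)
qed

lemma wf_cgs_at: assumes "valid_at A m z" shows "wf_cgs 2 {..<m} (cgs_at A m z)"
proof -
  have "delta (cgs_at A m z) q \<alpha> \<in> states (cgs_at A m z)"
    if q: "q < A z" and \<alpha>: "\<alpha> \<in> set (joint_actions 2 (cgs_at A m z) q)" for q \<alpha>
  proof -
    obtain a b where ab: "\<alpha> = [a, b]" "1 \<le> a" "a \<le> A (row A m z q + m + 1)" "1 \<le> b" "b \<le> A (row A m z q + m + 2)"
      using \<alpha> unfolding set_joint_actions_2 by (auto simp: cgs_at_def)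
    let ?r = "row A m z q"
    have "A (?r + 3 + m + ((a - 1) * A (?r + m + 2) + (b - 1))) < A z"
      using joint_action_index[OF ab(2-5)] assms q unfolding valid_at_def by blast
    then show ?thesis by (simp add: cgs_at_def ab(1))
  qed
  moreover have "1 \<le> acts (cgs_at A m z) q a" if "q < A z" "a \<in> agents 2" for q a
    using assms that by (auto simp: agents_2 cgs_at_def valid_at_def)
  ultimately show ?thesis by (auto simp: wf_cgs_def) (auto simp: cgs_at_def)
qed

lemma concat_upt: "(\<And>i. i < n \<Longrightarrow> f i \<le> f (Suc i)) \<Longrightarrow>
    concat (map (\<lambda>i. map A [f i..<f (Suc i)]) [0..<n]) = map A [f 0..<f n]"
proof (induction n)
  case (Suc n)
  have "f 0 \<le> f k" if "k \<le> n" for k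
    using that by (induction k) (auto intro: order_trans[OF _ Suc.prems])
  then have "f 0 \<le> f n" by simp
  moreover have "f n \<le> f (Suc n)" using Suc.prems by simp
  ultimately have "[f 0..<f (Suc n)] = [f 0..<f n] @ [f n..<f (Suc n)]"
    by (metis le_add_diff_inverse upt_add_eq_append)
  then show ?case using Suc by simp
qed simp

lemma card_cgs_at: "card (states (cgs_at A m z)) = A z"
  by (simp add: cgs_at_def)

lemma flatten_cgs_at:
  assumes "valid_at A m z"
  shows "flatten_cgs 2 m (cgs_at A m z) = map A [z..<row A m z (A z)]"
proof -
  have "concat (map (flatten_state 2 m (cgs_at A m z)) [0..<A z]) =
      concat (map (\<lambda>q. map A [row A m z q..<row A m z (Suc q)]) [0..<A z])"
    using flatten_state_at[OF assms] by (intro arg_cong[of _ _ concat] map_cong) auto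
  also have "\<dots> = map A [row A m z 0..<row A m z (A z)]"
    by (rule concat_upt) (simp add: row_Suc)
  also have "row A m z 0 = z + 1" by (rule row_0)
  finally have *: "concat (map (flatten_state 2 m (cgs_at A m z)) [0..<A z]) = map A [z + 1..<row A m z (A z)]" .
  have "z + 1 \<le> row A m z q" for q by (induction q) (auto simp: row_0 row_Suc)
  then have "z < row A m z (A z)" by (simp add: Suc_le_lessD)
  then have "map A [z..<row A m z (A z)] = A z # map A [z + 1..<row A m z (A z)]"
    by (simp add: upt_conv_Cons)
  then show ?thesis using * by (simp add: flatten_cgs_def card_cgs_at)
qed

text \<open>Structures that agree wherever the code of an instance looks at them.\<close>

definition same_cgs :: "(nat, nat) cgs \<Rightarrow> (nat, nat) cgs \<Rightarrow> bool" where
  "same_cgs C D \<longleftrightarrow> states C = states D \<and> init C = init D \<and> (\<forall>q \<in> states C. label C q = label D q \<and>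
     acts C q 1 = acts D q 1 \<and> acts C q 2 = acts D q 2 \<and>
     (\<forall>\<alpha> \<in> set (joint_actions 2 C q). delta C q \<alpha> = delta D q \<alpha>))"

lemma same_cgs_joint: "same_cgs C D \<Longrightarrow> q \<in> states C \<Longrightarrow> joint_actions 2 C q = joint_actions 2 D q"
  by (simp add: same_cgs_def joint_actions_2)

lemma same_cgs_pre:
  assumes "same_cgs C D" "q \<in> states C"
  shows "pre C A Y q \<longleftrightarrow> pre D A Y q"
  unfolding pre_def same_cgs_joint[OF assms]
  using assms same_cgs_joint[OF assms] unfolding same_cgs_def by metis

lemma same_cgs_upd:
  assumes "same_cgs C D" "q \<in> states C" "wf_cgs 2 Props C"
  shows "(upd op C A ^^ n) P q \<longleftrightarrow> (upd op D A ^^ n) P q"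
  using assms(2)
proof (induction n arbitrary: q)
  case (Suc n)
  have "upd op C A ((upd op C A ^^ n) P) q \<longleftrightarrow> upd op C A ((upd op D A ^^ n) P) q"
    by (rule upd_cong[OF assms(3) Suc.prems Suc.IH])
  also have "\<dots> \<longleftrightarrow> upd op D A ((upd op D A ^^ n) P) q"
    using same_cgs_pre[OF assms(1) Suc.prems] by (auto simp: upd_def split: tempop.split)
  finally show ?case by simp
qed simp

lemma upd_iter_cong:
  assumes "wf_cgs 2 Props C" "\<And>x. x \<in> states C \<Longrightarrow> P x \<longleftrightarrow> Q x"
  shows "q \<in> states C \<Longrightarrow> (upd op C A ^^ n) P q \<longleftrightarrow> (upd op C A ^^ n) Q q"
proof (induction n arbitrary: q)
  case (Suc n)
  then show ?case using upd_cong[OF assms(1) Suc.prems Suc.IH] by simp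
qed (use assms in simp)

text \<open>Proved through the approximants: \<open>pre\<close> looks only at listed joint actions
  of actual states, so values of the record fields elsewhere never enter.\<close>

lemma same_cgs_sat:
  assumes same: "same_cgs C D" and wf: "wf_cgs 2 Props C" "wf_cgs 2 Props D"
  shows "\<phi> \<in> ATL 2 Props' Ut Bl \<Longrightarrow> q \<in> states C \<Longrightarrow> sat 2 C \<phi> q \<longleftrightarrow> sat 2 D \<phi> q"
proof (induction arbitrary: q rule: ATL.induct)
  case (1 p)
  then show ?case using same by (simp add: same_cgs_def)
next
  case (3 A op \<phi>)
  have st: "states C = states D" using same by (simp add: same_cgs_def)
  let ?N = "card (states C)"
  have "sat 2 C (Strat A op \<phi>) q \<longleftrightarrow> (upd op C A ^^ ?N) (sat 2 C \<phi>) q"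
    by (rule sat_Strat[OF wf(1) 3(1,5) order_refl])
  also have "\<dots> \<longleftrightarrow> (upd op C A ^^ ?N) (sat 2 D \<phi>) q"
    by (rule upd_iter_cong[OF wf(1) 3(4) 3(5)])
  also have "\<dots> \<longleftrightarrow> (upd op D A ^^ ?N) (sat 2 D \<phi>) q"
    by (rule same_cgs_upd[OF same 3(5) wf(1)])
  also have "\<dots> \<longleftrightarrow> sat 2 D (Strat A op \<phi>) q"
    using sat_Strat[OF wf(2) 3(1), of q ?N op \<phi>] 3(5) st by simp
  finally show ?case .
qed simp

lemma length_joint_actions: "length (joint_actions 2 C q) = acts C q 1 * acts C q 2"
  using arg_cong[OF map_joint_actions[of id C q], of length] by simp

lemma length_flatten_state: "length (flatten_state 2 m C q) = 3 + m + acts C q 1 * acts C q 2"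
  by (simp add: flatten_state_def length_joint_actions)

lemma stored_cgs:
  assumes wf: "wf_cgs 2 {..<m} C" and st: "states C = {..<card (states C)}"
    and stored: "\<And>i. i < length (flatten_cgs 2 m C) \<Longrightarrow> A (z + i) = flatten_cgs 2 m C ! i"
  shows "valid_at A m z" "same_cgs (cgs_at A m z) C"
    "row A m z (A z) = z + length (flatten_cgs 2 m C)"
proof -
  let ?l = "card (states C)"
  let ?fs = "\<lambda>q. flatten_state 2 m C q" and ?r = "row A m z"
  let ?len = "\<lambda>q. length (concat (map ?fs [0..<q]))"
  have Az: "A z = ?l" using stored[of 0] by (simp add: flatten_cgs_def)
  have split: "concat (map ?fs [0..<?l]) = concat (map ?fs [0..<q]) @ ?fs q @ concat (map ?fs [Suc q..<?l])"
    if "q < ?l" for q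
  proof -
    have "[0..<?l] = [0..<q] @ q # [Suc q..<?l]"
      using upt_add_eq_append[of 0 q "?l - q"] upt_conv_Cons[OF that] that by simp
    then show ?thesis by simp
  qed
  have entry: "A (z + 1 + ?len q + i) = ?fs q ! i" if "q < ?l" "i < length (?fs q)" for q i
  proof -
    have "flatten_cgs 2 m C ! (1 + ?len q + i) = ?fs q ! i"
      unfolding flatten_cgs_def split[OF that(1)] using that(2) by (simp add: nth_append)
    moreover have "1 + ?len q + i < length (flatten_cgs 2 m C)"
      unfolding flatten_cgs_def split[OF that(1)] using that(2) by simp
    ultimately show ?thesis using stored[of "1 + ?len q + i"] by (simp add: add.assoc)
  qed
  have ag: "[1..<Suc 2] = [1, 2]" by (simp add: upt_rec)
  have fs: "?fs q = of_bool (q \<in> init C) # map (\<lambda>p. of_bool (p \<in> label C q)) [0..<m] @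
      [acts C q 1, acts C q 2] @ map (delta C q) (joint_actions 2 C q)" for q
    unfolding flatten_state_def ag by simp
  have acts: "A (z + 1 + ?len q + m + 1) = acts C q 1" "A (z + 1 + ?len q + m + 2) = acts C q 2"
    if "q < ?l" for q
  proof -
    have "?fs q ! (m + 1) = acts C q 1" "?fs q ! (m + 2) = acts C q 2"
      unfolding fs by (simp_all add: nth_append nth_Cons')
    then show "A (z + 1 + ?len q + m + 1) = acts C q 1" "A (z + 1 + ?len q + m + 2) = acts C q 2"
      using entry[OF that, of "m + 1"] entry[OF that, of "m + 2"] by (simp_all add: length_flatten_state add.assoc)
  qed
  have row: "?r q = z + 1 + ?len q" if "q \<le> ?l" for q
    using that
  proof (induction q)
    case (Suc q)
    then show ?case using acts[of q] by (simp add: row_Suc length_flatten_state)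
  qed (simp add: row_0)
  have e: "A (?r q + i) = ?fs q ! i" if "q < ?l" "i < 3 + m + acts C q 1 * acts C q 2" for q i
    using entry[of q i] row[of q] that by (simp add: length_flatten_state)
  have init: "A (?r q) = of_bool (q \<in> init C)" if "q < ?l" for q
    using e[OF that, of 0] by (simp add: fs)
  have lab: "A (?r q + 1 + p) = of_bool (p \<in> label C q)" if "q < ?l" "p < m" for q p
    using e[OF that(1), of "1 + p"] that(2) by (simp add: fs nth_append)
  have act: "A (?r q + m + 1) = acts C q 1" "A (?r q + m + 2) = acts C q 2" if "q < ?l" for q
    using acts[OF that] row[of q] that by simp_all
  have del: "A (?r q + 3 + m + i) = map (delta C q) (joint_actions 2 C q) ! i"
    if "q < ?l" "i < acts C q 1 * acts C q 2" for q i
    using e[OF that(1), of "3 + m + i"] that(2) by (simp add: fs nth_append nth_Cons' add.assoc)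
  have pos: "1 \<le> acts C q 1" "1 \<le> acts C q 2" "label C q \<subseteq> {..<m}" if "q < ?l" for q
    using wf that st by (auto simp: wf_cgs_def agents_2)
  have dC: "map (delta C q) (joint_actions 2 C q) ! i < ?l" if "q < ?l" "i < acts C q 1 * acts C q 2" for q i
  proof -
    have q: "q \<in> states C" using that(1) st by blast
    have "joint_actions 2 C q ! i \<in> set (joint_actions 2 C q)"
      using that(2) by (intro nth_mem) (simp add: length_joint_actions)
    then have "delta C q (joint_actions 2 C q ! i) \<in> {..<?l}"
      using wf_delta[OF wf q] st by blast
    then show ?thesis using that(2) by (simp add: length_joint_actions)
  qed
  show "valid_at A m z"
    unfolding valid_at_def Az
  proof (intro allI impI conjI)
    fix q assume q: "q < ?l"
    show "A (?r q) \<le> 1" using init[OF q] by simp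
    show "A (?r q + 1 + p) \<le> 1" if "p < m" for p using lab[OF q that] by simp
    show "1 \<le> A (?r q + m + 1)" "1 \<le> A (?r q + m + 2)" using act[OF q] pos[OF q] by simp_all
    show "A (?r q + 3 + m + i) < ?l" if "i < A (?r q + m + 1) * A (?r q + m + 2)" for i
      using del[OF q] dC[OF q] that unfolding act[OF q] by simp
  qed
  show "row A m z (A z) = z + length (flatten_cgs 2 m C)"
    unfolding Az using row[of ?l] by (simp add: flatten_cgs_def)
  have delta: "delta C q \<alpha> = A (?r q + 3 + m + ((\<alpha> ! 0 - 1) * A (?r q + m + 2) + (\<alpha> ! 1 - 1)))"
    if q: "q < ?l" and \<alpha>: "\<alpha> \<in> set (joint_actions 2 C q)" for q \<alpha>
  proof -
    let ?h = "\<lambda>\<alpha>. (\<alpha> ! 0 - 1) * acts C q 2 + (\<alpha> ! 1 - 1)"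
    obtain i where i: "i < length (joint_actions 2 C q)" "joint_actions 2 C q ! i = \<alpha>"
      using \<alpha> by (metis in_set_conv_nth)
    have "map ?h (joint_actions 2 C q) ! i = i"
      using map_joint_actions[of "\<lambda>i. i" C q] i(1) by (simp add: length_joint_actions)
    then have "?h \<alpha> = i" using i by simp
    then show ?thesis unfolding act[OF q]
      using del[OF q, of i] i by (simp add: length_joint_actions)
  qed
  show "same_cgs (cgs_at A m z) C"
    unfolding same_cgs_def
  proof (intro conjI ballI)
    show "states (cgs_at A m z) = states C" using st Az by (simp add: cgs_at_def)
    have "init C \<subseteq> {..<?l}" using wf st by (auto simp: wf_cgs_def)
    then show "init (cgs_at A m z) = init C"
      using init by (auto simp: cgs_at_def Az)
    fix q assume "q \<in> states (cgs_at A m z)"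
    then have q: "q < ?l" by (simp add: cgs_at_def Az)
    show "label (cgs_at A m z) q = label C q"
      using lab[OF q] pos(3)[OF q] by (auto simp: cgs_at_def)
    show "acts (cgs_at A m z) q 1 = acts C q 1" "acts (cgs_at A m z) q 2 = acts C q 2"
      using act[OF q] by (simp_all add: cgs_at_def)
    then have "joint_actions 2 (cgs_at A m z) q = joint_actions 2 C q" by (simp add: joint_actions_2)
    then show "delta (cgs_at A m z) q \<alpha> = delta C q \<alpha>" if "\<alpha> \<in> set (joint_actions 2 (cgs_at A m z) q)" for \<alpha>
      using that delta[OF q] by (simp add: cgs_at_def)
  qed
qed

lemma offset_Suc: "offset A m z (Suc i) = row A m (offset A m z i) (A (offset A m z i))"
  by (simp add: offset_def)

lemma offset_mono: "offset A m z i \<le> offset A m z (Suc i)"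
proof -
  have "z + 1 \<le> row A m z q" for z q by (induction q) (auto simp: row_0 row_Suc)
  then show ?thesis unfolding offset_Suc by (meson le_add1 order_trans)
qed

lemma flatten_list_at:
  assumes "\<And>i. i < n \<Longrightarrow> valid_at A m (offset A m z i)"
  shows "concat (map (flatten_cgs 2 m) (map (\<lambda>i. cgs_at A m (offset A m z i)) [0..<n])) =
    map A [z..<offset A m z n]"
proof -
  have "concat (map (flatten_cgs 2 m) (map (\<lambda>i. cgs_at A m (offset A m z i)) [0..<n])) =
      concat (map (\<lambda>i. map A [offset A m z i..<offset A m z (Suc i)]) [0..<n])"
    using assms by (intro arg_cong[of _ _ concat]) (auto simp: flatten_cgs_at offset_Suc)
  also have "\<dots> = map A [offset A m z 0..<offset A m z n]"
    by (rule concat_upt) (rule offset_mono)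
  also have "offset A m z 0 = z" by (simp add: offset_def)
  finally show ?thesis .
qed

lemma stored_list:
  assumes "\<And>C. C \<in> set Cs \<Longrightarrow> wf_cgs 2 {..<m} C \<and> states C = {..<card (states C)}"
    and "\<And>i. i < length (concat (map (flatten_cgs 2 m) Cs)) \<Longrightarrow>
      A (z + i) = concat (map (flatten_cgs 2 m) Cs) ! i"
  shows "offset A m z (length Cs) = z + length (concat (map (flatten_cgs 2 m) Cs)) \<and>
    (\<forall>i<length Cs. valid_at A m (offset A m z i) \<and> same_cgs (cgs_at A m (offset A m z i)) (Cs ! i))"
  using assms
proof (induction Cs rule: rev_induct)
  case Nil
  then show ?case by (simp add: offset_def)
next
  case (snoc C Cs)
  let ?u = "concat (map (flatten_cgs 2 m) Cs)"
  have IH: "offset A m z (length Cs) = z + length ?u \<and>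
    (\<forall>i<length Cs. valid_at A m (offset A m z i) \<and> same_cgs (cgs_at A m (offset A m z i)) (Cs ! i))"
  proof (rule snoc.IH)
    show "A (z + i) = ?u ! i" if "i < length ?u" for i
      using snoc.prems(2)[of i] that by (simp add: nth_append)
  qed (use snoc.prems(1) in auto)
  have C: "wf_cgs 2 {..<m} C" "states C = {..<card (states C)}" using snoc.prems(1)[of C] by auto
  have stored: "A (offset A m z (length Cs) + i) = flatten_cgs 2 m C ! i" if "i < length (flatten_cgs 2 m C)" for i
    using snoc.prems(2)[of "length ?u + i"] that IH by (simp add: nth_append add.assoc)
  note C = stored_cgs[OF C stored]
  show ?case
    using IH C by (auto simp: offset_Suc nth_append less_Suc_eq)
qed

section \<open>Membership in P\<close>

abbreviation row_of :: "bool list \<Rightarrow> nat \<Rightarrow> nat \<Rightarrow> nat" where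
  "row_of w \<equiv> row (num w) (num w 0)"

abbreviation offset_of :: "bool list \<Rightarrow> nat \<Rightarrow> nat \<Rightarrow> nat" where
  "offset_of w \<equiv> offset (num w) (num w 0)"

text \<open>Exceeds everything used as a digit or coordinate: entries and offsets of a valid word,
  segment numbers below \<open>5 n + 3\<close>, operator numbers and chain lengths.\<close>

definition base :: "nat \<Rightarrow> bool list \<Rightarrow> nat" where
  "base n w = length w + (5 * n + 15)"

text \<open>Repeated division instead of a power as divisor, because all intermediate values then
  stay below \<open>c\<close>, as computability of the recursion demands.\<close>

definition digit :: "nat \<Rightarrow> nat \<Rightarrow> nat \<Rightarrow> nat" where
  "digit Z c i = rec_nat c (\<lambda>_ x. x div Z) i mod Z"

definition seg_of :: "nat \<Rightarrow> nat \<Rightarrow> nat \<Rightarrow> seg" where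
  "seg_of Z c j = (digit Z c (4 * j), digit Z c (4 * j + 1), digit Z c (4 * j + 2), digit Z c (4 * j + 3))"

text \<open>
  The bit at position \<^term>\<open>cell n w c j s z q\<close> tells whether state \<open>q\<close> of the structure at
  offset \<open>z\<close> satisfies segment \<open>j\<close> of the code \<open>c\<close> after \<open>s\<close> steps of the fixpoint iterations;
  every operator of a chain is given \<^term>\<open>base n w\<close> steps.
\<close>

definition cell :: "nat \<Rightarrow> bool list \<Rightarrow> nat \<Rightarrow> nat \<Rightarrow> nat \<Rightarrow> nat \<Rightarrow> nat \<Rightarrow> nat" where
  "cell n w c j s z q =
     (((c * (5 * n + 3) + j) * Suc (base n w * base n w) + s) * base n w + z) * base n w + q"

text \<open>\<open>pre\<close> read off the encoded structure: \<open>i\<close> is the cell of state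
  \<open>0\<close> at the current stage, \<open>y\<close> a coalition number as for
  \<open>coal\<close>, and actions are counted from \<open>0\<close>.\<close>

definition can_force :: "glob \<Rightarrow> nat \<Rightarrow> nat \<Rightarrow> nat \<Rightarrow> nat \<Rightarrow> bool" where
  "can_force g i z q y \<longleftrightarrow>
     (\<exists>a<num (fst g) (row_of (fst g) z q + num (fst g) 0 + 1).
      \<exists>b<num (fst g) (row_of (fst g) z q + num (fst g) 0 + 2).
      \<forall>a'<num (fst g) (row_of (fst g) z q + num (fst g) 0 + 1).
      \<forall>b'<num (fst g) (row_of (fst g) z q + num (fst g) 0 + 2).
        ((y mod 2 = 1 \<longrightarrow> a' = a) \<and> (2 \<le> y \<longrightarrow> b' = b)) \<longrightarrow>
        bit_at (snd g) (i + num (fst g) (row_of (fst g) z q + 3 + num (fst g) 0 +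
          (a' * num (fst g) (row_of (fst g) z q + num (fst g) 0 + 2) + b'))))"

definition first_bit :: "nat \<Rightarrow> glob \<Rightarrow> nat \<Rightarrow> nat \<Rightarrow> nat \<Rightarrow> nat \<Rightarrow> bool" where
  "first_bit n g c j z q \<longleftrightarrow>
     (if digit (base n (fst g)) c (4 * j) = 0
      then num (fst g) (row_of (fst g) z q + 1 + digit (base n (fst g)) c (4 * j + 1)) \<noteq> 0
      else if digit (base n (fst g)) c (4 * j) = 1
      then \<exists>b\<in>set [0..<10]. digit (base n (fst g)) c (4 * j + 3) = b \<and>
        eval_binop (bops ! b)
          (bit_at (snd g) (cell n (fst g) c (digit (base n (fst g)) c (4 * j + 1)) (base n (fst g) * base n (fst g)) z q))
          (bit_at (snd g) (cell n (fst g) c (digit (base n (fst g)) c (4 * j + 2)) (base n (fst g) * base n (fst g)) z q))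
      else bit_at (snd g) (cell n (fst g) c (digit (base n (fst g)) c (4 * j + 1)) (base n (fst g) * base n (fst g)) z q))"

text \<open>The quotient \<open>s div base n (fst g)\<close> is the index of the chain operator
  being iterated, and its parity selects the coalition as in \<open>letter\<close>. Once the chain
  is finished, and for other kinds of segments, the bit is copied, so every result is found at the
  same last stage.\<close>

definition step_bit :: "tempop \<Rightarrow> nat \<Rightarrow> glob \<Rightarrow> nat \<Rightarrow> nat \<Rightarrow> nat \<Rightarrow> nat \<Rightarrow> nat \<Rightarrow> bool" where
  "step_bit op n g c j s z q \<longleftrightarrow>
     (if digit (base n (fst g)) c (4 * j) = 2 \<and> s div base n (fst g) < digit (base n (fst g)) c (4 * j + 3)
      then if op = Finally
        then bit_at (snd g) (cell n (fst g) c j s z q) \<or> can_force g (cell n (fst g) c j s z 0) z q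
          (if s div base n (fst g) mod 2 = 0 then digit (base n (fst g)) c (4 * j + 2)
           else 3 - digit (base n (fst g)) c (4 * j + 2))
        else bit_at (snd g) (cell n (fst g) c j s z q) \<and> can_force g (cell n (fst g) c j s z 0) z q
          (if s div base n (fst g) mod 2 = 0 then digit (base n (fst g)) c (4 * j + 2)
           else 3 - digit (base n (fst g)) c (4 * j + 2))
      else bit_at (snd g) (cell n (fst g) c j s z q))"

definition next_bit :: "tempop \<Rightarrow> nat \<Rightarrow> glob \<Rightarrow> nat \<Rightarrow> nat \<Rightarrow> nat \<Rightarrow> nat \<Rightarrow> nat \<Rightarrow> bool" where
  "next_bit op n g c j s z q \<longleftrightarrow> (if s = 0 then first_bit n g c j z q else step_bit op n g c j (s - 1) z q)"

definition dp_bit :: "tempop \<Rightarrow> nat \<Rightarrow> glob \<Rightarrow> nat list \<Rightarrow> bool" where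
  "dp_bit op n g e = next_bit op n g
     (e ! 0 div base n (fst g) div base n (fst g) div Suc (base n (fst g) * base n (fst g)) div (5 * n + 3))
     (e ! 0 div base n (fst g) div base n (fst g) div Suc (base n (fst g) * base n (fst g)) mod (5 * n + 3))
     (e ! 0 div base n (fst g) div base n (fst g) mod Suc (base n (fst g) * base n (fst g)))
     (e ! 0 div base n (fst g) mod base n (fst g)) (e ! 0 mod base n (fst g))"

text \<open>The first cell of the first number that is too large to be a code of
  \<open>4 * (5 * n + 3)\<close> digits; the table ends there.\<close>

definition dp_length :: "nat \<Rightarrow> bool list \<Rightarrow> nat" where
  "dp_length n w = cell n w (base n w ^ (4 * (5 * n + 3))) 0 0 0 0"

text \<open>Entry \<open>0\<close> is the number of propositions and entry \<open>1\<close> the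
  number of positive structures, whose records start at \<open>2\<close>; behind them stands the
  number of negative structures.\<close>

definition neg_start :: "bool list \<Rightarrow> nat" where
  "neg_start w = offset_of w 2 (num w 1)"

definition bound_pos :: "bool list \<Rightarrow> nat" where
  "bound_pos w = offset_of w (neg_start w + 1) (num w (neg_start w))"

text \<open>The number of zeros is the number of entries; the last conjunct says that the bound is
  the final entry, with nothing missing and nothing behind it.\<close>

definition valid_instance :: "bool list \<Rightarrow> bool" where
  "valid_instance w \<longleftrightarrow> \<not> bit_at w (length w - 1) \<and>
     (\<forall>i<num w 1. valid_at (num w) (num w 0) (offset_of w 2 i)) \<and>
     (\<forall>i<num w (neg_start w). valid_at (num w) (num w 0) (offset_of w (neg_start w + 1) i)) \<and>
     zeros w (length w) = bound_pos w + 1"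

definition accepts :: "binop set \<Rightarrow> nat \<Rightarrow> glob \<Rightarrow> nat \<Rightarrow> bool" where
  "accepts Bl n g c \<longleftrightarrow>
     (\<forall>j<5 * n + 3. good (num (fst g) 0) Bl j (seg_of (base n (fst g)) c j)) \<and>
     (\<Sum>j<5 * n + 3. weight (seg_of (base n (fst g)) c j)) \<le> num (fst g) (bound_pos (fst g)) \<and>
     (\<Sum>j<5 * n + 3. of_bool (fst (seg_of (base n (fst g)) c j) = 1)) \<le> n \<and>
     (\<forall>i<num (fst g) 1. \<forall>q<num (fst g) (offset_of (fst g) 2 i).
        num (fst g) (row_of (fst g) (offset_of (fst g) 2 i) q) \<noteq> 0 \<longrightarrow>
        bit_at (snd g) (cell n (fst g) c (5 * n + 2) (base n (fst g) * base n (fst g)) (offset_of (fst g) 2 i) q)) \<and>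
     (\<forall>i<num (fst g) (neg_start (fst g)). \<exists>q<num (fst g) (offset_of (fst g) (neg_start (fst g) + 1) i).
        num (fst g) (row_of (fst g) (offset_of (fst g) (neg_start (fst g) + 1) i) q) \<noteq> 0 \<and>
        \<not> bit_at (snd g) (cell n (fst g) c (5 * n + 2) (base n (fst g) * base n (fst g))
            (offset_of (fst g) (neg_start (fst g) + 1) i) q))"

subsection \<open>Computability\<close>

lemma lc_zeros: assumes "lc m A" shows "lc m (\<lambda>g e. zeros (fst g) (A g e))"
proof -
  have "lc 1 (\<lambda>g e. zeros (fst g) (e ! 0))"
    unfolding zeros_def by (intro lc_intros; simp)
  then show ?thesis by (rule lc_comp1[OF _ assms])
qed

lemma lc_num: assumes "lc m A" shows "lc m (\<lambda>g e. num (fst g) (A g e))"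
proof -
  have "lc 1 (\<lambda>g e. num (fst g) (e ! 0))"
    unfolding num_def by (intro lc_intros lc_zeros; simp)
  then show ?thesis by (rule lc_comp1[OF _ assms])
qed

text \<open>Valid for arbitrary words, since entries never exceed the length of the word;
  \<open>lc_rec\<close> requires its bound on all inputs, not only on instances.\<close>

lemma row_le: "row_of w z q \<le> z + 1 + q * (3 + length w + length w * length w)"
proof (induction q)
  case (Suc q)
  have "num w 0 \<le> length w" "num w i * num w j \<le> length w * length w" for i j
    by (auto intro: num_le mult_le_mono)
  then have "3 + num w 0 + num w (row_of w z q + num w 0 + 1) * num w (row_of w z q + num w 0 + 2) \<le>
      3 + length w + length w * length w" by (meson add_mono order_refl)
  then show ?case using Suc unfolding row_Suc by simp
qed (simp add: row_0)

lemma lc_row: assumes "lc m A" "lc m B" shows "lc m (\<lambda>g e. row_of (fst g) (A g e) (B g e))"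
proof -
  have "lc 2 (\<lambda>g e. rec_nat (e ! 0 + 1) (\<lambda>_ r. r + (3 + num (fst g) 0 +
      num (fst g) (r + num (fst g) 0 + 1) * num (fst g) (r + num (fst g) 0 + 2))) (e ! 1))"
  proof (rule lc_rec[of 2 "\<lambda>g e. e ! 0 + 1" "\<lambda>g i r e. r + (3 + num (fst g) 0 +
      num (fst g) (r + num (fst g) 0 + 1) * num (fst g) (r + num (fst g) 0 + 2))" "\<lambda>g e. e ! 1"
      "\<lambda>g e. e ! 0 + 1 + e ! 1 * (3 + length (fst g) + length (fst g) * length (fst g))"])
    fix g :: glob and e :: "nat list" and i assume "i \<le> e ! 1"
    have "row_of (fst g) (e ! 0) i \<le> e ! 0 + 1 + i * (3 + length (fst g) + length (fst g) * length (fst g))"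
      by (rule row_le)
    also have "\<dots> \<le> e ! 0 + 1 + e ! 1 * (3 + length (fst g) + length (fst g) * length (fst g))"
      using \<open>i \<le> e ! 1\<close> by (intro add_left_mono mult_right_mono) auto
    finally show "rec_nat (e ! 0 + 1) (\<lambda>i r. r + (3 + num (fst g) 0 +
      num (fst g) (r + num (fst g) 0 + 1) * num (fst g) (r + num (fst g) 0 + 2))) i \<le>
      e ! 0 + 1 + e ! 1 * (3 + length (fst g) + length (fst g) * length (fst g))"
      unfolding row_def .
  qed (intro lc_intros lc_num; simp)+
  then have "lc 2 (\<lambda>g e. row_of (fst g) (e ! 0) (e ! 1))" unfolding row_def .
  then show ?thesis by (rule lc_comp2[of "\<lambda>g a b. row_of (fst g) a b", OF _ assms])
qed

lemma lc_offset: assumes "lc m A" "lc m B" shows "lc m (\<lambda>g e. offset_of (fst g) (A g e) (B g e))"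
proof -
  let ?D = "\<lambda>g. 1 + length (fst g) * (3 + length (fst g) + length (fst g) * length (fst g))"
  have le: "offset_of w z i \<le> z + i * (1 + length w * (3 + length w + length w * length w))" for w z i
  proof (induction i)
    case (Suc i)
    have le0: "num w (offset_of w z i) * (3 + length w + length w * length w) \<le>
        length w * (3 + length w + length w * length w)"
      by (intro mult_right_mono num_le) auto
    show ?case using Suc le0 row_le[of w "offset_of w z i" "num w (offset_of w z i)"]
      unfolding offset_Suc mult_Suc by linarith
  qed (simp add: offset_def)
  have "lc 2 (\<lambda>g e. rec_nat (e ! 0) (\<lambda>_ z. row_of (fst g) z (num (fst g) z)) (e ! 1))"
  proof (rule lc_rec[of 2 "\<lambda>g e. e ! 0" "\<lambda>g i z e. row_of (fst g) z (num (fst g) z)" "\<lambda>g e. e ! 1"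
      "\<lambda>g e. e ! 0 + e ! 1 * ?D g"])
    fix g :: glob and e :: "nat list" and i assume "i \<le> e ! 1"
    have "offset_of (fst g) (e ! 0) i \<le> e ! 0 + i * ?D g" by (rule le)
    also have "\<dots> \<le> e ! 0 + e ! 1 * ?D g"
      using \<open>i \<le> e ! 1\<close> by (intro add_left_mono mult_right_mono) auto
    finally show "rec_nat (e ! 0) (\<lambda>i z. row_of (fst g) z (num (fst g) z)) i \<le> e ! 0 + e ! 1 * ?D g"
      unfolding offset_def .
  qed (intro lc_intros lc_num lc_row; simp)+
  then have "lc 2 (\<lambda>g e. offset_of (fst g) (e ! 0) (e ! 1))" unfolding offset_def .
  then show ?thesis by (rule lc_comp2[of "\<lambda>g a b. offset_of (fst g) a b", OF _ assms])
qed

lemma lc_base: "lc m (\<lambda>g e. base n (fst g))"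
  unfolding base_def by (intro lc_intros)

lemma lc_digit: assumes "lc m Z" "lc m A" "lc m B" shows "lc m (\<lambda>g e. digit (Z g e) (A g e) (B g e))"
proof -
  have "lc 3 (\<lambda>g e. rec_nat (e ! 1) (\<lambda>_ x. x div e ! 0) (e ! 2))"
  proof (rule lc_rec[of 3 "\<lambda>g e. e ! 1" "\<lambda>g i x e. x div e ! 0" "\<lambda>g e. e ! 2" "\<lambda>g e. e ! 1"])
    fix e :: "nat list" and i
    show "rec_nat (e ! 1) (\<lambda>i x. x div e ! 0) i \<le> e ! 1"
      by (induction i) (auto intro: order_trans[OF div_le_dividend])
  qed (intro lc_intros; simp)+
  then have "lc 3 (\<lambda>g e. digit (e ! 0) (e ! 1) (e ! 2))"
    unfolding digit_def by (intro lc_mod lc_V) auto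
  then show ?thesis by (rule lc_comp3[of "\<lambda>g. digit", OF _ assms])
qed

lemma lc_cell:
  assumes "lc m A" "lc m B" "lc m C" "lc m D" "lc m E"
  shows "lc m (\<lambda>g e. cell n (fst g) (A g e) (B g e) (C g e) (D g e) (E g e))"
  unfolding cell_def by (intro lc_intros lc_base assms)

lemma lb_can_force:
  assumes "lc m A" "lc m B" "lc m C" "lc m D"
  shows "lb m (\<lambda>g e. can_force g (A g e) (B g e) (C g e) (D g e))"
proof -
  have "lb 4 (\<lambda>g e. can_force g (e ! 0) (e ! 1) (e ! 2) (e ! 3))"
    unfolding can_force_def by (intro lc_intros lc_num lc_row; simp)
  then show ?thesis by (rule lc_comp4[of "\<lambda>g a b c d. of_bool (can_force g a b c d)", OF _ assms])
qed

lemma lb_eval_binop: "lb m P \<Longrightarrow> lb m Q \<Longrightarrow> lb m (\<lambda>g e. eval_binop b (P g e) (Q g e))"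
  by (cases b; simp only: eval_binop.simps; intro lb_not lb_conj lb_disj lb_imp lb_iff; assumption)

lemma lb_first_bit:
  assumes "lc m A" "lc m B" "lc m C" "lc m D"
  shows "lb m (\<lambda>g e. first_bit n g (A g e) (B g e) (C g e) (D g e))"
  unfolding first_bit_def
  by (intro lc_intros lb_ex_list lb_eval_binop lc_num lc_row lc_digit lc_base lc_cell assms)

lemma lb_step_bit:
  assumes "lc m A" "lc m B" "lc m C" "lc m D" "lc m E"
  shows "lb m (\<lambda>g e. step_bit op n g (A g e) (B g e) (C g e) (D g e) (E g e))"
  unfolding step_bit_def
  by (intro lc_intros lb_can_force lc_digit lc_base lc_cell assms)

lemma lb_dp_bit: "lb 1 (dp_bit op n)"
  unfolding dp_bit_def next_bit_def
  by (intro lc_intros lb_first_bit lb_step_bit lc_base; simp)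

lemma lc_dp_length: "lc m (\<lambda>g e. dp_length n (fst g))"
  unfolding dp_length_def by (intro lc_intros lc_cell lc_base)

lemma lc_neg_start: "lc m (\<lambda>g e. neg_start (fst g))"
  unfolding neg_start_def by (intro lc_intros lc_offset lc_num)

lemma lc_bound_pos: "lc m (\<lambda>g e. bound_pos (fst g))"
  unfolding bound_pos_def by (intro lc_intros lc_offset lc_num lc_neg_start)

lemma lb_valid_at: assumes "lc m A" shows "lb m (\<lambda>g e. valid_at (num (fst g)) (num (fst g) 0) (A g e))"
proof -
  have "lb 1 (\<lambda>g e. valid_at (num (fst g)) (num (fst g) 0) (e ! 0))"
    unfolding valid_at_def by (intro lc_intros lc_row lc_num; simp)
  then show ?thesis by (rule lc_comp1[of "\<lambda>g a. of_bool (valid_at (num (fst g)) (num (fst g) 0) a)", OF _ assms])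
qed

lemma lb_valid_instance: "lb m (\<lambda>g e. valid_instance (fst g))"
  unfolding valid_instance_def
  by (intro lc_intros lb_valid_at lc_offset lc_num lc_neg_start lc_zeros lc_bound_pos; simp)

lemma lb_bops: assumes "lc m A" shows "lb m (\<lambda>g e. A g e < 10 \<and> bops ! A g e \<in> Bl)"
  by (rule lb_table[of m A 10 "\<lambda>z. z < 10 \<and> bops ! z \<in> Bl", OF assms]) simp

lemma lb_accepts: "lb 1 (\<lambda>g e. accepts Bl n g (e ! 0))"
proof -
  have good: "lb 2 (\<lambda>g e. good (num (fst g) 0) Bl (e ! 0) (seg_of (base n (fst g)) (e ! 1) (e ! 0)))"
    unfolding seg_of_def good.simps
    by (intro lc_intros lb_bops lc_num lc_digit lc_base; simp)
  have weight: "lc 2 (\<lambda>g e. weight (seg_of (base n (fst g)) (e ! 1) (e ! 0)))"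
    unfolding seg_of_def weight.simps
    by (intro lc_intros lc_digit lc_base; simp)
  have kind: "lc 2 (\<lambda>g e. fst (seg_of (base n (fst g)) (e ! 1) (e ! 0)))"
    unfolding seg_of_def fst_conv
    by (intro lc_intros lc_digit lc_base; simp)
  have tl: "tl e ! 0 = e ! 1" if "length e = Suc 1" for e :: "nat list"
    using that by (simp add: nth_tl)
  have "lb (Suc 1) (\<lambda>g e. good (num (fst g) 0) Bl (e ! 0) (seg_of (base n (fst g)) (tl e ! 0) (e ! 0)))"
    using good by (auto elim!: lc_cong simp: tl numeral_2_eq_2)
  moreover have "lc (Suc 1) (\<lambda>g e. weight (seg_of (base n (fst g)) (tl e ! 0) (e ! 0)))"
    using weight by (auto elim!: lc_cong simp: tl numeral_2_eq_2)
  moreover have "lc (Suc 1) (\<lambda>g e. fst (seg_of (base n (fst g)) (tl e ! 0) (e ! 0)))"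
    using kind by (auto elim!: lc_cong simp: tl numeral_2_eq_2)
  ultimately show ?thesis
    unfolding accepts_def
    by (intro lc_intros lc_num lc_row lc_offset lc_neg_start lc_bound_pos lc_cell lc_base; (assumption | simp))
qed

subsection \<open>Correctness\<close>

lemma length_bitseq [simp]: "length (bitseq P w t) = t"
  by (induction t) auto

lemma bit_at_bitseq: "i < t \<Longrightarrow> bit_at (bitseq P w t) i \<longleftrightarrow> P (w, bitseq P w i) [i]"
proof (induction t)
  case (Suc t)
  then show ?case by (cases "i = t") (auto simp: bit_at_def nth_append)
qed simp

lemma digit_eq: "digit Z c i = c div Z ^ i mod Z"
proof -
  have "rec_nat c (\<lambda>_ x. x div Z) i = c div Z ^ i"
    by (induction i) (simp_all add: power_Suc2 div_mult2_eq del: power_Suc)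
  then show ?thesis by (simp add: digit_def)
qed

lemma digits_ex:
  assumes "\<And>i. i < L \<Longrightarrow> d i < Z"
  shows "\<exists>c<Z ^ L. \<forall>i<L. digit Z c i = d i"
  using assms
proof (induction L arbitrary: d)
  case (Suc L)
  obtain c where c: "c < Z ^ L" "\<forall>i<L. digit Z c i = d (Suc i)"
    using Suc.IH[of "\<lambda>i. d (Suc i)"] Suc.prems by auto
  have d0: "d 0 < Z" using Suc.prems by simp
  have "Z * c + d 0 < Z * (c + 1)" using d0 by simp
  also have "\<dots> \<le> Z * Z ^ L" using c(1) by (intro mult_left_mono) auto
  finally have "Z * c + d 0 < Z ^ Suc L" by simp
  moreover have "digit Z (Z * c + d 0) i = d i" if "i < Suc L" for i
  proof (cases i)
    case 0
    then show ?thesis using d0 by (simp add: digit_eq)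
  next
    case (Suc k)
    have "(Z * c + d 0) div Z = c" using d0 by simp
    then show ?thesis using c(2) that Suc by (simp add: digit_eq div_mult2_eq)
  qed
  ultimately show ?case by blast
qed simp

lemma fm_cong: "(\<And>i. i \<le> j \<Longrightarrow> sg i = sg' i) \<Longrightarrow> fm op sg j = fm op sg' j"
proof (induction j rule: less_induct)
  case (less j)
  obtain k x y z where sg: "sg j = (k, x, y, z)" by (metis prod_cases4)
  moreover have "sg' j = (k, x, y, z)" using less.prems[of j] sg by simp
  moreover have "fm op sg i = fm op sg' i" if "i < j" for i
    using less.IH[OF that] less.prems that by simp
  ultimately show ?case by (simp add: fm.simps[of op sg j] fm.simps[of op sg' j])
qed

context
  fixes op :: tempop and n :: nat and w :: "bool list"
begin

private abbreviation "J \<equiv> 5 * n + 3"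
private abbreviation "Z \<equiv> base n w"
private abbreviation "Y \<equiv> bit_at (bitseq (dp_bit op n) w (dp_length n w))"
private abbreviation "c_ok c \<equiv> c < Z ^ (4 * J)"

private lemma cell_decode:
  assumes "j < J" "s \<le> Z * Z" "z < Z" "q < Z"
  shows "cell n w c j s z q mod Z = q" "cell n w c j s z q div Z mod Z = z"
    "cell n w c j s z q div Z div Z mod Suc (Z * Z) = s"
    "cell n w c j s z q div Z div Z div Suc (Z * Z) mod J = j"
    "cell n w c j s z q div Z div Z div Suc (Z * Z) div J = c"
proof -
  have e: "(x * k + y) div k = x" "(x * k + y) mod k = y" if "y < k" for x y k :: nat
    using that by simp_all
  have d: "cell n w c j s z q div Z = ((c * J + j) * Suc (Z * Z) + s) * Z + z"
    unfolding cell_def by (rule e(1)[OF assms(4)])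
  have d2: "cell n w c j s z q div Z div Z = (c * J + j) * Suc (Z * Z) + s"
    unfolding d by (rule e(1)[OF assms(3)])
  have s: "s < Suc (Z * Z)" using assms(2) by simp
  have d3: "cell n w c j s z q div Z div Z div Suc (Z * Z) = c * J + j"
    unfolding d2 by (rule e(1)[OF s])
  show "cell n w c j s z q mod Z = q" unfolding cell_def by (rule e(2)[OF assms(4)])
  show "cell n w c j s z q div Z mod Z = z" unfolding d by (rule e(2)[OF assms(3)])
  show "cell n w c j s z q div Z div Z mod Suc (Z * Z) = s" unfolding d2 by (rule e(2)[OF s])
  show "cell n w c j s z q div Z div Z div Suc (Z * Z) mod J = j" unfolding d3 by (rule e(2)[OF assms(1)])
  show "cell n w c j s z q div Z div Z div Suc (Z * Z) div J = c" unfolding d3 by (rule e(1)[OF assms(1)])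
qed

private lemma radix_less: "x < x' \<Longrightarrow> y < k \<Longrightarrow> x * k + y < x' * (k::nat)"
proof -
  assume "x < x'" "y < k"
  then have "x * k + y < Suc x * k" by simp
  also have "\<dots> \<le> x' * k" using \<open>x < x'\<close> by (intro mult_right_mono) auto
  finally show ?thesis .
qed

text \<open>For a fixed code, cells are ordered by segment and then by stage. All bits consulted for
  a cell belong to an earlier segment or an earlier stage, so they are already in the table.\<close>

private lemma cell_less:
  assumes "j < j' \<or> (j = j' \<and> s < s')" "s \<le> Z * Z" "z < Z" "q < Z" "z' < Z" "q' < Z"
  shows "cell n w c j s z q < cell n w c j' s' z' q'"
proof -
  have "(c * J + j) * Suc (Z * Z) + s < (c * J + j') * Suc (Z * Z) + s'"
  proof (cases "j < j'")
    case True
    then have "(c * J + j) * Suc (Z * Z) + s < (c * J + j') * Suc (Z * Z)"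
      using assms(2) by (intro radix_less) auto
    then show ?thesis by simp
  qed (use assms in auto)
  then have "((c * J + j) * Suc (Z * Z) + s) * Z + z < ((c * J + j') * Suc (Z * Z) + s') * Z"
    using assms by (intro radix_less)
  then have "((c * J + j) * Suc (Z * Z) + s) * Z + z < ((c * J + j') * Suc (Z * Z) + s') * Z + z'" by simp
  then have "(((c * J + j) * Suc (Z * Z) + s) * Z + z) * Z + q < (((c * J + j') * Suc (Z * Z) + s') * Z + z') * Z"
    using assms by (intro radix_less)
  then show ?thesis unfolding cell_def by linarith
qed

private lemma cell_less_length:
  assumes "c_ok c" "j < J" "s \<le> Z * Z" "z < Z" "q < Z"
  shows "cell n w c j s z q < dp_length n w"
proof -
  have s: "s < Suc (Z * Z)" using assms(3) by simp
  from assms(1,2) have "c * J + j < Z ^ (4 * J) * J" by (rule radix_less)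
  from this s have "(c * J + j) * Suc (Z * Z) + s < Z ^ (4 * J) * J * Suc (Z * Z)"
    by (rule radix_less)
  from this assms(4) have "((c * J + j) * Suc (Z * Z) + s) * Z + z < Z ^ (4 * J) * J * Suc (Z * Z) * Z"
    by (rule radix_less)
  from this assms(5) have "(((c * J + j) * Suc (Z * Z) + s) * Z + z) * Z + q < Z ^ (4 * J) * J * Suc (Z * Z) * Z * Z"
    by (rule radix_less)
  then show ?thesis unfolding dp_length_def cell_def by simp
qed

private lemma Y_cell:
  assumes "c_ok c" "j < J" "s \<le> Z * Z" "z < Z" "q < Z"
  shows "Y (cell n w c j s z q) \<longleftrightarrow> next_bit op n (w, bitseq (dp_bit op n) w (cell n w c j s z q)) c j s z q"
  unfolding bit_at_bitseq[OF cell_less_length[OF assms]]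
  unfolding dp_bit_def fst_conv nth_Cons_0 cell_decode[OF assms(2-5)] ..

text \<open>The bits seen while a cell is computed are those of the finished table, because the
  table only grows at its end.\<close>

private lemma read_cell:
  assumes "i < cell n w c j s z q" "c_ok c" "j < J" "s \<le> Z * Z" "z < Z" "q < Z"
  shows "bit_at (bitseq (dp_bit op n) w (cell n w c j s z q)) i \<longleftrightarrow> Y i"
  using bit_at_bitseq[OF assms(1), of "dp_bit op n" w]
    bit_at_bitseq[of i "dp_length n w" "dp_bit op n" w] assms(1) cell_less_length[OF assms(2-)] by simp

private lemma Y_first:
  assumes c: "c_ok c" and j: "j < J" and z: "z < Z" and q: "q < Z"
    and sg: "seg_of Z c j = (k, x, y, l)" and good: "good (num w 0) Bl j (k, x, y, l)"
  shows "Y (cell n w c j 0 z q) \<longleftrightarrow>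
    (if k = 0 then num w (row_of w z q + 1 + x) \<noteq> 0
     else if k = 1 then eval_binop (bops ! l) (Y (cell n w c x (Z * Z) z q)) (Y (cell n w c y (Z * Z) z q))
     else Y (cell n w c x (Z * Z) z q))"
proof -
  have d: "digit Z c (4 * j) = k" "digit Z c (4 * j + 1) = x" "digit Z c (4 * j + 2) = y"
    "digit Z c (4 * j + 3) = l" using sg by (simp_all add: seg_of_def)
  have r: "bit_at (bitseq (dp_bit op n) w (cell n w c j 0 z q)) (cell n w c i (Z * Z) z q) \<longleftrightarrow>
      Y (cell n w c i (Z * Z) z q)" if "i < j" for i
    using that c j z q by (intro read_cell cell_less) auto
  show ?thesis
    unfolding Y_cell[OF c j le0 z q] next_bit_def first_bit_def fst_conv snd_conv d
    using good r by auto
qed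

private lemma ex_all_pairs:
  "(\<exists>\<alpha> \<in> (\<lambda>(a, b). h a b) ` ({..<k} \<times> {..<l}). \<forall>\<beta> \<in> (\<lambda>(a, b). h a b) ` ({..<k} \<times> {..<l}). R \<beta> \<alpha>) \<longleftrightarrow>
   (\<exists>a<k. \<exists>b<l. \<forall>a'<k. \<forall>b'<l. R (h a' b') (h a b))"
  for k l :: nat
  by force

private lemma Y_step:
  assumes c: "c_ok c" and j: "j < J" and s: "s < Z * Z" and z: "z < Z" and q: "q < Z"
    and sg: "seg_of Z c j = (k, x, y, l)"
    and valid: "valid_at (num w) (num w 0) z" and qz: "q < num w z" and y: "k = 2 \<Longrightarrow> y < 4"
  shows "Y (cell n w c j (Suc s) z q) \<longleftrightarrow>
    (if k = 2 \<and> s div Z < l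
     then upd op (cgs_at (num w) (num w 0) z) (letter y (s div Z)) (\<lambda>q. Y (cell n w c j s z q)) q
     else Y (cell n w c j s z q))"
proof -
  have d: "digit Z c (4 * j) = k" "digit Z c (4 * j + 2) = y"
    "digit Z c (4 * j + 3) = l" using sg by (simp_all add: seg_of_def)
  let ?g = "(w, bitseq (dp_bit op n) w (cell n w c j (Suc s) z q))"
  let ?C = "cgs_at (num w) (num w 0) z" and ?r = "row_of w z q"
  let ?n1 = "num w (?r + num w 0 + 1)" and ?n2 = "num w (?r + num w 0 + 2)"
  have r: "bit_at (snd ?g) (cell n w c j s z q') \<longleftrightarrow> Y (cell n w c j s z q')" if "q' < Z" for q'
    unfolding snd_conv using that c j s z q by (intro read_cell cell_less) auto
  have numZ: "num w i < Z" for i using num_le[of w i] by (simp add: base_def)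
  have force: "can_force ?g (cell n w c j s z 0) z q y' \<longleftrightarrow> pre ?C (coal y') (\<lambda>q. Y (cell n w c j s z q)) q" for y'
  proof -
    let ?t = "\<lambda>a b. num w (?r + 3 + num w 0 + (a * ?n2 + b))"
    have shift: "cell n w c j s z 0 + v = cell n w c j s z v" for v by (simp add: cell_def)
    have "can_force ?g (cell n w c j s z 0) z q y' \<longleftrightarrow> (\<exists>a<?n1. \<exists>b<?n2. \<forall>a'<?n1. \<forall>b'<?n2.
        ((y' mod 2 = 1 \<longrightarrow> a' = a) \<and> (2 \<le> y' \<longrightarrow> b' = b)) \<longrightarrow> Y (cell n w c j s z (?t a' b')))"
      unfolding can_force_def fst_conv shift r[OF numZ] ..
    also have "\<dots> \<longleftrightarrow> (\<exists>\<alpha> \<in> set (joint_actions 2 ?C q). \<forall>\<beta> \<in> set (joint_actions 2 ?C q).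
        (\<forall>a \<in> coal y'. \<beta> ! (a - 1) = \<alpha> ! (a - 1)) \<longrightarrow> Y (cell n w c j s z (delta ?C q \<beta>)))"
    proof -
      have ja: "set (joint_actions 2 ?C q) = (\<lambda>(a, b). [Suc a, Suc b]) ` ({..<?n1} \<times> {..<?n2})"
        unfolding set_joint_actions_2
      proof (intro set_eqI iffI)
        fix \<alpha> assume "\<alpha> \<in> {[a, b] | a b. 1 \<le> a \<and> a \<le> acts ?C q 1 \<and> 1 \<le> b \<and> b \<le> acts ?C q 2}"
        then obtain a b where "\<alpha> = [a, b]" "1 \<le> a" "a \<le> ?n1" "1 \<le> b" "b \<le> ?n2" by (auto simp: cgs_at_def)
        then show "\<alpha> \<in> (\<lambda>(a, b). [Suc a, Suc b]) ` ({..<?n1} \<times> {..<?n2})"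
          by (intro image_eqI[of _ _ "(a - 1, b - 1)"]) auto
      qed (auto simp: cgs_at_def)
      have co: "(\<forall>i \<in> coal y'. [Suc a', Suc b'] ! (i - 1) = [Suc a, Suc b] ! (i - 1)) \<longleftrightarrow>
          (y' mod 2 = 1 \<longrightarrow> a' = a) \<and> (2 \<le> y' \<longrightarrow> b' = b)" for a a' b b'
        by (auto simp: coal_def odd_iff_mod_2_eq_one)
      have de: "delta ?C q [Suc a', Suc b'] = ?t a' b'" for a' b' by (simp add: cgs_at_def)
      show ?thesis unfolding ja ex_all_pairs co de ..
    qed
    finally show ?thesis unfolding pre_def .
  qed
  have le: "Suc s \<le> Z * Z" using s by simp
  have l: "letter y (s div Z) = coal (if s div Z mod 2 = 0 then y else 3 - y)"
    by (simp add: letter_def even_iff_mod_2_eq_zero)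
  show ?thesis
    unfolding Y_cell[OF c j le z q] next_bit_def step_bit_def fst_conv d diff_Suc_1 r[OF q] force l upd_def
    by (cases op) auto
qed

text \<open>By induction on the segments, using the last stage of each; the cells of one structure
  \<open>z\<close> depend on no other structure.\<close>

lemma Y_sat:
  assumes c: "c_ok c" and good: "\<And>j. j < J \<Longrightarrow> good (num w 0) Bl j (seg_of Z c j)"
    and z: "z < Z" and valid: "valid_at (num w) (num w 0) z"
  shows "j < J \<Longrightarrow> q < num w z \<Longrightarrow> Y (cell n w c j (Z * Z) z q) \<longleftrightarrow>
    sat 2 (cgs_at (num w) (num w 0) z) (fm op (seg_of Z c) j) q"
proof (induction j arbitrary: q rule: less_induct)
  case (less j)
  let ?C = "cgs_at (num w) (num w 0) z" and ?sg = "seg_of Z c"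
  obtain k x y l where sg: "seg_of Z c j = (k, x, y, l)" by (metis prod_cases4)
  have g: "good (num w 0) Bl j (k, x, y, l)" using good[OF less.prems(1)] sg by simp
  have y4: "k = 2 \<Longrightarrow> y < 4" using g by auto
  have numZ: "num w i < Z" for i using num_le[of w i] by (simp add: base_def)
  have qZ: "q < Z" if "q < num w z" for q using that numZ[of z] by simp
  note first = Y_first[OF c less.prems(1) z _ sg g]
  have IH: "Y (cell n w c i (Z * Z) z q) \<longleftrightarrow> sat 2 ?C (fm op ?sg i) q" if "i < j" "q < num w z" for i q
    using less.IH[OF that(1) _ that(2)] that(1) less.prems(1) by simp
  consider "k = 0 \<or> k = 1" | "k = 2" using g by auto
  then show ?case
  proof cases
    case 1
    have "Y (cell n w c j s z q) \<longleftrightarrow> Y (cell n w c j 0 z q)" if "s \<le> Z * Z" for s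
      using that
    proof (induction s)
      case (Suc s)
      have s: "s < Z * Z" and k: "\<not> (k = 2 \<and> s div Z < l)" using Suc.prems 1 by auto
      have "Y (cell n w c j (Suc s) z q) \<longleftrightarrow> Y (cell n w c j s z q)"
        using Y_step[OF c less.prems(1) s z qZ[OF less.prems(2)] sg valid less.prems(2) y4]
        unfolding if_not_P[OF k] .
      then show ?case using Suc.IH[OF less_imp_le[OF s]] by (rule trans)
    qed (rule refl)
    from this[OF order_refl] have *: "Y (cell n w c j (Z * Z) z q) \<longleftrightarrow> Y (cell n w c j 0 z q)" .
    from 1 show ?thesis
    proof
      assume k: "k = 0"
      then have "fm op ?sg j = Atom x" by (simp add: fm.simps[of op ?sg j] sg)
      moreover have "x < num w 0" using g k by simp
      ultimately show ?thesis unfolding * using first[OF qZ[OF less.prems(2)]] k by (simp add: cgs_at_def)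
    next
      assume k: "k = 1"
      then have "x < j" "y < j" using g by auto
      then have "fm op ?sg j = Bin (bops ! l) (fm op ?sg x) (fm op ?sg y)"
        using k by (simp add: fm.simps[of op ?sg j] sg)
      then show ?thesis
        unfolding * using first[OF qZ[OF less.prems(2)]] k IH \<open>x < j\<close> \<open>y < j\<close> less.prems(2) by simp
    qed
  next
    case 2
    then have x: "x < j" using g by auto
    then have fm: "fm op ?sg j = chain op y l (fm op ?sg x)"
      using 2 by (simp add: fm.simps[of op ?sg j] sg)
    have lZ: "l < Z" using sg by (auto simp: seg_of_def digit_def base_def)
    have wf: "wf_cgs 2 {..<num w 0} ?C" by (rule wf_cgs_at[OF valid])
    have st: "q \<in> states ?C \<longleftrightarrow> q < num w z" for q by (simp add: cgs_at_def)
    have Z0: "0 < Z" by (simp add: base_def)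
    \<comment> \<open>After \<open>i * Z\<close> steps the lowest \<open>i\<close> operators of the
      chain are evaluated: each receives \<open>Z\<close> iterations, more than the structure has
      states.\<close>
    have stage: "i \<le> l \<Longrightarrow> q < num w z \<Longrightarrow> Y (cell n w c j (i * Z) z q) \<longleftrightarrow> sat 2 ?C (chain op y i (fm op ?sg x)) q"
      for i q
    proof (induction i arbitrary: q)
      case 0
      then show ?case using first[OF qZ[OF 0(2)]] 2 IH x by simp
    next
      case (Suc i)
      let ?P = "sat 2 ?C (chain op y i (fm op ?sg x))"
      have "r \<le> Z \<Longrightarrow> q < num w z \<Longrightarrow> Y (cell n w c j (i * Z + r) z q) \<longleftrightarrow> (upd op ?C (letter y i) ^^ r) ?P q" for r q
      proof (induction r arbitrary: q)
        case 0
        then show ?case using Suc.IH Suc.prems by simp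
      next
        case (Suc r)
        have div: "(i * Z + r) div Z = i" using Suc.prems(1) by simp
        have "i * Z + r < l * Z" using Suc.prems(1) \<open>Suc i \<le> l\<close> by (intro radix_less) auto
        also have "\<dots> \<le> Z * Z" using lZ by (intro mult_right_mono) auto
        finally have s: "i * Z + r < Z * Z" .
        have t: "k = 2 \<and> i < l" using 2 \<open>Suc i \<le> l\<close> by simp
        have "Y (cell n w c j (Suc (i * Z + r)) z q) \<longleftrightarrow>
            upd op ?C (letter y i) (\<lambda>q. Y (cell n w c j (i * Z + r) z q)) q"
          using Y_step[OF c less.prems(1) s z qZ[OF Suc.prems(2)] sg valid Suc.prems(2) y4]
          unfolding div if_P[OF t] .
        also have "\<dots> \<longleftrightarrow> upd op ?C (letter y i) ((upd op ?C (letter y i) ^^ r) ?P) q"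
        proof (rule upd_cong[OF wf])
          show "q \<in> states ?C" using st Suc.prems(2) by simp
          fix q assume "q \<in> states ?C"
          then show "Y (cell n w c j (i * Z + r) z q) \<longleftrightarrow> (upd op ?C (letter y i) ^^ r) ?P q"
            using Suc.IH[of q] Suc.prems(1) st by simp
        qed
        finally show ?case by simp
      qed
      from this[of Z q] have "Y (cell n w c j (Suc i * Z) z q) \<longleftrightarrow> (upd op ?C (letter y i) ^^ Z) ?P q"
        using Suc.prems(2) by (simp add: add.commute)
      also have "\<dots> \<longleftrightarrow> sat 2 ?C (Strat (letter y i) op (chain op y i (fm op ?sg x))) q"
        using numZ[of z] Suc.prems(2) st coal_agents
        by (intro sat_Strat[OF wf, symmetric]) (auto simp: card_cgs_at letter_def)
      finally show ?case by simp
    qed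
    have "Y (cell n w c j s z q) \<longleftrightarrow> Y (cell n w c j (l * Z) z q)" if "l * Z \<le> s" "s \<le> Z * Z" for s
      using that
    proof (induction s rule: dec_induct)
      case (step s)
      have "l \<le> s div Z" using step.hyps(1) Z0 by (simp add: less_eq_div_iff_mult_less_eq)
      then have k: "\<not> (k = 2 \<and> s div Z < l)" by simp
      have s: "s < Z * Z" using step.prems by simp
      have "Y (cell n w c j (Suc s) z q) \<longleftrightarrow> Y (cell n w c j s z q)"
        using Y_step[OF c less.prems(1) s z qZ[OF less.prems(2)] sg valid less.prems(2) y4]
        unfolding if_not_P[OF k] .
      then show ?case using step.IH[OF less_imp_le[OF s]] by (rule trans)
    qed (rule refl)
    moreover have "l * Z \<le> Z * Z" using lZ by (intro mult_right_mono) auto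
    ultimately have "Y (cell n w c j (Z * Z) z q) \<longleftrightarrow> Y (cell n w c j (l * Z) z q)" by blast
    then show ?thesis unfolding fm using stage[OF order_refl less.prems(2)] by simp
  qed
qed

end

section \<open>Agreement of words, codes and instances\<close>

definition decode :: "bool list \<Rightarrow> learn_instance" where
  "decode w = (num w 0,
     map (\<lambda>i. cgs_at (num w) (num w 0) (offset_of w 2 i)) [0..<num w 1],
     map (\<lambda>i. cgs_at (num w) (num w 0) (offset_of w (neg_start w + 1) i)) [0..<num w (neg_start w)],
     num w (bound_pos w))"

lemma zeros_le: "zeros w i \<le> i"
proof -
  have "zeros w i \<le> (\<Sum>i<i. 1)" unfolding zeros_def by (intro sum_mono) auto
  then show ?thesis by simp
qed

lemma offset_mono_le: "i \<le> j \<Longrightarrow> offset A m z i \<le> offset A m z j"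
  by (rule lift_Suc_mono_le[of "offset A m z"]) (rule offset_mono)

lemma offset_0: "offset A m z 0 = z"
  by (simp add: offset_def)

lemma offset_le: "z \<le> offset A m z i"
  using offset_mono_le[of 0 i A m z] by (simp add: offset_0)

lemma valid_instance_bound: "valid_instance w \<Longrightarrow> bound_pos w < length w"
  using zeros_le[of w "length w"] by (auto simp: valid_instance_def)

lemma init_cgs_at: "init (cgs_at A m z) = {q. q < A z \<and> A (row A m z q) \<noteq> 0}"
  by (simp add: cgs_at_def)

lemma accepts_iff_learnable:
  assumes valid: "valid_instance w"
  shows "(\<exists>c<base n w ^ (4 * (5 * n + 3)).
      accepts Bl n (w, bitseq (dp_bit op n) w (dp_length n w)) c) \<longleftrightarrow> learnable 2 {op} Bl n (decode w)"
proof -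
  let ?J = "5 * n + 3" and ?Z = "base n w" and ?m = "num w 0" and ?B = "num w (bound_pos w)"
  let ?Y = "bit_at (bitseq (dp_bit op n) w (dp_length n w))"
  let ?C = "cgs_at (num w) ?m" and ?p = "offset_of w 2" and ?q = "offset_of w (neg_start w + 1)"
  have pv: "valid_at (num w) ?m (?p i)" "?p i < ?Z" if "i < num w 1" for i
  proof -
    show "valid_at (num w) ?m (?p i)" using valid that by (auto simp: valid_instance_def)
    have "?p i \<le> neg_start w" unfolding neg_start_def using that by (intro offset_mono_le) simp
    also have "\<dots> \<le> bound_pos w" unfolding bound_pos_def using offset_le[of "neg_start w + 1" "num w"] by (meson add_leD1)
    finally show "?p i < ?Z" using valid_instance_bound[OF valid] by (simp add: base_def)
  qed
  have qv: "valid_at (num w) ?m (?q i)" "?q i < ?Z" if "i < num w (neg_start w)" for i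
  proof -
    show "valid_at (num w) ?m (?q i)" using valid that by (auto simp: valid_instance_def)
    have "?q i \<le> bound_pos w" unfolding bound_pos_def using that by (intro offset_mono_le) simp
    then show "?q i < ?Z" using valid_instance_bound[OF valid] by (simp add: base_def)
  qed
  have learn: "learnable 2 {op} Bl n (decode w) \<longleftrightarrow> (\<exists>\<phi> \<in> ATL 2 {..<?m} {op} Bl. form_size \<phi> \<le> ?B \<and> bin_size \<phi> \<le> n \<and>
      (\<forall>i<num w 1. \<forall>q<num w (?p i). num w (row_of w (?p i) q) \<noteq> 0 \<longrightarrow> sat 2 (?C (?p i)) \<phi> q) \<and>
      (\<forall>i<num w (neg_start w). \<exists>q<num w (?q i). num w (row_of w (?q i) q) \<noteq> 0 \<and> \<not> sat 2 (?C (?q i)) \<phi> q))"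
  proof -
    have p: "(\<forall>C \<in> set (map (\<lambda>i. ?C (?p i)) [0..<num w 1]). cgs_sat 2 C \<phi>) \<longleftrightarrow>
      (\<forall>i<num w 1. \<forall>q<num w (?p i). num w (row_of w (?p i) q) \<noteq> 0 \<longrightarrow> sat 2 (?C (?p i)) \<phi> q)" for \<phi>
      by (auto simp: cgs_sat_def init_cgs_at)
    have q: "(\<forall>C \<in> set (map (\<lambda>i. ?C (?q i)) [0..<num w (neg_start w)]). \<not> cgs_sat 2 C \<phi>) \<longleftrightarrow>
      (\<forall>i<num w (neg_start w). \<exists>q<num w (?q i). num w (row_of w (?q i) q) \<noteq> 0 \<and> \<not> sat 2 (?C (?q i)) \<phi> q)" for \<phi>
      by (auto simp: cgs_sat_def init_cgs_at)
    show ?thesis unfolding decode_def learnable.simps p q ..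
  qed
  show ?thesis
  proof
    assume "\<exists>c<?Z ^ (4 * ?J). accepts Bl n (w, bitseq (dp_bit op n) w (dp_length n w)) c"
    then obtain c where c: "c < ?Z ^ (4 * ?J)" "accepts Bl n (w, bitseq (dp_bit op n) w (dp_length n w)) c"
      by blast
    let ?sg = "seg_of ?Z c"
    let ?\<phi> = "fm op ?sg (5 * n + 2)"
    have good: "\<And>j. j < ?J \<Longrightarrow> good ?m Bl j (?sg j)"
      and weight: "(\<Sum>j<?J. weight (?sg j)) \<le> ?B"
      and bin: "(\<Sum>j<?J. of_bool (fst (?sg j) = 1)) \<le> n"
      and P: "\<And>i q. i < num w 1 \<Longrightarrow> q < num w (?p i) \<Longrightarrow> num w (row_of w (?p i) q) \<noteq> 0 \<Longrightarrow>
        ?Y (cell n w c (5 * n + 2) (?Z * ?Z) (?p i) q)"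
      and N: "\<And>i. i < num w (neg_start w) \<Longrightarrow> \<exists>q<num w (?q i). num w (row_of w (?q i) q) \<noteq> 0 \<and>
        \<not> ?Y (cell n w c (5 * n + 2) (?Z * ?Z) (?q i) q)"
      using c(2) unfolding accepts_def fst_conv snd_conv by blast+
    have j: "5 * n + 2 < ?J" by simp
    have Y: "?Y (cell n w c (5 * n + 2) (?Z * ?Z) z q) \<longleftrightarrow> sat 2 (?C z) ?\<phi> q"
      if "z < ?Z" "valid_at (num w) ?m z" "q < num w z" for z q
      by (rule Y_sat[OF c(1) _ that(1,2) j that(3)]) (rule good)
    have "?\<phi> \<in> ATL 2 {..<?m} {op} Bl" by (rule fm_ATL[OF good j])
    moreover have "form_size ?\<phi> \<le> ?B" "bin_size ?\<phi> \<le> n"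
      using code_sound[OF good j, of op] weight bin by (auto intro: order_trans)
    moreover have "sat 2 (?C (?p i)) ?\<phi> q"
      if "i < num w 1" "q < num w (?p i)" "num w (row_of w (?p i) q) \<noteq> 0" for i q
      using Y[OF pv(2,1)[OF that(1)] that(2)] P[OF that] by blast
    moreover have "\<exists>q<num w (?q i). num w (row_of w (?q i) q) \<noteq> 0 \<and> \<not> sat 2 (?C (?q i)) ?\<phi> q"
      if "i < num w (neg_start w)" for i
      using Y[OF qv(2,1)[OF that]] N[OF that] by blast
    ultimately show "learnable 2 {op} Bl n (decode w)" unfolding learn by blast
  next
    assume "learnable 2 {op} Bl n (decode w)"
    then obtain \<phi> where \<phi>: "\<phi> \<in> ATL 2 {..<?m} {op} Bl" "form_size \<phi> \<le> ?B" "bin_size \<phi> \<le> n"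
      and P: "\<And>i q. i < num w 1 \<Longrightarrow> q < num w (?p i) \<Longrightarrow> num w (row_of w (?p i) q) \<noteq> 0 \<Longrightarrow> sat 2 (?C (?p i)) \<phi> q"
      and N: "\<And>i. i < num w (neg_start w) \<Longrightarrow>
        \<exists>q<num w (?q i). num w (row_of w (?q i) q) \<noteq> 0 \<and> \<not> sat 2 (?C (?q i)) \<phi> q"
      unfolding learn by blast
    \<comment> \<open>Only normal forms need to have codes; passing to one preserves satisfaction
      and increases neither size.\<close>
    have nf: "nf \<phi> \<in> ATL 2 {..<?m} {op} Bl" "bin_size (nf \<phi>) \<le> n" "form_size (nf \<phi>) \<le> ?B"
      using nf_ATL[OF \<phi>(1)] bin_size_nf[of \<phi>] form_size_nf[of \<phi>] \<phi>(2,3) by auto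
    obtain sg where sg: "fm op sg (?J - 1) = nf \<phi>" "\<And>j. j < ?J \<Longrightarrow> good ?m Bl j (sg j)"
      "(\<Sum>j<?J. weight (sg j)) \<le> form_size (nf \<phi>)" "(\<Sum>j<?J. of_bool (fst (sg j) = 1)) \<le> n"
      "\<And>j k x y z. sg j = (k, x, y, z) \<Longrightarrow> k \<le> 2 \<and> x \<le> max ?m ?J \<and> y \<le> max 4 ?J \<and> z \<le> max 10 (form_size (nf \<phi>))"
      using code_complete[OF nf(1) alternating_nf nf(2)] by blast
    \<comment> \<open>The four components of all segments in a row, as the digits of one
      number.\<close>
    define d where "d = (\<lambda>i. case sg (i div 4) of (k, x, y, z) \<Rightarrow> [k, x, y, z] ! (i mod 4))"
    have "d i < ?Z" for i
    proof -
      obtain k x y z where s: "sg (i div 4) = (k, x, y, z)" by (metis prod_cases4)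
      have "?m \<le> length w" "?B \<le> length w" by (rule num_le)+
      then have "k < ?Z" "x < ?Z" "y < ?Z" "z < ?Z" using sg(5)[OF s] nf(3) by (auto simp: base_def)
      then have "\<forall>v \<in> set [k, x, y, z]. v < ?Z" by simp
      moreover have "i mod 4 < length [k, x, y, z]" by simp
      ultimately have "[k, x, y, z] ! (i mod 4) < ?Z" by (meson nth_mem)
      then show ?thesis by (simp add: d_def s)
    qed
    then obtain c where c: "c < ?Z ^ (4 * ?J)" "\<forall>i<4 * ?J. digit ?Z c i = d i"
      using digits_ex[of "4 * ?J" d ?Z] by blast
    have seg: "seg_of ?Z c j = sg j" if "j < ?J" for j
    proof -
      obtain k x y z where s: "sg j = (k, x, y, z)" by (metis prod_cases4)
      have "(4 * j + r) div 4 = j" "(4 * j + r) mod 4 = r" if "r < 4" for r using that by auto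
      then have "digit ?Z c (4 * j + r) = [k, x, y, z] ! r" if "r < 4" for r
        using c(2) \<open>j < ?J\<close> that by (simp add: d_def s)
      from this[of 0] this[of 1] this[of 2] this[of 3] show ?thesis by (simp add: seg_of_def s)
    qed
    have j: "5 * n + 2 < ?J" by simp
    have fm: "fm op (seg_of ?Z c) (5 * n + 2) = nf \<phi>"
      using fm_cong[of "5 * n + 2" "seg_of ?Z c" sg op] seg sg(1) by simp
    have good: "good ?m Bl j (seg_of ?Z c j)" if "j < ?J" for j using sg(2)[OF that] seg[OF that] by simp
    have Y: "?Y (cell n w c (5 * n + 2) (?Z * ?Z) z q) \<longleftrightarrow> sat 2 (?C z) \<phi> q"
      if "z < ?Z" "valid_at (num w) ?m z" "q < num w z" for z q
    proof -
      have "?Y (cell n w c (5 * n + 2) (?Z * ?Z) z q) \<longleftrightarrow> sat 2 (?C z) (fm op (seg_of ?Z c) (5 * n + 2)) q"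
        by (rule Y_sat[OF c(1) _ that(1,2) j that(3)]) (rule good)
      also have "\<dots> \<longleftrightarrow> sat 2 (?C z) \<phi> q"
        unfolding fm using that(3) by (intro sat_nf[OF wf_cgs_at[OF that(2)] \<phi>(1)]) (simp add: cgs_at_def)
      finally show ?thesis .
    qed
    have "accepts Bl n (w, bitseq (dp_bit op n) w (dp_length n w)) c"
      unfolding accepts_def fst_conv snd_conv
    proof (intro conjI allI impI)
      show "good ?m Bl j (seg_of ?Z c j)" if "j < ?J" for j by (rule good[OF that])
      have "(\<Sum>j<?J. weight (seg_of ?Z c j)) = (\<Sum>j<?J. weight (sg j))"
        by (intro sum.cong) (auto simp: seg)
      then show "(\<Sum>j<?J. weight (seg_of ?Z c j)) \<le> ?B" using sg(3) nf(3) by linarith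
      have "(\<Sum>j<?J. of_bool (fst (seg_of ?Z c j) = 1)) = (\<Sum>j<?J. of_bool (fst (sg j) = 1) :: nat)"
        by (intro sum.cong) (auto simp: seg)
      then show "(\<Sum>j<?J. of_bool (fst (seg_of ?Z c j) = 1)) \<le> n" using sg(4) by linarith
      show "?Y (cell n w c (5 * n + 2) (?Z * ?Z) (?p i) q)"
        if "i < num w 1" "q < num w (?p i)" "num w (row_of w (?p i) q) \<noteq> 0" for i q
        unfolding Y[OF pv(2,1)[OF that(1)] that(2)] by (rule P[OF that])
      show "\<exists>q<num w (?q i). num w (row_of w (?q i) q) \<noteq> 0 \<and>
          \<not> ?Y (cell n w c (5 * n + 2) (?Z * ?Z) (?q i) q)"
        if "i < num w (neg_start w)" for i
        using Y[OF qv(2,1)[OF that]] N[OF that] by blast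
    qed
    then show "\<exists>c<?Z ^ (4 * ?J). accepts Bl n (w, bitseq (dp_bit op n) w (dp_length n w)) c"
      using c(1) by blast
  qed
qed

lemma encode_decode:
  assumes valid: "valid_instance w"
  shows "wf_instance 2 (decode w)" "encode_instance 2 (decode w) = w"
proof -
  let ?A = "num w" and ?m = "num w 0" and ?e = "neg_start w" and ?b = "bound_pos w"
  obtain xs where xs: "w = encode_nats xs" using valid unfolding valid_instance_def encode_nats_iff[symmetric] by blast
  have A: "num w j = lk xs j" for j unfolding xs by (rule num_encode)
  have len: "length xs = ?b + 1" using valid zeros_encode[of xs] by (simp add: valid_instance_def xs)
  have p: "valid_at ?A ?m (offset_of w 2 i)" if "i < num w 1" for i
    using valid that by (auto simp: valid_instance_def)
  have q: "valid_at ?A ?m (offset_of w (?e + 1) i)" if "i < num w ?e" for i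
    using valid that by (auto simp: valid_instance_def)
  have wfz: "wf_cgs 2 {..<?m} (cgs_at ?A ?m z) \<and> states (cgs_at ?A ?m z) = {..<card (states (cgs_at ?A ?m z))}"
    if "valid_at ?A ?m z" for z
    using wf_cgs_at[OF that] by (simp add: cgs_at_def)
  show "wf_instance 2 (decode w)"
    unfolding decode_def wf_instance.simps
  proof (rule ballI)
    fix C assume "C \<in> set (map (\<lambda>i. cgs_at ?A ?m (offset_of w 2 i)) [0..<num w 1]) \<union>
      set (map (\<lambda>i. cgs_at ?A ?m (offset_of w (?e + 1) i)) [0..<num w ?e])"
    then obtain z where "C = cgs_at ?A ?m z" "valid_at ?A ?m z" using p q by auto
    then show "wf_cgs 2 {..<?m} C \<and> states C = {..<card (states C)}" using wfz by blast
  qed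
  have "?m # num w 1 # map ?A [2..<?e] @ num w ?e # map ?A [?e + 1..<?b] @ [num w ?b] = map ?A [0..<?b + 1]"
  proof -
    have e: "2 \<le> ?e" unfolding neg_start_def by (rule offset_le)
    have b: "?e + 1 \<le> ?b" unfolding bound_pos_def by (rule offset_le)
    have "[0..<?b + 1] = [0..<2] @ [2..<?e] @ [?e..<?b + 1]"
      using upt_add_eq_append[of 0 2 "?b - 1"] upt_add_eq_append[of 2 "?e" "?b + 1 - ?e"]
        upt_add_eq_append[of 2 "?e - 2 + 2" 0] e b
      by (metis append_assoc le_add_diff_inverse le_trans upt_add_eq_append le0 le_add1)
    moreover have "[?e..<?b + 1] = ?e # [?e + 1..<?b] @ [?b]" using b by (simp add: upt_conv_Cons)
    moreover have "[0..<2] = [0, 1::nat]" by (simp add: upt_rec)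
    ultimately show ?thesis by simp
  qed
  also have "map ?A [0..<?b + 1] = xs" by (rule nth_equalityI) (auto simp: len A lk_def simp del: upt_Suc)
  finally have "encode_nats (?m # num w 1 # map ?A [2..<?e] @ num w ?e # map ?A [?e + 1..<?b] @ [num w ?b]) = w"
    using xs by simp
  moreover have "concat (map (flatten_cgs 2 ?m) (map (\<lambda>i. cgs_at ?A ?m (offset_of w 2 i)) [0..<num w 1])) = map ?A [2..<?e]"
    unfolding neg_start_def by (rule flatten_list_at[OF p])
  moreover have "concat (map (flatten_cgs 2 ?m) (map (\<lambda>i. cgs_at ?A ?m (offset_of w (?e + 1) i)) [0..<num w ?e])) =
      map ?A [?e + 1..<?b]"
    unfolding bound_pos_def by (rule flatten_list_at[OF q])
  ultimately show "encode_instance 2 (decode w) = w"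
    by (simp only: decode_def encode_instance.simps length_map length_upt diff_zero)
qed

text \<open>Decoding recovers the structures only up to values outside their intended domains, so
  the claim is equivalence of learnability and not equality of instances.\<close>

lemma decode_encode:
  assumes wf: "wf_instance 2 x"
  shows "valid_instance (encode_instance 2 x)"
    and "learnable 2 Ut Bl n (decode (encode_instance 2 x)) \<longleftrightarrow> learnable 2 Ut Bl n x"
proof -
  obtain m Ps Ns B where x: "x = (m, Ps, Ns, B)" by (metis prod_cases4)
  let ?u = "concat (map (flatten_cgs 2 m) Ps)" and ?v = "concat (map (flatten_cgs 2 m) Ns)"
  define xs where "xs = m # length Ps # ?u @ length Ns # ?v @ [B]"
  define w where "w = encode_instance 2 x"
  have w: "w = encode_nats xs" by (simp add: w_def x xs_def)
  have A: "num w j = lk xs j" for j unfolding w by (rule num_encode)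
  have m: "num w 0 = m" "num w 1 = length Ps" by (simp_all add: A lk_def xs_def)
  have wfP: "wf_cgs 2 {..<m} C \<and> states C = {..<card (states C)}" if "C \<in> set Ps" for C
    using wf that by (auto simp: x)
  have wfN: "wf_cgs 2 {..<m} C \<and> states C = {..<card (states C)}" if "C \<in> set Ns" for C
    using wf that by (auto simp: x)
  have sP: "num w (2 + i) = ?u ! i" if "i < length ?u" for i
    using that by (simp add: A lk_def xs_def nth_append)
  note P = stored_list[OF wfP sP]
  have e: "neg_start w = 2 + length ?u" unfolding neg_start_def m using P by simp
  have nN: "num w (neg_start w) = length Ns" unfolding e by (simp add: A lk_def xs_def)
  have sN: "num w (neg_start w + 1 + i) = ?v ! i" if "i < length ?v" for i
    unfolding e using that by (simp add: A lk_def xs_def nth_append nth_Cons')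
  note N = stored_list[OF wfN sN]
  have b: "bound_pos w = neg_start w + 1 + length ?v" unfolding bound_pos_def m nN using N by simp
  have B: "num w (bound_pos w) = B" unfolding b e by (simp add: A lk_def xs_def nth_append nth_Cons')
  have "zeros w (length w) = bound_pos w + 1" unfolding b e by (simp add: w zeros_encode xs_def)
  moreover have "\<not> bit_at w (length w - 1)" using w encode_nats_iff by blast
  ultimately have valid: "valid_instance w" using P N unfolding valid_instance_def m nN by blast
  then show "valid_instance (encode_instance 2 x)" by (simp add: w_def)
  let ?p = "\<lambda>i. cgs_at (num w) m (offset_of w 2 i)" and ?q = "\<lambda>i. cgs_at (num w) m (offset_of w (neg_start w + 1) i)"
  have cs: "cgs_sat 2 (cgs_at (num w) m z) \<phi> \<longleftrightarrow> cgs_sat 2 C \<phi>"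
    if same: "same_cgs (cgs_at (num w) m z) C" and v: "valid_at (num w) m z"
      and wf: "wf_cgs 2 {..<m} C" and \<phi>: "\<phi> \<in> ATL 2 {..<m} Ut Bl" for z C \<phi>
  proof -
    have "init C \<subseteq> states C" using wf by (simp add: wf_cgs_def)
    moreover have i: "init (cgs_at (num w) m z) = init C" "states (cgs_at (num w) m z) = states C"
      using same by (simp_all add: same_cgs_def)
    ultimately have "sat 2 (cgs_at (num w) m z) \<phi> q \<longleftrightarrow> sat 2 C \<phi> q" if "q \<in> init C" for q
      using same_cgs_sat[OF same wf_cgs_at[OF v] wf \<phi>, of q] that by blast
    then show ?thesis unfolding cgs_sat_def i by blast
  qed
  have "(\<forall>C\<in>set (map ?p [0..<length Ps]). cgs_sat 2 C \<phi>) \<longleftrightarrow> (\<forall>C\<in>set Ps. cgs_sat 2 C \<phi>)"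
    if \<phi>: "\<phi> \<in> ATL 2 {..<m} Ut Bl" for \<phi>
  proof -
    have "(\<forall>C\<in>set (map ?p [0..<length Ps]). cgs_sat 2 C \<phi>) \<longleftrightarrow> (\<forall>i<length Ps. cgs_sat 2 (?p i) \<phi>)" by auto
    also have "\<dots> \<longleftrightarrow> (\<forall>i<length Ps. cgs_sat 2 (Ps ! i) \<phi>)"
      using P cs[OF _ _ _ \<phi>] wfP nth_mem unfolding m by metis
    also have "\<dots> \<longleftrightarrow> (\<forall>C\<in>set Ps. cgs_sat 2 C \<phi>)" by (metis in_set_conv_nth)
    finally show ?thesis .
  qed
  moreover have "(\<forall>C\<in>set (map ?q [0..<length Ns]). \<not> cgs_sat 2 C \<phi>) \<longleftrightarrow> (\<forall>C\<in>set Ns. \<not> cgs_sat 2 C \<phi>)"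
    if \<phi>: "\<phi> \<in> ATL 2 {..<m} Ut Bl" for \<phi>
  proof -
    have "(\<forall>C\<in>set (map ?q [0..<length Ns]). \<not> cgs_sat 2 C \<phi>) \<longleftrightarrow> (\<forall>i<length Ns. \<not> cgs_sat 2 (?q i) \<phi>)" by auto
    also have "\<dots> \<longleftrightarrow> (\<forall>i<length Ns. \<not> cgs_sat 2 (Ns ! i) \<phi>)"
      using N cs[OF _ _ _ \<phi>] wfN nth_mem unfolding m by metis
    also have "\<dots> \<longleftrightarrow> (\<forall>C\<in>set Ns. \<not> cgs_sat 2 C \<phi>)" by (metis in_set_conv_nth)
    finally show ?thesis .
  qed
  ultimately have "learnable 2 Ut Bl n (decode w) \<longleftrightarrow> learnable 2 Ut Bl n x"
    unfolding x decode_def m nN B learnable.simps by (intro bex_cong) auto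
  then show "learnable 2 Ut Bl n (decode (encode_instance 2 x)) \<longleftrightarrow> learnable 2 Ut Bl n x"
    by (simp add: w_def)
qed

lemma ATL_Learn_iff:
  "w \<in> ATL_Learn 2 Ut Bl n \<longleftrightarrow> valid_instance w \<and> learnable 2 Ut Bl n (decode w)"
proof
  assume "w \<in> ATL_Learn 2 Ut Bl n"
  then obtain x where "w = encode_instance 2 x" "wf_instance 2 x" "learnable 2 Ut Bl n x"
    by (auto simp: ATL_Learn_def)
  then show "valid_instance w \<and> learnable 2 Ut Bl n (decode w)" using decode_encode by metis
next
  assume "valid_instance w \<and> learnable 2 Ut Bl n (decode w)"
  then show "w \<in> ATL_Learn 2 Ut Bl n"
    using encode_decode[of w] unfolding ATL_Learn_def by (intro CollectI exI[of _ "decode w"]) simp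
qed

lemma encode_ATL_Learn:
  "wf_instance 2 x \<Longrightarrow> encode_instance 2 x \<in> ATL_Learn 2 Ut Bl n \<longleftrightarrow> learnable 2 Ut Bl n x"
  unfolding ATL_Learn_iff using decode_encode by blast

theorem polytime_ATL_Learn: "polytime (ATL_Learn 2 {op} Bl n)"
proof -
  let ?Q = "\<lambda>g e. valid_instance (fst g) \<and>
    (\<exists>c<base n (fst g) ^ (4 * (5 * n + 3)). accepts Bl n g c)"
  have "lb 0 ?Q"
    using lb_accepts by (intro lb_conj lb_valid_instance lb_ex lc_power lc_base) simp
  from polytime_lc[OF lc_dp_length[of 0 n] lb_dp_bit[of op n] this]
  have "polytime {w. ?Q (w, bitseq (dp_bit op n) w (dp_length n w)) []}" by simp
  moreover have "?Q (w, bitseq (dp_bit op n) w (dp_length n w)) [] \<longleftrightarrow> w \<in> ATL_Learn 2 {op} Bl n" for w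
    unfolding ATL_Learn_iff fst_conv using accepts_iff_learnable[of w n Bl op] by blast
  ultimately show ?thesis by simp
qed

section \<open>Hardness\<close>

type_synonym local_view = "nat \<times> insym \<times> nat list"

text \<open>A halted machine keeps rewriting what it scans and does not move, as \<open>step\<close>
  leaves its configuration alone; the answer therefore can be read at one fixed time.\<close>

fun eff :: "tm \<Rightarrow> local_view \<Rightarrow> nat \<times> move \<times> (nat \<times> move) list \<times> bool option" where
  "eff M (q, s, as) = (if q = acc M \<or> q = rej M then (q, Stay, map (\<lambda>a. (a, Stay)) as, None)
     else trans M q s as)"

text \<open>A list fixed by the machine alone, so that case distinctions over it are finite
  disjunctions in programs and \<open>trans\<close> only contributes constants.\<close>

definition local_views :: "tm \<Rightarrow> local_view list" where
  "local_views M = List.product [0..<num_states M] (List.product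
     [Left_End, Bit False, Bit True, Right_End] (List.n_lists (num_tapes M) [0..<num_syms M]))"

declare eff.simps [simp del]

lemma local_views_iff:
  "(q, s, as) \<in> set (local_views M) \<longleftrightarrow>
     q < num_states M \<and> length as = num_tapes M \<and> set as \<subseteq> {..<num_syms M}"
proof -
  have "s \<in> set [Left_End, Bit False, Bit True, Right_End]"
  proof (cases s)
    case (Bit b)
    then show ?thesis by (cases b) simp_all
  qed simp_all
  moreover have "as \<in> set (List.n_lists (num_tapes M) [0..<num_syms M]) \<longleftrightarrow>
      length as = num_tapes M \<and> set as \<subseteq> {..<num_syms M}"
    unfolding set_n_lists by (simp add: atLeast0LessThan)
  ultimately show ?thesis
    unfolding local_views_def set_product mem_Times_iff fst_conv snd_conv by simp
qed

text \<open>
  A view of a configuration is a number whose digits are the state, the position of the input head,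
  the positions of the work heads and the scanned work symbols.
\<close>

locale reduction =
  fixes M :: tm and d :: nat
  assumes wf: "wf_tm M"
begin

abbreviation "k \<equiv> num_tapes M"

lemma trans_wf:
  assumes "q < num_states M" "length rs = k" "set rs \<subseteq> {..<num_syms M}" and tr: "trans M q s rs = (q', mv, us, b)"
  shows "q' < num_states M" "length us = k" "fst ` set us \<subseteq> {..<num_syms M}"
proof -
  have "\<forall>q < num_states M. \<forall>s rs. length rs = num_tapes M \<and> set rs \<subseteq> {..<num_syms M} \<longrightarrow>
        (case trans M q s rs of (q', mv, ws, z) \<Rightarrow>
           q' < num_states M \<and> length ws = num_tapes M \<and> fst ` set ws \<subseteq> {..<num_syms M})"
    using wf unfolding wf_tm_def by (elim conjE)
  from this[THEN spec, THEN mp, OF assms(1), THEN spec, THEN spec, THEN mp, OF conjI[OF assms(2,3)], of s]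
  show "q' < num_states M" "length us = k" "fst ` set us \<subseteq> {..<num_syms M}"
    unfolding tr by simp_all
qed

definition time :: "bool list \<Rightarrow> nat" where
  "time w = (length w + 2) ^ d"

text \<open>Exceeds every digit of a view up to time \<open>time w\<close>: states, symbols, input
  positions up to \<open>length w + 1\<close>, and work heads, which move at most one cell per
  step.\<close>

definition radix :: "bool list \<Rightarrow> nat" where
  "radix w = time w + length w + num_states M + num_syms M + 2"

definition views :: "bool list \<Rightarrow> nat" where
  "views w = radix w ^ (2 * k + 2)"

abbreviation dig :: "bool list \<Rightarrow> nat \<Rightarrow> nat \<Rightarrow> nat" where
  "dig w \<equiv> digit (radix w)"

definition reads :: "bool list \<Rightarrow> nat \<Rightarrow> insym \<Rightarrow> bool" where
  "reads w i s \<longleftrightarrow> (case s of Left_End \<Rightarrow> i = 0 | Bit b \<Rightarrow> 0 < i \<and> i \<le> length w \<and> (bit_at w (i - Suc 0) \<longleftrightarrow> b)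
     | Right_End \<Rightarrow> length w < i)"

definition matches :: "bool list \<Rightarrow> nat \<Rightarrow> local_view \<Rightarrow> bool" where
  "matches w u x \<longleftrightarrow> dig w u 0 = fst x \<and> reads w (dig w u 1) (fst (snd x)) \<and>
     (\<forall>j\<in>set [0..<k]. dig w u (2 + k + j) = snd (snd x) ! j)"

text \<open>Compares state and head positions only. The symbols scanned in \<open>v\<close> may have
  been written long ago, so they are left to the separate claims about cells.\<close>

definition follows :: "bool list \<Rightarrow> nat \<Rightarrow> nat \<Rightarrow> bool" where
  "follows w u v \<longleftrightarrow> (\<exists>x\<in>set (local_views M). matches w u x \<and> dig w v 0 = fst (eff M x) \<and>
     dig w v 1 = min (move_head (fst (snd (eff M x))) (dig w u 1)) (length w + 1) \<and>
     (\<forall>j\<in>set [0..<k]. dig w v (2 + j) = move_head (snd (fst (snd (snd (eff M x))) ! j)) (dig w u (2 + j))))"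

text \<open>The tape number is compared with each constant \<open>i\<close>, because the table of
  \<open>eff\<close> can be consulted at constant indices only.\<close>

definition writes :: "bool list \<Rightarrow> nat \<Rightarrow> nat \<Rightarrow> nat \<Rightarrow> bool" where
  "writes w u j a \<longleftrightarrow> (\<exists>i\<in>set [0..<k]. j = i \<and>
     (\<exists>x\<in>set (local_views M). matches w u x \<and> a = fst (fst (snd (snd (eff M x))) ! i)))"

definition initial :: "bool list \<Rightarrow> nat \<Rightarrow> bool" where
  "initial w v \<longleftrightarrow> dig w v 0 = start M \<and> dig w v 1 = 0 \<and>
     (\<forall>j\<in>set [0..<k]. dig w v (2 + j) = 0 \<and> dig w v (2 + k + j) = 0)"

text \<open>
  The game positions are \<open>0\<close> (won by player \<open>1\<close>), \<open>1\<close> (lost), \<open>2\<close> (initial) and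
  \<^term>\<open>pos w t r v\<close>, which claims for \<open>r = 0\<close> that \<open>v\<close> is the view at time \<open>t\<close>, and for
  \<open>r = j + 1\<close> that at time \<open>t\<close> the cell of tape \<open>j\<close> named by \<open>v\<close> contains the symbol given by \<open>v\<close>.
  Player \<open>1\<close> names the view \<open>u\<close> at the preceding time, and player \<open>2\<close> chooses which of the claims
  that together imply the current one is examined next.
\<close>

definition pos :: "bool list \<Rightarrow> nat \<Rightarrow> nat \<Rightarrow> nat \<Rightarrow> nat" where
  "pos w t r v = 3 + ((t * (k + 1) + r) * views w + v)"

text \<open>For a cell claim the named view \<open>u\<close> decides: if the head stood on the cell,
  the symbol just written must be the claimed one, otherwise the claim is carried back one step. As
  this relies on \<open>u\<close>, player \<open>2\<close> can always have \<open>u\<close> itself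
  examined. At time \<open>0\<close> the claims are checked directly.\<close>

definition move_to :: "bool list \<Rightarrow> nat \<Rightarrow> nat \<Rightarrow> nat \<Rightarrow> nat \<Rightarrow> nat \<Rightarrow> nat" where
  "move_to w t r v u c =
     (if t = 0 then
        if r = 0 then if initial w v then 0 else 1
        else if dig w v (2 + k + (r - Suc 0)) = 0 then 0 else 1
      else if r = 0 then
        if follows w u v then if c = 0 then pos w (t - Suc 0) 0 u else pos w t c v else 1
      else if dig w u (2 + (r - Suc 0)) = dig w v (2 + (r - Suc 0)) then
        if writes w u (r - Suc 0) (dig w v (2 + k + (r - Suc 0))) then pos w (t - Suc 0) 0 u else 1
      else if c = 0 then pos w (t - Suc 0) 0 u else pos w (t - Suc 0) r v)"

definition next_pos :: "bool list \<Rightarrow> nat \<Rightarrow> nat \<Rightarrow> nat \<Rightarrow> nat" where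
  "next_pos w x u c =
     (if x < 2 then x
      else if x = 2 then if dig w u 0 = acc M then pos w (time w) 0 u else 1
      else move_to w ((x - 3) div views w div (k + 1)) ((x - 3) div views w mod (k + 1))
        ((x - 3) mod views w) u c)"

definition size_of :: "bool list \<Rightarrow> nat" where
  "size_of w = 3 + (time w + 1) * (k + 1) * views w"

text \<open>Positions \<open>0\<close> and \<open>1\<close> are absorbing and every play reaches one
  of them, because time decreases at least in every second move. Hence reaching \<open>0\<close> and
  avoiding \<open>1\<close> describe the same game.\<close>

definition goal :: "tempop \<Rightarrow> nat \<Rightarrow> bool" where
  "goal op x \<longleftrightarrow> (if op = Finally then x = 0 else x \<noteq> 1)"

definition game :: "tempop \<Rightarrow> bool list \<Rightarrow> (nat, nat) cgs" where
  "game op w = \<lparr>states = {..<size_of w}, init = {2}, label = \<lambda>x. if goal op x then {0} else {},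
     acts = \<lambda>x a. if a = 1 then views w else k + 1, delta = \<lambda>x \<alpha>. next_pos w x (\<alpha> ! 0 - 1) (\<alpha> ! 1 - 1)\<rparr>"

subsection \<open>The game simulates the machine\<close>

lemma views_pos: "0 < views w"
  by (simp add: views_def radix_def)

abbreviation tape_at :: "bool list \<Rightarrow> nat \<Rightarrow> nat \<Rightarrow> nat \<Rightarrow> nat" where
  "tape_at w t j \<equiv> fst (work (run M w t) ! j)"

abbreviation head_at :: "bool list \<Rightarrow> nat \<Rightarrow> nat \<Rightarrow> nat" where
  "head_at w t j \<equiv> snd (work (run M w t) ! j)"

abbreviation scanned :: "bool list \<Rightarrow> nat \<Rightarrow> nat list" where
  "scanned w t \<equiv> map (\<lambda>(f, h). f h) (work (run M w t))"

abbreviation local_at :: "bool list \<Rightarrow> nat \<Rightarrow> local_view" where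
  "local_at w t \<equiv> (state (run M w t), read_input w (in_pos (run M w t)),
     scanned w t)"

lemma nth_scanned: "j < length (work (run M w t)) \<Longrightarrow> scanned w t ! j = tape_at w t j (head_at w t j)"
  by (simp add: case_prod_beta)

lemma run_not_halted:
  assumes nh: "\<not> halted M (run M w t)" and len: "length (work (run M w t)) = k"
    and us: "length us = k"
    and tr: "trans M (state (run M w t)) (read_input w (in_pos (run M w t))) (scanned w t) = (q', mv, us, b)"
  shows "state (run M w (Suc t)) = q'"
    "in_pos (run M w (Suc t)) = min (move_head mv (in_pos (run M w t))) (length w + 1)"
    "length (work (run M w (Suc t))) = k"
    "j < k \<Longrightarrow> work (run M w (Suc t)) ! j =
       ((tape_at w t j)(head_at w t j := fst (us ! j)), move_head (snd (us ! j)) (head_at w t j))"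
proof -
  have st: "run M w (Suc t) = step M w (run M w t)" by (simp add: run_def)
  note s = st[unfolded step_def if_not_P[OF nh] tr prod.case]
  show "state (run M w (Suc t)) = q'"
    "in_pos (run M w (Suc t)) = min (move_head mv (in_pos (run M w t))) (length w + 1)"
    "length (work (run M w (Suc t))) = k"
    unfolding s using len us by simp_all
  show "work (run M w (Suc t)) ! j =
       ((tape_at w t j)(head_at w t j := fst (us ! j)), move_head (snd (us ! j)) (head_at w t j))" if "j < k"
    unfolding s using len us that by (simp add: case_prod_beta)
qed

lemma run_halted: "halted M (run M w t) \<Longrightarrow> run M w (Suc t) = run M w t"
  by (simp add: run_def step_def)

lemma run_invariant:
  "state (run M w t) < num_states M \<and> in_pos (run M w t) \<le> length w + 1 \<and>
   length (work (run M w t)) = k \<and> (\<forall>j<k. head_at w t j \<le> t \<and> (\<forall>i. tape_at w t j i < num_syms M))"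
proof (induction t)
  case 0
  then show ?case using wf by (auto simp: run_def init_config_def wf_tm_def)
next
  case (Suc t)
  let ?c = "run M w t"
  show ?case
  proof (cases "halted M ?c")
    case True
    then show ?thesis using Suc by (simp only: run_halted[OF True]) (auto intro: le_SucI)
  next
    case False
    obtain q' mv us b where tr: "trans M (state ?c) (read_input w (in_pos ?c)) (scanned w t) = (q', mv, us, b)"
      by (metis prod_cases4)
    have len: "length (work ?c) = k" using Suc by blast
    have as: "length (scanned w t) = num_tapes M \<and> set (scanned w t) \<subseteq> {..<num_syms M}"
    proof
      show "length (scanned w t) = num_tapes M" using len by simp
      show "set (scanned w t) \<subseteq> {..<num_syms M}"
      proof
        fix a assume "a \<in> set (scanned w t)"
        then obtain j where "j < k" "a = scanned w t ! j" using len by (metis in_set_conv_nth length_map)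
        then show "a \<in> {..<num_syms M}" using nth_scanned[of j w t] Suc len by simp
      qed
    qed
    have "state ?c < num_states M" using Suc by blast
    note wfs = trans_wf[OF this as[THEN conjunct1] as[THEN conjunct2] tr]
    have us: "fst (us ! j) < num_syms M" if "j < k" for j
      using wfs(2,3) that by (metis image_subset_iff lessThan_iff nth_mem)
    have mv: "move_head m h \<le> Suc h" for m h by (cases m) auto
    have hd: "move_head m (head_at w t j) \<le> Suc t" if "j < k" for m j
      using Suc that mv[of m "head_at w t j"] by (meson Suc_le_mono order_trans)
    note r = run_not_halted[OF False len wfs(2) tr]
    have "\<forall>j<k. head_at w (Suc t) j \<le> Suc t \<and> (\<forall>i. tape_at w (Suc t) j i < num_syms M)"
      using r(4) hd us Suc by simp
    then show ?thesis using r(1,2,3) wfs(1) by simp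
  qed
qed

lemma local_at_in: "local_at w t \<in> set (local_views M)"
proof -
  note inv = run_invariant[of w t]
  have "a < num_syms M" if a: "a \<in> set (scanned w t)" for a
  proof -
    obtain j where "j < k" "a = scanned w t ! j" using a inv by (metis in_set_conv_nth length_map)
    then show ?thesis using nth_scanned[of j w t] inv by simp
  qed
  then have "set (scanned w t) \<subseteq> {..<num_syms M}" by blast
  then show ?thesis unfolding local_views_iff using inv by simp
qed

lemma run_step:
  "state (run M w (Suc t)) = fst (eff M (local_at w t))"
  "in_pos (run M w (Suc t)) =
     min (move_head (fst (snd (eff M (local_at w t)))) (in_pos (run M w t))) (length w + 1)"
  "j < k \<Longrightarrow> work (run M w (Suc t)) ! j =
     ((tape_at w t j)(head_at w t j := fst (fst (snd (snd (eff M (local_at w t)))) ! j)),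
      move_head (snd (fst (snd (snd (eff M (local_at w t)))) ! j)) (head_at w t j))"
proof -
  let ?c = "run M w t"
  note inv = run_invariant[of w t]
  have "state (run M w (Suc t)) = fst (eff M (local_at w t)) \<and> in_pos (run M w (Suc t)) =
     min (move_head (fst (snd (eff M (local_at w t)))) (in_pos ?c)) (length w + 1) \<and>
    (\<forall>j<k. work (run M w (Suc t)) ! j = ((tape_at w t j)(head_at w t j := fst (fst (snd (snd (eff M (local_at w t)))) ! j)),
      move_head (snd (fst (snd (snd (eff M (local_at w t)))) ! j)) (head_at w t j)))"
  proof (cases "halted M ?c")
    case True
    then have e: "eff M (local_at w t) = (state ?c, Stay, map (\<lambda>a. (a, Stay)) (scanned w t), None)"
      by (simp add: halted_def eff.simps)
    have "j < k \<Longrightarrow> map (\<lambda>a. (a, Stay)) (scanned w t) ! j = (tape_at w t j (head_at w t j), Stay)" for j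
      using inv nth_scanned[of j w t] by simp
    then show ?thesis using inv unfolding e run_halted[OF True] by simp
  next
    case False
    then have e: "eff M (local_at w t) =
        trans M (state ?c) (read_input w (in_pos ?c)) (scanned w t)"
      by (simp add: halted_def eff.simps)
    obtain q' mv us b where tr: "trans M (state ?c) (read_input w (in_pos ?c)) (scanned w t) = (q', mv, us, b)"
      by (metis prod_cases4)
    have in': "state ?c < num_states M" "length (scanned w t) = num_tapes M \<and> set (scanned w t) \<subseteq> {..<num_syms M}"
      using local_at_in[of w t] unfolding local_views_iff by simp_all
    have "length us = k" by (rule trans_wf(2)[OF in'(1) in'(2)[THEN conjunct1] in'(2)[THEN conjunct2] tr])
    from run_not_halted[OF False _ this tr] show ?thesis using inv unfolding e tr by simp
  qed
  then show "state (run M w (Suc t)) = fst (eff M (local_at w t))"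
    "in_pos (run M w (Suc t)) =
       min (move_head (fst (snd (eff M (local_at w t)))) (in_pos (run M w t))) (length w + 1)"
    "j < k \<Longrightarrow> work (run M w (Suc t)) ! j =
     ((tape_at w t j)(head_at w t j := fst (fst (snd (snd (eff M (local_at w t)))) ! j)),
      move_head (snd (fst (snd (snd (eff M (local_at w t)))) ! j)) (head_at w t j))"
    by blast+
qed

definition view_at :: "bool list \<Rightarrow> nat \<Rightarrow> nat \<Rightarrow> bool" where
  "view_at w t v \<longleftrightarrow> dig w v 0 = state (run M w t) \<and> dig w v 1 = in_pos (run M w t) \<and>
     (\<forall>j<k. dig w v (2 + j) = head_at w t j \<and> dig w v (2 + k + j) = tape_at w t j (head_at w t j))"

definition cell_at :: "bool list \<Rightarrow> nat \<Rightarrow> nat \<Rightarrow> nat \<Rightarrow> bool" where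
  "cell_at w t j v \<longleftrightarrow> dig w v (2 + k + j) = tape_at w t j (dig w v (2 + j))"

lemma view_exists: assumes "t \<le> time w" shows "\<exists>v<views w. view_at w t v"
proof -
  note inv = run_invariant[of w t]
  define f where "f = (\<lambda>i. if i = 0 then state (run M w t) else if i = 1 then in_pos (run M w t)
    else if i < 2 + k then head_at w t (i - 2)
    else if i < 2 * k + 2 then tape_at w t (i - 2 - k) (head_at w t (i - 2 - k)) else 0)"
  have "f i < radix w" if "i < 2 * k + 2" for i
  proof -
    have "head_at w t (i - 2) < radix w" if "i < 2 + k" "2 \<le> i"
    proof -
      have "i - 2 < k" using that by simp
      then have "head_at w t (i - 2) \<le> t" using inv by blast
      then show ?thesis using assms by (simp add: radix_def)
    qed
    moreover have "tape_at w t (i - 2 - k) (head_at w t (i - 2 - k)) < radix w" if "2 + k \<le> i" "i < 2 * k + 2"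
    proof -
      have "i - 2 - k < k" using that by simp
      then have "tape_at w t (i - 2 - k) (head_at w t (i - 2 - k)) < num_syms M" using inv by blast
      then show ?thesis by (simp add: radix_def)
    qed
    ultimately show ?thesis using inv that by (auto simp: f_def radix_def)
  qed
  then obtain v where v: "v < radix w ^ (2 * k + 2)" "\<forall>i<2 * k + 2. dig w v i = f i"
    using digits_ex[of "2 * k + 2" f "radix w"] by blast
  then have "view_at w t v" by (auto simp: view_at_def f_def)
  then show ?thesis using v(1) unfolding views_def by blast
qed

lemma reads_iff: "reads w i s \<longleftrightarrow> read_input w i = s"
  by (cases s) (auto simp: reads_def read_input_def bit_at_def)

lemma matches_view:
  assumes "view_at w t u" "x \<in> set (local_views M)"
  shows "matches w u x \<longleftrightarrow> x = local_at w t"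
proof -
  obtain q s as where x: "x = (q, s, as)" by (metis prod_cases3)
  have len: "length as = k" using assms(2) by (simp add: x local_views_iff)
  have lw: "length (work (run M w t)) = k" using run_invariant by blast
  have "(\<forall>j<k. tape_at w t j (head_at w t j) = as ! j) \<longleftrightarrow> as = scanned w t"
    unfolding list_eq_iff_nth_eq using len lw nth_scanned[of _ w t] by (simp add: eq_commute)
  then show ?thesis
    using assms(1) unfolding matches_def view_at_def reads_iff x by auto
qed

lemma follows_view:
  assumes "view_at w t u"
  shows "follows w u v \<longleftrightarrow> dig w v 0 = state (run M w (Suc t)) \<and> dig w v 1 = in_pos (run M w (Suc t)) \<and>
    (\<forall>j<k. dig w v (2 + j) = head_at w (Suc t) j)"
proof -
  have u: "dig w u 1 = in_pos (run M w t)" "\<And>j. j < k \<Longrightarrow> dig w u (2 + j) = head_at w t j"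
    using assms by (auto simp: view_at_def)
  have "follows w u v \<longleftrightarrow> dig w v 0 = fst (eff M (local_at w t)) \<and>
     dig w v 1 = min (move_head (fst (snd (eff M (local_at w t)))) (dig w u 1)) (length w + 1) \<and>
     (\<forall>j\<in>set [0..<k]. dig w v (2 + j) =
       move_head (snd (fst (snd (snd (eff M (local_at w t)))) ! j)) (dig w u (2 + j)))"
    unfolding follows_def using matches_view[OF assms] local_at_in by blast
  then show ?thesis using u by (simp add: run_step Ball_def)
qed

lemma writes_view:
  assumes "view_at w t u" "j < k"
  shows "writes w u j a \<longleftrightarrow> a = tape_at w (Suc t) j (head_at w t j)"
proof -
  have "writes w u j a \<longleftrightarrow> a = fst (fst (snd (snd (eff M (local_at w t)))) ! j)"
    unfolding writes_def using matches_view[OF assms(1)] local_at_in assms(2) by auto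
  then show ?thesis using assms(2) by (simp add: run_step)
qed

lemma tape_unchanged: "j < k \<Longrightarrow> i \<noteq> head_at w t j \<Longrightarrow> tape_at w (Suc t) j i = tape_at w t j i"
  by (simp add: run_step)

lemma move_to_pos:
  assumes "v < views w" "r \<le> k"
  shows "next_pos w (pos w t r v) u c = move_to w t r v u c"
proof -
  have "pos w t r v - 3 = (t * (k + 1) + r) * views w + v" by (simp add: pos_def)
  moreover have "((t * (k + 1) + r) * views w + v) div views w = t * (k + 1) + r"
    "((t * (k + 1) + r) * views w + v) mod views w = v" using assms(1) by simp_all
  moreover have "(t * (k + 1) + r) div (k + 1) = t" "(t * (k + 1) + r) mod (k + 1) = r"
    using assms(2) div_mult_self3[of "k + 1" t r] mod_mult_self3[of t "k + 1" r] by simp_all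
  moreover have "\<not> pos w t r v < 2" "pos w t r v \<noteq> 2" by (simp_all add: pos_def)
  ultimately show ?thesis unfolding next_pos_def by simp
qed

lemma pos_less:
  assumes "t \<le> time w" "r \<le> k" "v < views w"
  shows "pos w t r v < size_of w"
proof -
  have "t * (k + 1) + r < (t + 1) * (k + 1)" using assms(2) by simp
  also have "\<dots> \<le> (time w + 1) * (k + 1)" using assms(1) by (intro mult_right_mono) auto
  finally have "Suc (t * (k + 1) + r) * views w \<le> (time w + 1) * (k + 1) * views w"
    by (intro mult_right_mono) auto
  moreover have "(t * (k + 1) + r) * views w + v < Suc (t * (k + 1) + r) * views w" using assms(3) by simp
  ultimately show ?thesis unfolding pos_def size_of_def by linarith
qed

lemma next_pos_less:
  assumes x: "x < size_of w" and u: "u < views w" and c: "c \<le> k"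
  shows "next_pos w x u c < size_of w"
proof -
  consider "x < 2" | "x = 2" | "3 \<le> x" by linarith
  then show ?thesis
  proof cases
    case 1
    then show ?thesis using x by (simp add: next_pos_def)
  next
    case 2
    then show ?thesis using pos_less[OF order_refl le0 u] x by (simp add: next_pos_def)
  next
    case 3
    let ?y = "x - 3" and ?t = "(x - 3) div views w div (k + 1)"
    have v: "?y mod views w < views w" using views_pos by simp
    have r: "?y div views w mod (k + 1) \<le> k" using less_Suc_eq_le by simp
    have "?y < (time w + 1) * (k + 1) * views w" using x 3 by (simp add: size_of_def)
    then have "?y div views w < (time w + 1) * (k + 1)" by (rule less_mult_imp_div_less)
    then have "?t < time w + 1" by (rule less_mult_imp_div_less)
    then have t: "?t \<le> time w" "?t - Suc 0 \<le> time w" by simp_all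
    have "move_to w ?t (?y div views w mod (k + 1)) (?y mod views w) u c < size_of w"
      unfolding move_to_def using pos_less[OF t(1) c v] pos_less[OF t(2) le0 u] pos_less[OF t(2) r v] x 3 by simp
    then show ?thesis using 3 by (simp add: next_pos_def)
  qed
qed

lemma wf_game: "wf_cgs 2 {..<1} (game op w)"
proof -
  have "2 \<in> {..<size_of w}" using views_pos by (simp add: size_of_def)
  moreover have "delta (game op w) x \<alpha> \<in> {..<size_of w}"
    if "x < size_of w" "\<alpha> \<in> set (joint_actions 2 (game op w) x)" for x \<alpha>
    using that(2) next_pos_less[OF that(1)] unfolding set_joint_actions_2 by (auto simp: game_def)
  ultimately show ?thesis
    using views_pos by (auto simp: wf_cgs_def) (auto simp: game_def Suc_le_eq split: if_splits)
qed

lemma pre_game: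
  "pre (game op w) {1} Y x \<longleftrightarrow> (\<exists>u<views w. \<forall>c\<le>k. Y (next_pos w x u c))"
proof
  assume "pre (game op w) {1} Y x"
  then obtain \<alpha> where \<alpha>: "\<alpha> \<in> set (joint_actions 2 (game op w) x)"
    and all: "\<forall>\<beta>\<in>set (joint_actions 2 (game op w) x). (\<forall>i\<in>{1}. \<beta> ! (i - 1) = \<alpha> ! (i - 1)) \<longrightarrow> Y (delta (game op w) x \<beta>)"
    unfolding pre_def by blast
  from \<alpha> obtain a b where ab: "\<alpha> = [a, b]" "1 \<le> a" "a \<le> views w"
    unfolding set_joint_actions_2 by (auto simp: game_def)
  have a: "1 \<le> a" "a \<le> views w" by fact+
  have *: "Y (next_pos w x (a - 1) (b' - 1))" if "1 \<le> b'" "b' \<le> k + 1" for b'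
  proof -
    have "[a, b'] \<in> set (joint_actions 2 (game op w) x)"
      unfolding set_joint_actions_2 using a that by (simp add: game_def)
    with all have "Y (delta (game op w) x [a, b'])" unfolding ab by simp
    then show ?thesis by (simp add: game_def)
  qed
  have "Y (next_pos w x (a - 1) c)" if "c \<le> k" for c
    using *[of "c + 1"] that by simp
  moreover have "a - 1 < views w" using a by simp
  ultimately show "\<exists>u<views w. \<forall>c\<le>k. Y (next_pos w x u c)" by blast
next
  assume "\<exists>u<views w. \<forall>c\<le>k. Y (next_pos w x u c)"
  then obtain u where u: "u < views w" "\<forall>c\<le>k. Y (next_pos w x u c)" by blast
  have "[u + 1, 1] \<in> set (joint_actions 2 (game op w) x)"
    unfolding set_joint_actions_2 using u by (auto simp: game_def)
  moreover have "Y (delta (game op w) x \<beta>)"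
    if "\<beta> \<in> set (joint_actions 2 (game op w) x)" "\<forall>a \<in> {1}. \<beta> ! (a - 1) = [u + 1, 1] ! (a - 1)" for \<beta>
    using that u unfolding set_joint_actions_2 by (auto simp: game_def)
  ultimately show "pre (game op w) {1} Y x" unfolding pre_def by blast
qed

abbreviation target :: "tempop \<Rightarrow> nat form" where
  "target op \<equiv> Strat {1} op (Atom 0)"

lemma sat_atom: "sat 2 (game op w) (Atom 0) x \<longleftrightarrow> goal op x"
  by (simp add: game_def)

text \<open>Positions \<open>0\<close> and \<open>1\<close> loop, so where the goal does not settle
  them at once, extremality of the fixpoint does. The goal is constant above \<open>1\<close>, so
  every other position is decided by one unfolding.\<close>

lemma winning:
  shows "sat 2 (game op w) (target op) 0"
    and "\<not> sat 2 (game op w) (target op) 1"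
    and "x < size_of w \<Longrightarrow> 1 < x \<Longrightarrow> sat 2 (game op w) (target op) x \<longleftrightarrow>
       (\<exists>u<views w. \<forall>c\<le>k. sat 2 (game op w) (target op) (next_pos w x u c))"
proof -
  let ?G = "game op w" and ?W = "sat 2 (game op w) (target op)"
  have A: "{1} \<subseteq> agents 2" by (auto simp: agents_2)
  have st: "x \<in> states ?G \<longleftrightarrow> x < size_of w" for x by (simp add: game_def)
  have s01: "0 \<in> states ?G" "1 \<in> states ?G" unfolding st by (simp_all add: size_of_def)
  have loop: "pre ?G {1} Y x \<longleftrightarrow> Y x" if "x < 2" for Y x
    unfolding pre_game using that views_pos by (auto simp: next_pos_def)
  have unfold: "?W x \<longleftrightarrow> (case op of Finally \<Rightarrow> goal op x \<or> pre ?G {1} ?W x | Globally \<Rightarrow> goal op x \<and> pre ?G {1} ?W x)"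
    if "x \<in> states ?G" for x
    using Finally_unfold[OF wf_game A that, of "Atom 0"] Globally_unfold[OF wf_game A that, of "Atom 0"]
    by (cases op) (simp_all only: sat_atom tempop.case)
  show "?W 0"
  proof (cases op)
    case Finally
    then show ?thesis unfolding unfold[OF s01(1)] by (simp add: goal_def)
  next
    case Globally
    have "sat 2 ?G (Atom 0) x \<and> pre ?G {1} (\<lambda>x. x = 0) x" if "x \<in> states ?G" "x = 0" for x
      using that loop[of 0 "\<lambda>x. x = 0"] Globally unfolding sat_atom goal_def by simp
    then show ?thesis
      unfolding Globally using Globally_greatest[OF wf_game A s01(1), where Y = "\<lambda>x. x = 0" and \<phi> = "Atom 0"] Globally by blast
  qed
  show "\<not> ?W 1"
  proof (cases op)
    case Finally
    have "x \<noteq> 1" if "x \<in> states ?G" "sat 2 ?G (Atom 0) x \<or> pre ?G {1} (\<lambda>x. x \<noteq> 1) x" for x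
      using that loop[of 1 "\<lambda>x. x \<noteq> 1"] Finally unfolding sat_atom goal_def by auto
    then show ?thesis
      using Finally_least[OF wf_game A s01(2), where \<phi> = "Atom 0" and Y = "\<lambda>x. x \<noteq> 1"] Finally by blast
  next
    case Globally
    then show ?thesis unfolding unfold[OF s01(2)] by (simp add: goal_def)
  qed
  show "?W x \<longleftrightarrow> (\<exists>u<views w. \<forall>c\<le>k. ?W (next_pos w x u c))" if "x < size_of w" "1 < x"
  proof -
    have "?W x \<longleftrightarrow> pre ?G {1} ?W x"
      unfolding unfold[OF that(1)[folded st]] using that(2) by (cases op) (simp_all add: goal_def)
    then show ?thesis unfolding pre_game .
  qed
qed

text \<open>A false view \<open>u\<close> loses when player \<open>2\<close> asks for it, and a true
  one always exists. With the true view the remaining claims are equivalent to the current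
  one.\<close>

lemma winning_pos:
  assumes "t \<le> time w" "r \<le> k" "v < views w"
  shows "sat 2 (game op w) (target op) (pos w t r v) \<longleftrightarrow> (if r = 0 then view_at w t v else cell_at w t (r - 1) v)"
  using assms
proof (induction t arbitrary: r v)
  case 0
  let ?W = "sat 2 (game op w) (target op)"
  have v0: "view_at w 0 v \<longleftrightarrow> initial w v"
    by (auto simp: view_at_def initial_def run_def init_config_def)
  have c0: "cell_at w 0 j v \<longleftrightarrow> dig w v (2 + k + j) = 0" if "j < k" for j
    using that by (simp add: cell_at_def run_def init_config_def)
  have "1 < pos w 0 r v" by (simp add: pos_def)
  note W = winning(3)[OF pos_less[OF 0] this, of op, unfolded move_to_pos[OF 0(3,2)]]
  show ?case
    unfolding W move_to_def using v0 c0[of "r - 1"] 0 views_pos winning(1,2)[of op w] by auto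
next
  case (Suc t)
  let ?W = "sat 2 (game op w) (target op)"
  have t: "t \<le> time w" using Suc.prems(1) by simp
  obtain u where u: "u < views w" "view_at w t u" using view_exists[OF t] by blast
  have V: "?W (pos w t 0 u) \<longleftrightarrow> view_at w t u" if "u < views w" for u
    using Suc.IH[OF t le0 that] by simp
  have C: "?W (pos w t r v) \<longleftrightarrow> cell_at w t (r - 1) v" if "0 < r" "r \<le> k" "v < views w" for r v
    using Suc.IH[OF t that(2,3)] that(1) by simp
  note lose = winning(2)[of op w]
  have step: "?W (pos w (Suc t) r v) \<longleftrightarrow> (\<exists>u<views w. \<forall>c\<le>k. ?W (move_to w (Suc t) r v u c))"
    if "r \<le> k" "v < views w" for r v
  proof -
    have "1 < pos w (Suc t) r v" by (simp add: pos_def)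
    from winning(3)[OF pos_less[OF Suc.prems(1) that] this, of op] show ?thesis
      unfolding move_to_pos[OF that(2,1)] .
  qed
  \<comment> \<open>Cell claims at time \<open>Suc t\<close> refer only to time \<open>t\<close>,
    but view claims at \<open>Suc t\<close> refer to cell claims at the same time; hence cells come
    before views.\<close>
  have cells: "?W (pos w (Suc t) r v) \<longleftrightarrow> cell_at w (Suc t) (r - 1) v" if r: "0 < r" "r \<le> k" and v: "v < views w" for r v
  proof -
    let ?j = "r - 1"
    have j: "?j < k" using r by simp
    have "?W (pos w (Suc t) r v) \<longleftrightarrow> (\<exists>u<views w. view_at w t u \<and>
      (if dig w u (2 + ?j) = dig w v (2 + ?j) then writes w u ?j (dig w v (2 + k + ?j)) else cell_at w t ?j v))"
    proof -
      have "(\<forall>c\<le>k. ?W (move_to w (Suc t) r v u c)) \<longleftrightarrow> view_at w t u \<and>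
        (if dig w u (2 + ?j) = dig w v (2 + ?j) then writes w u ?j (dig w v (2 + k + ?j)) else cell_at w t ?j v)"
        if u: "u < views w" for u
      proof (cases "dig w u (2 + ?j) = dig w v (2 + ?j)")
        case True
        then have "move_to w (Suc t) r v u c =
            (if writes w u ?j (dig w v (2 + k + ?j)) then pos w t 0 u else 1)" for c
          using r by (simp add: move_to_def)
        then show ?thesis using True V[OF u] lose by auto
      next
        case False
        then have "move_to w (Suc t) r v u c = (if c = 0 then pos w t 0 u else pos w t r v)" for c
          using r by (simp add: move_to_def)
        then have m: "?W (move_to w (Suc t) r v u c) \<longleftrightarrow> (if c = 0 then ?W (pos w t 0 u) else ?W (pos w t r v))" for c
          by simp
        have "(\<forall>c\<le>k. ?W (move_to w (Suc t) r v u c)) \<longleftrightarrow> ?W (pos w t 0 u) \<and> ?W (pos w t r v)"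
          unfolding m using j by (auto dest: spec[of _ 1])
        then show ?thesis using False V[OF u] C[OF r v] by simp
      qed
      then show ?thesis unfolding step[OF r(2) v] by blast
    qed
    also have "\<dots> \<longleftrightarrow> cell_at w (Suc t) ?j v"
    proof -
      have "(if dig w u (2 + ?j) = dig w v (2 + ?j) then writes w u ?j (dig w v (2 + k + ?j)) else cell_at w t ?j v) \<longleftrightarrow>
        cell_at w (Suc t) ?j v" if u: "view_at w t u" for u
      proof -
        have "dig w u (2 + ?j) = head_at w t ?j" using u j by (simp add: view_at_def)
        then show ?thesis
          using writes_view[OF u j] tape_unchanged[OF j, of "dig w v (2 + ?j)" w t] by (auto simp: cell_at_def)
      qed
      then show ?thesis using u by blast
    qed
    finally show ?thesis .
  qed
  show ?case
  proof (cases "r = 0")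
    case False
    then show ?thesis using cells[of r v] Suc.prems by simp
  next
    case True
    have v: "v < views w" by fact
    have "(\<forall>c\<le>k. ?W (move_to w (Suc t) 0 v u c)) \<longleftrightarrow>
        view_at w t u \<and> follows w u v \<and> (\<forall>j<k. cell_at w (Suc t) j v)" if u: "u < views w" for u
    proof (cases "follows w u v")
      case True
      then have m: "move_to w (Suc t) 0 v u c = (if c = 0 then pos w t 0 u else pos w (Suc t) c v)" for c
        by (simp add: move_to_def)
      have "(\<forall>c\<le>k. ?W (move_to w (Suc t) 0 v u c)) \<longleftrightarrow>
          ?W (pos w t 0 u) \<and> (\<forall>c\<le>k. 0 < c \<longrightarrow> ?W (pos w (Suc t) c v))"
        unfolding m by auto
      also have "\<dots> \<longleftrightarrow> view_at w t u \<and> (\<forall>c\<le>k. 0 < c \<longrightarrow> cell_at w (Suc t) (c - 1) v)"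
        using V[OF u] cells[OF _ _ v] by blast
      also have "(\<forall>c\<le>k. 0 < c \<longrightarrow> cell_at w (Suc t) (c - 1) v) \<longleftrightarrow> (\<forall>j<k. cell_at w (Suc t) j v)"
        by (metis Suc_le_eq Suc_pred diff_Suc_1 zero_less_Suc)
      finally show ?thesis using True by blast
    next
      case False
      then show ?thesis using lose by (auto simp: move_to_def)
    qed
    then have "?W (pos w (Suc t) 0 v) \<longleftrightarrow>
        (\<exists>u<views w. view_at w t u \<and> follows w u v \<and> (\<forall>j<k. cell_at w (Suc t) j v))"
      unfolding step[OF le0 v] by blast
    also have "\<dots> \<longleftrightarrow> view_at w (Suc t) v"
    proof -
      have "follows w u v \<and> (\<forall>j<k. cell_at w (Suc t) j v) \<longleftrightarrow> view_at w (Suc t) v" if "view_at w t u" for u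
        unfolding follows_view[OF that] view_at_def cell_at_def by auto
      then show ?thesis using u by blast
    qed
    finally show ?thesis using True by simp
  qed
qed

lemma winning_start:
  "sat 2 (game op w) (target op) 2 \<longleftrightarrow> state (run M w (time w)) = acc M"
proof -
  let ?W = "sat 2 (game op w) (target op)"
  have "?W 2 \<longleftrightarrow> (\<exists>u<views w. \<forall>c\<le>k. ?W (next_pos w 2 u c))"
    using winning(3)[of 2 w op] views_pos by (simp add: size_of_def)
  also have "\<dots> \<longleftrightarrow> (\<exists>u<views w. dig w u 0 = acc M \<and> view_at w (time w) u)"
    using winning(2)[of op w] winning_pos[OF order_refl le0, of _ w op] by (auto simp: next_pos_def)
  also have "\<dots> \<longleftrightarrow> state (run M w (time w)) = acc M"
    using view_exists[OF order_refl, of w] unfolding view_at_def by metis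
  finally show ?thesis .
qed

end

text \<open>
  On the negative structure only the coalitions that contain player \<open>2\<close> achieve their goal; this
  forces a formula of size \<open>2\<close> that separates the structures to speak about player \<open>1\<close>.
\<close>

definition neg :: "tempop \<Rightarrow> (nat, nat) cgs" where
  "neg op = \<lparr>states = {..<2}, init = {0}, label = \<lambda>x. if (op = Finally) = (x = 1) then {0} else {},
     acts = \<lambda>_ a. if a = 1 then 1 else 2, delta = \<lambda>x \<alpha>. if x = 0 then \<alpha> ! 1 - 1 else 1\<rparr>"

lemma joint_actions_neg: "set (joint_actions 2 (neg op) x) = {[1, 1], [1, 2]}"
  unfolding set_joint_actions_2 by (auto simp: neg_def)

lemma wf_neg: "wf_cgs 2 {..<1} (neg op)"
  unfolding wf_cgs_def joint_actions_neg by (simp add: neg_def)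

lemma pre_neg:
  "2 \<in> A \<Longrightarrow> Y 0 \<or> Y 1 \<Longrightarrow> pre (neg op) A Y 0"
  "pre (neg op) {1} Y 0 \<Longrightarrow> Y 0 \<and> Y 1"
proof -
  assume *: "2 \<in> A" "Y 0 \<or> Y 1"
  have eq: "\<beta> = \<alpha>" if "\<forall>a\<in>A. \<beta> ! (a - 1) = \<alpha> ! (a - 1)" "\<alpha> \<in> {[1, 1], [1, 2]}" "\<beta> \<in> {[1, 1], [1, 2]}"
    for \<alpha> \<beta> :: "nat list"
    using that(2,3) bspec[OF that(1) *(1)] by auto
  have "delta (neg op) 0 [1, 1] = 0" "delta (neg op) 0 [1, 2] = 1" by (simp_all add: neg_def)
  then obtain \<alpha> where \<alpha>: "\<alpha> \<in> {[1, 1], [1, 2]}" "Y (delta (neg op) 0 \<alpha>)"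
    using *(2) by (metis insertI1 insertI2)
  show "pre (neg op) A Y 0"
    unfolding pre_def joint_actions_neg
  proof (intro bexI[of _ \<alpha>] ballI impI)
    fix \<beta> assume \<beta>: "\<beta> \<in> {[1, 1], [1, 2]}" "\<forall>a\<in>A. \<beta> ! (a - 1) = \<alpha> ! (a - 1)"
    have "\<beta> = \<alpha>" by (rule eq[OF \<beta>(2) \<alpha>(1) \<beta>(1)])
    then show "Y (delta (neg op) 0 \<beta>)" using \<alpha>(2) by simp
  qed (rule \<alpha>(1))
next
  assume "pre (neg op) {1} Y 0"
  then have "Y (delta (neg op) 0 [1, 1]) \<and> Y (delta (neg op) 0 [1, 2])"
    unfolding pre_def joint_actions_neg by auto
  then show "Y 0 \<and> Y 1" by (simp add: neg_def)
qed

text \<open>In state \<open>0\<close> the action of player \<open>2\<close> selects the successor: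
  moving to \<open>1\<close> reaches the proposition for \<open>Finally\<close>, staying in
  \<open>0\<close> keeps it for \<open>Globally\<close>.\<close>

lemma sat_neg:
  assumes A: "A \<subseteq> agents 2" "2 \<in> A"
  shows "sat 2 (neg op) (Strat A op (Atom 0)) 0"
proof (cases op)
  case Finally
  have s: "0 \<in> states (neg op)" "1 \<in> states (neg op)" by (simp_all add: neg_def)
  have "sat 2 (neg op) (Strat A Finally (Atom 0)) 1"
    unfolding Finally_unfold[OF wf_neg A(1) s(2)] using Finally by (simp add: neg_def)
  then show ?thesis
    unfolding Finally Finally_unfold[OF wf_neg[of Finally] A(1) s(1)[unfolded Finally]]
    using pre_neg(1)[OF A(2)] Finally by blast
next
  case Globally
  have s: "0 \<in> states (neg op)" by (simp add: neg_def)
  have "sat 2 (neg op) (Atom 0) x \<and> pre (neg op) A (\<lambda>x. x = 0) x" if "x = 0" for x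
    using that pre_neg(1)[OF A(2), of "\<lambda>x. x = 0" op] Globally by (simp add: neg_def)
  then show ?thesis
    using Globally_greatest[OF wf_neg A(1) s, where Y = "\<lambda>x. x = 0" and \<phi> = "Atom 0"] Globally by blast
qed

text \<open>Player \<open>1\<close> has a single action, so both successors of \<open>0\<close>
  remain possible: the adversary stays in \<open>0\<close> against \<open>Finally\<close> and moves
  to \<open>1\<close> against \<open>Globally\<close>.\<close>

lemma not_sat_neg: "\<not> sat 2 (neg op) (Strat {1} op (Atom 0)) 0"
proof (cases op)
  case Finally
  have A: "{1} \<subseteq> agents 2" by (simp add: agents_2)
  have s: "0 \<in> states (neg op)" by (simp add: neg_def)
  have "x = 1" if x: "x \<in> states (neg op)" "sat 2 (neg op) (Atom 0) x \<or> pre (neg op) {1} (\<lambda>x. x = 1) x" for x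
  proof (rule ccontr)
    assume "x \<noteq> 1"
    then have x0: "x = 0" using x(1) by (simp add: neg_def)
    then have "\<not> sat 2 (neg op) (Atom 0) x" using Finally by (simp add: neg_def)
    then show False using x(2) pre_neg(2)[of op "\<lambda>x. x = 1"] unfolding x0 by simp
  qed
  then have "\<not> sat 2 (neg op) (Strat {1} Finally (Atom 0)) 0"
    using Finally_least[OF wf_neg A s, where \<phi> = "Atom 0" and Y = "\<lambda>x. x = 1"] zero_neq_one by blast
  then show ?thesis unfolding Finally .
next
  case Globally
  have A: "{1} \<subseteq> agents 2" by (simp add: agents_2)
  have s: "0 \<in> states (neg op)" "1 \<in> states (neg op)" by (simp_all add: neg_def)
  have n: "\<not> sat 2 (neg op) (Strat {1} Globally (Atom 0)) 1"
    unfolding Globally_unfold[OF wf_neg A s(2)] using Globally by (simp add: neg_def)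
  show ?thesis
  proof
    assume "sat 2 (neg op) (Strat {1} op (Atom 0)) 0"
    then have "pre (neg op) {1} (sat 2 (neg op) (Strat {1} Globally (Atom 0))) 0"
      using Globally_unfold[OF wf_neg A s(1), of "Atom 0"] Globally by simp
    from pre_neg(2)[OF this] show False using n by blast
  qed
qed

subsection \<open>Formulas of size two\<close>

lemma has_atom: "\<exists>p. Atom p \<in> subformulas \<phi>"
  by (induction \<phi>) auto

text \<open>Otherwise \<phi>, \<psi> and an atom below \<psi> would be three distinct
  subformulas.\<close>

lemma proper_subformula_atom:
  assumes "form_size \<phi> \<le> 2" "\<psi> \<in> subformulas \<phi>" "\<psi> \<noteq> \<phi>"
  shows "\<exists>p. \<psi> = Atom p"
proof (rule ccontr)
  assume n: "\<nexists>p. \<psi> = Atom p"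
  obtain p where p: "Atom p \<in> subformulas \<psi>" using has_atom[of \<psi>] ..
  then have "Atom p \<in> subformulas \<phi>" by (rule subformulas_trans[OF assms(2)])
  then have "{\<phi>, \<psi>, Atom p} \<subseteq> subformulas \<phi>" using assms(2) subformulas_refl by blast
  then have "card {\<phi>, \<psi>, Atom p} \<le> 2"
    using card_mono[OF finite_subformulas] assms(1) unfolding form_size_def by (meson order_trans)
  moreover have "\<phi> \<noteq> Atom p" using assms(2,3) by auto
  ultimately show False using n assms(3) by auto
qed

lemma small_formula:
  assumes "\<phi> \<in> ATL 2 {..<1::nat} {op} Bl" "form_size \<phi> \<le> 2"
  obtains "\<phi> = Atom 0" | b where "\<phi> = Bin b (Atom 0) (Atom 0)"
    | A where "A \<subseteq> agents 2" "\<phi> = Strat A op (Atom 0)"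
proof -
  have ne: "\<psi> \<noteq> Bin b \<psi> \<chi>" "\<chi> \<noteq> Bin b \<psi> \<chi>" "\<psi> \<noteq> Strat A op \<psi>" for b A and \<psi> \<chi> :: "nat form"
  proof -
    have "size \<psi> \<noteq> size (Bin b \<psi> \<chi>)" "size \<chi> \<noteq> size (Bin b \<psi> \<chi>)" "size \<psi> \<noteq> size (Strat A op \<psi>)"
      by simp_all
    then show "\<psi> \<noteq> Bin b \<psi> \<chi>" "\<chi> \<noteq> Bin b \<psi> \<chi>" "\<psi> \<noteq> Strat A op \<psi>" by metis+
  qed
  have atom: "\<psi> = Atom 0" if "\<psi> \<in> ATL 2 {..<1} {op} Bl" "\<psi> \<in> subformulas \<phi>" "\<psi> \<noteq> \<phi>" for \<psi>
    using proper_subformula_atom[OF assms(2) that(2,3)] that(1) by (auto elim: ATL.cases)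
  from assms(1) show ?thesis
  proof cases
    case (1 p)
    then show ?thesis using that(1) by simp
  next
    case (2 b \<psi> \<chi>)
    have "\<psi> = Atom 0" using atom[OF 2(3)] ne(1) subformulas_refl[of \<psi>] unfolding 2(1) by auto
    moreover have "\<chi> = Atom 0" using atom[OF 2(4)] ne(2) subformulas_refl[of \<chi>] unfolding 2(1) by auto
    ultimately show ?thesis using that(2) 2(1) by blast
  next
    case (3 A op' \<psi>)
    have "\<psi> = Atom 0" using atom[OF 3(4)] ne(3) subformulas_refl[of \<psi>] 3(3) unfolding 3(1) by auto
    then show ?thesis using that(3) 3 by blast
  qed
qed

lemma concat_blocks:
  "concat (map (\<lambda>q. map (g q) [0..<r]) [0..<s]) = map (\<lambda>i. g (i div r) (i mod r)) [0..<s * r]"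
proof (induction s)
  case (Suc s)
  have "map (\<lambda>i. g ((s * r + i) div r) ((s * r + i) mod r)) [0..<r] = map (g s) [0..<r]"
    by (rule map_cong) auto
  moreover have "Suc s * r = s * r + r" by simp
  ultimately show ?case using Suc.IH by (simp only: map_upt_split) simp
qed simp

context reduction
begin

lemma wf_reduction: "wf_instance 2 (1, [game op w], [neg op], 2)"
proof -
  have "states (game op w) = {..<card (states (game op w))}" "states (neg op) = {..<card (states (neg op))}"
    by (simp_all add: game_def neg_def)
  then show ?thesis using wf_game[of op w] wf_neg[of op] by simp
qed

lemma learnable_reduction:
  "learnable 2 {op} Bl n (1, [game op w], [neg op], 2) \<longleftrightarrow> state (run M w (time w)) = acc M"
proof -
  let ?G = "game op w"
  have init: "cgs_sat 2 ?G \<phi> \<longleftrightarrow> sat 2 ?G \<phi> 2" "cgs_sat 2 (neg op) \<phi> \<longleftrightarrow> sat 2 (neg op) \<phi> 0" for \<phi>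
    by (simp_all add: cgs_sat_def game_def neg_def)
  have s: "2 \<in> states ?G" "0 \<in> states (neg op)"
    using views_pos[of w] by (simp_all add: game_def neg_def size_of_def)
  have one: "{1} \<subseteq> agents 2" by (simp add: agents_2)
  \<comment> \<open>The proposition does not separate the two initial states, and therefore no
    binary operator applied to two copies of it does.\<close>
  have atom: "sat 2 ?G (Atom 0) 2 \<longleftrightarrow> sat 2 (neg op) (Atom 0) 0"
    by (cases op) (simp_all add: game_def neg_def goal_def)
  have "learnable 2 {op} Bl n (1, [?G], [neg op], 2) \<longleftrightarrow> sat 2 ?G (target op) 2"
  proof
    assume "learnable 2 {op} Bl n (1, [?G], [neg op], 2)"
    then obtain \<phi> where \<phi>: "\<phi> \<in> ATL 2 {..<1} {op} Bl" "form_size \<phi> \<le> 2"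
      and G: "sat 2 ?G \<phi> 2" and N: "\<not> sat 2 (neg op) \<phi> 0" by (auto simp: init)
    from \<phi> show "sat 2 ?G (target op) 2"
    proof (cases rule: small_formula)
      case 1
      then show ?thesis using G N atom by blast
    next
      case (2 b)
      then show ?thesis using G N atom by (simp only: sat.simps(2)) blast
    next
      case (3 A)
      \<comment> \<open>What remains is the empty coalition or \<open>{1}\<close>; the former
        achieves no more than the latter, so in both cases player \<open>1\<close> wins the
        game.\<close>
      then have "2 \<notin> A" using N sat_neg by blast
      then have "A \<subseteq> {1}" using 3(1) unfolding agents_2 by blast
      then show ?thesis using sat_mono_coalition[OF wf_game one _ s(1)] G 3(2) by blast
    qed
  next
    assume W: "sat 2 ?G (target op) 2"
    have "target op \<in> ATL 2 {..<1} {op} Bl" using one by (auto intro!: ATL.intros)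
    moreover have "form_size (target op) \<le> 2" by (simp add: form_size_def card_insert_if)
    moreover have "bin_size (target op) = 0" by (auto simp: bin_size_def)
    moreover note W not_sat_neg[of op]
    ultimately show "learnable 2 {op} Bl n (1, [?G], [neg op], 2)"
      unfolding learnable.simps by (intro bexI[of _ "target op"]) (simp_all add: init del: sat.simps)
  qed
  then show ?thesis unfolding winning_start .
qed

subsection \<open>The reduction is computable in logarithmic space\<close>

definition entry :: "tempop \<Rightarrow> bool list \<Rightarrow> nat \<Rightarrow> nat \<Rightarrow> nat" where
  "entry op w q c = (if c = 0 then of_bool (q = 2) else if c = 1 then of_bool (goal op q)
     else if c = 2 then views w else if c = 3 then k + 1
     else next_pos w q ((c - 4) div (k + 1)) ((c - 4) mod (k + 1)))"

definition row_length :: "bool list \<Rightarrow> nat" where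
  "row_length w = 4 + views w * (k + 1)"

text \<open>The part of the code behind the game, independent of the input: the count
  \<open>1\<close> of negative structures, the structure itself, and the bound
  \<open>2\<close>.\<close>

definition tail :: "tempop \<Rightarrow> nat list" where
  "tail op = 1 # flatten_cgs 2 1 (neg op) @ [2]"

definition tail_at :: "tempop \<Rightarrow> nat \<Rightarrow> nat" where
  "tail_at op x = (if x < length (tail op) then tail op ! x else 0)"

text \<open>Entry \<open>i\<close> of the code computed from \<open>i\<close> alone, so that it can
  be printed without being stored. The first three entries are one proposition, one positive
  structure and its number of states.\<close>

definition code_at :: "tempop \<Rightarrow> bool list \<Rightarrow> nat \<Rightarrow> nat" where
  "code_at op w i = (if i < 3 then if i = 2 then size_of w else 1
     else if i - 3 < size_of w * row_length w then entry op w ((i - 3) div row_length w) ((i - 3) mod row_length w)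
     else tail_at op (i - 3 - size_of w * row_length w))"

lemma flatten_game: "flatten_state 2 1 (game op w) q = map (entry op w q) [0..<row_length w]"
proof -
  have a: "acts (game op w) q 1 = views w" "acts (game op w) q 2 = k + 1" by (simp_all add: game_def)
  have "map (delta (game op w) q) (joint_actions 2 (game op w) q) =
      map (\<lambda>\<alpha>. (\<lambda>i. next_pos w q (i div (k + 1)) (i mod (k + 1)))
        ((\<alpha> ! 0 - 1) * acts (game op w) q 2 + (\<alpha> ! 1 - 1))) (joint_actions 2 (game op w) q)"
  proof (rule map_cong[OF refl])
    fix \<alpha> assume "\<alpha> \<in> set (joint_actions 2 (game op w) q)"
    then have "\<alpha> ! 1 - 1 < k + 1" unfolding set_joint_actions_2 by (auto simp: game_def)
    then have "((\<alpha> ! 0 - 1) * (k + 1) + (\<alpha> ! 1 - 1)) div (k + 1) = \<alpha> ! 0 - 1"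
      "((\<alpha> ! 0 - 1) * (k + 1) + (\<alpha> ! 1 - 1)) mod (k + 1) = \<alpha> ! 1 - 1" by (simp_all only: div_mult_self3 mod_mult_self3 div_less mod_less add_0_right)
    then show "delta (game op w) q \<alpha> = (\<lambda>i. next_pos w q (i div (k + 1)) (i mod (k + 1)))
        ((\<alpha> ! 0 - 1) * acts (game op w) q 2 + (\<alpha> ! 1 - 1))"
      by (simp add: game_def)
  qed
  also have "\<dots> = map (\<lambda>i. next_pos w q (i div (k + 1)) (i mod (k + 1))) [0..<views w * (k + 1)]"
    using map_joint_actions[of "\<lambda>i. next_pos w q (i div (k + 1)) (i mod (k + 1))" "game op w" q]
    by (simp only: a)
  also have "\<dots> = map (\<lambda>i. entry op w q (4 + i)) [0..<views w * (k + 1)]"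
    by (rule map_cong) (simp_all add: entry_def)
  finally have "flatten_state 2 1 (game op w) q =
      map (entry op w q) [0..<4] @ map (\<lambda>i. entry op w q (4 + i)) [0..<views w * (k + 1)]"
  proof -
    assume *: "map (delta (game op w) q) (joint_actions 2 (game op w) q) =
      map (\<lambda>i. entry op w q (4 + i)) [0..<views w * (k + 1)]"
    have u: "[0..<4] = [0, 1, 2, 3::nat]" "[0..<1] = [0::nat]" "[1..<Suc 2] = [1, 2::nat]"
      by (simp_all add: upt_rec)
    show ?thesis unfolding flatten_state_def * u by (simp add: entry_def game_def)
  qed
  then show ?thesis unfolding row_length_def map_upt_split .
qed

lemma encode_reduction:
  "encode_instance 2 (1, [game op w], [neg op], 2) =
   encode_nats (map (code_at op w) [0..<3 + (size_of w * row_length w + length (tail op))])"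
proof -
  let ?n = "size_of w * row_length w"
  have "map (code_at op w) [0..<3] = [1, 1, size_of w]" by (simp add: upt_rec code_at_def)
  moreover have "map (\<lambda>i. code_at op w (3 + i)) [0..<?n] =
      concat (map (flatten_state 2 1 (game op w)) [0..<size_of w])"
    unfolding flatten_game concat_blocks by (rule map_cong) (simp_all add: code_at_def)
  moreover have "map (\<lambda>i. code_at op w (3 + (?n + i))) [0..<length (tail op)] = tail op"
    by (rule nth_equalityI) (simp_all add: code_at_def tail_at_def)
  ultimately have code: "map (code_at op w) [0..<3 + (?n + length (tail op))] =
      [1, 1, size_of w] @ concat (map (flatten_state 2 1 (game op w)) [0..<size_of w]) @ tail op"
    unfolding map_upt_split by simp
  have "card (states (game op w)) = size_of w" by (simp add: game_def)
  then show ?thesis unfolding code by (simp add: flatten_cgs_def[of _ _ "game op w"] tail_def)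
qed

lemma lc_time: "lc m (\<lambda>g e. time (fst g))"
  unfolding time_def by (intro lc_intros)

lemma lc_radix: "lc m (\<lambda>g e. radix (fst g))"
  unfolding radix_def by (intro lc_intros lc_time)

lemma lc_views: "lc m (\<lambda>g e. views (fst g))"
  unfolding views_def by (intro lc_intros lc_radix)

lemma lc_size_of: "lc m (\<lambda>g e. size_of (fst g))"
  unfolding size_of_def by (intro lc_intros lc_time lc_views)

lemma lc_row_length: "lc m (\<lambda>g e. row_length (fst g))"
  unfolding row_length_def by (intro lc_intros lc_views)

lemma lc_dig: assumes "lc m A" shows "lc m (\<lambda>g e. dig (fst g) (A g e) i)"
  by (intro lc_digit lc_radix assms lc_const)

lemma lc_dig': assumes "lc m A" "lc m B" shows "lc m (\<lambda>g e. dig (fst g) (A g e) (B g e))"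
  by (intro lc_digit lc_radix assms)

lemma lc_move_head: assumes "lc m A" shows "lc m (\<lambda>g e. move_head mv (A g e))"
  using assms by (cases mv) (auto intro: lc_intros)

lemma lc_min: assumes "lc m A" "lc m B" shows "lc m (\<lambda>g e. min (A g e) (B g e))"
  unfolding min_def by (intro lc_if lb_le assms)

lemma lb_reads: assumes "lc m A" shows "lb m (\<lambda>g e. reads (fst g) (A g e) s)"
  unfolding reads_def by (cases s; simp only: insym.case) (intro lc_intros assms)+

lemma lb_matches: assumes "lc m A" shows "lb m (\<lambda>g e. matches (fst g) (A g e) x)"
  unfolding matches_def by (intro lb_conj lb_eq lb_all_list lb_reads lc_dig lc_const assms)

lemma lb_follows: assumes "lc m A" "lc m B" shows "lb m (\<lambda>g e. follows (fst g) (A g e) (B g e))"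
  unfolding follows_def
  by (intro lb_conj lb_eq lb_all_list lb_ex_list lb_matches lc_min lc_move_head lc_dig lc_add
      lc_length lc_const assms)

lemma lb_writes:
  assumes "lc m A" "lc m B" "lc m C" shows "lb m (\<lambda>g e. writes (fst g) (A g e) (B g e) (C g e))"
  unfolding writes_def by (intro lb_conj lb_eq lb_ex_list lb_matches lc_const assms)

lemma lb_initial: assumes "lc m A" shows "lb m (\<lambda>g e. initial (fst g) (A g e))"
  unfolding initial_def by (intro lb_conj lb_eq lb_all_list lc_dig lc_const assms)

lemma lc_pos: assumes "lc m A" "lc m B" "lc m C" shows "lc m (\<lambda>g e. pos (fst g) (A g e) (B g e) (C g e))"
  unfolding pos_def by (intro lc_add lc_mult lc_const lc_views assms)

lemma lc_move_to:
  assumes "lc m A" "lc m B" "lc m C" "lc m D" "lc m E"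
  shows "lc m (\<lambda>g e. move_to (fst g) (A g e) (B g e) (C g e) (D g e) (E g e))"
  unfolding move_to_def
  by (intro lc_if lb_eq lb_initial lb_follows lb_writes lc_pos lc_dig' lc_add lc_diff lc_const assms)

lemma lc_next_pos:
  assumes "lc m A" "lc m B" "lc m C"
  shows "lc m (\<lambda>g e. next_pos (fst g) (A g e) (B g e) (C g e))"
  unfolding next_pos_def
  by (intro lc_if lb_eq lb_less lc_move_to lc_pos lc_dig lc_div lc_mod lc_diff lc_time lc_views lc_const assms)

lemma lb_goal: assumes "lc m A" shows "lb m (\<lambda>g e. goal op (A g e))"
  unfolding goal_def by (intro lb_if lb_const lb_eq lb_not lc_const assms)

lemma lc_entry:
  assumes "lc m A" "lc m B" shows "lc m (\<lambda>g e. entry op (fst g) (A g e) (B g e))"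
  unfolding entry_def
  by (intro lc_if lb_eq lb_goal lc_next_pos lc_views lc_div lc_mod lc_diff lc_const assms)

lemma lc_code_at: "lc 1 (\<lambda>g e. code_at op (fst g) (e ! 0))"
proof -
  have A: "lc 1 (\<lambda>g e. e ! 0)" by (rule lc_V) simp
  have "lc 1 (\<lambda>g e. tail_at op (e ! 0 - 3 - size_of (fst g) * row_length (fst g)))"
    by (rule lc_table[of _ _ "length (tail op)" _ 0])
      (intro lc_diff lc_mult lc_size_of lc_row_length lc_const A, simp add: tail_at_def)
  then show ?thesis
    unfolding code_at_def
    by (intro lc_if lb_eq lb_less lc_entry lc_diff lc_mult lc_div lc_mod lc_size_of lc_row_length lc_const A)
qed

lemma logspace_reduction:
  "logspace_computable (\<lambda>w. encode_instance 2 (1, [game op w], [neg op], 2))"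
proof -
  have "lc 0 (\<lambda>g e. 3 + (size_of (fst g) * row_length (fst g) + length (tail op)))"
    by (intro lc_add lc_mult lc_size_of lc_row_length lc_const)
  from logspace_computable_lc[OF this lc_code_at[of op]] show ?thesis
    unfolding encode_reduction by simp
qed

end

lemma pbound_poly: "pbound (poly (p :: nat poly))"
proof (induction p)
  case 0
  have "pbound (\<lambda>_. 0)" by (rule pbound_const)
  moreover have "poly (0 :: nat poly) = (\<lambda>_. 0)" by (simp add: fun_eq_iff)
  ultimately show ?case by simp
next
  case (pCons a p)
  have "pbound (\<lambda>n. a + n * poly p n)" by (intro pbound_add pbound_mult pbound_const pbound_id pCons.IH)
  then show ?case by simp
qed

theorem logspace_reducible_ATL_Learn:
  assumes "polytime L" shows "logspace_reducible L (ATL_Learn 2 {op} Bl n)"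
proof -
  obtain M and p :: "nat poly" where M: "wf_tm M"
    and L: "\<And>w. \<exists>t\<le>poly p (length w). halted M (run M w t) \<and> (state (run M w t) = acc M \<longleftrightarrow> w \<in> L)"
    using assms unfolding polytime_def by blast
  obtain d where d: "\<And>n. poly p n \<le> (n + 2) ^ d" using pbound_poly[of p] unfolding pbound_def by blast
  interpret reduction M d by unfold_locales (rule M)
  \<comment> \<open>Halted configurations are fixed by \<open>step\<close>, so the answer given at
    some earlier time is still present when the clock reaches \<open>time w\<close>.\<close>
  have acc: "state (run M w (time w)) = acc M \<longleftrightarrow> w \<in> L" for w
  proof -
    obtain t where t: "t \<le> poly p (length w)" "halted M (run M w t)" "state (run M w t) = acc M \<longleftrightarrow> w \<in> L"
      using L by blast
    have "t \<le> time w" using t(1) d[of "length w"] unfolding time_def by (rule order_trans)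
    then have "run M w (time w) = run M w t"
      using t(2) by (induction rule: dec_induct) (simp_all add: run_halted)
    then show ?thesis using t(3) by simp
  qed
  have "w \<in> L \<longleftrightarrow> encode_instance 2 (1, [game op w], [neg op], 2) \<in> ATL_Learn 2 {op} Bl n" for w
    unfolding encode_ATL_Learn[OF wf_reduction] learnable_reduction acc ..
  then show ?thesis unfolding logspace_reducible_def using logspace_reduction by blast
qed

theorem P_complete_ATL_Learn: "P_complete (ATL_Learn 2 {op} Bl n)"
  unfolding P_complete_def using polytime_ATL_Learn logspace_reducible_ATL_Learn by blast

theorem theorem9:
  fixes Bl :: "binop set" and n :: nat
  shows "P_complete (ATL_Learn 2 {Finally} Bl n) \<and> P_complete (ATL_Learn 2 {Globally} Bl n)"
  by (intro conjI P_complete_ATL_Learn)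

end
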